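(* Let $\Omega$ be a bounded domain in $\mathbb{R}^n$ and let $A$ be a symmetric nonnegative semidefinite matrix-valued function on $\Omega$ such that $\sqrt A$ is bounded and Lipschitz. Let $\mathcal{A}(x,z)$ be a symmetric nonnegative semidefinite matrix defined for $(x,z)\in\Omega\times\mathbb{R}$ such that for some $0<\lambda\le\Lambda<\infty$ $$0\le\lambda\,\xi^{\mathrm{tr}}A(x)\xi\le \xi^{\mathrm{tr}}\mathcal{A}(x,z)\xi\le\Lambda\,\xi^{\mathrm{tr}}A(x)\xi$$ for a.e. $x\in\Omega$, all $\xi\in\mathbb{R}^n$, $z\in\mathbb{R}$. Let $d$ be a metric in $\Omega$ with balls $B(x,r)=\{y\in\Omega:d(x,y)<r\}$. Fix $x\in\Omega$, and suppose there is $r_0>0$ such that: (i) the pair $(\phi_0,\vec\phi_1)$ is $A$-admissible at $(x,r_0)$; (ii) the single scale $(\Phi,A,\varphi)$-Orlicz–Sobolev bump inequality holds at $(x,r_0)$ with $\Phi=\Phi_m$ for some $m>2$; (iii) there exists an $(A,d)$-standard accumulating sequence of Lipschitz cutoff functions at $(x,r_0)$. Then, for the equation $-\nabla^{\mathrm{tr}}\mathcal A(x,u(x))\nabla u=\phi_0-\mathrm{div}_A\vec\phi_1$ in $\Omega$: every weak subsolution is locally bounded above at $x$, every weak supersolution is locally bounded below at $x$, and every weak solution is locally bounded at $x$.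
   Context: **Differential structure.** $\nabla_Av=\sqrt{A}\,\nabla v$, $\mathrm{div}_A\vec w=\mathrm{div}(\sqrt A\,\vec w)$. $\mathrm{Lip}_c(U)$: Lipschitz functions with compact support in $U$. $W^{1,2}_A(\Omega)$ is the Hilbert space of $u\in L^2(\Omega)$ with weak $A$-gradient $\nabla_Au\in L^2(\Omega)^n$ (i.e. $\int\nabla_Au\cdot\vec v=-\int u\,\mathrm{div}_A\vec v$ for all $\vec v\in(\mathrm{Lip}_c(\Omega))^n$), with norm $(\int_\Omega |u|^2+|\nabla_Au|^2)^{1/2}$. $W^{1,1}_{A,0}(U)$ is the closure of $\mathrm{Lip}_c(U)$ in the norm $\int_U|v|+|\nabla_Av|$. If $\tilde A$ is symmetric with $\lambda\xi^{\mathrm{tr}}A\xi\le\xi^{\mathrm{tr}}\tilde A\xi\le\Lambda\xi^{\mathrm{tr}}A\xi$, then $\sqrt{\tilde A}=M\sqrt A$ with $M$ bounded, $\nabla_{\tilde A}u:=M\nabla_Au$, and $\int\tilde A\nabla u\cdot\nabla w$ means $\int\nabla_{\tilde A}u\cdot\nabla_{\tilde A}w$. **Weak (sub/super)solutions.** $u\in W^{1,2}_A(\Omega)$ is a weak subsolution (supersolution) of $-\nabla^{\mathrm{tr}}\mathcal A(x,u)\nabla u=\phi_0-\mathrm{div}_A\vec\phi_1$ if, with $\tilde A(x)=\mathcal A(x,u(x))$, $\int_\Omega\tilde A\nabla u\cdot\nabla w\le\int_\Omega(\phi_0w+\vec\phi_1\cdot\nabla_Aw)$ (respectively $\ge$)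 for all nonnegative $w\in\mathrm{Lip}_c(\Omega)$; a weak solution if equality holds for all $w\in\mathrm{Lip}_c(\Omega)$. **Admissibility.** $\phi_0:\Omega\to\mathbb{R}$, $\vec\phi_1:\Omega\to\mathbb{R}^n$ locally integrable; the pair is $A$-admissible at $(x,\rho)$ if, with $B=B(x,\rho)$ and $\mathcal W_1=\{v\in W^{1,1}_{A,0}(B):\int_B|\nabla_Av|=1\}$, $$\|(\phi_0,\vec\phi_1)\|_{\mathcal X(B)}:=\sup_{v\in\mathcal W_1}\Big|\int_Bv\phi_0\Big|+\sup_{v\in\mathcal W_1}\Big|\int_B\nabla_Av\cdot\vec\phi_1\Big|<\infty.$$ **Young function.** With $E=e^{2^m}$, $F=e^{3^m}$: $\Phi_m(t)=e^{((\ln t)^{1/m}+1)^m}$ for $t\ge E$, $\Phi_m(t)=\frac FEt$ for $0\le t\le E$. **Single scale Orlicz–Sobolev inequality at $(x,r)$** (where $B(x,r)\subset\Omega$): with $d\mu_{x,r}=|B(x,r)|^{-1}\mathbf 1_{B(x,r)}dy$, $$\Phi^{-1}\Big(\int_{B(x,r)}\Phi(|w|)\,d\mu_{x,r}\Big)\le\varphi(r)\,\|\nabla_Aw\|_{L^1(\mu_{x,r})}\quad\text{for all }w\in\mathrm{Lip}_c(B(x,r)),$$ where the superradius $\varphi$ is continuous, nondecreasing, $\varphi(0)=0$, $\varphi(\rho)\ge\rho$ for $0\le\rho\le r$. **$(A,d)$-standard sequence of Lipschitz cutoffs at $(x,r)$.** For $\nu\in(0,1)$: Lipschitz functions $\{\psi_j\}_{j\ge1}$,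 $0\le\psi_j\le1$, and radii $r_1=r$, $r_j-r_{j+1}=\frac{c}{j^2}(1-\nu)r$ with $c$ the constant for which $r_\infty=\lim r_j=\nu r$, such that $\mathrm{supp}\,\psi_j\subset B(x,r_j)$, $\psi_j=1$ on $B(x,r_{j+1})$, and $\|\nabla_A\psi_j\|_\infty\le C_0\frac{j^2}{(1-\nu)r}$ with $C_0$ independent of $j$ and $\nu$. Existence in (iii) is understood for every $\nu\in(0,1)$. **Locally bounded above at $x$**: $u$ can be modified on a null set so that it is bounded above in some neighbourhood of $x$; similarly for bounded below and bounded. *)

theory Defs
  imports "HOL-Analysis.Analysis"
begin

definition psd_matrix :: "real^'n^'n \<Rightarrow> bool" where
  "psd_matrix M \<longleftrightarrow> transpose M = M \<and> (\<forall>\<xi>. 0 \<le> \<xi> \<bullet> (M *v \<xi>))"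

definition mat_sqrt :: "real^'n^'n \<Rightarrow> real^'n^'n" where
  "mat_sqrt M = (THE S. psd_matrix S \<and> S ** S = M)"

text \<open>Functions on an open set with compact support in it are represented by their extension
  by zero to the whole space. With codomain \<open>real^'n\<close> this is \<open>(Lip_c U)^n\<close>.\<close>

definition supp :: "(real^'n \<Rightarrow> 'b::real_normed_vector) \<Rightarrow> (real^'n) set" where
  "supp f = closure {y. f y \<noteq> 0}"

definition Lip_c :: "(real^'n) set \<Rightarrow> (real^'n \<Rightarrow> 'b::real_normed_vector) set" where
  "Lip_c U = {f. (\<exists>L. L-lipschitz_on UNIV f) \<and> compact (supp f) \<and> supp f \<subseteq> U}"

text \<open>The classical gradient and divergence are only applied to Lipschitz functions, which are
  differentiable almost everywhere; the values at the remaining points are irrelevant.\<close>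

definition grad :: "(real^'n \<Rightarrow> real) \<Rightarrow> real^'n \<Rightarrow> real^'n" where
  "grad f y = (\<chi> i. frechet_derivative f (at y) (axis i 1))"

definition divergence :: "(real^'n \<Rightarrow> real^'n) \<Rightarrow> real^'n \<Rightarrow> real" where
  "divergence f y = trace (jacobian f (at y))"

definition grad_A :: "(real^'n \<Rightarrow> real^'n^'n) \<Rightarrow> (real^'n \<Rightarrow> real) \<Rightarrow> real^'n \<Rightarrow> real^'n" where
  "grad_A A f y = mat_sqrt (A y) *v grad f y"

definition div_A :: "(real^'n \<Rightarrow> real^'n^'n) \<Rightarrow> (real^'n \<Rightarrow> real^'n) \<Rightarrow> real^'n \<Rightarrow> real" where
  "div_A A f = divergence (\<lambda>y. mat_sqrt (A y) *v f y)"

definition locally_integrable ::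
    "(real^'n) set \<Rightarrow> (real^'n \<Rightarrow> 'b::{banach,second_countable_topology}) \<Rightarrow> bool" where
  "locally_integrable \<Omega> f \<longleftrightarrow> (\<forall>K. compact K \<and> K \<subseteq> \<Omega> \<longrightarrow> integrable (lebesgue_on K) f)"

definition in_L2 :: "(real^'n) set \<Rightarrow> (real^'n \<Rightarrow> 'b::{banach,second_countable_topology}) \<Rightarrow> bool" where
  "in_L2 \<Omega> f \<longleftrightarrow> f \<in> borel_measurable (lebesgue_on \<Omega>) \<and>
     integrable (lebesgue_on \<Omega>) (\<lambda>y. (norm (f y))\<^sup>2)"

definition is_weak_grad_A ::
    "(real^'n) set \<Rightarrow> (real^'n \<Rightarrow> real^'n^'n) \<Rightarrow> (real^'n \<Rightarrow> real) \<Rightarrow> (real^'n \<Rightarrow> real^'n) \<Rightarrow> bool" where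
  "is_weak_grad_A \<Omega> A u g \<longleftrightarrow>
     (\<forall>v \<in> Lip_c \<Omega>. (LINT y|lebesgue_on \<Omega>. g y \<bullet> v y) = - (LINT y|lebesgue_on \<Omega>. u y * div_A A v y))"

text \<open>\<open>W12 \<Omega> A u g\<close>: the function \<open>u\<close> belongs to the degenerate Sobolev space and \<open>g\<close> is
  (a representative of) its weak \<open>A\<close>-gradient, which is unique up to null sets.\<close>

definition W12 ::
    "(real^'n) set \<Rightarrow> (real^'n \<Rightarrow> real^'n^'n) \<Rightarrow> (real^'n \<Rightarrow> real) \<Rightarrow> (real^'n \<Rightarrow> real^'n) \<Rightarrow> bool" where
  "W12 \<Omega> A u g \<longleftrightarrow> in_L2 \<Omega> u \<and> in_L2 \<Omega> g \<and> is_weak_grad_A \<Omega> A u g"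

text \<open>\<open>W11_0 U A v g\<close>: the function \<open>v\<close> belongs to the closure of \<open>Lip_c U\<close> in the
  \<open>W^{1,1}_A\<close> norm and \<open>g\<close> is its \<open>A\<close>-gradient, i.e. the \<open>L^1\<close> limit of the \<open>A\<close>-gradients of an
  approximating sequence.\<close>

definition W11_0 ::
    "(real^'n) set \<Rightarrow> (real^'n \<Rightarrow> real^'n^'n) \<Rightarrow> (real^'n \<Rightarrow> real) \<Rightarrow> (real^'n \<Rightarrow> real^'n) \<Rightarrow> bool" where
  "W11_0 U A v g \<longleftrightarrow> integrable (lebesgue_on U) v \<and> integrable (lebesgue_on U) g \<and>
     (\<exists>w. (\<forall>k::nat. w k \<in> Lip_c U) \<and>
        (\<lambda>k. LINT y|lebesgue_on U. \<bar>w k y - v y\<bar> + norm (grad_A A (w k) y - g y)) \<longlonglongrightarrow> 0)"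

text \<open>A bounded measurable factor \<open>M\<close> with \<open>sqrt At = M sqrt A\<close>. It is determined on the range of
  \<open>sqrt A\<close>, where the \<open>A\<close>-gradients take their values, so \<open>M \<nabla>_A u\<close> does not depend on its choice.\<close>

definition sqrt_factor ::
    "(real^'n) set \<Rightarrow> (real^'n \<Rightarrow> real^'n^'n) \<Rightarrow> (real^'n \<Rightarrow> real^'n^'n) \<Rightarrow> (real^'n \<Rightarrow> real^'n^'n) \<Rightarrow> bool" where
  "sqrt_factor \<Omega> A At M \<longleftrightarrow>
     M \<in> borel_measurable (lebesgue_on \<Omega>) \<and> bounded (M ` \<Omega>) \<and>
     (AE y in lebesgue_on \<Omega>. mat_sqrt (At y) = M y ** mat_sqrt (A y))"

definition energy_form ::
    "(real^'n) set \<Rightarrow> (real^'n \<Rightarrow> real^'n^'n) \<Rightarrow> (real^'n \<Rightarrow> real^'n) \<Rightarrow> (real^'n \<Rightarrow> real^'n) \<Rightarrow> real" where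
  "energy_form \<Omega> M g h = (LINT y|lebesgue_on \<Omega>. (M y *v g y) \<bullet> (M y *v h y))"

definition rhs_form ::
    "(real^'n) set \<Rightarrow> (real^'n \<Rightarrow> real^'n^'n) \<Rightarrow> (real^'n \<Rightarrow> real) \<Rightarrow> (real^'n \<Rightarrow> real^'n) \<Rightarrow> (real^'n \<Rightarrow> real) \<Rightarrow> real" where
  "rhs_form \<Omega> A \<phi>0 \<phi>1 w = (LINT y|lebesgue_on \<Omega>. \<phi>0 y * w y + \<phi>1 y \<bullet> grad_A A w y)"

definition weak_subsolution ::
    "(real^'n) set \<Rightarrow> (real^'n \<Rightarrow> real^'n^'n) \<Rightarrow> (real^'n \<Rightarrow> real \<Rightarrow> real^'n^'n) \<Rightarrow>
     (real^'n \<Rightarrow> real) \<Rightarrow> (real^'n \<Rightarrow> real^'n) \<Rightarrow> (real^'n \<Rightarrow> real) \<Rightarrow> bool" where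
  "weak_subsolution \<Omega> A \<A> \<phi>0 \<phi>1 u \<longleftrightarrow>
     (\<exists>g M. W12 \<Omega> A u g \<and> sqrt_factor \<Omega> A (\<lambda>y. \<A> y (u y)) M \<and>
        (\<forall>w \<in> Lip_c \<Omega>. (\<forall>y. 0 \<le> w y) \<longrightarrow>
           energy_form \<Omega> M g (grad_A A w) \<le> rhs_form \<Omega> A \<phi>0 \<phi>1 w))"

definition weak_supersolution ::
    "(real^'n) set \<Rightarrow> (real^'n \<Rightarrow> real^'n^'n) \<Rightarrow> (real^'n \<Rightarrow> real \<Rightarrow> real^'n^'n) \<Rightarrow>
     (real^'n \<Rightarrow> real) \<Rightarrow> (real^'n \<Rightarrow> real^'n) \<Rightarrow> (real^'n \<Rightarrow> real) \<Rightarrow> bool" where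
  "weak_supersolution \<Omega> A \<A> \<phi>0 \<phi>1 u \<longleftrightarrow>
     (\<exists>g M. W12 \<Omega> A u g \<and> sqrt_factor \<Omega> A (\<lambda>y. \<A> y (u y)) M \<and>
        (\<forall>w \<in> Lip_c \<Omega>. (\<forall>y. 0 \<le> w y) \<longrightarrow>
           energy_form \<Omega> M g (grad_A A w) \<ge> rhs_form \<Omega> A \<phi>0 \<phi>1 w))"

definition weak_solution ::
    "(real^'n) set \<Rightarrow> (real^'n \<Rightarrow> real^'n^'n) \<Rightarrow> (real^'n \<Rightarrow> real \<Rightarrow> real^'n^'n) \<Rightarrow>
     (real^'n \<Rightarrow> real) \<Rightarrow> (real^'n \<Rightarrow> real^'n) \<Rightarrow> (real^'n \<Rightarrow> real) \<Rightarrow> bool" where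
  "weak_solution \<Omega> A \<A> \<phi>0 \<phi>1 u \<longleftrightarrow>
     (\<exists>g M. W12 \<Omega> A u g \<and> sqrt_factor \<Omega> A (\<lambda>y. \<A> y (u y)) M \<and>
        (\<forall>w \<in> Lip_c \<Omega>. energy_form \<Omega> M g (grad_A A w) = rhs_form \<Omega> A \<phi>0 \<phi>1 w))"

definition unit_W11_0 ::
    "(real^'n) set \<Rightarrow> (real^'n \<Rightarrow> real^'n^'n) \<Rightarrow> ((real^'n \<Rightarrow> real) \<times> (real^'n \<Rightarrow> real^'n)) set" where
  "unit_W11_0 B A = {(v, g). W11_0 B A v g \<and> (LINT y|lebesgue_on B. norm (g y)) = 1}"

text \<open>A pairing whose integrand is not integrable has Bochner integral \<open>0\<close> and so does not enter
  the suprema; the integrands are integrable in particular for \<open>v\<close> in \<open>Lip_c B\<close>.\<close>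

definition X_norm ::
    "(real^'n) set \<Rightarrow> (real^'n \<Rightarrow> real^'n^'n) \<Rightarrow> (real^'n \<Rightarrow> real) \<Rightarrow> (real^'n \<Rightarrow> real^'n) \<Rightarrow> ennreal" where
  "X_norm B A \<phi>0 \<phi>1 =
     (SUP (v, g) \<in> unit_W11_0 B A. ennreal \<bar>LINT y|lebesgue_on B. v y * \<phi>0 y\<bar>) +
     (SUP (v, g) \<in> unit_W11_0 B A. ennreal \<bar>LINT y|lebesgue_on B. g y \<bullet> \<phi>1 y\<bar>)"

definition admissible ::
    "(real^'n) set \<Rightarrow> (real^'n \<Rightarrow> real^'n \<Rightarrow> real) \<Rightarrow> (real^'n \<Rightarrow> real^'n^'n) \<Rightarrow>
     (real^'n \<Rightarrow> real) \<Rightarrow> (real^'n \<Rightarrow> real^'n) \<Rightarrow> real^'n \<Rightarrow> real \<Rightarrow> bool" where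
  "admissible \<Omega> d A \<phi>0 \<phi>1 x \<rho> \<longleftrightarrow> X_norm (Metric_space.mball \<Omega> d x \<rho>) A \<phi>0 \<phi>1 < \<infinity>"

definition Young_Phi :: "real \<Rightarrow> real \<Rightarrow> real" where
  "Young_Phi m t =
     (let E = exp (2 powr m); F = exp (3 powr m)
      in if E \<le> t then exp ((ln t powr (1 / m) + 1) powr m) else F / E * t)"

definition superradius :: "real \<Rightarrow> (real \<Rightarrow> real) \<Rightarrow> bool" where
  "superradius r \<phi> \<longleftrightarrow> continuous_on {0..r} \<phi> \<and> mono_on {0..r} \<phi> \<and> \<phi> 0 = 0 \<and>
     (\<forall>\<rho>\<in>{0..r}. \<rho> \<le> \<phi> \<rho>)"

definition Orlicz_Sobolev ::
    "(real^'n) set \<Rightarrow> (real^'n \<Rightarrow> real^'n \<Rightarrow> real) \<Rightarrow> (real \<Rightarrow> real) \<Rightarrow> (real^'n \<Rightarrow> real^'n^'n) \<Rightarrow>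
     (real \<Rightarrow> real) \<Rightarrow> real^'n \<Rightarrow> real \<Rightarrow> bool" where
  "Orlicz_Sobolev \<Omega> d \<Phi> A \<phi> x r \<longleftrightarrow> superradius r \<phi> \<and>
     (let B = Metric_space.mball \<Omega> d x r; \<mu> = uniform_measure lebesgue B in
      \<forall>w \<in> Lip_c B.
        the_inv_into {0..} \<Phi> (LINT y|\<mu>. \<Phi> \<bar>w y\<bar>) \<le> \<phi> r * (LINT y|\<mu>. norm (grad_A A w y)))"

definition standard_cutoffs ::
    "(real^'n) set \<Rightarrow> (real^'n \<Rightarrow> real^'n \<Rightarrow> real) \<Rightarrow> (real^'n \<Rightarrow> real^'n^'n) \<Rightarrow> real^'n \<Rightarrow> real \<Rightarrow> bool" where
  "standard_cutoffs \<Omega> d A x r \<longleftrightarrow>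
     (\<exists>C0. \<forall>\<nu>\<in>{0<..<1}. \<exists>c (\<psi> :: nat \<Rightarrow> real^'n \<Rightarrow> real) (rr :: nat \<Rightarrow> real).
        rr 1 = r \<and> rr \<longlonglongrightarrow> \<nu> * r \<and>
        (\<forall>j\<ge>1. rr j - rr (Suc j) = c / (real j)\<^sup>2 * (1 - \<nu>) * r) \<and>
        (\<forall>j\<ge>1. (\<exists>L. L-lipschitz_on UNIV (\<psi> j)) \<and>
           (\<forall>y. 0 \<le> \<psi> j y \<and> \<psi> j y \<le> 1) \<and>
           supp (\<psi> j) \<subseteq> Metric_space.mball \<Omega> d x (rr j) \<and>
           (\<forall>y \<in> Metric_space.mball \<Omega> d x (rr (Suc j)). \<psi> j y = 1) \<and>
           (AE y in lebesgue_on \<Omega>. norm (grad_A A (\<psi> j) y) \<le> C0 * (real j)\<^sup>2 / ((1 - \<nu>) * r))))"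

definition locally_bdd_above_at :: "(real^'n) set \<Rightarrow> (real^'n \<Rightarrow> real) \<Rightarrow> real^'n \<Rightarrow> bool" where
  "locally_bdd_above_at \<Omega> u x \<longleftrightarrow>
     (\<exists>v. (AE y in lebesgue_on \<Omega>. v y = u y) \<and>
          (\<exists>U. open U \<and> x \<in> U \<and> U \<subseteq> \<Omega> \<and> bdd_above (v ` U)))"

definition locally_bdd_below_at :: "(real^'n) set \<Rightarrow> (real^'n \<Rightarrow> real) \<Rightarrow> real^'n \<Rightarrow> bool" where
  "locally_bdd_below_at \<Omega> u x \<longleftrightarrow>
     (\<exists>v. (AE y in lebesgue_on \<Omega>. v y = u y) \<and>
          (\<exists>U. open U \<and> x \<in> U \<and> U \<subseteq> \<Omega> \<and> bdd_below (v ` U)))"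

definition locally_bounded_at :: "(real^'n) set \<Rightarrow> (real^'n \<Rightarrow> real) \<Rightarrow> real^'n \<Rightarrow> bool" where
  "locally_bounded_at \<Omega> u x \<longleftrightarrow>
     (\<exists>v. (AE y in lebesgue_on \<Omega>. v y = u y) \<and>
          (\<exists>U. open U \<and> x \<in> U \<and> U \<subseteq> \<Omega> \<and> bounded (v ` U)))"

end

theory Submission
  imports Defs "HOL-Real_Asymp.Real_Asymp"
begin

text \<open>De Giorgi iteration. Near \<open>x\<close> a function in the degenerate Sobolev space is approximated, together
  with its weak \<open>A\<close>-gradient, by smooth functions (Friedrichs' commutator lemma), so the equation may
  be tested with \<open>\<psi>\<^sup>2\<close> times a smoothed truncation of \<open>u - k\<close>. Admissibility bounds the right-hand side
  by a multiple of the \<open>L\<^sup>1\<close> norm of the \<open>A\<close>-gradient of the test function, with no power of the data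
  to spare, and yields a Caccioppoli inequality with the measure of \<open>{u > k}\<close> as an additional term.
  Since \<open>\<Phi>\<^sub>m(t) \<ge> t e\<^bsup>2 sqrt (ln t)\<^esup>\<close> for large \<open>t\<close> when \<open>m > 2\<close>, the Orlicz-Sobolev inequality
  applied to \<open>(\<psi> (u - k)\<^sub>+)\<^sup>2\<close> gains the factor \<open>e\<^bsup>- sqrt (ln (1/\<eta>))\<^esup>\<close> on a set of relative measure \<open>\<eta>\<close>. For
  \<open>U\<^sub>j = \<integral> (u - k\<^sub>j)\<^sub>+\<^sup>2\<close> over the support of the \<open>j\<close>-th cutoff, with levels increasing by about \<open>1/j\<^sup>2\<close>, this gives
  \<open>U\<^sub>j\<^sub>+\<^sub>1 \<le> C j\<^sup>8 e\<^bsup>- sqrt (ln (1/(c j\<^sup>4 U\<^sub>j)))\<^esup> U\<^sub>j\<close>, hence \<open>U\<^sub>j \<rightarrow> 0\<close> if \<open>U\<^sub>1\<close> is small, which holds for high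
  levels. Supersolutions are treated through \<open>- u\<close>.\<close>

section \<open>Square roots of positive semidefinite matrices\<close>

text \<open>The weak formulations admit only Lipschitz test functions, and \<open>\<psi>\<close>
  squared times a truncation of \<open>u\<close> need not be one. This is why approximation is
  unavoidable, and why Rademacher's theorem is proved: \<open>grad\<close> and \<open>div_A\<close>
  are classical derivatives, meaningful only almost everywhere. Square roots come first because
  \<open>mat_sqrt\<close> is a definite description. In the energy the gradient of the test function
  is multiplied by \<open>g\<close>, so dominated convergence tolerates only truncations of linear
  growth. The square of the positive part is used only in the Orlicz-Sobolev inequality, where the
  gradient stands alone. Young's inequality turns the data term into a part absorbed by the energy
  and a constant on a superlevel set. The measure of that set is not controlled by the integral at
  its own level, so each step uses three levels and Chebyshev's inequality. A step loses about j^4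
  from the squared gradient of the cutoff and j^4 from the inverse square of the level gap, whence
  the power 8. The gain beats every power of j once the integrals decay like exp(-j^2/64).\<close>

lemma selfadjoint_nonneg_kernel:
  fixes f :: "'a::euclidean_space \<Rightarrow> 'a"
  assumes lin: "linear f" and V: "subspace V" and inv: "\<And>x. x \<in> V \<Longrightarrow> f x \<in> V"
    and sym: "\<And>x y. x \<in> V \<Longrightarrow> y \<in> V \<Longrightarrow> x \<bullet> f y = f x \<bullet> y"
    and pos: "\<And>x. x \<in> V \<Longrightarrow> 0 \<le> x \<bullet> f x"
    and e: "e \<in> V" "e \<bullet> f e = 0"
  shows "f e = 0"
proof -
  let ?w = "f e"
  have wV: "?w \<in> V" using inv e by auto
  let ?C = "?w \<bullet> f ?w"
  have C: "0 \<le> ?C" using pos wV by auto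
  have key: "0 \<le> 2 * t * (?w \<bullet> ?w) + t\<^sup>2 * ?C" for t
  proof -
    have "e + t *\<^sub>R ?w \<in> V" using V e wV by (simp add: subspace_add subspace_scale)
    then have "0 \<le> (e + t *\<^sub>R ?w) \<bullet> f (e + t *\<^sub>R ?w)" by (rule pos)
    also have "f (e + t *\<^sub>R ?w) = f e + t *\<^sub>R f ?w"
      using lin by (simp add: linear_add linear_scale)
    also have "(e + t *\<^sub>R ?w) \<bullet> (f e + t *\<^sub>R f ?w) = e \<bullet> f e + t * (?w \<bullet> ?w) + t * (e \<bullet> f ?w) + t\<^sup>2 * ?C"
      by (simp add: inner_add_left inner_add_right power2_eq_square algebra_simps)
    also have "e \<bullet> f ?w = ?w \<bullet> ?w" using sym e wV by auto
    finally show ?thesis using e by (simp add: algebra_simps)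
  qed
  let ?W = "?w \<bullet> ?w"
  \<comment> \<open>The minimiser of the quadratic in \<open>key\<close> would be -W/C; adding 1
    avoids division by zero and still makes the value negative unless W = 0.\<close>
  let ?t = "- (?W / (?C + 1))"
  have pc: "?C + 1 > 0" using C by linarith
  have "0 \<le> ?t * (2 * ?W + ?t * ?C)" using key[of ?t] by (simp add: algebra_simps power2_eq_square)
  also have "\<dots> = - (?W\<^sup>2 * (?C + 2) / (?C+1)\<^sup>2)"
    using pc by (simp add: field_simps power2_eq_square)
  finally have "?W\<^sup>2 * (?C + 2) / (?C+1)\<^sup>2 \<le> 0" by simp
  then have "?W\<^sup>2 * (?C + 2) \<le> 0" using pc by (simp add: divide_le_0_iff)
  moreover have "0 \<le> ?W\<^sup>2 * (?C + 2)" using C by simp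
  ultimately have "?W = 0" using C by (smt (verit, best) mult_eq_0_iff zero_eq_power2)
  then show ?thesis by simp
qed

text \<open>Spectral theorem by induction on the dimension. At a maximiser \<open>e\<close> of the
  Rayleigh quotient on the unit sphere of \<open>V\<close>, the operator \<open>c - f\<close> with c
  the maximum is nonnegative on \<open>V\<close> and its form vanishes at \<open>e\<close>, so
  \<open>selfadjoint_nonneg_kernel\<close> makes \<open>e\<close> an eigenvector. Symmetry keeps its
  orthogonal complement invariant.\<close>

lemma selfadjoint_eigenbasis:
  fixes f :: "'a::euclidean_space \<Rightarrow> 'a"
  assumes lin: "linear f" and sym: "\<And>x y. x \<bullet> f y = f x \<bullet> y"
    and "subspace V" "\<And>x. x \<in> V \<Longrightarrow> f x \<in> V"
  shows "\<exists>B c. finite B \<and> B \<subseteq> V \<and> pairwise orthogonal B \<and> (\<forall>b\<in>B. norm b = 1 \<and> f b = c b *\<^sub>R b)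
           \<and> span B = V"
  using assms(3,4)
proof (induction "dim V" arbitrary: V rule: less_induct)
  case less
  show ?case
  proof (cases "V = {0}")
    case True
    then show ?thesis by (intro exI[of _ "{}"]) auto
  next
    case False
    then obtain a where a: "a \<in> V" "a \<noteq> 0" using less.prems(1) subspace_0 by blast
    let ?S = "V \<inter> sphere 0 1"
    have "compact ?S" using less.prems(1) closed_subspace compact_sphere by (metis closed_Int_compact)
    moreover have "a /\<^sub>R norm a \<in> ?S" using a less.prems(1) by (auto simp: subspace_scale)
    moreover have "continuous_on ?S (\<lambda>x. x \<bullet> f x)"
      using lin by (intro continuous_intros linear_continuous_on) (auto simp: linear_linear)
    ultimately obtain e where e: "e \<in> ?S" "\<And>x. x \<in> ?S \<Longrightarrow> x \<bullet> f x \<le> e \<bullet> f e"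
      using continuous_attains_sup[of ?S "\<lambda>x. x \<bullet> f x"] by (metis empty_iff)
    let ?c = "e \<bullet> f e"
    have en: "norm e = 1" "e \<in> V" using e by auto
    have eb: "?c *\<^sub>R e - f e = 0"
    proof (rule selfadjoint_nonneg_kernel[where V=V and f="\<lambda>x. ?c *\<^sub>R x - f x"])
      show "linear (\<lambda>x. ?c *\<^sub>R x - f x)"
        by (intro linear_compose_sub lin) (simp add: linear_scale_self)
      show "subspace V" by fact
      show "e \<in> V" using e by auto
      show "e \<bullet> (?c *\<^sub>R e - f e) = 0" using en by (simp add: inner_diff_right dot_square_norm)
      fix x assume x: "x \<in> V"
      show "?c *\<^sub>R x - f x \<in> V" using x less.prems by (simp add: subspace_diff subspace_scale)
      show "0 \<le> x \<bullet> (?c *\<^sub>R x - f x)"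
      proof (cases "x = 0")
        case False
        have "x /\<^sub>R norm x \<in> ?S" using x False less.prems(1) by (auto simp: subspace_scale)
        then have "(x /\<^sub>R norm x) \<bullet> f (x /\<^sub>R norm x) \<le> ?c" by (rule e)
        then have "(x \<bullet> f x) / (norm x)\<^sup>2 \<le> ?c"
          using lin by (simp add: linear_scale power2_eq_square field_simps)
        then have "x \<bullet> f x \<le> ?c * (norm x)\<^sup>2" using False by (simp add: field_simps)
        then show ?thesis by (simp add: inner_diff_right dot_square_norm)
      qed simp
      show "x \<bullet> (?c *\<^sub>R y - f y) = (?c *\<^sub>R x - f x) \<bullet> y" for y
        by (simp add: inner_diff_right inner_diff_left sym)
    qed
    let ?V = "{x \<in> V. x \<bullet> e = 0}"
    have sV: "subspace ?V" using less.prems(1) unfolding subspace_def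
      by (auto simp: inner_add_left)
    have "e \<notin> ?V" using en by (auto simp: dot_square_norm)
    then have "?V \<subset> V" using en(2) by blast
    then have dV: "dim ?V < dim V" using sV less.prems(1) by (metis dim_psubset span_eq_iff)
    have iV: "f x \<in> ?V" if "x \<in> ?V" for x
    proof -
      have "f x \<bullet> e = x \<bullet> f e" by (simp add: sym)
      also have "f e = ?c *\<^sub>R e" using eb by simp
      finally show ?thesis using that less.prems by auto
    qed
    from less.hyps[OF dV sV iV] obtain B c where B: "finite B" "B \<subseteq> ?V" "pairwise orthogonal B"
      "\<forall>b\<in>B. norm b = 1 \<and> f b = c b *\<^sub>R b" "span B = ?V" by blast
    have eB: "e \<notin> B" using B \<open>e \<notin> ?V\<close> by blast
    have "span (insert e B) = V"
    proof
      show "span (insert e B) \<subseteq> V" using B en less.prems(1) by (intro span_minimal) auto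
      show "V \<subseteq> span (insert e B)"
      proof
        fix x assume x: "x \<in> V"
        have "x - (x \<bullet> e) *\<^sub>R e \<in> ?V" using x en less.prems(1)
          by (auto simp: subspace_diff subspace_scale inner_diff_left dot_square_norm)
        then show "x \<in> span (insert e B)" unfolding span_insert B(5)[symmetric] by blast
      qed
    qed
    moreover have "pairwise orthogonal (insert e B)"
      using B(2,3) by (auto simp: pairwise_insert orthogonal_def inner_commute)
    ultimately show ?thesis using B en eb eB
      by (intro exI[of _ "insert e B"] exI[of _ "c(e := ?c)"]) auto
  qed
qed

lemma psd_matrix_transpose_inner:
  fixes S :: "real^'n^'n"
  assumes "transpose S = S" shows "x \<bullet> (S *v y) = (S *v x) \<bullet> y"
  using assms dot_lmul_matrix[of x S y] transpose_matrix_vector[of S x] by simp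

lemma psd_matrix_sqrt_exists:
  fixes A :: "real^'n^'n"
  assumes A: "psd_matrix A"
  shows "\<exists>S. psd_matrix S \<and> S ** S = A"
proof -
  have sym: "x \<bullet> (A *v y) = (A *v x) \<bullet> y" for x y
    using A psd_matrix_transpose_inner by (auto simp: psd_matrix_def)
  obtain B c where B: "finite B" "pairwise orthogonal B"
      "\<And>b. b\<in>B \<Longrightarrow> norm b = 1" "\<And>b. b \<in> B \<Longrightarrow> A *v b = c b *\<^sub>R b" "span B = UNIV"
    using selfadjoint_eigenbasis[of "(*v) A" UNIV, OF matrix_vector_mul_linear sym subspace_UNIV] by auto
  have bb: "b \<bullet> b' = (if b = b' then 1 else 0)" if "b \<in> B" "b' \<in> B" for b b'
    using B(2,3) that by (auto simp: pairwise_def orthogonal_def dot_square_norm)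
  have expand: "(\<Sum>b\<in>B. (b \<bullet> x) *\<^sub>R b) = x" for x
  proof -
    have "x \<in> span B" using B by auto
    then obtain w where w: "x = (\<Sum>b\<in>B. w b *\<^sub>R b)" using B(1) by (auto simp: span_finite)
    have "b \<bullet> x = w b" if "b \<in> B" for b
    proof -
      have "b \<bullet> x = (\<Sum>b'\<in>B. if b = b' then w b' else 0)"
        unfolding w inner_sum_right by (intro sum.cong refl) (simp add: bb that)
      then show ?thesis using that B(1) by simp
    qed
    then show ?thesis using w by auto
  qed
  have c0: "0 \<le> c b" if "b \<in> B" for b
  proof -
    have "0 \<le> b \<bullet> (A *v b)" using A by (auto simp: psd_matrix_def)
    then show ?thesis using B that by (simp add: dot_square_norm)
  qed
  define f where "f x = (\<Sum>b\<in>B. (sqrt (c b) * (b \<bullet> x)) *\<^sub>R b)" for x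
  have lf: "linear f" unfolding f_def
    by (intro linearI) (auto simp: inner_add_right algebra_simps scaleR_sum_right sum.distrib)
  define S where "S = matrix f"
  have Sf: "S *v x = f x" for x unfolding S_def by (rule fun_cong[OF matrix_vector_mul(2)[OF lf]])
  have symf: "x \<bullet> f y = f x \<bullet> y" for x y
    unfolding f_def inner_sum_right inner_sum_left
    by (intro sum.cong refl) (simp add: inner_commute)
  have "x \<bullet> (transpose S *v y) = (S *v x) \<bullet> y" for x y
    by (simp only: transpose_matrix_vector inner_commute[of x] dot_lmul_matrix inner_commute[of y])
  then have "x \<bullet> (transpose S *v y) = x \<bullet> (S *v y)" for x y
    by (simp only: Sf symf)
  then have tr: "transpose S = S" by (metis matrix_eq vector_eq_ldot)
  have pos: "0 \<le> x \<bullet> (S *v x)" for x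
    unfolding Sf f_def inner_sum_right
  proof (rule sum_nonneg)
    fix b assume "b \<in> B"
    have eq: "x \<bullet> (sqrt (c b) * (b \<bullet> x)) *\<^sub>R b = sqrt (c b) * (b \<bullet> x)\<^sup>2"
      by (simp add: power2_eq_square inner_commute[of x b])
    show "0 \<le> x \<bullet> (sqrt (c b) * (b \<bullet> x)) *\<^sub>R b" unfolding eq using c0[OF \<open>b \<in> B\<close>] by simp
  qed
  have bf: "b \<bullet> f x = sqrt (c b) * (b \<bullet> x)" if "b \<in> B" for b x
  proof -
    have "b \<bullet> f x = (\<Sum>b'\<in>B. if b = b' then sqrt (c b') * (b' \<bullet> x) else 0)"
      unfolding f_def inner_sum_right by (intro sum.cong refl) (simp add: bb that)
    then show ?thesis using that B(1) by simp
  qed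
  have "f (f x) = A *v x" for x
  proof -
    have "f (f x) = (\<Sum>b\<in>B. (sqrt (c b) * (sqrt (c b) * (b \<bullet> x))) *\<^sub>R b)"
      unfolding f_def[of "f x"] by (intro sum.cong refl) (simp add: bf)
    also have "\<dots> = (\<Sum>b\<in>B. (b \<bullet> x) *\<^sub>R (A *v b))"
      by (intro sum.cong refl) (use c0 B in \<open>auto simp: mult.assoc[symmetric]\<close>)
    also have "\<dots> = A *v (\<Sum>b\<in>B. (b \<bullet> x) *\<^sub>R b)"
      by (simp add: linear_sum[OF matrix_vector_mul_linear] matrix_vector_mult_scaleR)
    finally show ?thesis by (simp add: expand)
  qed
  then have "S ** S = A" by (simp add: matrix_eq matrix_vector_mul_assoc[symmetric] Sf)
  then show ?thesis using tr pos by (auto simp: psd_matrix_def)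
qed

lemma psd_matrix_kernel:
  fixes S :: "real^'n^'n"
  assumes "psd_matrix S" "x \<bullet> (S *v x) = 0" shows "S *v x = 0"
  using selfadjoint_nonneg_kernel[of "(*v) S" UNIV x] assms
  by (auto simp: psd_matrix_def psd_matrix_transpose_inner)

text \<open>Exhibits the trace as a sum of values of the quadratic form of \<open>S\<close>, which
  are nonnegative when \<open>S\<close> is positive semidefinite.\<close>

lemma trace_sandwich:
  fixes D S :: "real^'n^'n"
  assumes "transpose D = D"
  shows "trace (D ** (S ** D)) = (\<Sum>i\<in>UNIV. (D *v axis i 1) \<bullet> (S *v (D *v axis i 1)))"
proof -
  have "(D ** (S ** D)) $ i $ i = axis i 1 \<bullet> ((D ** (S ** D)) *v axis i 1)" for i
    by (simp add: inner_axis' matrix_vector_mult_basis column_def)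
  also have "\<And>i. axis i 1 \<bullet> ((D ** (S ** D)) *v axis i 1) = (D *v axis i 1) \<bullet> (S *v (D *v axis i 1))"
    by (simp add: matrix_vector_mul_assoc[symmetric] psd_matrix_transpose_inner[OF assms])
  finally show ?thesis by (simp add: trace_def)
qed

text \<open>For D = S - T one has SD + DT = SS - TT = 0. Multiplying by D and taking traces gives
  tr(DSD) + tr(DTD) = 0 with both terms nonnegative, so every summand vanishes. Then SD = TD = 0 by
  the kernel lemma, hence DD = 0, and D = 0 by symmetry.\<close>

lemma psd_matrix_sqrt_unique:
  fixes S T :: "real^'n^'n"
  assumes S: "psd_matrix S" and T: "psd_matrix T" and eq: "S ** S = T ** T"
  shows "S = T"
proof -
  define D where "D = S - T"
  have trD: "transpose D = D" using S T by (simp add: D_def psd_matrix_def transpose_def vec_eq_iff)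
  have "S *v (S *v x) = T *v (T *v x)" for x by (simp add: matrix_vector_mul_assoc eq)
  then have "S ** D + D ** T = 0"
    by (simp add: D_def matrix_eq matrix_vector_mult_add_rdistrib matrix_vector_mul_assoc[symmetric]
        matrix_vector_mult_diff_rdistrib matrix_vector_mult_diff_distrib)
  then have "trace (D ** (S ** D + D ** T)) = 0" by (simp add: trace_def)
  then have "trace (D ** (S ** D)) + trace (D ** (D ** T)) = 0"
    by (simp only: trace_add matrix_add_ldistrib)
  moreover have "trace (D ** (D ** T)) = trace (D ** (T ** D))"
    by (simp only: trace_mul_sym[of D "D ** T"] matrix_mul_assoc[symmetric])
  ultimately have sum0: "(\<Sum>i\<in>UNIV. (D *v axis i 1) \<bullet> (S *v (D *v axis i 1)))
     + (\<Sum>i\<in>UNIV. (D *v axis i 1) \<bullet> (T *v (D *v axis i 1))) = 0"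
    by (simp add: trace_sandwich[OF trD])
  have nn: "0 \<le> (D *v axis i 1) \<bullet> (S *v (D *v axis i 1))" "0 \<le> (D *v axis i 1) \<bullet> (T *v (D *v axis i 1))" for i
    using S T by (auto simp: psd_matrix_def)
  have "(\<Sum>i\<in>UNIV. (D *v axis i 1) \<bullet> (S *v (D *v axis i 1))) = 0"
       "(\<Sum>i\<in>UNIV. (D *v axis i 1) \<bullet> (T *v (D *v axis i 1))) = 0"
    using sum0 nn by (smt (verit) sum_nonneg)+
  then have "(D *v axis i 1) \<bullet> (S *v (D *v axis i 1)) = 0" "(D *v axis i 1) \<bullet> (T *v (D *v axis i 1)) = 0" for i
    using nn by (simp_all add: sum_nonneg_eq_0_iff)
  then have "S *v (D *v axis i 1) = 0" "T *v (D *v axis i 1) = 0" for i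
    using S T psd_matrix_kernel by blast+
  then have "D *v (D *v axis i 1) = 0" for i
    by (metis D_def diff_self matrix_vector_mult_diff_rdistrib)
  then have "(D *v axis i 1) \<bullet> (D *v axis i 1) = 0" for i
    using psd_matrix_transpose_inner[OF trD, of "axis i 1" "D *v axis i 1"] by simp
  then have "D = 0"
    by (simp add: matrix_vector_mult_basis column_def vec_eq_iff)
  then show ?thesis by (simp add: D_def)
qed

lemma mat_sqrt:
  assumes "psd_matrix M"
  shows "psd_matrix (mat_sqrt M)" "mat_sqrt M ** mat_sqrt M = M"
proof -
  have "\<exists>!S. psd_matrix S \<and> S ** S = M"
    using psd_matrix_sqrt_exists[OF assms] psd_matrix_sqrt_unique by metis
  from theI'[OF this] show "psd_matrix (mat_sqrt M)" "mat_sqrt M ** mat_sqrt M = M"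
    by (auto simp: mat_sqrt_def)
qed

lemma norm_mat_sqrt:
  assumes "psd_matrix M"
  shows "(norm (mat_sqrt M *v \<xi>))\<^sup>2 = \<xi> \<bullet> (M *v \<xi>)"
proof -
  have "(norm (mat_sqrt M *v \<xi>))\<^sup>2 = (mat_sqrt M *v \<xi>) \<bullet> (mat_sqrt M *v \<xi>)"
    by (simp add: dot_square_norm)
  also have "\<dots> = \<xi> \<bullet> (mat_sqrt M *v (mat_sqrt M *v \<xi>))"
    using mat_sqrt(1)[OF assms] by (simp add: psd_matrix_def psd_matrix_transpose_inner)
  finally show ?thesis by (simp add: matrix_vector_mul_assoc mat_sqrt(2)[OF assms])
qed

section \<open>Continuity of translations in the mean\<close>

lemma integrable_translate:
  fixes f :: "'a::euclidean_space \<Rightarrow> 'b::{banach, second_countable_topology}"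
  assumes "integrable lborel f"
  shows "integrable lborel (\<lambda>y. f (h + y))" "(\<integral>y. f (h + y) \<partial>lborel) = (\<integral>y. f y \<partial>lborel)"
proof -
  have "integrable (distr lborel borel ((+) h)) f" using assms by (simp add: lborel_distr_plus)
  then show "integrable lborel (\<lambda>y. f (h + y))" 
    using assms by (subst (asm) integrable_distr_eq) auto
  have "(\<integral>y. f y \<partial>lborel) = (\<integral>y. f y \<partial>distr lborel borel ((+) h))" by (simp add: lborel_distr_plus)
  also have "\<dots> = (\<integral>y. f (h + y) \<partial>lborel)" 
    using assms by (intro integral_distr) auto
  finally show "(\<integral>y. f (h + y) \<partial>lborel) = (\<integral>y. f y \<partial>lborel)" by simp
qed

lemma nn_integral_translate:
  fixes f :: "'a::euclidean_space \<Rightarrow> ennreal"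
  assumes "f \<in> borel_measurable borel"
  shows "(\<integral>\<^sup>+y. f (h + y) \<partial>lborel) = (\<integral>\<^sup>+y. f y \<partial>lborel)"
proof -
  have "(\<integral>\<^sup>+y. f y \<partial>lborel) = (\<integral>\<^sup>+y. f y \<partial>distr lborel borel ((+) h))" by (simp add: lborel_distr_plus)
  also have "\<dots> = (\<integral>\<^sup>+y. f (h + y) \<partial>lborel)" 
    using assms by (intro nn_integral_distr) auto
  finally show ?thesis by simp
qed

lemma mult_divide_Suc_less:
  fixes n e :: real
  assumes "0 \<le> n" "e > 0"
  shows "n * (e / (n + 1)) < e"
proof -
  have "n * (e / (n + 1)) < (n + 1) * (e / (n + 1))" using assms by (intro mult_strict_right_mono) auto
  then show ?thesis using assms by simp
qed

definition L1_translation_continuous :: "('a::euclidean_space \<Rightarrow> 'b::{banach, second_countable_topology}) \<Rightarrow> bool" where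
  "L1_translation_continuous w \<longleftrightarrow>
     (\<forall>e>0. \<exists>d>0. \<forall>h. norm h < d \<longrightarrow> (\<integral>y. norm (w (h + y) - w y) \<partial>lborel) < e)"

lemma L1_translation_continuous_approx:
  fixes w :: "'a::euclidean_space \<Rightarrow> 'b::{banach, second_countable_topology}"
  assumes w: "integrable lborel w"
    and ap: "\<And>e::real. e > 0 \<Longrightarrow> \<exists>w'. integrable lborel w' \<and> L1_translation_continuous w' \<and> (\<integral>y. norm (w y - w' y) \<partial>lborel) < e"
  shows "L1_translation_continuous w"
  unfolding L1_translation_continuous_def
proof (intro allI impI)
  fix e :: real assume "e > 0"
  then obtain w' where w': "integrable lborel w'" "L1_translation_continuous w'" "(\<integral>y. norm (w y - w' y) \<partial>lborel) < e/3"
    using ap[of "e/3"] by auto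
  then obtain d where d: "d > 0" "\<And>h. norm h < d \<Longrightarrow> (\<integral>y. norm (w' (h + y) - w' y) \<partial>lborel) < e/3"
    using \<open>e > 0\<close> unfolding L1_translation_continuous_def by (metis zero_less_divide_iff zero_less_numeral)
  have "(\<integral>y. norm (w (h + y) - w y) \<partial>lborel) < e" if h: "norm h < d" for h
  proof -
    note [intro] = w w'(1) integrable_translate(1)[OF w] integrable_translate(1)[OF w'(1)]
    have "(\<integral>y. norm (w (h + y) - w y) \<partial>lborel) \<le>
        (\<integral>y. norm (w (h + y) - w' (h + y)) + norm (w' (h + y) - w' y) + norm (w y - w' y) \<partial>lborel)"
    proof (rule integral_mono)
      fix y
      have "w (h + y) - w y = (w (h + y) - w' (h + y)) + (w' (h + y) - w' y) - (w y - w' y)" by simp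
      then show "norm (w (h + y) - w y) \<le> norm (w (h + y) - w' (h + y)) + norm (w' (h + y) - w' y) + norm (w y - w' y)"
        using norm_triangle_ineq4 norm_triangle_ineq by (smt (verit))
    qed (intro integrable_norm Bochner_Integration.integrable_diff Bochner_Integration.integrable_add; blast)+
    also have "\<dots> = (\<integral>y. norm (w (h + y) - w' (h + y)) \<partial>lborel) + (\<integral>y. norm (w' (h + y) - w' y) \<partial>lborel) + (\<integral>y. norm (w y - w' y) \<partial>lborel)"
      by (subst Bochner_Integration.integral_add; (intro integrable_norm Bochner_Integration.integrable_diff Bochner_Integration.integrable_add)?; blast?)+
    also have "(\<integral>y. norm (w (h + y) - w' (h + y)) \<partial>lborel) = (\<integral>y. norm (w y - w' y) \<partial>lborel)"
      using integrable_translate(2)[of "\<lambda>y. norm (w y - w' y)" h] w w'(1) by auto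
    finally show ?thesis using w'(3) d(2)[OF h] by linarith
  qed
  with d(1) show "\<exists>d>0. \<forall>h. norm h < d \<longrightarrow> (\<integral>y. norm (w (h + y) - w y) \<partial>lborel) < e" by blast
qed

text \<open>An indicator and its translate have equal integrals, so the integral of their absolute
  difference is twice that of the positive part of one minus the other. This positive part lives on
  \<open>U\<close>, is dominated by the indicator of \<open>U\<close>, and tends to 0 pointwise
  because \<open>U\<close> is open.\<close>

lemma L1_translation_continuous_open:
  fixes U :: "'a::euclidean_space set" and c :: "'b::{banach, second_countable_topology}"
  assumes U: "open U" and fin: "emeasure lborel U < \<infinity>"
  shows "L1_translation_continuous (\<lambda>y. indicator U y *\<^sub>R c)"
proof -
  let ?I = "indicator U :: 'a \<Rightarrow> real"
  have [measurable]: "U \<in> sets borel" using U by auto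
  have int: "integrable lborel ?I" using fin by (simp add: less_top)
  let ?g = "\<lambda>h y. max 0 (?I y - ?I (h + y))"
  have intg: "integrable lborel (?g h)" for h
    using int integrable_translate(1)[OF int, of h] by auto
  have eq: "(\<integral>y. \<bar>?I (h + y) - ?I y\<bar> \<partial>lborel) = 2 * (\<integral>y. ?g h y \<partial>lborel)" for h
  proof -
    have "(\<integral>y. \<bar>?I (h + y) - ?I y\<bar> \<partial>lborel) = (\<integral>y. 2 * ?g h y + (?I (h + y) - ?I y) \<partial>lborel)"
      by (intro Bochner_Integration.integral_cong refl) (auto simp: max_def abs_if)
    also have "\<dots> = 2 * (\<integral>y. ?g h y \<partial>lborel) + ((\<integral>y. ?I (h + y) \<partial>lborel) - (\<integral>y. ?I y \<partial>lborel))"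
      using intg[of h] int integrable_translate(1)[OF int, of h]
      by (subst Bochner_Integration.integral_add) auto
    finally show ?thesis using integrable_translate(2)[OF int] by simp
  qed
  have cont: "isCont (\<lambda>h. \<integral>y. ?g h y \<partial>lborel) 0"
    unfolding continuous_at_sequentially
  proof (intro allI impI)
    fix x :: "nat \<Rightarrow> 'a" assume x: "x \<longlonglongrightarrow> 0"
    have "(\<lambda>n. \<integral>y. ?g (x n) y \<partial>lborel) \<longlonglongrightarrow> (\<integral>y. 0 \<partial>(lborel::'a measure))"
    proof (rule integral_dominated_convergence[where w="?I"])
      show "integrable lborel ?I" by fact
      show "AE y in lborel. (\<lambda>n. ?g (x n) y) \<longlonglongrightarrow> 0"
      proof (intro AE_I2)
        fix y
        show "(\<lambda>n. ?g (x n) y) \<longlonglongrightarrow> 0"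
        proof (cases "y \<in> U")
          case True
          have "(\<lambda>n. x n + y) \<longlonglongrightarrow> 0 + y" by (intro tendsto_intros x)
          then have "eventually (\<lambda>n. x n + y \<in> U) sequentially"
            using U True by (metis add_0 topological_tendstoD)
          then have "eventually (\<lambda>n. ?g (x n) y = 0) sequentially"
            by eventually_elim (use True in auto)
          then show ?thesis by (rule tendsto_eventually)
        qed auto
      qed
      show "AE y in lborel. norm (?g (x n) y) \<le> ?I y" for n
        by (intro AE_I2) (auto simp: indicator_def)
    qed measurable
    then show "((\<lambda>h. \<integral>y. ?g h y \<partial>lborel) \<circ> x) \<longlonglongrightarrow> (\<integral>y. ?g 0 y \<partial>lborel)"
      by (simp add: o_def)
  qed
  show ?thesis unfolding L1_translation_continuous_def
  proof (intro allI impI)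
    fix e :: real assume "e > 0"
    let ?e = "e / (2 * (norm c + 1))"
    have "?e > 0" using \<open>e > 0\<close> by (simp add: add_nonneg_pos)
    then obtain d where d: "d > 0" "\<And>h. norm h < d \<Longrightarrow> \<bar>\<integral>y. ?g h y \<partial>lborel\<bar> < ?e"
      using cont unfolding continuous_at_eps_delta by fastforce
    have "(\<integral>y. norm (?I (h + y) *\<^sub>R c - ?I y *\<^sub>R c) \<partial>lborel) < e" if "norm h < d" for h
    proof -
      have "(\<integral>y. norm (?I (h + y) *\<^sub>R c - ?I y *\<^sub>R c) \<partial>lborel) = (\<integral>y. norm c * \<bar>?I (h + y) - ?I y\<bar> \<partial>lborel)"
        by (intro Bochner_Integration.integral_cong refl) (simp add: scaleR_diff_left[symmetric])
      also have "\<dots> = norm c * (2 * (\<integral>y. ?g h y \<partial>lborel))" by (simp only: eq integral_mult_right_zero)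
      also have "\<dots> \<le> norm c * (2 * ?e)" using d(2)[OF that] by (intro mult_left_mono) auto
      also have "\<dots> = norm c * (e / (norm c + 1))"
      proof -
        have "2 * (e / (2 * x)) = e / x" for x by simp
        then show ?thesis by metis
      qed
      also have "\<dots> < e" using \<open>e > 0\<close> by (intro mult_divide_Suc_less) auto
      finally show ?thesis .
    qed
    with d(1) show "\<exists>d>0. \<forall>h. norm h < d \<longrightarrow> (\<integral>y. norm (?I (h + y) *\<^sub>R c - ?I y *\<^sub>R c) \<partial>lborel) < e" by blast
  qed
qed

text \<open>The property is stable under sums and \<open>L\<^sup>1\<close> limits, so it is enough
  to treat indicators of Borel sets of finite measure. Outer regularity replaces such a set by an
  open one.\<close>

lemma integrable_L1_translation_continuous:
  fixes w :: "'a::euclidean_space \<Rightarrow> 'b::{banach, second_countable_topology}"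
  assumes "integrable lborel w"
  shows "L1_translation_continuous w"
  using assms
proof (induction rule: integrable_induct)
  case (base A c)
  then have A[measurable]: "A \<in> sets borel" and finA: "emeasure lborel A < \<infinity>" by auto
  show ?case
  proof (rule L1_translation_continuous_approx)
    show "integrable lborel (\<lambda>x. indicat_real A x *\<^sub>R c)" using finA by (auto intro!: integrable_scaleR_left)
    fix e :: real assume "e > 0"
    let ?e = "e / (norm c + 1)"
    have e': "?e > 0" using \<open>e > 0\<close> by (simp add: add_nonneg_pos)
    obtain U where U: "open U" "A \<subseteq> U" "emeasure lborel (U - A) < ennreal ?e"
      using outer_regular_lborel[OF A e'] by auto
    have [measurable]: "U \<in> sets borel" using U by auto
    have "emeasure lborel U = emeasure lborel A + emeasure lborel (U - A)"
      using U(2) by (subst plus_emeasure) (auto simp: Un_absorb1)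
    also have "\<dots> < \<infinity>" using finA order.strict_trans[OF U(3) ennreal_less_top] by simp
    finally have finU: "emeasure lborel U < \<infinity>" .
    have "(\<integral>y. norm (indicat_real A y *\<^sub>R c - indicat_real U y *\<^sub>R c) \<partial>lborel) = (\<integral>y. norm c * indicat_real (U - A) y \<partial>lborel)"
      using U(2) by (intro Bochner_Integration.integral_cong refl) (auto simp: indicator_def)
    also have "\<dots> = norm c * measure lborel (U - A)" by simp
    also have "\<dots> \<le> norm c * ?e" using U(3) e' by (intro mult_left_mono) (auto simp: measure_def enn2real_leI less_imp_le)
    also have "\<dots> < e" using \<open>e > 0\<close> by (intro mult_divide_Suc_less) auto
    finally show "\<exists>w'. integrable lborel w' \<and> L1_translation_continuous w' \<and> (\<integral>y. norm (indicat_real A y *\<^sub>R c - w' y) \<partial>lborel) < e"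
      using L1_translation_continuous_open[OF U(1) finU] finU 
      by (intro exI[of _ "\<lambda>y. indicat_real U y *\<^sub>R c"]) (auto intro!: integrable_scaleR_left)
  qed
next
  case (add f g)
  show ?case unfolding L1_translation_continuous_def
  proof (intro allI impI)
    fix e :: real assume "e > 0"
    then have "e/2 > 0" by simp
    obtain d1 where d1: "d1 > 0" "\<And>h. norm h < d1 \<Longrightarrow> (\<integral>y. norm (f (h + y) - f y) \<partial>lborel) < e/2"
      using add.IH(1) \<open>e/2 > 0\<close> unfolding L1_translation_continuous_def by blast
    obtain d2 where d2: "d2 > 0" "\<And>h. norm h < d2 \<Longrightarrow> (\<integral>y. norm (g (h + y) - g y) \<partial>lborel) < e/2"
      using add.IH(2) \<open>e/2 > 0\<close> unfolding L1_translation_continuous_def by blast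
    have "(\<integral>y. norm (f (h + y) + g (h + y) - (f y + g y)) \<partial>lborel) < e" if h: "norm h < min d1 d2" for h
    proof -
      note [intro] = add.hyps integrable_translate(1)[OF add.hyps(1)] integrable_translate(1)[OF add.hyps(2)]
      have "(\<integral>y. norm (f (h + y) + g (h + y) - (f y + g y)) \<partial>lborel) \<le> (\<integral>y. norm (f (h + y) - f y) + norm (g (h + y) - g y) \<partial>lborel)"
      proof (rule integral_mono)
        fix y
        have "f (h + y) + g (h + y) - (f y + g y) = (f (h + y) - f y) + (g (h + y) - g y)" by simp
        then show "norm (f (h + y) + g (h + y) - (f y + g y)) \<le> norm (f (h + y) - f y) + norm (g (h + y) - g y)"
          by (metis norm_triangle_ineq)
      qed (intro integrable_norm Bochner_Integration.integrable_diff Bochner_Integration.integrable_add; blast)+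
      also have "\<dots> = (\<integral>y. norm (f (h + y) - f y) \<partial>lborel) + (\<integral>y. norm (g (h + y) - g y) \<partial>lborel)"
        by (intro Bochner_Integration.integral_add integrable_norm Bochner_Integration.integrable_diff) blast+
      finally show ?thesis using d1(2)[of h] d2(2)[of h] h by simp
    qed
    then show "\<exists>d>0. \<forall>h. norm h < d \<longrightarrow> (\<integral>y. norm (f (h + y) + g (h + y) - (f y + g y)) \<partial>lborel) < e"
      using d1(1) d2(1) by (intro exI[of _ "min d1 d2"]) auto
  qed
next
  case (lim f s)
  show ?case
  proof (rule L1_translation_continuous_approx)
    show "integrable lborel f" by fact
    fix e :: real assume "e > 0"
    have "(\<lambda>i. \<integral>y. norm (f y - s i y) \<partial>lborel) \<longlonglongrightarrow> (\<integral>y. 0 \<partial>(lborel::'a measure))"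
    proof (rule integral_dominated_convergence[where w="\<lambda>y. 3 * norm (f y)"])
      show "AE y in lborel. (\<lambda>i. norm (f y - s i y)) \<longlonglongrightarrow> 0"
      proof (intro AE_I2)
        fix y
        have "(\<lambda>i. norm (f y - s i y)) \<longlonglongrightarrow> norm (f y - f y)"
          by (intro tendsto_intros lim.hyps) auto
        then show "(\<lambda>i. norm (f y - s i y)) \<longlonglongrightarrow> 0" by simp
      qed
      show "AE y in lborel. norm (norm (f y - s i y)) \<le> 3 * norm (f y)" for i
      proof (intro AE_I2)
        fix y
        show "norm (norm (f y - s i y)) \<le> 3 * norm (f y)"
          using lim.hyps(3)[of y i] norm_triangle_ineq4[of "f y" "s i y"] by simp
      qed
    qed (use lim.hyps in auto)
    then have "(\<lambda>i. \<integral>y. norm (f y - s i y) \<partial>lborel) \<longlonglongrightarrow> 0" by simp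
    then have "eventually (\<lambda>i. (\<integral>y. norm (f y - s i y) \<partial>lborel) < e) sequentially"
      using \<open>e > 0\<close> by (rule order_tendstoD)
    then obtain i where "(\<integral>y. norm (f y - s i y) \<partial>lborel) < e" by (auto simp: eventually_sequentially)
    then show "\<exists>w'. integrable lborel w' \<and> L1_translation_continuous w' \<and> (\<integral>y. norm (f y - w' y) \<partial>lborel) < e"
      using lim.hyps(1) lim.IH by blast
  qed
qed

text \<open>Reduces continuity of translations in \<open>L\<^sup>2\<close> to the \<open>L\<^sup>1\<close> case for the function \<open>u \<bar>u\<bar>\<close>.\<close>

lemma square_diff_le_signed_square:
  fixes a b :: real
  shows "(a - b)\<^sup>2 \<le> 2 * \<bar>a * \<bar>a\<bar> - b * \<bar>b\<bar>\<bar>"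
proof -
  have same: "(a - b)\<^sup>2 \<le> \<bar>a\<^sup>2 - b\<^sup>2\<bar>" if "0 \<le> a" "0 \<le> b" for a b :: real
  proof -
    have "(a - b)\<^sup>2 = \<bar>a - b\<bar> * \<bar>a - b\<bar>" by (simp add: power2_eq_square)
    also have "\<dots> \<le> \<bar>a - b\<bar> * \<bar>a + b\<bar>" using that by (intro mult_left_mono) auto
    also have "\<dots> = \<bar>a\<^sup>2 - b\<^sup>2\<bar>" by (simp add: abs_mult[symmetric] power2_eq_square algebra_simps)
    finally show ?thesis .
  qed
  have opp: "(a - b)\<^sup>2 \<le> 2 * (a\<^sup>2 + b\<^sup>2)" for a b :: real
    using zero_le_power2[of "a + b"] by (simp add: power2_eq_square algebra_simps)
  have dbl: "t \<le> \<bar>s\<bar> \<Longrightarrow> t \<le> 2 * \<bar>s\<bar>" for t s :: real by linarith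
  consider "0 \<le> a" "0 \<le> b" | "a \<le> 0" "b \<le> 0" | "0 \<le> a" "b \<le> 0" | "a \<le> 0" "0 \<le> b" by linarith
  then show ?thesis
  proof cases
    case 1
    then have "(a - b)\<^sup>2 \<le> \<bar>a * \<bar>a\<bar> - b * \<bar>b\<bar>\<bar>" using same[of a b] by (simp add: power2_eq_square)
    then show ?thesis by (rule dbl)
  next
    case 2
    then have "(a - b)\<^sup>2 \<le> \<bar>a * \<bar>a\<bar> - b * \<bar>b\<bar>\<bar>"
      using same[of "-b" "-a"] by (simp add: power2_eq_square abs_minus_commute algebra_simps)
    then show ?thesis by (rule dbl)
  next
    case 3 
    have "0 \<le> a * a" "0 \<le> b * b" by auto
    then show ?thesis using 3 opp[of a b] by (simp add: power2_eq_square)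
  next
    case 4
    have "0 \<le> a * a" "0 \<le> b * b" by auto
    then show ?thesis using 4 opp[of a b] by (simp add: power2_eq_square)
  qed
qed

lemma L2_translation_continuous:
  fixes u :: "'a::euclidean_space \<Rightarrow> real"
  assumes [measurable]: "u \<in> borel_measurable borel" and u2: "integrable lborel (\<lambda>y. (u y)\<^sup>2)" and e: "e > 0"
  shows "\<exists>d>0. \<forall>h. norm h < d \<longrightarrow> (\<integral>\<^sup>+y. ennreal ((u (h + y) - u y)\<^sup>2) \<partial>lborel) \<le> ennreal e"
proof -
  let ?w = "\<lambda>y. u y * \<bar>u y\<bar>"
  have w: "integrable lborel ?w"
    by (rule Bochner_Integration.integrable_bound[OF u2]) (auto simp: power2_eq_square abs_mult)
  obtain d where d: "d > 0" "\<And>h. norm h < d \<Longrightarrow> (\<integral>y. norm (?w (h + y) - ?w y) \<partial>lborel) < e/2"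
    using integrable_L1_translation_continuous[OF w] e unfolding L1_translation_continuous_def
    by (meson half_gt_zero)
  have "(\<integral>\<^sup>+y. ennreal ((u (h + y) - u y)\<^sup>2) \<partial>lborel) \<le> ennreal e" if h: "norm h < d" for h
  proof -
    have "(\<integral>\<^sup>+y. ennreal ((u (h + y) - u y)\<^sup>2) \<partial>lborel) \<le> (\<integral>\<^sup>+y. ennreal (2 * norm (?w (h + y) - ?w y)) \<partial>lborel)"
      by (intro nn_integral_mono ennreal_leI) (use square_diff_le_signed_square in auto)
    also have "\<dots> = ennreal (\<integral>y. 2 * norm (?w (h + y) - ?w y) \<partial>lborel)"
      using w integrable_translate(1)[OF w, of h] by (intro nn_integral_eq_integral) auto
    also have "\<dots> \<le> ennreal e" using d(2)[OF h] by (intro ennreal_leI) simp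
    finally show ?thesis .
  qed
  with d(1) show ?thesis by blast
qed

text \<open>Cauchy-Schwarz on the ball, Fubini and continuity of translations in
  \<open>L\<^sup>2\<close>. The error \<open>v\<close> is left abstract so that one estimate serves
  the mollification error, the commutator, and the uniqueness argument with bumps. Cauchy-Schwarz
  costs the factor c^2; the 1 added to it below allows c = 0.\<close>

lemma kernel_approx_L2:
  fixes u :: "'a::euclidean_space \<Rightarrow> real"
  assumes [measurable]: "u \<in> borel_measurable borel" and u2: "integrable lborel (\<lambda>y. (u y)\<^sup>2)"
    and c: "0 \<le> c" and e: "e > 0"
  shows "\<exists>d>0. \<forall>\<epsilon> v. 0 < \<epsilon> \<and> \<epsilon> < d \<and>
     (\<forall>y. ennreal \<bar>v y\<bar> \<le> (\<integral>\<^sup>+h. ennreal (c / measure lborel (ball 0 \<epsilon> :: 'a set) * \<bar>u (h + y) - u y\<bar>) * indicator (ball 0 \<epsilon>) h \<partial>lborel)) \<longrightarrow>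
     (\<integral>\<^sup>+y. ennreal ((v y)\<^sup>2) \<partial>lborel) \<le> ennreal e"
proof -
  let ?e = "e / (c\<^sup>2 + 1)"
  have "?e > 0" using e by (simp add: add_nonneg_pos)
  from L2_translation_continuous[OF assms(1) u2 this] obtain d where d: "d > 0"
    "\<And>h. norm h < d \<Longrightarrow> (\<integral>\<^sup>+y. ennreal ((u (h + y) - u y)\<^sup>2) \<partial>lborel) \<le> ennreal ?e" by blast
  have "(\<integral>\<^sup>+y. ennreal ((v y)\<^sup>2) \<partial>lborel) \<le> ennreal e"
    if \<epsilon>: "0 < \<epsilon>" "\<epsilon> < d" and v: "\<And>y. ennreal \<bar>v y\<bar> \<le> (\<integral>\<^sup>+h. ennreal (c / measure lborel (ball 0 \<epsilon> :: 'a set) * \<bar>u (h + y) - u y\<bar>) * indicator (ball 0 \<epsilon>) h \<partial>lborel)"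
    for \<epsilon> v
  proof -
    let ?B = "ball 0 \<epsilon> :: 'a set"
    let ?b = "measure lborel ?B"
    have [measurable]: "?B \<in> sets borel" by simp
    have b: "?b > 0" using \<epsilon> content_ball_pos[of \<epsilon> "0::'a"] by simp
    have fin: "emeasure lborel ?B = ennreal ?b"
      using emeasure_lborel_ball_finite[of "0::'a" \<epsilon>] by (intro emeasure_eq_ennreal_measure) auto
    have "ennreal ((v y)\<^sup>2) \<le> ennreal (c\<^sup>2 / ?b) * (\<integral>\<^sup>+h. ennreal ((u (h + y) - u y)\<^sup>2) * indicator ?B h \<partial>lborel)" for y
    proof -
      have "ennreal ((v y)\<^sup>2) = (ennreal \<bar>v y\<bar>)\<^sup>2" by (simp add: ennreal_power)
      also have "\<dots> \<le> (\<integral>\<^sup>+h. (ennreal (c / ?b * \<bar>u (h + y) - u y\<bar>) * indicator ?B h) * indicator ?B h \<partial>lborel)\<^sup>2"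
        by (intro power_mono order.trans[OF v] nn_integral_mono) (auto simp: indicator_def)
      also have "\<dots> \<le> (\<integral>\<^sup>+h. (ennreal (c / ?b * \<bar>u (h + y) - u y\<bar>) * indicator ?B h)\<^sup>2 \<partial>lborel) * (\<integral>\<^sup>+h. (indicator ?B h)\<^sup>2 \<partial>(lborel :: 'a measure))"
        by (rule Cauchy_Schwarz_nn_integral) measurable
      also have "(\<integral>\<^sup>+h. (indicator ?B h)\<^sup>2 \<partial>(lborel :: 'a measure)) = (\<integral>\<^sup>+h. indicator ?B h \<partial>(lborel :: 'a measure))"
        by (intro nn_integral_cong) (auto simp: indicator_def)
      also have "\<dots> = ennreal ?b" by (simp add: fin)
      also have "(\<integral>\<^sup>+h. (ennreal (c / ?b * \<bar>u (h + y) - u y\<bar>) * indicator ?B h)\<^sup>2 \<partial>lborel) =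
         (\<integral>\<^sup>+h. ennreal ((c / ?b)\<^sup>2) * (ennreal ((u (h + y) - u y)\<^sup>2) * indicator ?B h) \<partial>lborel)"
      proof (intro nn_integral_cong)
        fix h
        have "(ennreal (c / ?b * \<bar>u (h + y) - u y\<bar>))\<^sup>2 = ennreal ((c / ?b)\<^sup>2) * ennreal ((u (h + y) - u y)\<^sup>2)"
          using c b by (subst ennreal_power) (auto simp only: power_mult_distrib power2_abs ennreal_mult[symmetric] zero_le_power2
              intro!: mult_nonneg_nonneg divide_nonneg_pos)
        then show "(ennreal (c / ?b * \<bar>u (h + y) - u y\<bar>) * indicator ?B h)\<^sup>2 =
            ennreal ((c / ?b)\<^sup>2) * (ennreal ((u (h + y) - u y)\<^sup>2) * indicator ?B h)"
          by (simp only: indicator_def split: if_split) simp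
      qed
      also have "\<dots> = ennreal ((c / ?b)\<^sup>2) * (\<integral>\<^sup>+h. ennreal ((u (h + y) - u y)\<^sup>2) * indicator ?B h \<partial>lborel)"
        by (rule nn_integral_cmult) measurable
      also have "\<dots> * ennreal ?b = (ennreal ((c / ?b)\<^sup>2) * ennreal ?b) * (\<integral>\<^sup>+h. ennreal ((u (h + y) - u y)\<^sup>2) * indicator ?B h \<partial>lborel)"
        by (simp add: mult_ac)
      also have "ennreal ((c / ?b)\<^sup>2) * ennreal ?b = ennreal (c\<^sup>2 / ?b)"
        using b by (simp add: ennreal_mult[symmetric] power2_eq_square)
      finally show ?thesis .
    qed
    then have "(\<integral>\<^sup>+y. ennreal ((v y)\<^sup>2) \<partial>lborel) \<le>
      (\<integral>\<^sup>+y. ennreal (c\<^sup>2 / ?b) * (\<integral>\<^sup>+h. ennreal ((u (h + y) - u y)\<^sup>2) * indicator ?B h \<partial>lborel) \<partial>lborel)"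
      by (intro nn_integral_mono)
    also have "\<dots> = ennreal (c\<^sup>2 / ?b) * (\<integral>\<^sup>+y. (\<integral>\<^sup>+h. ennreal ((u (h + y) - u y)\<^sup>2) * indicator ?B h \<partial>lborel) \<partial>lborel)"
      by (rule nn_integral_cmult) measurable
    also have "(\<integral>\<^sup>+y. (\<integral>\<^sup>+h. ennreal ((u (h + y) - u y)\<^sup>2) * indicator ?B h \<partial>lborel) \<partial>lborel) =
       (\<integral>\<^sup>+h. (\<integral>\<^sup>+y. ennreal ((u (h + y) - u y)\<^sup>2) * indicator ?B h \<partial>lborel) \<partial>lborel)"
      by (rule lborel_pair.Fubini') measurable
    also have "\<dots> \<le> (\<integral>\<^sup>+h. ennreal ?e * indicator ?B h \<partial>lborel)"
    proof (intro nn_integral_mono)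
      fix h :: 'a
      show "(\<integral>\<^sup>+y. ennreal ((u (h + y) - u y)\<^sup>2) * indicator ?B h \<partial>lborel) \<le> ennreal ?e * indicator ?B h"
        using d(2)[of h] \<epsilon> by (cases "h \<in> ?B") auto
    qed
    also have "\<dots> = ennreal ?e * ennreal ?b" by (simp add: fin nn_integral_cmult_indicator)
    also have "ennreal (c\<^sup>2 / ?b) * (ennreal ?e * ennreal ?b) = ennreal (c\<^sup>2 * ?e)"
    proof -
      have "ennreal (c\<^sup>2 * ?e) = ennreal (c\<^sup>2 / ?b * (?e * ?b))" using b by simp
      also have "\<dots> = ennreal (c\<^sup>2 / ?b) * (ennreal ?e * ennreal ?b)"
        using b \<open>?e > 0\<close> by (simp only: ennreal_mult zero_le_power2 divide_nonneg_pos mult_nonneg_nonneg less_imp_le)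
      finally show ?thesis by simp
    qed
    also have "\<dots> \<le> ennreal e" using mult_divide_Suc_less[of "c\<^sup>2" e] e by (intro ennreal_leI) simp
    finally show ?thesis using b by (simp add: mult_left_mono)
  qed
  with d(1) show ?thesis by blast
qed

section \<open>Rademacher's theorem\<close>

text \<open>After adding a linear function \<open>f\<close> is a bi-Lipschitz homeomorphism \<open>G\<close> of the line, whose Stieltjes measure
  has a density by Radon-Nikodym; \<open>f\<close> is then an indefinite integral.\<close>

lemma lipschitz_right_derivative_AE:
  fixes f :: "real \<Rightarrow> real"
  assumes f: "L-lipschitz_on UNIV f"
  shows "\<exists>N. negligible N \<and> (\<forall>t. t \<notin> N \<longrightarrow> (\<exists>l. ((\<lambda>h. (f (t + h) - f t) / h) \<longlongrightarrow> l) (at_right 0)))"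
proof -
  \<comment> \<open>The slope \<open>L + 1\<close> makes \<open>G\<close> increase at least as fast
    as the identity, so the inverse \<open>H\<close> is 1-Lipschitz.\<close>
  define G where "G t = f t + (L + 1) * t" for t
  have L: "0 \<le> L" using f lipschitz_on_nonneg by blast
  have lip: "\<bar>f s - f t\<bar> \<le> L * \<bar>s - t\<bar>" for s t
    using lipschitz_onD[OF f, of s t] by (simp add: dist_real_def)
  have Glow: "t - s \<le> G t - G s" if "s \<le> t" for s t
    using lip[of t s] that unfolding G_def by (simp add: algebra_simps)
  have Gup: "\<bar>G t - G s\<bar> \<le> (2 * L + 1) * \<bar>t - s\<bar>" for s t
  proof -
    have "G t - G s = (f t - f s) + (L + 1) * (t - s)" by (simp add: G_def algebra_simps)
    also have "\<bar>\<dots>\<bar> \<le> \<bar>f t - f s\<bar> + \<bar>(L + 1) * (t - s)\<bar>" by simp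
    also have "\<dots> \<le> L * \<bar>t - s\<bar> + (L + 1) * \<bar>t - s\<bar>" using lip[of t s] L by (simp add: abs_mult)
    finally show ?thesis by (simp add: algebra_simps)
  qed
  have Gless: "G s < G t \<longleftrightarrow> s < t" for s t
    using Glow[of s t] Glow[of t s] by (cases s t rule: linorder_cases) auto
  then have Gle: "G s \<le> G t \<longleftrightarrow> s \<le> t" for s t by (metis not_less)
  have Gcont: "continuous_on X G" for X
    unfolding G_def using lipschitz_on_continuous_on[OF f] continuous_on_subset
    by (intro continuous_intros) blast
  have "inj G" using Gless by (metis injI less_irrefl linorder_less_linear)
  have "surj G"
  proof (rule surjI)
    fix y
    let ?a = "\<bar>y - G 0\<bar>"
    have "G (-?a) \<le> y" "y \<le> G ?a" using Glow[of "-?a" 0] Glow[of 0 ?a] by auto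
    then obtain x where "G x = y" using IVT'[of G "-?a" y ?a] Gcont by auto
    then show "G (inv G y) = y" by (metis f_inv_into_f rangeI)
  qed
  define H where "H = inv G"
  have HG: "H (G t) = t" and GH: "G (H y) = y" for t y
    using \<open>inj G\<close> \<open>surj G\<close> by (auto simp: H_def surj_f_inv_f)
  have "1-lipschitz_on UNIV H"
  proof (rule lipschitz_onI)
    fix a b
    have "\<bar>H a - H b\<bar> \<le> \<bar>G (H a) - G (H b)\<bar>"
      using Glow[of "H a" "H b"] Glow[of "H b" "H a"] by linarith
    then show "dist (H a) (H b) \<le> 1 * dist a b" by (simp add: GH dist_real_def)
  qed simp
  then have [measurable]: "H \<in> borel_measurable borel"
    by (intro borel_measurable_continuous_onI lipschitz_on_continuous_on)
  \<comment> \<open>The Stieltjes measure of \<open>G\<close>: the preimage of an interval under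
    \<open>H\<close> is its image under \<open>G\<close>. It is absolutely continuous because
    Lipschitz maps send null sets to null sets.\<close>
  define \<nu> where "\<nu> = distr lborel borel H"
  have \<nu>: "emeasure \<nu> X = emeasure lborel (H -` X)" if "X \<in> sets borel" for X
    unfolding \<nu>_def using that by (subst emeasure_distr) auto
  have "absolutely_continuous lborel \<nu>"
    unfolding absolutely_continuous_def
  proof
    fix X assume X: "X \<in> null_sets (lborel :: real measure)"
    then have Xb: "X \<in> sets borel" by auto
    have "negligible X" using X negligible_iff_null_sets null_sets_completionI by blast
    then have "negligible (G ` X)"
    proof (rule negligible_locally_Lipschitz_image[rotated])
      show "DIM(real) \<le> DIM(real)" by simp
      fix x assume "x \<in> X"
      show "\<exists>T B. open T \<and> x \<in> T \<and> (\<forall>y\<in>X \<inter> T. norm (G y - G x) \<le> B * norm (y - x))"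
        using Gup by (intro exI[of _ UNIV] exI[of _ "2 * L + 1"]) auto
    qed
    moreover have "G ` X = H -` X" by (auto simp: HG) (metis GH imageI)
    ultimately have nl: "H -` X \<in> null_sets lebesgue" by (simp add: negligible_iff_null_sets)
    have "H -` X \<in> sets lborel" using Xb measurable_sets_borel[of H borel X] by auto
    then have "H -` X \<in> null_sets lborel" using nl by (simp add: null_sets_completion_iff)
    then have "emeasure lborel (H -` X) = 0" by auto
    then show "X \<in> null_sets \<nu>" using \<nu>[OF Xb] Xb by (auto simp: null_sets_def \<nu>_def)
  qed
  then obtain h where h[measurable]: "h \<in> borel_measurable lborel" and hd: "density lborel h = \<nu>"
    using sigma_finite_measure.Radon_Nikodym[OF lborel.sigma_finite_measure_axioms, of \<nu>] by (auto simp: \<nu>_def)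
  \<comment> \<open>\<open>enn2real\<close> replaces the value infinity by 0. This changes no
    integral, since \<open>h\<close> is finite almost everywhere on every bounded interval.\<close>
  define k where "k t = enn2real (h t)" for t
  have [measurable]: "k \<in> borel_measurable borel" using h unfolding k_def by measurable
  have hbi: "has_bochner_integral lborel (\<lambda>x. indicator {a..b} x *\<^sub>R k x) (G b - G a)" if ab: "a \<le> b" for a b
  proof -
    have "H -` {a..b} = {G a..G b}" using Gle HG GH by (auto) (metis Gle GH)+
    then have "emeasure \<nu> {a..b} = ennreal (G b - G a)" using Gle ab by (simp add: \<nu>)
    then have I: "(\<integral>\<^sup>+x. h x * indicator {a..b} x \<partial>lborel) = ennreal (G b - G a)"
      by (simp add: hd[symmetric] emeasure_density)
    have "AE x in lborel. h x * indicator {a..b} x \<noteq> \<infinity>"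
      using I by (intro nn_integral_PInf_AE) auto
    then have "AE x in lborel. h x * indicator {a..b} x = ennreal (indicator {a..b} x *\<^sub>R k x)"
      by eventually_elim (auto simp: indicator_def k_def top.not_eq_extremum)
    then have "(\<integral>\<^sup>+x. ennreal (indicator {a..b} x *\<^sub>R k x) \<partial>lborel) = ennreal (G b - G a)"
      using I nn_integral_cong_AE by fastforce
    then show ?thesis using Gle ab
      by (intro has_bochner_integral_nn_integral) (auto simp: k_def)
  qed
  have kint: "k integrable_on {a..b} \<and> integral {a..b} k = G b - G a" if "a \<le> b" for a b
  proof -
    have "set_integrable lborel {a..b} k" "(LINT x:{a..b}|lborel. k x) = G b - G a"
      using hbi[OF that] by (auto simp: set_integrable_def set_lebesgue_integral_def has_bochner_integral_iff)
    then show ?thesis using set_borel_integral_eq_integral by metis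
  qed
  have "k integrable_on cbox a b" for a b
    using kint[of a b] by (cases "a \<le> b") (auto simp: integrable_on_empty)
  \<comment> \<open>Lebesgue differentiation over cubes having \<open>x\<close> as lower corner; in
    one variable this yields the derivative from the right.\<close>
  then obtain N where N: "negligible N" "\<And>x e. \<lbrakk>x \<notin> N; 0 < e\<rbrakk> \<Longrightarrow>
       \<exists>d>0. \<forall>h. 0 < h \<and> h < d \<longrightarrow> norm (integral (cbox x (x + h *\<^sub>R One)) k /\<^sub>R h ^ DIM(real) - k x) < e"
    using integrable_ccontinuous_explicit[of k] by blast
  have "((\<lambda>h. (f (t + h) - f t) / h) \<longlongrightarrow> k t - (L + 1)) (at_right 0)" if t: "t \<notin> N" for t
  proof (rule tendstoI)
    fix e :: real assume "e > 0"
    then obtain d where d: "d > 0" "\<And>h. 0 < h \<and> h < d \<Longrightarrow> \<bar>integral {t..t+h} k / h - k t\<bar> < e"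
      using N(2)[OF t, of e] by (auto simp: divide_inverse mult.commute)
    have "\<bar>(f (t + h) - f t) / h - (k t - (L + 1))\<bar> < e" if h: "0 < h" "h < d" for h
    proof -
      have "integral {t..t+h} k / h = (f (t + h) - f t) / h + (L + 1)"
        using kint[of t "t+h"] h by (simp add: G_def field_simps)
      then show ?thesis using d(2)[of h] h by (simp add: algebra_simps)
    qed
    then show "\<forall>\<^sub>F h in at_right 0. dist ((f (t + h) - f t) / h) (k t - (L + 1)) < e"
      unfolding eventually_at_right_field dist_real_def using d(1) by auto
  qed
  with N(1) show ?thesis by blast
qed

section \<open>Difference quotients of Lipschitz functions in several variables\<close>

definition dirquot :: "('a::euclidean_space \<Rightarrow> real) \<Rightarrow> 'a \<Rightarrow> nat \<Rightarrow> 'a \<Rightarrow> real" where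
  "dirquot f v k x = (f (x + v /\<^sub>R real (Suc k)) - f x) * real (Suc k)"

lemma dirquot_bound:
  assumes "L-lipschitz_on UNIV f" shows "\<bar>dirquot f v k x\<bar> \<le> L * norm v"
proof -
  have "\<bar>f (x + v /\<^sub>R real (Suc k)) - f x\<bar> \<le> L * norm (v /\<^sub>R real (Suc k))"
    using lipschitz_onD[OF assms, of "x + v /\<^sub>R real (Suc k)" x] by (simp add: dist_norm)
  then have "\<bar>f (x + v /\<^sub>R real (Suc k)) - f x\<bar> * real (Suc k) \<le> L * norm v / real (Suc k) * real (Suc k)"
    by (intro mult_right_mono) (auto simp: divide_inverse mult_ac)
  then show ?thesis by (simp add: dirquot_def abs_mult)
qed

lemma dirquot_diff_bound:
  assumes "L-lipschitz_on UNIV f" shows "\<bar>dirquot f v k x - dirquot f w k x\<bar> \<le> L * norm (v - w)"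
proof -
  have "\<bar>f (x + v /\<^sub>R real (Suc k)) - f (x + w /\<^sub>R real (Suc k))\<bar> \<le> L * norm ((v - w) /\<^sub>R real (Suc k))"
    using lipschitz_onD[OF assms, of "x + v /\<^sub>R real (Suc k)" "x + w /\<^sub>R real (Suc k)"] 
    by (simp add: dist_norm scaleR_diff_right)
  then have "\<bar>f (x + v /\<^sub>R real (Suc k)) - f (x + w /\<^sub>R real (Suc k))\<bar> * real (Suc k) \<le> L * norm (v - w) / real (Suc k) * real (Suc k)"
    by (intro mult_right_mono) (auto simp: divide_inverse mult_ac)
  moreover have "dirquot f v k x - dirquot f w k x = (f (x + v /\<^sub>R real (Suc k)) - f (x + w /\<^sub>R real (Suc k))) * real (Suc k)"
    by (simp add: dirquot_def algebra_simps)
  ultimately show ?thesis by (simp add: abs_mult)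
qed

lemma dirquot_measurable:
  assumes "L-lipschitz_on UNIV f" shows "dirquot f v k \<in> borel_measurable borel"
proof -
  have "continuous_on UNIV f" using assms by (rule lipschitz_on_continuous_on)
  then have "continuous_on UNIV (\<lambda>x. f (x + v /\<^sub>R real (Suc k)))"
    by (rule continuous_on_compose2) (auto intro!: continuous_intros)
  then show ?thesis unfolding dirquot_def[abs_def]
    using \<open>continuous_on UNIV f\<close> by (intro borel_measurable_continuous_onI continuous_intros)
qed

text \<open>On every line in direction \<open>v\<close> the function is Lipschitz in one variable,
  so the line meets the set of divergence in a null set of parameters. Fubini then makes the whole
  set null.\<close>

lemma dirquot_convergent_AE:
  fixes f :: "'a::euclidean_space \<Rightarrow> real"
  assumes f: "L-lipschitz_on UNIV f"
  shows "AE x in lborel. convergent (\<lambda>k. dirquot f v k x)"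
proof -
  note [measurable] = dirquot_measurable[OF f]
  define N where "N = {x. \<not> convergent (\<lambda>k. dirquot f v k x)}"
  have "{x \<in> space borel. Cauchy (\<lambda>k. dirquot f v k x)} \<in> sets borel"
    by (rule sets_Collect_Cauchy) measurable
  then have "UNIV - {x. Cauchy (\<lambda>k. dirquot f v k x)} \<in> sets borel" by (intro sets.Diff) auto
  moreover have "N = UNIV - {x. Cauchy (\<lambda>k. dirquot f v k x)}" by (auto simp: N_def Cauchy_convergent_iff)
  ultimately have Nb[measurable]: "N \<in> sets borel" by simp
  have L: "0 \<le> L" using f lipschitz_on_nonneg by blast
  have line: "(\<integral>\<^sup>+t. indicator N (t *\<^sub>R v + x) * indicator {0..1} t \<partial>lborel) = 0" for x
  proof -
    define g where "g t = f (t *\<^sub>R v + x)" for t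
    have "(L * norm v)-lipschitz_on UNIV g"
    proof (rule lipschitz_onI)
      fix s t
      have "dist (g s) (g t) \<le> L * dist (s *\<^sub>R v + x) (t *\<^sub>R v + x)"
        unfolding g_def by (rule lipschitz_onD[OF f]) auto
      also have "dist (s *\<^sub>R v + x) (t *\<^sub>R v + x) = norm v * dist s t"
        by (simp add: dist_norm scaleR_diff_left[symmetric] dist_real_def)
      finally show "dist (g s) (g t) \<le> L * norm v * dist s t" by (simp add: mult_ac)
    qed (use L in simp)
    then obtain M where M: "negligible M" "\<And>t. t \<notin> M \<Longrightarrow> \<exists>l. ((\<lambda>h. (g (t + h) - g t) / h) \<longlongrightarrow> l) (at_right 0)"
      using lipschitz_right_derivative_AE by blast
    have NM: "t \<in> M" if "t *\<^sub>R v + x \<in> N" for t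
    proof (rule ccontr)
      assume "t \<notin> M"
      then obtain l where "((\<lambda>h. (g (t + h) - g t) / h) \<longlongrightarrow> l) (at_right 0)" using M by blast
      moreover have "filterlim (\<lambda>k. inverse (real (Suc k))) (at_right 0) sequentially"
        by (intro tendsto_imp_filterlim_at_right LIMSEQ_inverse_real_of_nat) (auto intro!: always_eventually)
      ultimately have "(\<lambda>k. (g (t + inverse (real (Suc k))) - g t) / inverse (real (Suc k))) \<longlonglongrightarrow> l"
        by (rule filterlim_compose)
      then have "(\<lambda>k. dirquot f v k (t *\<^sub>R v + x)) \<longlonglongrightarrow> l"
      proof (rule Lim_transform_eventually, intro always_eventually allI)
        fix k
        have "(t + inverse (real (Suc k))) *\<^sub>R v + x = t *\<^sub>R v + x + v /\<^sub>R real (Suc k)"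
          by (simp only: scaleR_add_left add_ac)
        then show "(g (t + inverse (real (Suc k))) - g t) / inverse (real (Suc k)) = dirquot f v k (t *\<^sub>R v + x)"
          unfolding dirquot_def g_def by (simp only: divide_inverse inverse_inverse_eq)
      qed
      then show False using that by (auto simp: N_def convergent_def)
    qed
    have ng: "negligible {t. t *\<^sub>R v + x \<in> N}"
      by (intro negligible_subset[OF M(1)] subsetI) (simp add: NM)
    have "(\<lambda>t. t *\<^sub>R v + x) -` N \<inter> space borel \<in> sets borel"
      by (rule measurable_sets[OF _ Nb]) measurable
    then have "{t. t *\<^sub>R v + x \<in> N} \<in> sets lborel" by (simp add: vimage_def)
    then have "{t. t *\<^sub>R v + x \<in> N} \<in> null_sets lborel"
      using ng by (simp add: negligible_iff_null_sets null_sets_completion_iff)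
    then have "AE t in lborel. \<not> t *\<^sub>R v + x \<in> N" using AE_not_in by fastforce
    then have "AE t in lborel. indicator N (t *\<^sub>R v + x) * indicator {0..1} t = (0 :: ennreal)"
      by eventually_elim simp
    then show ?thesis by (subst nn_integral_0_iff_AE) measurable
  qed
  \<comment> \<open>Averaging the measure of \<open>N\<close> over its translates by
    \<open>t *\<^sub>R v\<close> with t in [0,1] brings the lines into play without coordinates
    adapted to \<open>v\<close>, and covers \<open>v = 0\<close>.\<close>
  have "emeasure lborel N = (\<integral>\<^sup>+t. emeasure lborel N * indicator {0..1} t \<partial>(lborel :: real measure))"
    by (simp add: nn_integral_cmult_indicator)
  also have "\<dots> = (\<integral>\<^sup>+t. (\<integral>\<^sup>+x. indicator N (t *\<^sub>R v + x) * indicator {0..1} t \<partial>lborel) \<partial>(lborel :: real measure))"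
  proof (intro nn_integral_cong)
    fix t :: real
    have "(\<integral>\<^sup>+x. indicator N (t *\<^sub>R v + x) * indicator {0..1} t \<partial>lborel) = (\<integral>\<^sup>+x. indicator N (t *\<^sub>R v + x) \<partial>lborel) * (indicator {0..1} t :: ennreal)"
      by (rule nn_integral_multc) measurable
    also have "(\<integral>\<^sup>+x. indicator N (t *\<^sub>R v + x) \<partial>lborel) = (\<integral>\<^sup>+x. indicator N x \<partial>distr lborel borel ((+) (t *\<^sub>R v)))"
      by (subst nn_integral_distr) auto
    also have "\<dots> = emeasure lborel N" by (simp add: lborel_distr_plus)
    finally show "emeasure lborel N * indicator {0..1} t = (\<integral>\<^sup>+x. indicator N (t *\<^sub>R v + x) * indicator {0..1} t \<partial>lborel)" by simp
  qed
  also have "\<dots> = (\<integral>\<^sup>+x. (\<integral>\<^sup>+t. indicator N (t *\<^sub>R v + x) * indicator {0..1} t \<partial>lborel) \<partial>lborel)"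
    by (rule lborel_pair.Fubini') measurable
  also have "\<dots> = 0" by (simp add: line)
  finally have "N \<in> null_sets lborel" by (auto simp: null_sets_def)
  then show ?thesis using AE_not_in by (force simp: N_def)
qed

text \<open>A squared truncated quadratic: C^1 with an explicit gradient and a quadratic Taylor
  remainder, also across the boundary sphere of its support. It is not normalised;
  \<open>bump_mass\<close> is divided out where needed.\<close>

definition bump :: "real \<Rightarrow> 'a::euclidean_space \<Rightarrow> real" where
  "bump \<epsilon> z = (max 0 (\<epsilon>\<^sup>2 - (norm z)\<^sup>2))\<^sup>2"

definition bump_grad :: "real \<Rightarrow> 'a::euclidean_space \<Rightarrow> 'a" where
  "bump_grad \<epsilon> z = (- 4 * max 0 (\<epsilon>\<^sup>2 - (norm z)\<^sup>2)) *\<^sub>R z"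

definition bump_mass :: "'a::euclidean_space itself \<Rightarrow> real \<Rightarrow> real" where
  "bump_mass _ \<epsilon> = (\<integral>z. bump \<epsilon> (z::'a) \<partial>lborel)"

lemma bump_nonneg [simp]: "0 \<le> bump \<epsilon> z" by (simp add: bump_def)

lemma bump_eq_0: "0 < \<epsilon> \<Longrightarrow> \<epsilon> \<le> norm z \<Longrightarrow> bump \<epsilon> z = 0"
  by (simp add: bump_def max_def)

lemma bump_grad_eq_0: "0 < \<epsilon> \<Longrightarrow> \<epsilon> \<le> norm z \<Longrightarrow> bump_grad \<epsilon> z = 0"
  by (simp add: bump_grad_def max_def)

lemma bump_le: "bump \<epsilon> z \<le> \<epsilon> ^ 4"
proof -
  have "(max 0 (\<epsilon>\<^sup>2 - (norm z)\<^sup>2))\<^sup>2 \<le> (\<epsilon>\<^sup>2)\<^sup>2" by (intro power_mono) auto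
  then show ?thesis by (simp add: bump_def)
qed

lemma norm_bump_grad_le: 
  assumes "0 < \<epsilon>" shows "norm (bump_grad \<epsilon> z) \<le> 4 * \<epsilon> ^ 3"
proof (cases "\<epsilon> \<le> norm z")
  case True then show ?thesis using assms by (simp add: bump_grad_eq_0)
next
  case False
  have "norm (bump_grad \<epsilon> z) = 4 * max 0 (\<epsilon>\<^sup>2 - (norm z)\<^sup>2) * norm z" by (simp add: bump_grad_def)
  also have "\<dots> \<le> 4 * \<epsilon>\<^sup>2 * \<epsilon>" using False by (intro mult_mono) auto
  finally show ?thesis by (simp add: power2_eq_square power3_eq_cube)
qed

lemma bump_continuous [continuous_intros]: 
  "continuous_on S f \<Longrightarrow> continuous_on S (\<lambda>z. bump \<epsilon> (f z))"
  unfolding bump_def by (intro continuous_intros)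

lemma bump_grad_continuous [continuous_intros]: 
  "continuous_on S f \<Longrightarrow> continuous_on S (\<lambda>z. bump_grad \<epsilon> (f z))"
  unfolding bump_grad_def by (intro continuous_intros)

lemma bump_measurable [measurable]: "bump \<epsilon> \<in> borel_measurable borel"
  by (intro borel_measurable_continuous_onI continuous_intros)

lemma bump_grad_measurable [measurable]: "bump_grad \<epsilon> \<in> borel_measurable borel"
  by (intro borel_measurable_continuous_onI continuous_intros)

text \<open>First-order Taylor expansion of the squared positive part, whose derivative is
  Lipschitz. Both the bump and the truncations of \<open>u\<close> are built from this
  function.\<close>

lemma square_max_remainder:
  fixes s t :: real
  shows "\<bar>(max 0 t)\<^sup>2 - (max 0 s)\<^sup>2 - 2 * max 0 s * (t - s)\<bar> \<le> (t - s)\<^sup>2"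
proof -
  consider "0 \<le> s" "0 \<le> t" | "s \<le> 0" "t \<le> 0" | "0 \<le> s" "t \<le> 0" | "s \<le> 0" "0 \<le> t" by linarith
  then show ?thesis
  proof cases
    case 1
    have "t\<^sup>2 - s\<^sup>2 - 2 * s * (t - s) = (t - s)\<^sup>2" by (simp add: power2_eq_square algebra_simps)
    then show ?thesis using 1 by simp
  next
    case 2 then show ?thesis by simp
  next
    case 3
    then have "s * t \<le> 0" by (simp add: mult_nonneg_nonpos)
    have e: "(max 0 t)\<^sup>2 - (max 0 s)\<^sup>2 - 2 * max 0 s * (t - s) = s\<^sup>2 - 2 * (s * t)"
      using 3 by (simp add: power2_eq_square algebra_simps)
    have "(t - s)\<^sup>2 = t\<^sup>2 - 2 * (s * t) + s\<^sup>2" by (simp add: power2_eq_square algebra_simps)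
    then show ?thesis unfolding e using \<open>s * t \<le> 0\<close> zero_le_power2[of s] zero_le_power2[of t] by linarith
  next
    case 4
    then have "s * t \<le> 0" by (simp add: mult_nonpos_nonneg)
    moreover have "(t - s)\<^sup>2 = t\<^sup>2 - 2 * (s * t) + s\<^sup>2" by (simp add: power2_eq_square algebra_simps)
    moreover have "(max 0 t)\<^sup>2 - (max 0 s)\<^sup>2 - 2 * max 0 s * (t - s) = t\<^sup>2" using 4 by simp
    ultimately show ?thesis using zero_le_power2[of s] zero_le_power2[of t] by linarith
  qed
qed

text \<open>The constant is 25 + 2. For norm z below 2 \<epsilon> the quantity inside the positive
  part changes by at most 5 \<epsilon> norm h, namely 4 from the inner product and 1 from the square
  of \<open>h\<close>, which gives 25 through \<open>square_max_remainder\<close>. The square of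
  \<open>h\<close> in that change, multiplied by the derivative, gives 2.\<close>

lemma bump_remainder:
  fixes z h :: "'a::euclidean_space"
  assumes e: "0 < \<epsilon>" and h: "norm h \<le> \<epsilon>"
  shows "\<bar>bump \<epsilon> (z + h) - bump \<epsilon> z - bump_grad \<epsilon> z \<bullet> h\<bar> \<le> 27 * \<epsilon>\<^sup>2 * (norm h)\<^sup>2"
proof (cases "2 * \<epsilon> \<le> norm z")
  case True
  have "norm z \<le> norm (z + h) + norm h" by (metis add_diff_cancel_right' norm_triangle_ineq4)
  then have "\<epsilon> \<le> norm (z + h)" using True h by linarith
  then show ?thesis using True e by (simp add: bump_eq_0 bump_grad_eq_0)
next
  case False
  define s where "s = \<epsilon>\<^sup>2 - (norm z)\<^sup>2"
  define t where "t = \<epsilon>\<^sup>2 - (norm (z + h))\<^sup>2"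
  have ts: "t - s = - 2 * (z \<bullet> h) - (norm h)\<^sup>2"
    unfolding s_def t_def power2_norm_eq_inner by (simp add: inner_add_left inner_add_right inner_commute)
  have "\<bar>z \<bullet> h\<bar> \<le> norm z * norm h" by (rule Cauchy_Schwarz_ineq2)
  also have "\<dots> \<le> 2 * \<epsilon> * norm h" using False by (intro mult_right_mono) auto
  finally have zh: "\<bar>z \<bullet> h\<bar> \<le> 2 * \<epsilon> * norm h" .
  have "(norm h)\<^sup>2 \<le> \<epsilon> * norm h" using h by (simp add: power2_eq_square mult_right_mono)
  moreover have "\<bar>t - s\<bar> \<le> 2 * \<bar>z \<bullet> h\<bar> + (norm h)\<^sup>2"
    using abs_triangle_ineq4[of "- 2 * (z \<bullet> h)" "(norm h)\<^sup>2"] unfolding ts by (simp add: abs_mult)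
  ultimately have "\<bar>t - s\<bar> \<le> 5 * \<epsilon> * norm h" using zh by simp
  then have "(t - s)\<^sup>2 \<le> (5 * \<epsilon> * norm h)\<^sup>2" by (metis abs_ge_zero power2_abs power_mono)
  then have 1: "(t - s)\<^sup>2 \<le> 25 * \<epsilon>\<^sup>2 * (norm h)\<^sup>2" by (simp add: power_mult_distrib)
  have "max 0 s \<le> \<epsilon>\<^sup>2" by (simp add: s_def)
  then have 2: "2 * max 0 s * (norm h)\<^sup>2 \<le> 2 * \<epsilon>\<^sup>2 * (norm h)\<^sup>2" by (intro mult_right_mono) auto
  have 3: "0 \<le> 2 * max 0 s * (norm h)\<^sup>2" by simp
  have "bump \<epsilon> (z + h) - bump \<epsilon> z - bump_grad \<epsilon> z \<bullet> h =
     ((max 0 t)\<^sup>2 - (max 0 s)\<^sup>2 - 2 * max 0 s * (t - s)) - 2 * max 0 s * (norm h)\<^sup>2"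
  proof -
    have "bump \<epsilon> (z + h) = (max 0 t)\<^sup>2" "bump \<epsilon> z = (max 0 s)\<^sup>2" "bump_grad \<epsilon> z = (- 4 * max 0 s) *\<^sub>R z"
      by (simp_all add: bump_def bump_grad_def s_def t_def)
    then show ?thesis unfolding ts by (simp add: algebra_simps)
  qed
  then show ?thesis using square_max_remainder[of t s] 1 2 3 by linarith
qed

lemma has_derivative_quadratic_remainder:
  fixes f :: "'a::euclidean_space \<Rightarrow> real"
  assumes d: "d > 0" and r: "\<And>h. norm h \<le> d \<Longrightarrow> \<bar>f (z + h) - f z - g \<bullet> h\<bar> \<le> C * (norm h)\<^sup>2"
  shows "(f has_derivative (\<lambda>h. g \<bullet> h)) (at z)"
  unfolding has_derivative_at
proof
  show "bounded_linear ((\<bullet>) g)" by (rule bounded_linear_inner_right)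
  have "eventually (\<lambda>h. norm h \<le> d) (at (0::'a))"
    unfolding eventually_at using d by (intro exI[of _ d]) (auto simp: dist_norm)
  then have ev: "eventually (\<lambda>h. norm (norm (f (z + h) - f z - g \<bullet> h) / norm h) \<le> C * norm h) (at 0)"
  proof eventually_elim
    case (elim h)
    then have "norm (f (z + h) - f z - g \<bullet> h) / norm h \<le> C * (norm h)\<^sup>2 / norm h"
      using r[OF elim] by (intro divide_right_mono) auto
    then show ?case by (cases "h = 0") (auto simp: power2_eq_square)
  qed
  have "((\<lambda>h::'a. C * norm h) \<longlongrightarrow> 0) (at 0)"
    by (rule tendsto_mult_right_zero, rule tendsto_norm_zero, rule tendsto_ident_at)
  then show "((\<lambda>h. norm (f (z + h) - f z - g \<bullet> h) / norm h) \<longlongrightarrow> 0) (at 0)"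
    by (rule Lim_null_comparison[OF ev])
qed

lemma bump_has_derivative:
  assumes "0 < \<epsilon>" shows "(bump \<epsilon> has_derivative (\<lambda>h. bump_grad \<epsilon> z \<bullet> h)) (at z)"
  using has_derivative_quadratic_remainder[OF assms] bump_remainder[OF assms] by blast

lemma lipschitz_of_gradient_bound:
  fixes f :: "'a::euclidean_space \<Rightarrow> real"
  assumes "\<And>z. (f has_derivative (\<lambda>h. g z \<bullet> h)) (at z)" "\<And>z. norm (g z) \<le> B"
  shows "B-lipschitz_on UNIV f"
proof (rule bounded_derivative_imp_lipschitz)
  show "(f has_derivative (\<lambda>h. g z \<bullet> h)) (at z within UNIV)" for z using assms by simp
  show "onorm (\<lambda>h. g z \<bullet> h) \<le> B" for z
  proof (rule onorm_le)
    fix h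
    have "\<bar>g z \<bullet> h\<bar> \<le> norm (g z) * norm h" by (rule Cauchy_Schwarz_ineq2)
    also have "\<dots> \<le> B * norm h" using assms by (intro mult_right_mono) auto
    finally show "norm (g z \<bullet> h) \<le> B * norm h" by simp
  qed
  show "0 \<le> B" using assms(2) norm_ge_zero order.trans by blast
qed auto

lemma bump_lipschitz: "0 < \<epsilon> \<Longrightarrow> (4 * \<epsilon> ^ 3)-lipschitz_on UNIV (bump \<epsilon>)"
  using lipschitz_of_gradient_bound[OF bump_has_derivative norm_bump_grad_le] by blast

section \<open>Mass of the bump and comparison with averages over balls\<close>

lemma integrable_continuous_vanishing:
  fixes f :: "'a::euclidean_space \<Rightarrow> 'b::{banach, second_countable_topology}"
  assumes "continuous_on UNIV f" "\<And>z. R \<le> norm z \<Longrightarrow> f z = 0"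
  shows "integrable lborel f"
proof -
  have "integrable lborel (\<lambda>z. indicator (cball 0 R) z *\<^sub>R f z)"
    using continuous_on_subset[OF assms(1)] by (intro borel_integrable_compact) auto
  moreover have "(\<lambda>z. indicator (cball 0 R) z *\<^sub>R f z) = f"
    using assms(2) by (auto simp: indicator_def fun_eq_iff)
  ultimately show ?thesis by simp
qed

lemma integrable_bump: "0 < \<epsilon> \<Longrightarrow> integrable lborel (bump \<epsilon> :: 'a::euclidean_space \<Rightarrow> real)"
  by (rule integrable_continuous_vanishing[where R=\<epsilon>]) (auto intro!: continuous_intros simp: bump_eq_0)

lemma integrable_bump_shift: "0 < \<epsilon> \<Longrightarrow> integrable lborel (\<lambda>z::'a::euclidean_space. bump \<epsilon> (z - y))"
  and integral_bump_shift: "0 < \<epsilon> \<Longrightarrow> (\<integral>z. bump \<epsilon> (z - y) \<partial>lborel) = bump_mass TYPE('a) \<epsilon>"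
  using integrable_translate[OF integrable_bump[of \<epsilon>], of "-y"] by (simp_all add: bump_mass_def)

text \<open>On the concentric ball of half the radius the bump is at least 9/16, hence 1/2, of
  \<epsilon>^4; halving the radius costs 2 to the dimension. This makes the normalised bump
  comparable to the uniform density of the ball.\<close>

lemma bump_mass_ge:
  assumes e: "0 < \<epsilon>"
  shows "\<epsilon> ^ 4 * measure lborel (ball 0 \<epsilon> :: 'a::euclidean_space set) \<le> 2 ^ (DIM('a) + 1) * bump_mass TYPE('a) \<epsilon>"
proof -
  let ?h = "ball 0 (\<epsilon>/2) :: 'a set"
  have m: "measure lborel (ball 0 \<epsilon> :: 'a set) = 2 ^ DIM('a) * measure lborel ?h"
    using e by (simp add: content_ball power_divide)
  have "measure lborel ?h * (\<epsilon> ^ 4 / 2) = (\<integral>z. (\<epsilon> ^ 4 / 2) * indicator ?h z \<partial>lborel)" by simp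
  also have "\<dots> \<le> bump_mass TYPE('a) \<epsilon>"
    unfolding bump_mass_def
  proof (rule integral_mono)
    show "integrable lborel (\<lambda>z. \<epsilon> ^ 4 / 2 * indicat_real ?h z)" using emeasure_lborel_ball_finite[of "0::'a" "\<epsilon>/2"] by simp
    show "integrable lborel (bump \<epsilon> :: 'a \<Rightarrow> real)" using e by (rule integrable_bump)
    fix z :: 'a
    show "\<epsilon> ^ 4 / 2 * indicat_real ?h z \<le> bump \<epsilon> z"
    proof (cases "z \<in> ?h")
      case True
      then have "(norm z)\<^sup>2 \<le> (\<epsilon>/2)\<^sup>2" by (intro power_mono) auto
      then have "3/4 * \<epsilon>\<^sup>2 \<le> max 0 (\<epsilon>\<^sup>2 - (norm z)\<^sup>2)" by (simp add: power2_eq_square le_max_iff_disj)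
      then have "(3/4 * \<epsilon>\<^sup>2)\<^sup>2 \<le> bump \<epsilon> z" unfolding bump_def by (intro power_mono) auto
      moreover have "\<epsilon> ^ 4 / 2 \<le> (3/4 * \<epsilon>\<^sup>2)\<^sup>2" by (simp add: power_mult_distrib power_divide flip: power_mult)
      ultimately show ?thesis using True by simp
    qed simp
  qed
  finally have "measure lborel ?h * (\<epsilon> ^ 4 / 2) \<le> bump_mass TYPE('a) \<epsilon>" .
  then have "2 ^ (DIM('a) + 1) * (measure lborel ?h * (\<epsilon> ^ 4 / 2)) \<le> 2 ^ (DIM('a) + 1) * bump_mass TYPE('a) \<epsilon>"
    by (intro mult_left_mono) auto
  then show ?thesis unfolding m by (simp add: mult_ac)
qed

lemma measure_ball_pos: "0 < \<epsilon> \<Longrightarrow> 0 < measure lborel (ball (a::'a::euclidean_space) \<epsilon>)"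
  using content_ball_pos[of \<epsilon> a] by simp

lemma bump_mass_pos: "0 < \<epsilon> \<Longrightarrow> 0 < bump_mass TYPE('a::euclidean_space) \<epsilon>"
  using bump_mass_ge[of \<epsilon>, where ?'a='a] measure_ball_pos[of \<epsilon> "0::'a"]
  by (smt (verit, best) mult_pos_pos zero_less_mult_pos zero_less_power)

text \<open>The second bound carries a factor \<epsilon> on the left: in the commutator it is
  supplied by the increment of a Lipschitz coefficient over a distance below \<epsilon>.\<close>

lemma bump_kernel_bound:
  fixes z :: "'a::euclidean_space"
  assumes e: "0 < \<epsilon>"
  shows "bump \<epsilon> z / bump_mass TYPE('a) \<epsilon> \<le> 2 ^ (DIM('a) + 1) / measure lborel (ball 0 \<epsilon> :: 'a set) * indicator (ball 0 \<epsilon>) z"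
    and "norm (bump_grad \<epsilon> z) * \<epsilon> / bump_mass TYPE('a) \<epsilon> \<le> 4 * 2 ^ (DIM('a) + 1) / measure lborel (ball 0 \<epsilon> :: 'a set) * indicator (ball 0 \<epsilon>) z"
proof -
  let ?m = "bump_mass TYPE('a) \<epsilon>" and ?b = "measure lborel (ball 0 \<epsilon> :: 'a set)" and ?K = "2 ^ (DIM('a) + 1) :: real"
  have m: "?m > 0" and b: "?b > 0" using e bump_mass_pos measure_ball_pos by auto
  have main: "\<epsilon> ^ 4 / ?m \<le> ?K / ?b"
    using bump_mass_ge[OF e, where ?'a='a] m b by (simp add: field_simps)
  show "bump \<epsilon> z / ?m \<le> ?K / ?b * indicator (ball 0 \<epsilon>) z"
  proof (cases "norm z < \<epsilon>")
    case True
    have "bump \<epsilon> z / ?m \<le> \<epsilon> ^ 4 / ?m" using bump_le m by (intro divide_right_mono) auto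
    then show ?thesis using main True by simp
  qed (use e in \<open>simp add: bump_eq_0\<close>)
  show "norm (bump_grad \<epsilon> z) * \<epsilon> / ?m \<le> 4 * ?K / ?b * indicator (ball 0 \<epsilon>) z"
  proof (cases "norm z < \<epsilon>")
    case True
    have "norm (bump_grad \<epsilon> z) * \<epsilon> / ?m \<le> (4 * \<epsilon> ^ 3) * \<epsilon> / ?m"
      using norm_bump_grad_le[OF e] m e by (intro divide_right_mono mult_right_mono) auto
    also have "\<dots> = 4 * (\<epsilon> ^ 4 / ?m)" by (simp add: eval_nat_numeral)
    also have "\<dots> \<le> 4 * (?K / ?b)" using main by (intro mult_left_mono) auto
    finally show ?thesis using True by simp
  qed (use e in \<open>simp add: bump_grad_eq_0\<close>)
qed

lemma kernel_average_bound:
  fixes u :: "'a::euclidean_space \<Rightarrow> real"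
  assumes [measurable]: "u \<in> borel_measurable borel" "k \<in> borel_measurable borel"
    and k: "AE z in lborel. \<bar>k z\<bar> \<le> c * indicator (ball 0 \<epsilon>) (z - y)"
  shows "ennreal \<bar>\<integral>z. (u z - u y) * k z \<partial>lborel\<bar> \<le>
    (\<integral>\<^sup>+h. ennreal (c * \<bar>u (h + y) - u y\<bar>) * indicator (ball 0 \<epsilon>) h \<partial>lborel)"
proof -
  have [measurable]: "ball 0 \<epsilon> \<in> sets (borel :: 'a measure)" by simp
  have "ennreal \<bar>\<integral>z. (u z - u y) * k z \<partial>lborel\<bar> \<le> (\<integral>\<^sup>+z. ennreal (norm ((u z - u y) * k z)) \<partial>lborel)"
  proof (cases "integrable lborel (\<lambda>z. (u z - u y) * k z)")
    case True
    then show ?thesis using integral_norm_bound_ennreal[OF True] by simp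
  qed (simp add: not_integrable_integral_eq)
  also have "\<dots> \<le> (\<integral>\<^sup>+z. ennreal (c * \<bar>u z - u y\<bar>) * indicator (ball 0 \<epsilon>) (z - y) \<partial>lborel)"
  proof (rule nn_integral_mono_AE, use k in eventually_elim)
    fix z assume "\<bar>k z\<bar> \<le> c * indicator (ball 0 \<epsilon>) (z - y)"
    then have "norm ((u z - u y) * k z) \<le> \<bar>u z - u y\<bar> * (c * indicator (ball 0 \<epsilon>) (z - y))"
      unfolding real_norm_def abs_mult by (intro mult_left_mono) auto
    then show "ennreal (norm ((u z - u y) * k z)) \<le> ennreal (c * \<bar>u z - u y\<bar>) * indicator (ball 0 \<epsilon>) (z - y)"
      by (cases "z - y \<in> ball 0 \<epsilon>") (auto intro!: ennreal_leI simp: mult_ac)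
  qed
  also have "\<dots> = (\<integral>\<^sup>+h. ennreal (c * \<bar>u (y + h) - u y\<bar>) * indicator (ball 0 \<epsilon>) ((y + h) - y) \<partial>lborel)"
    by (subst nn_integral_translate[symmetric, where h=y]) (auto, measurable)
  finally show ?thesis by (simp add: add.commute)
qed

text \<open>Orthogonality means that all mollifications of \<open>w\<close> vanish, so
  \<open>- w\<close> equals its own mollification error. By \<open>kernel_approx_L2\<close> the
  \<open>L\<^sup>2\<close> norm of \<open>w\<close> on a ball of radius R is then below every
  positive number. The function is cut off at radius R + 1, so that bumps of radius at most 1
  centred in the smaller ball do not see the cut.\<close>

lemma bump_orthogonal_AE_0:
  fixes w :: "'a::euclidean_space \<Rightarrow> real"
  assumes w[measurable]: "w \<in> borel_measurable borel" and bd: "\<And>z. \<bar>w z\<bar> \<le> K"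
    and orth: "\<And>\<epsilon> y. 0 < \<epsilon> \<Longrightarrow> (\<integral>z. w z * bump \<epsilon> (z - y) \<partial>lborel) = 0"
  shows "AE z in lborel. w z = 0"
proof -
  have "AE z in lborel. norm z < real R \<longrightarrow> w z = 0" for R :: nat
  proof -
    let ?B = "ball 0 (real R + 1) :: 'a set"
    have [measurable]: "?B \<in> sets borel" "ball 0 (real R) \<in> sets (borel :: 'a measure)" by auto
    define u where "u z = w z * indicator ?B z" for z
    have um[measurable]: "u \<in> borel_measurable borel" unfolding u_def by measurable
    have "integrable lborel (\<lambda>z. K\<^sup>2 * indicator ?B z)"
      using emeasure_lborel_ball_finite[of "0::'a" "real R + 1"] by (intro integrable_mult_right integrable_real_indicator) auto
    then have u2: "integrable lborel (\<lambda>z. (u z)\<^sup>2)"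
    proof (rule Bochner_Integration.integrable_bound)
      have "(w z)\<^sup>2 \<le> K\<^sup>2" for z using bd[of z] by (metis abs_ge_zero power2_abs power_mono)
      then show "AE z in lborel. norm ((u z)\<^sup>2) \<le> norm (K\<^sup>2 * indicat_real ?B z)"
        by (intro AE_I2) (auto simp: u_def indicator_def)
    qed measurable
    have le: "(\<integral>\<^sup>+y. ennreal ((w y * indicator (ball 0 (real R)) y)\<^sup>2) \<partial>lborel) \<le> ennreal e" if e: "e > 0" for e
    proof -
      obtain d where d: "d > 0" "\<And>\<epsilon> v. 0 < \<epsilon> \<and> \<epsilon> < d \<and>
         (\<forall>y. ennreal \<bar>v y\<bar> \<le> (\<integral>\<^sup>+h. ennreal (2 ^ (DIM('a) + 1) / measure lborel (ball 0 \<epsilon> :: 'a set) * \<bar>u (h + y) - u y\<bar>) * indicator (ball 0 \<epsilon>) h \<partial>lborel)) \<Longrightarrow>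
         (\<integral>\<^sup>+y. ennreal ((v y)\<^sup>2) \<partial>lborel) \<le> ennreal e"
        using kernel_approx_L2[of u "2 ^ (DIM('a) + 1)" e, OF um u2 _ e] by auto
      define \<epsilon> where "\<epsilon> = min (d/2) 1"
      have \<epsilon>: "0 < \<epsilon>" "\<epsilon> < d" "\<epsilon> \<le> 1" using d(1) by (auto simp: \<epsilon>_def)
      let ?m = "bump_mass TYPE('a) \<epsilon>"
      have m: "?m > 0" using \<epsilon> bump_mass_pos by auto
      let ?v = "\<lambda>y. w y * indicator (ball 0 (real R)) y"
      show ?thesis
      proof (rule d(2)[of \<epsilon> ?v], intro conjI allI \<epsilon>)
        fix y :: 'a
        show "ennreal \<bar>?v y\<bar> \<le> (\<integral>\<^sup>+h. ennreal (2 ^ (DIM('a) + 1) / measure lborel (ball 0 \<epsilon> :: 'a set) * \<bar>u (h + y) - u y\<bar>) * indicator (ball 0 \<epsilon>) h \<partial>lborel)"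
        proof (cases "norm y < real R")
          case True
          have "(\<integral>z. (u z - u y) * (bump \<epsilon> (z - y) / ?m) \<partial>lborel) = (\<integral>z. w z * bump \<epsilon> (z - y) / ?m - w y * (bump \<epsilon> (z - y) / ?m) \<partial>lborel)"
          proof (intro Bochner_Integration.integral_cong refl)
            fix z
            show "(u z - u y) * (bump \<epsilon> (z - y) / ?m) = w z * bump \<epsilon> (z - y) / ?m - w y * (bump \<epsilon> (z - y) / ?m)"
            proof (cases "norm (z - y) < \<epsilon>")
              case zy: True
              have "norm z \<le> norm (z - y) + norm y" by (metis diff_add_cancel norm_triangle_ineq)
              then have "norm z < real R + 1" using zy True \<epsilon> by linarith
              then show ?thesis using True by (simp add: u_def diff_divide_distrib left_diff_distrib)
            qed (use \<epsilon> in \<open>simp add: bump_eq_0\<close>)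
          qed
          also have "\<dots> = (\<integral>z. w z * bump \<epsilon> (z - y) / ?m \<partial>lborel) - (\<integral>z. w y * (bump \<epsilon> (z - y) / ?m) \<partial>lborel)"
          proof (rule Bochner_Integration.integral_diff)
            show "integrable lborel (\<lambda>z. w y * (bump \<epsilon> (z - y) / ?m))" using integrable_bump_shift[of \<epsilon> y] \<epsilon> by simp
            have "integrable lborel (\<lambda>z. K * bump \<epsilon> (z - y))" using integrable_bump_shift[of \<epsilon> y] \<epsilon> by simp
            then have "integrable lborel (\<lambda>z. w z * bump \<epsilon> (z - y))"
            proof (rule Bochner_Integration.integrable_bound)
              show "AE z in lborel. norm (w z * bump \<epsilon> (z - y)) \<le> norm (K * bump \<epsilon> (z - y))"
                using bd by (intro AE_I2) (auto simp: abs_mult intro!: mult_right_mono order.trans[OF bd])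
            qed measurable
            then show "integrable lborel (\<lambda>z. w z * bump \<epsilon> (z - y) / ?m)" by simp
          qed
          also have "\<dots> = - w y" using \<epsilon> m orth integral_bump_shift[of \<epsilon> y] by simp
          finally have "ennreal \<bar>?v y\<bar> = ennreal \<bar>\<integral>z. (u z - u y) * (bump \<epsilon> (z - y) / ?m) \<partial>lborel\<bar>"
            using True by simp
          also have "\<dots> \<le> (\<integral>\<^sup>+h. ennreal (2 ^ (DIM('a) + 1) / measure lborel (ball 0 \<epsilon> :: 'a set) * \<bar>u (h + y) - u y\<bar>) * indicator (ball 0 \<epsilon>) h \<partial>lborel)"
          proof (rule kernel_average_bound, goal_cases)
            case 3
            show ?case
            proof (rule AE_I2)
            fix z
            show "\<bar>bump \<epsilon> (z - y) / ?m\<bar> \<le> 2 ^ (DIM('a) + 1) / measure lborel (ball 0 \<epsilon> :: 'a set) * indicat_real (ball 0 \<epsilon>) (z - y)"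
              using bump_kernel_bound(1)[OF \<epsilon>(1), of "z - y"] m by simp
            qed
          qed measurable
          finally show ?thesis .
        qed simp
      qed
    qed
    have "(\<integral>\<^sup>+y. ennreal ((w y * indicator (ball 0 (real R)) y)\<^sup>2) \<partial>lborel) \<le> 0"
      by (rule ennreal_le_epsilon) (use le in simp)
    then have "AE y in lborel. ennreal ((w y * indicator (ball 0 (real R)) y)\<^sup>2) = 0"
      by (subst (asm) le_zero_eq, subst (asm) nn_integral_0_iff_AE) measurable
    then show ?thesis by eventually_elim (auto simp: indicator_def)
  qed
  then have "AE z in lborel. \<forall>R::nat. norm z < real R \<longrightarrow> w z = 0" by (subst AE_all_countable) blast
  then show ?thesis by eventually_elim (use reals_Archimedean2 in blast)
qed

text \<open>Taking \<open>lim\<close> at every point keeps the function Borel measurable. Its value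
  where the quotients diverge is arbitrary, but for Lipschitz \<open>f\<close> this concerns only a
  null set.\<close>

definition dirlim :: "('a::euclidean_space \<Rightarrow> real) \<Rightarrow> 'a \<Rightarrow> 'a \<Rightarrow> real" where
  "dirlim f v x = lim (\<lambda>k. dirquot f v k x)"

lemma dirlim_measurable:
  assumes "L-lipschitz_on UNIV f" shows "dirlim f v \<in> borel_measurable borel"
  unfolding dirlim_def[abs_def] using dirquot_measurable[OF assms] by (intro borel_measurable_lim_metric)

lemma dirlim_AE:
  fixes f :: "'a::euclidean_space \<Rightarrow> real"
  assumes "L-lipschitz_on UNIV f"
  shows "AE x in lborel. (\<lambda>k. dirquot f v k x) \<longlonglongrightarrow> dirlim f v x"
  using dirquot_convergent_AE[OF assms, of v] by eventually_elim (simp add: dirlim_def convergent_LIMSEQ_iff)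

lemma dirlim_bound_AE:
  fixes f :: "'a::euclidean_space \<Rightarrow> real"
  assumes "L-lipschitz_on UNIV f"
  shows "AE x in lborel. \<bar>dirlim f v x\<bar> \<le> L * norm v"
  using dirlim_AE[OF assms, of v]
proof eventually_elim
  case (elim x)
  then have "(\<lambda>k. \<bar>dirquot f v k x\<bar>) \<longlonglongrightarrow> \<bar>dirlim f v x\<bar>" by (rule tendsto_rabs)
  then show ?case by (rule LIMSEQ_le_const2) (use dirquot_bound[OF assms] in auto)
qed

text \<open>Integration by parts without derivatives of \<open>f\<close>: translation invariance
  moves the difference quotient from \<open>f\<close> to the bump with \<open>v\<close> reversed,
  and dominated convergence is applied on both sides.\<close>

lemma dirlim_bump_integral:
  fixes f :: "'a::euclidean_space \<Rightarrow> real"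
  assumes f: "L-lipschitz_on UNIV f" and e: "0 < \<epsilon>"
  shows "(\<integral>z. dirlim f v z * bump \<epsilon> (z - y) \<partial>lborel) = - (\<integral>z. f z * (bump_grad \<epsilon> (z - y) \<bullet> v) \<partial>lborel)"
    and "integrable lborel (\<lambda>z. dirlim f v z * bump \<epsilon> (z - y))"
    and "integrable lborel (\<lambda>z. f z * (bump_grad \<epsilon> (z - y) \<bullet> v))"
proof -
  note [measurable] = dirquot_measurable[OF f] dirlim_measurable[OF f]
  have fc: "continuous_on UNIV f" using f by (rule lipschitz_on_continuous_on)
  have [measurable]: "f \<in> borel_measurable borel" using fc by (rule borel_measurable_continuous_onI)
  let ?\<zeta> = "\<lambda>z. bump \<epsilon> (z - y)"
  have \<zeta>i: "integrable lborel ?\<zeta>" using e by (rule integrable_bump_shift)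
  have dom: "integrable lborel (\<lambda>z. L * norm v * ?\<zeta> z)" using \<zeta>i by simp
  have L: "\<bar>L\<bar> = L" using lipschitz_on_nonneg[OF f] by simp
  show "integrable lborel (\<lambda>z. dirlim f v z * ?\<zeta> z)"
  proof (rule Bochner_Integration.integrable_bound[OF dom])
    show "AE z in lborel. norm (dirlim f v z * ?\<zeta> z) \<le> norm (L * norm v * ?\<zeta> z)"
      using dirlim_bound_AE[OF f, of v] 
      by eventually_elim (auto simp: abs_mult L intro!: mult_right_mono)
  qed measurable
  have far: "\<epsilon> \<le> norm (z - y)" if "norm y + \<epsilon> \<le> norm z" for z
    using that norm_triangle_ineq2[of z y] by linarith
  show fg: "integrable lborel (\<lambda>z. f z * (bump_grad \<epsilon> (z - y) \<bullet> v))"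
    by (rule integrable_continuous_vanishing[where R="norm y + \<epsilon>"])
       (use fc far e in \<open>auto intro!: continuous_intros simp: bump_grad_eq_0\<close>)
  have L1: "(\<lambda>k. \<integral>z. dirquot f v k z * ?\<zeta> z \<partial>lborel) \<longlonglongrightarrow> (\<integral>z. dirlim f v z * ?\<zeta> z \<partial>lborel)"
  proof (rule integral_dominated_convergence[OF _ _ dom])
    show "AE z in lborel. (\<lambda>k. dirquot f v k z * ?\<zeta> z) \<longlonglongrightarrow> dirlim f v z * ?\<zeta> z"
      using dirlim_AE[OF f, of v] by eventually_elim (intro tendsto_intros)
    show "AE z in lborel. norm (dirquot f v k z * ?\<zeta> z) \<le> L * norm v * ?\<zeta> z" for k
      using dirquot_bound[OF f] by (intro AE_I2) (auto simp: abs_mult intro!: mult_right_mono)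
  qed measurable
  have fc': "continuous_on UNIV (\<lambda>z. f (z + w))" for w
    using fc by (rule continuous_on_compose2) (auto intro!: continuous_intros)
  have swap: "(\<integral>z. dirquot f v k z * ?\<zeta> z \<partial>lborel) = (\<integral>z. f z * dirquot ?\<zeta> (- v) k z \<partial>lborel)" for k
  proof -
    let ?h = "v /\<^sub>R real (Suc k)"
    have i1: "integrable lborel (\<lambda>z. f (z + ?h) * ?\<zeta> z)"
      by (rule integrable_continuous_vanishing[where R="norm y + \<epsilon>"])
        (use fc' far e in \<open>auto intro!: continuous_intros simp: bump_eq_0\<close>)
    have i2: "integrable lborel (\<lambda>z. f z * ?\<zeta> z)"
      by (rule integrable_continuous_vanishing[where R="norm y + \<epsilon>"])
        (use fc far e in \<open>auto intro!: continuous_intros simp: bump_eq_0\<close>)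
    have i3: "integrable lborel (\<lambda>z. f z * ?\<zeta> (z - ?h))"
      using integrable_translate(1)[OF i1, of "- ?h"] by simp
    have tr: "(\<integral>z. f (z + ?h) * ?\<zeta> z \<partial>lborel) = (\<integral>z. f z * ?\<zeta> (z - ?h) \<partial>lborel)"
      using integrable_translate(2)[OF i1, of "- ?h"] by simp
    have "(\<integral>z. dirquot f v k z * ?\<zeta> z \<partial>lborel) = (\<integral>z. (f (z + ?h) * ?\<zeta> z - f z * ?\<zeta> z) * real (Suc k) \<partial>lborel)"
      by (intro Bochner_Integration.integral_cong refl) (unfold dirquot_def, algebra)
    also have "\<dots> = (\<integral>z. (f z * ?\<zeta> (z - ?h) - f z * ?\<zeta> z) * real (Suc k) \<partial>lborel)"
      using i1 i2 i3 tr by simp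
    also have "\<dots> = (\<integral>z. f z * dirquot ?\<zeta> (- v) k z \<partial>lborel)"
      by (intro Bochner_Integration.integral_cong refl) (unfold dirquot_def scaleR_minus_right add_uminus_conv_diff, algebra)
    finally show ?thesis .
  qed
  have lip: "(4 * \<epsilon> ^ 3)-lipschitz_on UNIV ?\<zeta>"
    using lipschitz_on_compose2[of 1 UNIV "\<lambda>z. z - y" "4 * \<epsilon> ^ 3" "bump \<epsilon>"] bump_lipschitz[OF e]
      lipschitz_on_subset[OF bump_lipschitz[OF e]]
    by (auto intro!: lipschitz_onI simp: dist_norm lipschitz_on_def)
  \<comment> \<open>All shifts in the quotients have length at most \<open>norm v\<close>, so every
    quotient of the bump vanishes outside this ball, uniformly in \<open>k\<close>.\<close>
  let ?R = "norm y + \<epsilon> + norm v"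
  have L2: "(\<lambda>k. \<integral>z. f z * dirquot ?\<zeta> (- v) k z \<partial>lborel) \<longlonglongrightarrow> (\<integral>z. f z * (bump_grad \<epsilon> (z - y) \<bullet> (- v)) \<partial>lborel)"
  proof (rule integral_dominated_convergence)
    show "integrable lborel (\<lambda>z. (4 * \<epsilon> ^ 3 * norm v) * (indicator (cball 0 ?R) z *\<^sub>R \<bar>f z\<bar>))"
      using fc by (intro integrable_mult_right borel_integrable_compact continuous_intros continuous_on_subset[OF fc]) auto
    show "AE z in lborel. (\<lambda>k. f z * dirquot ?\<zeta> (- v) k z) \<longlonglongrightarrow> f z * (bump_grad \<epsilon> (z - y) \<bullet> (- v))"
    proof (intro AE_I2 tendsto_intros)
      fix z
      have "(bump \<epsilon> has_derivative (\<lambda>h. bump_grad \<epsilon> (z - y) \<bullet> h)) (at (z - y))" by (rule bump_has_derivative[OF e])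
      then have *: "((\<lambda>t. bump \<epsilon> (z - y + t *\<^sub>R (- v))) has_derivative (\<lambda>t. bump_grad \<epsilon> (z - y) \<bullet> (t *\<^sub>R (- v)))) (at 0)"
        by (intro has_derivative_compose[where f="\<lambda>t. z - y + t *\<^sub>R (- v)" and g="bump \<epsilon>"]) (auto intro!: derivative_eq_intros)
      then have "((\<lambda>t. bump \<epsilon> (z - y + t *\<^sub>R (- v))) has_real_derivative bump_grad \<epsilon> (z - y) \<bullet> (- v)) (at 0)"
      proof -
        have eq: "(\<lambda>t. bump_grad \<epsilon> (z - y) \<bullet> (t *\<^sub>R (- v))) = (*) (bump_grad \<epsilon> (z - y) \<bullet> (- v))"
          by (auto simp: fun_eq_iff)
        show ?thesis using * by (simp only: has_field_derivative_def eq)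
      qed
      then have "(\<lambda>t. (bump \<epsilon> (z - y + t *\<^sub>R (- v)) - bump \<epsilon> (z - y)) / t) \<midarrow>0\<rightarrow> bump_grad \<epsilon> (z - y) \<bullet> (- v)"
        by (simp add: DERIV_def)
      moreover have "filterlim (\<lambda>k. inverse (real (Suc k))) (at 0) sequentially"
        using LIMSEQ_inverse_real_of_nat by (auto simp: filterlim_at)
      ultimately have "(\<lambda>k. (bump \<epsilon> (z - y + inverse (real (Suc k)) *\<^sub>R (- v)) - bump \<epsilon> (z - y)) / inverse (real (Suc k))) \<longlonglongrightarrow> bump_grad \<epsilon> (z - y) \<bullet> (- v)"
        by (rule filterlim_compose)
      then show "(\<lambda>k. dirquot ?\<zeta> (- v) k z) \<longlonglongrightarrow> bump_grad \<epsilon> (z - y) \<bullet> (- v)"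
      proof (rule Lim_transform_eventually, intro always_eventually allI)
        fix k
        have "z - y + inverse (real (Suc k)) *\<^sub>R (- v) = z + (- v) /\<^sub>R real (Suc k) - y" by simp
        then show "(bump \<epsilon> (z - y + inverse (real (Suc k)) *\<^sub>R (- v)) - bump \<epsilon> (z - y)) / inverse (real (Suc k)) = dirquot ?\<zeta> (- v) k z"
          unfolding dirquot_def by (simp only: divide_inverse inverse_inverse_eq)
      qed
    qed
    show "AE z in lborel. norm (f z * dirquot ?\<zeta> (- v) k z) \<le> (4 * \<epsilon> ^ 3 * norm v) * (indicator (cball 0 ?R) z *\<^sub>R \<bar>f z\<bar>)" for k
    proof (intro AE_I2)
      fix z
      show "norm (f z * dirquot ?\<zeta> (- v) k z) \<le> (4 * \<epsilon> ^ 3 * norm v) * (indicator (cball 0 ?R) z *\<^sub>R \<bar>f z\<bar>)"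
      proof (cases "norm z \<le> ?R")
        case True
        have "\<bar>f z\<bar> * \<bar>dirquot ?\<zeta> (- v) k z\<bar> \<le> \<bar>f z\<bar> * (4 * \<epsilon> ^ 3 * norm (- v))"
          using dirquot_bound[OF lip, of "- v" k z] by (intro mult_left_mono) auto
        then show ?thesis using True by (simp add: abs_mult mult_ac)
      next
        case False
        have "norm (v /\<^sub>R real (Suc k)) \<le> norm v" by (simp add: field_simps mult_le_cancel_left1)
        then have "norm y + \<epsilon> \<le> norm (z - v /\<^sub>R real (Suc k))"
          using False norm_triangle_ineq2[of z "v /\<^sub>R real (Suc k)"] by linarith
        moreover have "norm y + \<epsilon> \<le> norm z" using False norm_ge_zero[of v] by linarith
        ultimately have "dirquot ?\<zeta> (- v) k z = 0"
          using far[of z] far[of "z - v /\<^sub>R real (Suc k)"] False e 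
          by (simp add: dirquot_def bump_eq_0)
        then show ?thesis using e by (simp add: False)
      qed
    qed
    have "dirquot ?\<zeta> (- v) k \<in> borel_measurable borel" for k by (rule dirquot_measurable[OF lip])
    then show "(\<lambda>z. f z * dirquot ?\<zeta> (- v) k z) \<in> borel_measurable lborel" for k by measurable
  qed measurable
  have "(\<integral>z. dirlim f v z * ?\<zeta> z \<partial>lborel) = (\<integral>z. f z * (bump_grad \<epsilon> (z - y) \<bullet> (- v)) \<partial>lborel)"
    using L1 L2 unfolding swap by (rule LIMSEQ_unique)
  then show "(\<integral>z. dirlim f v z * ?\<zeta> z \<partial>lborel) = - (\<integral>z. f z * (bump_grad \<epsilon> (z - y) \<bullet> v) \<partial>lborel)" by simp
qed

text \<open>The difference of the two sides is orthogonal to all translated bumps, by integration by parts.\<close>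

lemma dirlim_linear_AE:
  fixes f :: "'a::euclidean_space \<Rightarrow> real"
  assumes f: "L-lipschitz_on UNIV f"
  shows "AE x in lborel. dirlim f v x = (\<Sum>b\<in>Basis. (v \<bullet> b) * dirlim f b x)"
proof -
  note [measurable] = dirlim_measurable[OF f]
  have L: "0 \<le> L" using f lipschitz_on_nonneg by blast
  define d where "d x = dirlim f v x - (\<Sum>b\<in>Basis. (v \<bullet> b) * dirlim f b x)" for x
  define C where "C = L * norm v + (\<Sum>b\<in>Basis. \<bar>v \<bullet> b\<bar> * (L * norm b))"
  have [measurable]: "d \<in> borel_measurable borel" unfolding d_def by measurable
  have "AE x in lborel. \<forall>b\<in>Basis. \<bar>dirlim f b x\<bar> \<le> L * norm b"
    by (intro AE_finite_allI finite_Basis dirlim_bound_AE[OF f])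
  with dirlim_bound_AE[OF f, of v] have bd: "AE x in lborel. \<bar>d x\<bar> \<le> C"
  proof eventually_elim
    case (elim x)
    have "\<bar>d x\<bar> \<le> \<bar>dirlim f v x\<bar> + \<bar>\<Sum>b\<in>Basis. (v \<bullet> b) * dirlim f b x\<bar>" by (simp add: d_def)
    also have "\<bar>\<Sum>b\<in>Basis. (v \<bullet> b) * dirlim f b x\<bar> \<le> (\<Sum>b\<in>Basis. \<bar>(v \<bullet> b) * dirlim f b x\<bar>)" by (rule sum_abs)
    also have "\<dots> \<le> (\<Sum>b\<in>Basis. \<bar>v \<bullet> b\<bar> * (L * norm b))"
      unfolding abs_mult by (intro sum_mono mult_left_mono) (use elim in auto)
    finally show ?case using elim by (simp add: C_def)
  qed
  \<comment> \<open>\<open>d\<close> is bounded only almost everywhere, whereas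
    \<open>bump_orthogonal_AE_0\<close> asks for a bound at every point.\<close>
  define w where "w x = max (- C) (min C (d x))" for x
  have wd: "AE x in lborel. w x = d x" using bd by eventually_elim (auto simp: w_def)
  have C0: "0 \<le> C" unfolding C_def using L by (intro add_nonneg_nonneg sum_nonneg) auto
  have "AE x in lborel. w x = 0"
  proof (rule bump_orthogonal_AE_0[where K=C])
    show "w \<in> borel_measurable borel" unfolding w_def by measurable
    then have [measurable]: "w \<in> borel_measurable borel" .
    show "\<bar>w z\<bar> \<le> C" for z using C0 by (auto simp: w_def)
    fix \<epsilon> :: real and y :: 'a assume e: "0 < \<epsilon>"
    note I = dirlim_bump_integral[OF f e]
    have "(\<integral>z. w z * bump \<epsilon> (z - y) \<partial>lborel) = (\<integral>z. d z * bump \<epsilon> (z - y) \<partial>lborel)"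
      by (rule integral_cong_AE) (measurable, use wd in eventually_elim, simp)
    also have "\<dots> = (\<integral>z. dirlim f v z * bump \<epsilon> (z - y) - (\<Sum>b\<in>Basis. (v \<bullet> b) * (dirlim f b z * bump \<epsilon> (z - y))) \<partial>lborel)"
      by (intro Bochner_Integration.integral_cong refl) (simp add: d_def left_diff_distrib sum_distrib_right mult.assoc)
    also have "\<dots> = (\<integral>z. dirlim f v z * bump \<epsilon> (z - y) \<partial>lborel) - (\<Sum>b\<in>Basis. (v \<bullet> b) * (\<integral>z. dirlim f b z * bump \<epsilon> (z - y) \<partial>lborel))"
      using I(2) by (simp add: Bochner_Integration.integral_diff Bochner_Integration.integral_sum Bochner_Integration.integrable_sum)
    also have "\<dots> = - (\<integral>z. f z * (bump_grad \<epsilon> (z - y) \<bullet> v) \<partial>lborel) + (\<Sum>b\<in>Basis. (v \<bullet> b) * (\<integral>z. f z * (bump_grad \<epsilon> (z - y) \<bullet> b) \<partial>lborel))"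
      by (simp add: I(1) sum_negf)
    also have "(\<Sum>b\<in>Basis. (v \<bullet> b) * (\<integral>z. f z * (bump_grad \<epsilon> (z - y) \<bullet> b) \<partial>lborel)) = (\<integral>z. (\<Sum>b\<in>Basis. (v \<bullet> b) * (f z * (bump_grad \<epsilon> (z - y) \<bullet> b))) \<partial>lborel)"
      using I(3) by (simp add: Bochner_Integration.integral_sum)
    also have "\<dots> = (\<integral>z. f z * (bump_grad \<epsilon> (z - y) \<bullet> v) \<partial>lborel)"
      by (intro Bochner_Integration.integral_cong refl) 
         (simp add: euclidean_inner[of "bump_grad \<epsilon> (_ - y)" v] sum_distrib_left mult_ac)
    finally show "(\<integral>z. w z * bump \<epsilon> (z - y) \<partial>lborel) = 0" by simp
  qed
  with wd show ?thesis by eventually_elim (simp add: d_def)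
qed

text \<open>The quotients are Lipschitz in the direction uniformly in \<open>k\<close>, so finitely
  many directions of \<open>D\<close> control the whole unit ball. The radius \<open>r\<close> is
  chosen so that moving the direction by \<open>r\<close> changes the quotient and the linear form
  together by at most e/2.\<close>

lemma dirquot_uniform_limit:
  fixes f :: "'a::euclidean_space \<Rightarrow> real"
  assumes f: "L-lipschitz_on UNIV f"
    and D: "\<And>U::'a set. open U \<Longrightarrow> U \<noteq> {} \<Longrightarrow> \<exists>d\<in>D. d \<in> U"
    and lim: "\<And>d. d \<in> D \<Longrightarrow> (\<lambda>k. dirquot f d k x) \<longlonglongrightarrow> g \<bullet> d" and e: "e > 0"
  shows "\<exists>K. \<forall>k\<ge>K. \<forall>v\<in>cball 0 1. \<bar>dirquot f v k x - g \<bullet> v\<bar> \<le> e"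
proof -
  have L: "0 \<le> L" using f lipschitz_on_nonneg by blast
  define r where "r = e / (2 * (L + norm g + 1))"
  have den: "L + norm g + 1 > 0" using L by (simp add: add_nonneg_pos)
  have r: "r > 0" using e den by (simp add: r_def)
  have rr: "(L + norm g) * r \<le> e / 2"
  proof -
    have "(L + norm g) * r \<le> (L + norm g + 1) * r" using r by (intro mult_right_mono) auto
    also have "\<dots> = e / 2" 
    proof -
      have "x * (e / (2 * x)) = e / 2" if "x > 0" for x using that by simp
      from this[OF den] show ?thesis by (simp only: r_def)
    qed
    finally show ?thesis .
  qed
  have cov: "cball 0 1 \<subseteq> (\<Union>d\<in>D. ball d r)"
  proof
    fix v :: 'a
    obtain d where "d \<in> D" "d \<in> ball v r" using D[of "ball v r"] r by auto
    then show "v \<in> (\<Union>d\<in>D. ball d r)" by (auto simp: dist_commute)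
  qed
  obtain F where F: "F \<subseteq> D" "finite F" "cball 0 1 \<subseteq> (\<Union>d\<in>F. ball d r)"
    using compactE_image[OF compact_cball, of D "\<lambda>d. ball d r" 0 1] cov by auto
  have "\<forall>d\<in>F. eventually (\<lambda>k. \<bar>dirquot f d k x - g \<bullet> d\<bar> < e / 2) sequentially"
  proof
    fix d assume "d \<in> F"
    then have "(\<lambda>k. dirquot f d k x) \<longlonglongrightarrow> g \<bullet> d" using lim F by auto
    then show "eventually (\<lambda>k. \<bar>dirquot f d k x - g \<bullet> d\<bar> < e / 2) sequentially"
      using e by (auto dest!: tendstoD[where e="e/2"] simp: dist_real_def)
  qed
  then have "eventually (\<lambda>k. \<forall>d\<in>F. \<bar>dirquot f d k x - g \<bullet> d\<bar> < e / 2) sequentially"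
    using F(2) by (simp add: eventually_ball_finite)
  then obtain K where K: "\<And>k d. k \<ge> K \<Longrightarrow> d \<in> F \<Longrightarrow> \<bar>dirquot f d k x - g \<bullet> d\<bar> < e / 2"
    by (auto simp: eventually_sequentially)
  have "\<bar>dirquot f v k x - g \<bullet> v\<bar> \<le> e" if k: "k \<ge> K" and v: "v \<in> cball 0 1" for k v
  proof -
    obtain d where d: "d \<in> F" "norm (v - d) < r" using F(3) v by (force simp: dist_norm norm_minus_commute)
    have 1: "\<bar>dirquot f v k x - dirquot f d k x\<bar> \<le> L * r"
      using dirquot_diff_bound[OF f, of v k x d] d(2) L by (meson less_imp_le mult_left_mono order.trans)
    have "\<bar>g \<bullet> d - g \<bullet> v\<bar> = \<bar>g \<bullet> (d - v)\<bar>" by (simp add: inner_diff_right)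
    also have "\<dots> \<le> norm g * norm (d - v)" by (rule Cauchy_Schwarz_ineq2)
    also have "\<dots> \<le> norm g * r" using d(2) by (intro mult_left_mono) (auto simp: norm_minus_commute)
    finally have 2: "\<bar>g \<bullet> d - g \<bullet> v\<bar> \<le> norm g * r" .
    have "L * r + norm g * r \<le> e / 2" using rr by (simp add: algebra_simps)
    then show ?thesis using 1 2 K[OF k d(1)] by linarith
  qed
  then show ?thesis by blast
qed

text \<open>Only the steps 1/(k+1) are available, but every increment y - x is such a step times a
  vector whose length lies between 1/2 and 1, so uniformity over the unit ball covers all
  increments.\<close>

lemma dirquot_has_derivative:
  fixes f :: "'a::euclidean_space \<Rightarrow> real"
  assumes unif: "\<And>e. e > 0 \<Longrightarrow> \<exists>K. \<forall>k\<ge>K. \<forall>v\<in>cball 0 1. \<bar>dirquot f v k x - g \<bullet> v\<bar> \<le> e"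
  shows "(f has_derivative (\<lambda>h. g \<bullet> h)) (at x)"
  unfolding has_derivative_at_alt
proof (intro conjI allI impI)
  show "bounded_linear ((\<bullet>) g)" by (rule bounded_linear_inner_right)
  fix e :: real assume e: "e > 0"
  then obtain K where K: "\<And>k v. k \<ge> K \<Longrightarrow> norm v \<le> 1 \<Longrightarrow> \<bar>dirquot f v k x - g \<bullet> v\<bar> \<le> e / 2"
    using unif[of "e/2"] by (metis half_gt_zero mem_cball_0)
  have "norm (f y - f x - g \<bullet> (y - x)) \<le> e * norm (y - x)" if y: "norm (y - x) < 1 / real (Suc K)" for y
  proof (cases "y = x")
    case False
    define s where "s = norm (y - x)"
    have s: "s > 0" using False by (simp add: s_def)
    \<comment> \<open>With this choice \<open>Suc k\<close> is the integer part of 1/s,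
      \<open>dirquot\<close> counting its steps from \<open>Suc k\<close>. Then (k+1)s is at most 1
      and at least 1/2, which turns the error e/2 of the quotient into e times
      \<open>s\<close>.\<close>
    define k where "k = nat \<lfloor>1 / s\<rfloor> - 1"
    have fl: "real (nat \<lfloor>1 / s\<rfloor>) \<le> 1 / s" "1 / s < real (nat \<lfloor>1 / s\<rfloor>) + 1"
      using s by (auto simp: of_nat_nat floor_le_iff)
    have "real (Suc K) < 1 / s" using y s by (simp add: s_def field_simps)
    then have "Suc K \<le> nat \<lfloor>1 / s\<rfloor>" using fl by linarith
    then have k: "k \<ge> K" "real (nat \<lfloor>1 / s\<rfloor>) = real (Suc k)" by (auto simp: k_def)
    have ks: "real (Suc k) * s \<le> 1" "1 < (real (Suc k) + 1) * s"
      using fl s unfolding k(2) by (auto simp: field_simps)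
    define v where "v = real (Suc k) *\<^sub>R (y - x)"
    have nv: "norm v \<le> 1" using ks by (simp add: v_def s_def)
    have "x + v /\<^sub>R real (Suc k) = y" by (simp add: v_def)
    then have dq: "dirquot f v k x - g \<bullet> v = real (Suc k) * (f y - f x - g \<bullet> (y - x))"
      by (simp only: dirquot_def) (simp add: v_def algebra_simps)
    have "real (Suc k) * \<bar>f y - f x - g \<bullet> (y - x)\<bar> \<le> e / 2"
      using K[OF k(1) nv] unfolding dq by (simp add: abs_mult)
    also have "\<dots> \<le> real (Suc k) * (e * s)"
    proof -
      have "(real (Suc k) + 1) * s \<le> 2 * real (Suc k) * s" using s by (intro mult_right_mono) auto
      then have "1 \<le> 2 * real (Suc k) * s" using ks(2) by linarith
      then have "e / 2 * 1 \<le> e / 2 * (2 * real (Suc k) * s)" using e by (intro mult_left_mono) auto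
      then show ?thesis by (simp add: algebra_simps)
    qed
    finally have "\<bar>f y - f x - g \<bullet> (y - x)\<bar> \<le> e * s" by (rule mult_left_le_imp_le) simp
    then show ?thesis by (simp add: s_def)
  qed simp
  then show "\<exists>d>0. \<forall>y. norm (y - x) < d \<longrightarrow> norm (f y - f x - g \<bullet> (y - x)) \<le> e * norm (y - x)"
    by (intro exI[of _ "1 / real (Suc K)"]) auto
qed

text \<open>Convergence and linearity hold off a null set for each single direction; a countable
  dense set of directions keeps the union of these null sets null.\<close>

theorem rademacher:
  fixes f :: "'a::euclidean_space \<Rightarrow> real"
  assumes f: "L-lipschitz_on UNIV f"
  shows "AE x in lborel. f differentiable (at x)"
proof -
  obtain D :: "'a set" where D: "countable D" "\<And>U. open U \<Longrightarrow> U \<noteq> {} \<Longrightarrow> \<exists>d\<in>D. d \<in> U"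
    using countable_dense_exists by blast
  have "AE x in lborel. \<forall>v\<in>D. (\<lambda>k. dirquot f v k x) \<longlonglongrightarrow> dirlim f v x"
    using D(1) dirlim_AE[OF f] by (simp add: AE_ball_countable)
  moreover have "AE x in lborel. \<forall>v\<in>D. dirlim f v x = (\<Sum>b\<in>Basis. (v \<bullet> b) * dirlim f b x)"
    using D(1) dirlim_linear_AE[OF f] by (simp add: AE_ball_countable)
  ultimately show ?thesis
  proof eventually_elim
    case (elim x)
    let ?g = "\<Sum>b\<in>Basis. dirlim f b x *\<^sub>R b"
    have "dirlim f v x = ?g \<bullet> v" if "v \<in> D" for v
      using elim(2) that by (simp add: inner_sum_left mult.commute inner_commute[of v])
    then have "(\<lambda>k. dirquot f v k x) \<longlonglongrightarrow> ?g \<bullet> v" if "v \<in> D" for v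
      using elim(1) that by auto
    then have "(f has_derivative (\<lambda>h. ?g \<bullet> h)) (at x)"
      using dirquot_has_derivative dirquot_uniform_limit[OF f D(2)] by blast
    then show ?case by (auto simp: differentiable_def)
  qed
qed

text \<open>Extends the entries of the square root of \<open>A\<close> from \<open>\<Omega>\<close>
  to the whole space, where Rademacher's theorem and the bump integrals are available.\<close>

lemma mcshane_extension:
  fixes f :: "'a::metric_space \<Rightarrow> real"
  assumes f: "L-lipschitz_on S f"
  obtains F where "L-lipschitz_on UNIV F" "\<And>x. x \<in> S \<Longrightarrow> F x = f x"
proof (cases "S = {}")
  case True
  have "L-lipschitz_on UNIV (\<lambda>x. 0::real)" 
    using lipschitz_on_nonneg[OF f] by (auto intro!: lipschitz_onI)
  then show ?thesis using that True by blast
next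
  case False
  have L: "0 \<le> L" using f lipschitz_on_nonneg by blast
  obtain s0 where s0: "s0 \<in> S" using False by auto
  define F where "F x = (INF y\<in>S. f y + L * dist x y)" for x
  have low: "f s0 - L * dist x s0 \<le> f y + L * dist x y" if "y \<in> S" for x y
  proof -
    have "f s0 - f y \<le> L * dist s0 y" using lipschitz_onD[OF f s0 that] by (simp add: dist_real_def)
    also have "\<dots> \<le> L * (dist x s0 + dist x y)" using L dist_triangle3[of s0 y x] by (intro mult_left_mono) (auto simp: dist_commute)
    finally show ?thesis by (simp add: algebra_simps)
  qed
  have bdd: "bdd_below ((\<lambda>y. f y + L * dist x y) ` S)" for x
    using low by (intro bdd_belowI2[where m="f s0 - L * dist x s0"]) auto
  have upper: "F x \<le> F x' + L * dist x x'" for x x'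
  proof -
    have "F x - L * dist x x' \<le> F x'" unfolding F_def[of x']
    proof (rule cINF_greatest[OF False])
      fix y assume y: "y \<in> S"
      have "F x \<le> f y + L * dist x y" unfolding F_def using bdd y by (rule cINF_lower)
      also have "\<dots> \<le> f y + L * (dist x x' + dist x' y)" using L dist_triangle by (intro add_left_mono mult_left_mono) auto
      finally show "F x - L * dist x x' \<le> f y + L * dist x' y" by (simp add: algebra_simps)
    qed
    then show ?thesis by simp
  qed
  have "L-lipschitz_on UNIV F"
  proof (rule lipschitz_onI)
    fix x y
    show "dist (F x) (F y) \<le> L * dist x y"
      using upper[of x y] upper[of y x] by (simp add: dist_real_def dist_commute abs_le_iff)
  qed (rule L)
  moreover have "F x = f x" if x: "x \<in> S" for x
  proof (rule antisym)
    show "F x \<le> f x" unfolding F_def using cINF_lower[OF bdd x, of x] by simp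
    show "f x \<le> F x" unfolding F_def
    proof (rule cINF_greatest[OF False])
      fix y assume "y \<in> S"
      then show "f x \<le> f y + L * dist x y" using lipschitz_onD[OF f x] by (auto simp: dist_real_def abs_le_iff algebra_simps)
    qed
  qed
  ultimately show ?thesis by (rule that)
qed

lemma dirlim_eq_derivative:
  fixes f :: "'a::euclidean_space \<Rightarrow> real"
  assumes "(f has_derivative f') (at x)"
  shows "dirlim f v x = f' v"
proof -
  interpret bounded_linear f' using assms by (rule has_derivative_bounded_linear)
  have "(f has_derivative f') (at (x + 0 *\<^sub>R v))" using assms by simp
  then have *: "((\<lambda>t. f (x + t *\<^sub>R v)) has_derivative (\<lambda>t. f' (t *\<^sub>R v))) (at 0)"
    by (intro has_derivative_compose[where f="\<lambda>t. x + t *\<^sub>R v" and g=f]) (auto intro!: derivative_eq_intros)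
  have eq: "(\<lambda>t. f' (t *\<^sub>R v)) = (*) (f' v)" by (auto simp: scaleR fun_eq_iff)
  have "((\<lambda>t. f (x + t *\<^sub>R v)) has_real_derivative f' v) (at 0)"
    using * by (simp only: has_field_derivative_def eq)
  then have "(\<lambda>t. (f (x + t *\<^sub>R v) - f x) / t) \<midarrow>0\<rightarrow> f' v" by (simp add: DERIV_def)
  moreover have "filterlim (\<lambda>k. inverse (real (Suc k))) (at 0) sequentially"
    using LIMSEQ_inverse_real_of_nat by (auto simp: filterlim_at)
  ultimately have "(\<lambda>k. (f (x + inverse (real (Suc k)) *\<^sub>R v) - f x) / inverse (real (Suc k))) \<longlonglongrightarrow> f' v"
    by (rule filterlim_compose)
  then have "(\<lambda>k. dirquot f v k x) \<longlonglongrightarrow> f' v"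
    unfolding dirquot_def by (simp only: divide_inverse inverse_inverse_eq)
  then show ?thesis unfolding dirlim_def by (rule limI)
qed

section \<open>Mollification and Friedrichs' commutator lemma\<close>

definition moll :: "real \<Rightarrow> ('a::euclidean_space \<Rightarrow> real) \<Rightarrow> 'a \<Rightarrow> real" where
  "moll \<epsilon> u y = (\<integral>z. u z * bump \<epsilon> (z - y) \<partial>lborel) / bump_mass TYPE('a) \<epsilon>"

text \<open>The sign arises from differentiating \<open>bump \<epsilon> (z - y)\<close> with respect
  to \<open>y\<close>.\<close>

definition moll_grad :: "real \<Rightarrow> ('a::euclidean_space \<Rightarrow> real) \<Rightarrow> 'a \<Rightarrow> 'a" where
  "moll_grad \<epsilon> u y = - ((\<integral>z. u z *\<^sub>R bump_grad \<epsilon> (z - y) \<partial>lborel) /\<^sub>R bump_mass TYPE('a) \<epsilon>)"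

context
  fixes u :: "'a::euclidean_space \<Rightarrow> real" and \<epsilon> :: real
  assumes u: "integrable lborel u" and e: "0 < \<epsilon>"
begin

lemma integrable_mult_bump: "integrable lborel (\<lambda>z. u z * bump \<epsilon> (z - y))"
proof (rule Bochner_Integration.integrable_bound)
  show "integrable lborel (\<lambda>z. \<epsilon> ^ 4 * u z)" using u by simp
  show "AE z in lborel. norm (u z * bump \<epsilon> (z - y)) \<le> norm (\<epsilon> ^ 4 * u z)"
  proof (rule AE_I2)
    fix z
    have "\<bar>u z\<bar> * bump \<epsilon> (z - y) \<le> \<bar>u z\<bar> * \<epsilon> ^ 4" by (intro mult_left_mono bump_le) auto
    then show "norm (u z * bump \<epsilon> (z - y)) \<le> norm (\<epsilon> ^ 4 * u z)" by (simp add: abs_mult mult.commute)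
  qed
qed (use u in measurable)

lemma integrable_scaleR_bump_grad: "integrable lborel (\<lambda>z. u z *\<^sub>R bump_grad \<epsilon> (z - y))"
proof (rule Bochner_Integration.integrable_bound)
  show "integrable lborel (\<lambda>z. (4 * \<epsilon> ^ 3) * u z)" using u by simp
  show "AE z in lborel. norm (u z *\<^sub>R bump_grad \<epsilon> (z - y)) \<le> norm ((4 * \<epsilon> ^ 3) * u z)"
  proof (rule AE_I2)
    fix z
    have "\<bar>u z\<bar> * norm (bump_grad \<epsilon> (z - y)) \<le> \<bar>u z\<bar> * (4 * \<epsilon> ^ 3)"
      using norm_bump_grad_le[OF e] by (intro mult_left_mono) auto
    then show "norm (u z *\<^sub>R bump_grad \<epsilon> (z - y)) \<le> norm ((4 * \<epsilon> ^ 3) * u z)"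
      using e by (simp add: abs_mult mult.commute)
  qed
qed (use u in measurable)

lemma moll_bound: "\<bar>moll \<epsilon> u y\<bar> \<le> \<epsilon> ^ 4 * (\<integral>z. \<bar>u z\<bar> \<partial>lborel) / bump_mass TYPE('a) \<epsilon>"
proof -
  have "\<bar>\<integral>z. u z * bump \<epsilon> (z - y) \<partial>lborel\<bar> \<le> (\<integral>z. \<bar>u z * bump \<epsilon> (z - y)\<bar> \<partial>lborel)"
    by (rule integral_abs_bound)
  also have "\<dots> \<le> (\<integral>z. \<epsilon> ^ 4 * \<bar>u z\<bar> \<partial>lborel)"
  proof (rule integral_mono)
    fix z
    have "\<bar>u z\<bar> * bump \<epsilon> (z - y) \<le> \<bar>u z\<bar> * \<epsilon> ^ 4" by (intro mult_left_mono bump_le) auto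
    then show "\<bar>u z * bump \<epsilon> (z - y)\<bar> \<le> \<epsilon> ^ 4 * \<bar>u z\<bar>" by (simp add: abs_mult mult.commute)
  qed (use integrable_mult_bump[of y] u in auto)
  finally show ?thesis using bump_mass_pos[OF e, where ?'a='a] by (simp add: moll_def abs_mult divide_right_mono)
qed

lemma moll_grad_bound: "norm (moll_grad \<epsilon> u y) \<le> 4 * \<epsilon> ^ 3 * (\<integral>z. \<bar>u z\<bar> \<partial>lborel) / bump_mass TYPE('a) \<epsilon>"
proof -
  have "norm (\<integral>z. u z *\<^sub>R bump_grad \<epsilon> (z - y) \<partial>lborel) \<le> (\<integral>z. norm (u z *\<^sub>R bump_grad \<epsilon> (z - y)) \<partial>lborel)"
    by (rule integral_norm_bound)
  also have "\<dots> \<le> (\<integral>z. (4 * \<epsilon> ^ 3) * \<bar>u z\<bar> \<partial>lborel)"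
  proof (rule integral_mono)
    fix z
    have "\<bar>u z\<bar> * norm (bump_grad \<epsilon> (z - y)) \<le> \<bar>u z\<bar> * (4 * \<epsilon> ^ 3)"
      using norm_bump_grad_le[OF e] by (intro mult_left_mono) auto
    then show "norm (u z *\<^sub>R bump_grad \<epsilon> (z - y)) \<le> (4 * \<epsilon> ^ 3) * \<bar>u z\<bar>" by (simp add: mult.commute)
    show "integrable lborel (\<lambda>z. norm (u z *\<^sub>R bump_grad \<epsilon> (z - y)))"
      by (rule integrable_norm, rule integrable_scaleR_bump_grad)
  qed (use u in auto)
  finally have "norm (\<integral>z. u z *\<^sub>R bump_grad \<epsilon> (z - y) \<partial>lborel) \<le> 4 * \<epsilon> ^ 3 * (\<integral>z. \<bar>u z\<bar> \<partial>lborel)" by simp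
  then have "norm (\<integral>z. u z *\<^sub>R bump_grad \<epsilon> (z - y) \<partial>lborel) / bump_mass TYPE('a) \<epsilon>
      \<le> 4 * \<epsilon> ^ 3 * (\<integral>z. \<bar>u z\<bar> \<partial>lborel) / bump_mass TYPE('a) \<epsilon>"
    using bump_mass_pos[OF e, where ?'a='a] by (intro divide_right_mono) auto
  then show ?thesis using bump_mass_pos[OF e, where ?'a='a] by (simp add: moll_grad_def divide_inverse mult.commute)
qed

text \<open>The quadratic remainder of the bump is uniform in \<open>z\<close>; integrated against
  \<open>u\<close> it becomes a quadratic remainder of the mollification, so no theorem on
  differentiation under the integral is invoked.\<close>

lemma moll_has_derivative: "(moll \<epsilon> u has_derivative (\<lambda>h. moll_grad \<epsilon> u y \<bullet> h)) (at y)"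
proof (rule has_derivative_quadratic_remainder[OF e])
  fix h :: 'a assume h: "norm h \<le> \<epsilon>"
  let ?m = "bump_mass TYPE('a) \<epsilon>"
  have m: "?m > 0" using e by (rule bump_mass_pos)
  let ?r = "\<lambda>z. bump \<epsilon> (z - (y + h)) - bump \<epsilon> (z - y) - bump_grad \<epsilon> (z - y) \<bullet> (- h)"
  have ib: "integrable lborel (\<lambda>z. u z * (bump_grad \<epsilon> (z - y) \<bullet> h))"
    using integrable_inner_left[OF integrable_scaleR_bump_grad[of y], of h] by simp
  have 1: "(\<integral>z. u z * (bump_grad \<epsilon> (z - y) \<bullet> h) \<partial>lborel) = (\<integral>z. u z *\<^sub>R bump_grad \<epsilon> (z - y) \<partial>lborel) \<bullet> h"
    using integral_inner_left[OF integrable_scaleR_bump_grad[of y], of h] by simp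
  have "moll \<epsilon> u (y + h) - moll \<epsilon> u y - moll_grad \<epsilon> u y \<bullet> h = ((\<integral>z. u z * bump \<epsilon> (z - (y + h)) \<partial>lborel)
     - (\<integral>z. u z * bump \<epsilon> (z - y) \<partial>lborel) + (\<integral>z. u z * (bump_grad \<epsilon> (z - y) \<bullet> h) \<partial>lborel)) / ?m"
    unfolding 1 moll_def moll_grad_def inner_minus_left inner_scaleR_left divide_inverse by algebra
  also have "\<dots> = (\<integral>z. u z * ?r z \<partial>lborel) / ?m"
  proof -
    have "(\<integral>z. u z * ?r z \<partial>lborel) = (\<integral>z. u z * bump \<epsilon> (z - (y + h)) - u z * bump \<epsilon> (z - y) + u z * (bump_grad \<epsilon> (z - y) \<bullet> h) \<partial>lborel)"
      by (intro Bochner_Integration.integral_cong refl) (simp add: algebra_simps)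
    also have "\<dots> = (\<integral>z. u z * bump \<epsilon> (z - (y + h)) \<partial>lborel) - (\<integral>z. u z * bump \<epsilon> (z - y) \<partial>lborel) + (\<integral>z. u z * (bump_grad \<epsilon> (z - y) \<bullet> h) \<partial>lborel)"
      using ib integrable_mult_bump by simp
    finally show ?thesis by simp
  qed
  finally have eq: "moll \<epsilon> u (y + h) - moll \<epsilon> u y - moll_grad \<epsilon> u y \<bullet> h = (\<integral>z. u z * ?r z \<partial>lborel) / ?m" .
  have rb: "\<bar>?r z\<bar> \<le> 27 * \<epsilon>\<^sup>2 * (norm h)\<^sup>2" for z
    using bump_remainder[OF e, of "- h" "z - y"] h by (simp add: diff_diff_eq)
  have "\<bar>\<integral>z. u z * ?r z \<partial>lborel\<bar> \<le> (\<integral>z. \<bar>u z * ?r z\<bar> \<partial>lborel)"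
    by (rule integral_abs_bound)
  also have "\<dots> \<le> (\<integral>z. (27 * \<epsilon>\<^sup>2 * (norm h)\<^sup>2) * \<bar>u z\<bar> \<partial>lborel)"
  proof (rule integral_mono)
    have "integrable lborel (\<lambda>z. u z * bump \<epsilon> (z - (y + h)) - u z * bump \<epsilon> (z - y) + u z * (bump_grad \<epsilon> (z - y) \<bullet> h))"
      using ib integrable_mult_bump by auto
    then have "integrable lborel (\<lambda>z. u z * ?r z)" by (simp add: algebra_simps)
    then show "integrable lborel (\<lambda>z. \<bar>u z * ?r z\<bar>)" by (rule integrable_abs)
    show "integrable lborel (\<lambda>z. (27 * \<epsilon>\<^sup>2 * (norm h)\<^sup>2) * \<bar>u z\<bar>)" using u by simp
    show "\<bar>u z * ?r z\<bar> \<le> (27 * \<epsilon>\<^sup>2 * (norm h)\<^sup>2) * \<bar>u z\<bar>" for z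
      using mult_left_mono[OF rb[of z], of "\<bar>u z\<bar>"] by (simp only: abs_mult mult.commute abs_ge_zero)
  qed
  finally have "\<bar>\<integral>z. u z * ?r z \<partial>lborel\<bar> / ?m \<le> (27 * \<epsilon>\<^sup>2 * (norm h)\<^sup>2) * (\<integral>z. \<bar>u z\<bar> \<partial>lborel) / ?m"
    using m by (intro divide_right_mono) auto
  then show "\<bar>moll \<epsilon> u (y + h) - moll \<epsilon> u y - moll_grad \<epsilon> u y \<bullet> h\<bar> \<le> (27 * \<epsilon>\<^sup>2 * (\<integral>z. \<bar>u z\<bar> \<partial>lborel) / ?m) * (norm h)\<^sup>2"
    unfolding eq using m by (simp add: abs_mult mult_ac)
qed

lemma moll_minus: "moll \<epsilon> u y - u y = (\<integral>z. (u z - u y) * (bump \<epsilon> (z - y) / bump_mass TYPE('a) \<epsilon>) \<partial>lborel)"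
proof -
  let ?m = "bump_mass TYPE('a) \<epsilon>"
  have m: "?m > 0" using e by (rule bump_mass_pos)
  have "(\<integral>z. (u z - u y) * (bump \<epsilon> (z - y) / ?m) \<partial>lborel) = (\<integral>z. (u z * bump \<epsilon> (z - y) - u y * bump \<epsilon> (z - y)) / ?m \<partial>lborel)"
    by (intro Bochner_Integration.integral_cong refl) (simp add: algebra_simps)
  also have "\<dots> = ((\<integral>z. u z * bump \<epsilon> (z - y) \<partial>lborel) - u y * ?m) / ?m"
    using integrable_mult_bump[of y] integrable_bump_shift[OF e, of y] integral_bump_shift[OF e, of y] by simp
  finally show ?thesis using m by (simp add: moll_def diff_divide_distrib)
qed

end

lemma moll_measurable [measurable]:
  "u \<in> borel_measurable borel \<Longrightarrow> moll \<epsilon> u \<in> borel_measurable borel"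
proof -
  assume [measurable]: "u \<in> borel_measurable borel"
  have "moll \<epsilon> u \<in> borel_measurable lborel" unfolding moll_def[abs_def] by measurable
  then show ?thesis by simp
qed

lemma moll_grad_measurable [measurable]:
  "u \<in> borel_measurable borel \<Longrightarrow> moll_grad \<epsilon> u \<in> borel_measurable borel"
proof -
  assume [measurable]: "u \<in> borel_measurable borel"
  have "moll_grad \<epsilon> u \<in> borel_measurable lborel" unfolding moll_grad_def[abs_def] by measurable
  then show ?thesis by simp
qed

lemma moll_minus_kernel_bound:
  fixes u :: "'a::euclidean_space \<Rightarrow> real"
  assumes u: "integrable lborel u" and e: "0 < \<epsilon>"
  shows "ennreal \<bar>moll \<epsilon> u y - u y\<bar> \<le>
    (\<integral>\<^sup>+h. ennreal (2 ^ (DIM('a) + 1) / measure lborel (ball 0 \<epsilon> :: 'a set) * \<bar>u (h + y) - u y\<bar>) * indicator (ball 0 \<epsilon>) h \<partial>lborel)"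
  unfolding moll_minus[OF u e]
proof (rule kernel_average_bound)
  show "AE z in lborel. \<bar>bump \<epsilon> (z - y) / bump_mass TYPE('a) \<epsilon>\<bar> \<le> 2 ^ (DIM('a) + 1) / measure lborel (ball 0 \<epsilon> :: 'a set) * indicat_real (ball 0 \<epsilon>) (z - y)"
    using bump_kernel_bound(1)[OF e] bump_mass_pos[OF e, where ?'a='a] by (intro AE_I2) simp
  show "u \<in> borel_measurable borel" using u by auto
qed measurable

text \<open>Integration by parts against the constant function 1, whose directional limits
  vanish.\<close>

lemma integral_bump_grad:
  fixes y :: "'a::euclidean_space"
  assumes e: "0 < \<epsilon>" shows "(\<integral>z. bump_grad \<epsilon> (z - y) \<bullet> v \<partial>lborel) = 0"
proof -
  have "0-lipschitz_on UNIV (\<lambda>z::'a. 1::real)" by (rule lipschitz_on_constant)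
  from dirlim_bump_integral(1)[OF this e, of v y]
  show ?thesis by (simp add: dirlim_eq_derivative[OF has_derivative_const])
qed

text \<open>Translations and Fubini are used for Borel functions and \<open>lborel\<close>, whereas
  the given functions are Lebesgue measurable on \<open>\<Omega>\<close>. This lemma and the next
  two pass between the two settings.\<close>

lemma borel_representative:
  fixes f :: "'a::euclidean_space \<Rightarrow> real"
  assumes \<Omega>: "\<Omega> \<in> sets borel" and f: "f \<in> borel_measurable (lebesgue_on \<Omega>)"
  obtains f0 where "f0 \<in> borel_measurable borel" "AE y in lborel. f0 y = indicator \<Omega> y * f y" "\<And>y. y \<notin> \<Omega> \<Longrightarrow> f0 y = 0"
proof -
  have "(\<lambda>y. indicator \<Omega> y *\<^sub>R f y) \<in> borel_measurable lebesgue"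
    using f \<Omega> by (subst (asm) borel_measurable_restrict_space_iff) (auto simp: sets_completionI_sets)
  then obtain f1 where f1: "f1 \<in> borel_measurable lborel" "AE y in lborel. indicator \<Omega> y *\<^sub>R f y = f1 y"
    using completion_ex_borel_measurable_real by blast
  show ?thesis
  proof (rule that)
    show "(\<lambda>y. indicator \<Omega> y * f1 y) \<in> borel_measurable borel" using f1(1) \<Omega> by simp
    show "AE y in lborel. indicator \<Omega> y * f1 y = indicator \<Omega> y * f y"
      using f1(2) by eventually_elim (auto simp: indicator_def)
  qed auto
qed

lemma integral_lebesgue_on_eq_lborel:
  fixes F F0 :: "'a::euclidean_space \<Rightarrow> real"
  assumes \<Omega>: "\<Omega> \<in> sets borel" and F0: "F0 \<in> borel_measurable borel" and eq: "AE y in lborel. F0 y = indicator \<Omega> y * F y"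
  shows "(LINT y|lebesgue_on \<Omega>. F y) = (LINT y|lborel. F0 y)"
proof -
  have F0l: "F0 \<in> borel_measurable lebesgue" by (rule measurable_completion) (use F0 in simp)
  have eql: "AE y in lebesgue. F0 y = indicator \<Omega> y *\<^sub>R F y" using eq by (simp add: AE_completion)
  have "(LINT y|lebesgue_on \<Omega>. F y) = (LINT y|lebesgue. indicator \<Omega> y *\<^sub>R F y)"
    using \<Omega> by (intro integral_restrict_space) (auto simp: sets_completionI_sets)
  also have "\<dots> = (LINT y|lebesgue. F0 y)"
    using eql by (intro integral_cong_AE F0l borel_measurable_AE[OF F0l eql]) auto
  also have "\<dots> = (LINT y|lborel. F0 y)" using F0 by (intro integral_completion) auto
  finally show ?thesis .
qed

lemma nn_integral_lebesgue_on_eq_lborel: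
  fixes F F0 :: "'a::euclidean_space \<Rightarrow> ennreal"
  assumes \<Omega>: "\<Omega> \<in> sets borel" and eq: "AE y in lborel. F0 y = F y * indicator \<Omega> y"
  shows "(\<integral>\<^sup>+y. F y \<partial>lebesgue_on \<Omega>) = (\<integral>\<^sup>+y. F0 y \<partial>lborel)"
proof -
  have "(\<integral>\<^sup>+y. F y \<partial>lebesgue_on \<Omega>) = (\<integral>\<^sup>+y. F y * indicator \<Omega> y \<partial>lebesgue)"
    using \<Omega> by (intro nn_integral_restrict_space) (auto simp: sets_completionI_sets)
  also have "\<dots> = (\<integral>\<^sup>+y. F y * indicator \<Omega> y \<partial>lborel)" by (rule nn_integral_completion)
  also have "\<dots> = (\<integral>\<^sup>+y. F0 y \<partial>lborel)" using eq by (intro nn_integral_cong_AE) auto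
  finally show ?thesis .
qed

section \<open>Testing the weak A-gradient with translated bumps\<close>

lemma lipschitz_matrix_entry:
  fixes \<sigma> :: "'b::metric_space \<Rightarrow> real^'n^'m"
  assumes "L-lipschitz_on X \<sigma>" shows "L-lipschitz_on X (\<lambda>y. \<sigma> y $ i $ j)"
proof (rule lipschitz_onI)
  fix y z assume yz: "y \<in> X" "z \<in> X"
  have "dist (\<sigma> y $ i $ j) (\<sigma> z $ i $ j) \<le> dist (\<sigma> y $ i) (\<sigma> z $ i)" by (rule dist_vec_nth_le)
  also have "\<dots> \<le> dist (\<sigma> y) (\<sigma> z)" by (rule dist_vec_nth_le)
  also have "\<dots> \<le> L * dist y z" using lipschitz_onD[OF assms yz] .
  finally show "dist (\<sigma> y $ i $ j) (\<sigma> z $ i $ j) \<le> L * dist y z" .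
qed (use assms lipschitz_on_nonneg in blast)

lemma sum_scaleR_axis: "(\<Sum>i\<in>UNIV. c i *\<^sub>R axis i (1::real)) = (\<chi> i. c i)"
  by (simp add: vec_eq_iff axis_def if_distrib cong: if_cong)

text \<open>The product rule for a bump times a basis vector. Off \<open>\<Omega>\<close> the
  extension \<open>S\<close> is unrelated to the square root of \<open>A\<close>, but there the bump
  vanishes; the two expressions for the field therefore agree on the whole space and may be
  differentiated at any point.\<close>

lemma div_A_bump:
  fixes A :: "real^'n \<Rightarrow> real^'n^'n"
  assumes S: "\<And>z i. z \<in> \<Omega> \<Longrightarrow> S i z = mat_sqrt (A z) $ i $ j"
    and diff: "\<And>i. S i differentiable (at z)" and e: "0 < \<epsilon>" and sub: "cball y \<epsilon> \<subseteq> \<Omega>"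
  shows "div_A A (\<lambda>z. bump \<epsilon> (z - y) *\<^sub>R axis j 1) z =
    bump \<epsilon> (z - y) * (\<Sum>i\<in>UNIV. dirlim (S i) (axis i 1) z) + (\<Sum>i\<in>UNIV. (bump_grad \<epsilon> (z - y) \<bullet> axis i 1) * S i z)"
proof -
  let ?f = "\<lambda>z. mat_sqrt (A z) *v (bump \<epsilon> (z - y) *\<^sub>R axis j 1)"
  have f: "?f = (\<lambda>z. \<Sum>i\<in>UNIV. (bump \<epsilon> (z - y) * S i z) *\<^sub>R axis i 1)"
  proof
    fix z
    show "?f z = (\<Sum>i\<in>UNIV. (bump \<epsilon> (z - y) * S i z) *\<^sub>R axis i 1)"
    proof (cases "z \<in> \<Omega>")
      case True
      then show ?thesis unfolding sum_scaleR_axis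
        by (simp add: matrix_vector_mult_scaleR matrix_vector_mult_basis column_def vec_eq_iff S)
    next
      case False
      then have "\<epsilon> \<le> norm (z - y)" using sub by (force simp: dist_norm norm_minus_commute)
      then show ?thesis using e by (simp add: bump_eq_0)
    qed
  qed
  define D where "D i = frechet_derivative (S i) (at z)" for i
  have D: "(S i has_derivative D i) (at z)" for i
    using diff by (simp add: D_def frechet_derivative_works)
  have b: "((\<lambda>z. bump \<epsilon> (z - y)) has_derivative (\<lambda>h. bump_grad \<epsilon> (z - y) \<bullet> h)) (at z)"
  proof -
    have "((\<lambda>z. z - y) has_derivative (\<lambda>h. h)) (at z)" by (auto intro!: derivative_eq_intros)
    from has_derivative_compose[OF this bump_has_derivative[OF e]] show ?thesis .
  qed
  let ?f' = "\<lambda>h. \<Sum>i\<in>UNIV. (bump \<epsilon> (z - y) * D i h + (bump_grad \<epsilon> (z - y) \<bullet> h) * S i z) *\<^sub>R axis i (1::real)"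
  have "(?f has_derivative ?f') (at z)"
    unfolding f by (intro has_derivative_sum has_derivative_scaleR_left has_derivative_mult b D)
  then have "frechet_derivative ?f (at z) = ?f'" by (rule frechet_derivative_at[symmetric])
  then have "div_A A (\<lambda>z. bump \<epsilon> (z - y) *\<^sub>R axis j 1) z = (\<Sum>k\<in>UNIV. ?f' (axis k 1) $ k)"
    by (simp add: div_A_def divergence_def jacobian_def trace_def matrix_def)
  also have "\<dots> = (\<Sum>k\<in>UNIV. bump \<epsilon> (z - y) * D k (axis k 1) + (bump_grad \<epsilon> (z - y) \<bullet> axis k 1) * S k z)"
    unfolding sum_scaleR_axis by simp
  finally show ?thesis
    by (simp add: sum.distrib sum_distrib_left dirlim_eq_derivative[OF D])
qed

lemma Lip_c_bump:
  assumes e: "0 < \<epsilon>" and sub: "cball y \<epsilon> \<subseteq> \<Omega>"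
  shows "(\<lambda>z. bump \<epsilon> (z - y) *\<^sub>R v) \<in> Lip_c \<Omega>"
proof -
  have "(4 * \<epsilon> ^ 3 * norm v)-lipschitz_on UNIV (\<lambda>z. bump \<epsilon> (z - y) *\<^sub>R v)"
  proof (rule lipschitz_onI)
    fix a b
    have "dist (bump \<epsilon> (a - y) *\<^sub>R v) (bump \<epsilon> (b - y) *\<^sub>R v) = dist (bump \<epsilon> (a - y)) (bump \<epsilon> (b - y)) * norm v"
      by (simp add: dist_norm scaleR_diff_left[symmetric])
    also have "\<dots> \<le> (4 * \<epsilon> ^ 3 * dist (a - y) (b - y)) * norm v"
      by (intro mult_right_mono lipschitz_onD[OF bump_lipschitz[OF e]]) auto
    finally show "dist (bump \<epsilon> (a - y) *\<^sub>R v) (bump \<epsilon> (b - y) *\<^sub>R v) \<le> 4 * \<epsilon> ^ 3 * norm v * dist a b"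
      by (simp add: dist_norm mult_ac)
  qed (use e in simp)
  moreover have s: "supp (\<lambda>z. bump \<epsilon> (z - y) *\<^sub>R v) \<subseteq> cball y \<epsilon>"
    unfolding supp_def
  proof (rule closure_minimal)
    show "{z. bump \<epsilon> (z - y) *\<^sub>R v \<noteq> 0} \<subseteq> cball y \<epsilon>"
    proof
      fix z assume "z \<in> {z. bump \<epsilon> (z - y) *\<^sub>R v \<noteq> 0}"
      then have "\<not> \<epsilon> \<le> norm (z - y)" using bump_eq_0[OF e, of "z - y"] by auto
      then show "z \<in> cball y \<epsilon>" by (simp add: dist_norm norm_minus_commute)
    qed
  qed auto
  moreover have "compact (supp (\<lambda>z. bump \<epsilon> (z - y) *\<^sub>R v))"
    using bounded_subset[OF bounded_cball s] by (simp add: compact_eq_bounded_closed supp_def)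
  ultimately show ?thesis unfolding Lip_c_def using sub by blast
qed

lemma mult_indicator_le_abs: "(t::real) * indicator S x \<le> \<bar>t\<bar>"
  by (auto simp: indicator_def)

text \<open>The filter form lets one \<epsilon> meet the finitely many requirements of the
  approximation theorem at once.\<close>

lemma kernel_approx_L2_eventually:
  fixes u :: "'a::euclidean_space \<Rightarrow> real"
  assumes u: "u \<in> borel_measurable borel" "integrable lborel (\<lambda>y. (u y)\<^sup>2)" and c: "0 \<le> c" and d: "\<delta> > 0"
  shows "eventually (\<lambda>\<epsilon>. \<forall>v.
     (\<forall>y. ennreal \<bar>v y\<bar> \<le> (\<integral>\<^sup>+h. ennreal (c / measure lborel (ball 0 \<epsilon> :: 'a set) * \<bar>u (h + y) - u y\<bar>) * indicator (ball 0 \<epsilon>) h \<partial>lborel)) \<longrightarrow>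
     (\<integral>\<^sup>+y. ennreal ((v y)\<^sup>2) \<partial>lborel) \<le> ennreal \<delta>) (at_right 0)"
proof -
  obtain d where d: "d > 0" "\<And>\<epsilon> v. 0 < \<epsilon> \<and> \<epsilon> < d \<and>
     (\<forall>y. ennreal \<bar>v y\<bar> \<le> (\<integral>\<^sup>+h. ennreal (c / measure lborel (ball 0 \<epsilon> :: 'a set) * \<bar>u (h + y) - u y\<bar>) * indicator (ball 0 \<epsilon>) h \<partial>lborel)) \<Longrightarrow>
     (\<integral>\<^sup>+y. ennreal ((v y)\<^sup>2) \<partial>lborel) \<le> ennreal \<delta>"
    using kernel_approx_L2[OF u c d] by blast
  show ?thesis
    unfolding eventually_at_right_field
    by (rule exI[of _ d], intro conjI allI impI d(1)) (rule d(2), blast)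
qed

text \<open>The commutator of mollification with the operator \<open>\<Sum>i. S i \<cdot> \<partial>i\<close> is an integral against a kernel
  of total mass zero and of size comparable to the kernel of a ball average: the singularity of the
  gradient of the mollifier is compensated by the Lipschitz increments of the coefficients.\<close>

definition comm_kernel :: "real \<Rightarrow> ('n::finite \<Rightarrow> real^'n \<Rightarrow> real) \<Rightarrow> real^'n \<Rightarrow> real^'n \<Rightarrow> real" where
  "comm_kernel \<epsilon> S y z = bump \<epsilon> (z - y) * (\<Sum>i\<in>UNIV. dirlim (S i) (axis i 1) z) +
     (\<Sum>i\<in>UNIV. (bump_grad \<epsilon> (z - y) \<bullet> axis i 1) * (S i z - S i y))"

lemma commutator_kernel:
  fixes S :: "'n::finite \<Rightarrow> real^'n \<Rightarrow> real" and y :: "real^'n"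
  assumes S: "\<And>i. L-lipschitz_on UNIV (S i)" and e: "0 < \<epsilon>"
  defines "k \<equiv> comm_kernel \<epsilon> S y"
  shows "k \<in> borel_measurable borel"
    and "AE z in lborel. \<bar>k z / bump_mass TYPE(real^'n) \<epsilon>\<bar> \<le>
      5 * real CARD('n) * L * 2 ^ (DIM(real^'n) + 1) / measure lborel (ball 0 \<epsilon> :: (real^'n) set) * indicator (ball 0 \<epsilon>) (z - y)"
    and "(\<integral>z. k z \<partial>lborel) = 0"
proof -
  let ?m = "bump_mass TYPE(real^'n) \<epsilon>" and ?b = "measure lborel (ball 0 \<epsilon> :: (real^'n) set)"
  let ?K = "2 ^ (DIM(real^'n) + 1) :: real" and ?n = "real CARD('n)"
  have L: "0 \<le> L" using lipschitz_on_nonneg[OF S] .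
  have m: "?m > 0" using e by (rule bump_mass_pos)
  note [measurable] = dirlim_measurable[OF S]
  have [measurable]: "S i \<in> borel_measurable borel" for i
    by (rule borel_measurable_continuous_onI) (rule lipschitz_on_continuous_on[OF S])
  show "k \<in> borel_measurable borel" unfolding k_def comm_kernel_def[abs_def] by measurable
  have "AE z in lborel. \<forall>i\<in>UNIV. \<bar>dirlim (S i) (axis i 1) z\<bar> \<le> L * norm (axis i (1::real) :: real^'n)"
    by (intro AE_finite_allI finite dirlim_bound_AE[OF S])
  then show "AE z in lborel. \<bar>k z / ?m\<bar> \<le> 5 * ?n * L * ?K / ?b * indicator (ball 0 \<epsilon>) (z - y)"
  proof eventually_elim
    case (elim z)
    have "\<bar>\<Sum>i\<in>UNIV. dirlim (S i) (axis i 1) z\<bar> \<le> (\<Sum>i\<in>(UNIV::'n set). \<bar>dirlim (S i) (axis i 1) z\<bar>)" by (rule sum_abs)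
    also have "\<dots> \<le> (\<Sum>i\<in>(UNIV::'n set). L)" using elim by (intro sum_mono) auto
    finally have T: "\<bar>\<Sum>i\<in>UNIV. dirlim (S i) (axis i 1) z\<bar> \<le> ?n * L" by simp
    have "\<bar>\<Sum>i\<in>UNIV. (bump_grad \<epsilon> (z - y) \<bullet> axis i 1) * (S i z - S i y)\<bar> \<le>
        (\<Sum>i\<in>(UNIV::'n set). \<bar>(bump_grad \<epsilon> (z - y) \<bullet> axis i 1) * (S i z - S i y)\<bar>)" by (rule sum_abs)
    also have "\<dots> \<le> (\<Sum>i\<in>(UNIV::'n set). norm (bump_grad \<epsilon> (z - y)) * (L * \<epsilon>))"
    proof (rule sum_mono)
      fix i :: 'n
      show "\<bar>(bump_grad \<epsilon> (z - y) \<bullet> axis i 1) * (S i z - S i y)\<bar> \<le> norm (bump_grad \<epsilon> (z - y)) * (L * \<epsilon>)"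
      proof (cases "norm (z - y) < \<epsilon>")
        case True
        have "\<bar>S i z - S i y\<bar> \<le> L * norm (z - y)"
          using lipschitz_onD[OF S, of z y i] by (simp add: dist_norm)
        also have "\<dots> \<le> L * \<epsilon>" using True L by (intro mult_left_mono) auto
        finally have "\<bar>S i z - S i y\<bar> \<le> L * \<epsilon>" .
        moreover have "\<bar>bump_grad \<epsilon> (z - y) \<bullet> axis i 1\<bar> \<le> norm (bump_grad \<epsilon> (z - y))"
          using Cauchy_Schwarz_ineq2[of "bump_grad \<epsilon> (z - y)" "axis i 1"] by simp
        ultimately show ?thesis unfolding abs_mult by (intro mult_mono) auto
      qed (use e in \<open>simp add: bump_grad_eq_0\<close>)
    qed
    finally have R: "\<bar>\<Sum>i\<in>UNIV. (bump_grad \<epsilon> (z - y) \<bullet> axis i 1) * (S i z - S i y)\<bar> \<le> ?n * L * (norm (bump_grad \<epsilon> (z - y)) * \<epsilon>)"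
      by (simp add: mult_ac)
    have "\<bar>k z\<bar> \<le> \<bar>bump \<epsilon> (z - y) * (\<Sum>i\<in>UNIV. dirlim (S i) (axis i 1) z)\<bar> + ?n * L * (norm (bump_grad \<epsilon> (z - y)) * \<epsilon>)"
      unfolding k_def comm_kernel_def using R by (rule order.trans[OF abs_triangle_ineq add_left_mono])
    also have "\<bar>bump \<epsilon> (z - y) * (\<Sum>i\<in>UNIV. dirlim (S i) (axis i 1) z)\<bar> \<le> bump \<epsilon> (z - y) * (?n * L)"
      unfolding abs_mult using mult_left_mono[OF T, of "bump \<epsilon> (z - y)"] by simp
    finally have kb: "\<bar>k z\<bar> \<le> bump \<epsilon> (z - y) * (?n * L) + ?n * L * (norm (bump_grad \<epsilon> (z - y)) * \<epsilon>)" by simp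
    have "\<bar>k z / ?m\<bar> = \<bar>k z\<bar> / ?m" using m by simp
    also have "\<dots> \<le> (bump \<epsilon> (z - y) * (?n * L) + ?n * L * (norm (bump_grad \<epsilon> (z - y)) * \<epsilon>)) / ?m"
      using kb m by (intro divide_right_mono) auto
    also have "\<dots> = ?n * L * (bump \<epsilon> (z - y) / ?m) + ?n * L * (norm (bump_grad \<epsilon> (z - y)) * \<epsilon> / ?m)"
      unfolding divide_inverse by algebra
    \<comment> \<open>The factor 5 is 1 for the divergence of the coefficients plus 4 for the
      gradient of the bump, after its factor \<epsilon> has been paid by a Lipschitz
      increment.\<close>
    also have "\<dots> \<le> ?n * L * (?K / ?b * indicator (ball 0 \<epsilon>) (z - y)) + ?n * L * (4 * ?K / ?b * indicator (ball 0 \<epsilon>) (z - y))"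
      using L by (intro add_mono mult_left_mono bump_kernel_bound[OF e]) auto
    also have "\<dots> = 5 * ?n * L * ?K / ?b * indicator (ball 0 \<epsilon>) (z - y)"
      unfolding divide_inverse by algebra
    finally show ?case .
  qed
  have gi: "integrable lborel (\<lambda>z. bump_grad \<epsilon> (z - y) \<bullet> axis i 1)" for i :: 'n
  proof -
    have "0-lipschitz_on UNIV (\<lambda>z::real^'n. 1::real)" by (rule lipschitz_on_constant)
    from dirlim_bump_integral(3)[OF this e, of y "axis i 1"] show ?thesis by simp
  qed
  note I = dirlim_bump_integral[OF S e]
  have "k = (\<lambda>z. (\<Sum>i\<in>UNIV. dirlim (S i) (axis i 1) z * bump \<epsilon> (z - y)) +
       (\<Sum>i\<in>UNIV. S i z * (bump_grad \<epsilon> (z - y) \<bullet> axis i 1) - S i y * (bump_grad \<epsilon> (z - y) \<bullet> axis i 1)))"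
    unfolding k_def by (simp add: comm_kernel_def fun_eq_iff sum_distrib_left algebra_simps)
  then have "(\<integral>z. k z \<partial>lborel) = (\<Sum>i\<in>UNIV. (\<integral>z. dirlim (S i) (axis i 1) z * bump \<epsilon> (z - y) \<partial>lborel)) +
       (\<Sum>i\<in>UNIV. (\<integral>z. S i z * (bump_grad \<epsilon> (z - y) \<bullet> axis i 1) \<partial>lborel) - S i y * (\<integral>z. bump_grad \<epsilon> (z - y) \<bullet> axis i 1 \<partial>lborel))"
    using I(2,3) gi by (simp add: Bochner_Integration.integral_sum Bochner_Integration.integrable_sum)
  also have "\<dots> = 0" using e by (simp add: I(1) integral_bump_grad sum_negf)
  finally show "(\<integral>z. k z \<partial>lborel) = 0" .
qed

lemma friedrichs_identity:
  fixes A :: "real^'n \<Rightarrow> real^'n^'n"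
  assumes \<Omega>: "open \<Omega>"
    and S: "\<And>i. L-lipschitz_on UNIV (S i)"
    and S_eq: "\<And>z i. z \<in> \<Omega> \<Longrightarrow> S i z = mat_sqrt (A z) $ i $ j"
    and weak: "is_weak_grad_A \<Omega> A u g"
    and u0: "integrable lborel u0" "AE y in lborel. u0 y = indicator \<Omega> y * u y"
    and g0: "integrable lborel g0" "AE y in lborel. g0 y = indicator \<Omega> y * (g y $ j)"
    and e: "0 < \<epsilon>" and sub: "cball y \<epsilon> \<subseteq> \<Omega>"
  defines "k \<equiv> comm_kernel \<epsilon> S y"
  shows "(\<Sum>i\<in>UNIV. S i y * (moll_grad \<epsilon> u0 y \<bullet> axis i 1)) - moll \<epsilon> g0 y =
    (\<integral>z. (u0 z - u0 y) * (k z / bump_mass TYPE(real^'n) \<epsilon>) \<partial>lborel)"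
proof -
  let ?m = "bump_mass TYPE(real^'n) \<epsilon>"
  have \<Omega>b: "\<Omega> \<in> sets borel" using \<Omega> by auto
  have m: "?m > 0" using e by (rule bump_mass_pos)
  note K = commutator_kernel[where y=y and S=S, OF S e, folded k_def]
  note [measurable] = dirlim_measurable[OF S]
  have km[measurable]: "k \<in> borel_measurable borel" by (rule K(1))
  have [measurable]: "S i \<in> borel_measurable borel" for i
    by (rule borel_measurable_continuous_onI) (rule lipschitz_on_continuous_on[OF S])
  have [measurable]: "u0 \<in> borel_measurable borel" "g0 \<in> borel_measurable borel" using u0 g0 by auto
  let ?v = "\<lambda>z. bump \<epsilon> (z - y) *\<^sub>R (axis j 1 :: real^'n)"
  have zero: "bump \<epsilon> (z - y) = 0" "bump_grad \<epsilon> (z - y) = 0" if "z \<notin> \<Omega>" for z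
  proof -
    have "\<epsilon> \<le> norm (z - y)" using sub that by (force simp: dist_norm norm_minus_commute)
    then show "bump \<epsilon> (z - y) = 0" "bump_grad \<epsilon> (z - y) = 0" using e by (auto simp: bump_eq_0 bump_grad_eq_0)
  qed
  have "AE z in lborel. \<forall>i\<in>UNIV. S i differentiable (at z)"
    by (intro AE_finite_allI finite rademacher[OF S])
  then have D: "AE z in lborel. u0 z * (k z + (\<Sum>i\<in>UNIV. S i y * (bump_grad \<epsilon> (z - y) \<bullet> axis i 1))) = indicator \<Omega> z * (u z * div_A A ?v z)"
    using u0(2)
  proof eventually_elim
    case (elim z)
    have "div_A A ?v z = k z + (\<Sum>i\<in>UNIV. S i y * (bump_grad \<epsilon> (z - y) \<bullet> axis i 1))"
      using elim(1) by (subst div_A_bump[where S=S and \<Omega>=\<Omega>])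
        (auto simp: S_eq e sub k_def comm_kernel_def algebra_simps sum.distrib[symmetric] intro!: sum.cong)
    then show ?case using elim(2) by simp
  qed
  have "(LINT z|lebesgue_on \<Omega>. u z * div_A A ?v z) = (\<integral>z. u0 z * (k z + (\<Sum>i\<in>UNIV. S i y * (bump_grad \<epsilon> (z - y) \<bullet> axis i 1))) \<partial>lborel)"
    by (rule integral_lebesgue_on_eq_lborel[OF \<Omega>b _ D]) measurable
  moreover have "(LINT z|lebesgue_on \<Omega>. g z \<bullet> ?v z) = (\<integral>z. g0 z * bump \<epsilon> (z - y) \<partial>lborel)"
  proof (rule integral_lebesgue_on_eq_lborel[OF \<Omega>b])
    show "AE z in lborel. g0 z * bump \<epsilon> (z - y) = indicat_real \<Omega> z * (g z \<bullet> ?v z)"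
      using g0(2) by eventually_elim (simp add: inner_axis)
  qed measurable
  moreover have "(LINT z|lebesgue_on \<Omega>. g z \<bullet> ?v z) = - (LINT z|lebesgue_on \<Omega>. u z * div_A A ?v z)"
    by (rule bspec[OF weak[unfolded is_weak_grad_A_def] Lip_c_bump[OF e sub]])
  ultimately have W: "(\<integral>z. g0 z * bump \<epsilon> (z - y) \<partial>lborel) = - (\<integral>z. u0 z * (k z + (\<Sum>i\<in>UNIV. S i y * (bump_grad \<epsilon> (z - y) \<bullet> axis i 1))) \<partial>lborel)"
    by simp
  have kint: "integrable lborel k"
  proof -
    let ?c = "5 * real CARD('n) * L * 2 ^ (DIM(real^'n) + 1) / measure lborel (ball 0 \<epsilon> :: (real^'n) set) * ?m"
    have "integrable lborel (\<lambda>z. ?c * indicator (ball y \<epsilon>) z)"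
      using emeasure_lborel_ball_finite[of y \<epsilon>] by (intro integrable_mult_right integrable_real_indicator) auto
    then show ?thesis
    proof (rule Bochner_Integration.integrable_bound)
      show "AE z in lborel. norm (k z) \<le> norm (?c * indicat_real (ball y \<epsilon>) z)"
        using K(2)
      proof eventually_elim
        case (elim z)
        have "indicat_real (ball 0 \<epsilon>) (z - y) = indicat_real (ball y \<epsilon>) z"
          by (simp add: indicator_def dist_norm norm_minus_commute)
        then have "\<bar>k z\<bar> / ?m \<le> ?c / ?m * indicat_real (ball y \<epsilon>) z" using elim m by simp
        then have "\<bar>k z\<bar> \<le> ?c * indicat_real (ball y \<epsilon>) z" using m by (simp add: field_simps)
        then show ?case unfolding real_norm_def by (rule order.trans[OF _ abs_ge_self])
      qed
    qed measurable
  qed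
  have ukint: "integrable lborel (\<lambda>z. u0 z * k z)"
  proof -
    let ?c = "5 * real CARD('n) * L * 2 ^ (DIM(real^'n) + 1) / measure lborel (ball 0 \<epsilon> :: (real^'n) set) * ?m"
    have "integrable lborel (\<lambda>z. ?c * u0 z)" using u0(1) by simp
    then show ?thesis
    proof (rule Bochner_Integration.integrable_bound)
      show "AE z in lborel. norm (u0 z * k z) \<le> norm (?c * u0 z)"
        using K(2)
      proof eventually_elim
        case (elim z)
        then have "\<bar>k z\<bar> / ?m \<le> ?c / ?m * indicator (ball 0 \<epsilon>) (z - y)" using m by simp
        then have "\<bar>k z\<bar> \<le> ?c * indicator (ball 0 \<epsilon>) (z - y)" using m by (simp add: field_simps)
        also have "\<dots> \<le> \<bar>?c\<bar>" by (rule mult_indicator_le_abs)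
        finally have "\<bar>u0 z\<bar> * \<bar>k z\<bar> \<le> \<bar>u0 z\<bar> * \<bar>?c\<bar>" by (intro mult_left_mono) auto
        then show ?case by (simp only: real_norm_def abs_mult mult.commute)
      qed
    qed measurable
  qed
  have ib: "integrable lborel (\<lambda>z. u0 z * (bump_grad \<epsilon> (z - y) \<bullet> axis i 1))" for i
    using integrable_inner_left[OF integrable_scaleR_bump_grad[OF u0(1) e, of y], of "axis i 1"] by simp
  have ig: "(\<integral>z. u0 z * (bump_grad \<epsilon> (z - y) \<bullet> axis i 1) \<partial>lborel) = - ?m * (moll_grad \<epsilon> u0 y \<bullet> axis i 1)" for i
    using integral_inner_left[OF integrable_scaleR_bump_grad[OF u0(1) e, of y], of "axis i 1"] m
    by (simp add: moll_grad_def)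
  have "(\<integral>z. u0 z * (k z + (\<Sum>i\<in>UNIV. S i y * (bump_grad \<epsilon> (z - y) \<bullet> axis i 1))) \<partial>lborel)
     = (\<integral>z. u0 z * k z + (\<Sum>i\<in>UNIV. S i y * (u0 z * (bump_grad \<epsilon> (z - y) \<bullet> axis i 1))) \<partial>lborel)"
    by (intro Bochner_Integration.integral_cong refl) (simp add: sum_distrib_left algebra_simps)
  also have "\<dots> = (\<integral>z. u0 z * k z \<partial>lborel) + (\<Sum>i\<in>UNIV. S i y * (- ?m * (moll_grad \<epsilon> u0 y \<bullet> axis i 1)))"
    using ukint ib by (simp add: Bochner_Integration.integral_sum Bochner_Integration.integrable_sum ig)
  also have "(\<Sum>i\<in>UNIV. S i y * (- ?m * (moll_grad \<epsilon> u0 y \<bullet> axis i 1))) = - ?m * (\<Sum>i\<in>UNIV. S i y * (moll_grad \<epsilon> u0 y \<bullet> axis i 1))"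
    by (simp add: sum_distrib_left sum_negf mult_ac)
  finally have *: "(\<integral>z. u0 z * (k z + (\<Sum>i\<in>UNIV. S i y * (bump_grad \<epsilon> (z - y) \<bullet> axis i 1))) \<partial>lborel) =
    (\<integral>z. u0 z * k z \<partial>lborel) + - ?m * (\<Sum>i\<in>UNIV. S i y * (moll_grad \<epsilon> u0 y \<bullet> axis i 1))" .
  have "?m * ((\<Sum>i\<in>UNIV. S i y * (moll_grad \<epsilon> u0 y \<bullet> axis i 1)) - moll \<epsilon> g0 y) = (\<integral>z. u0 z * k z \<partial>lborel)"
  proof -
    have "?m * moll \<epsilon> g0 y = (\<integral>z. g0 z * bump \<epsilon> (z - y) \<partial>lborel)" using m by (simp add: moll_def)
    then show ?thesis using W * by (simp add: right_diff_distrib)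
  qed
  \<comment> \<open>The kernel has mean zero, so \<open>u0 y\<close> may be subtracted. Only
    differences of \<open>u0\<close> remain, as the \<open>L\<^sup>2\<close> estimate for kernels
    requires.\<close>
  also have "\<dots> = (\<integral>z. u0 z * k z - u0 y * k z \<partial>lborel)" using ukint kint K(3) by simp
  also have "\<dots> = (\<integral>z. ?m * ((u0 z - u0 y) * (k z / ?m)) \<partial>lborel)"
  proof -
    have "?m * (t * (s / ?m)) = t * s" for t s using m by simp
    then show ?thesis by (simp only:) (simp only: left_diff_distrib)
  qed
  also have "\<dots> = ?m * (\<integral>z. (u0 z - u0 y) * (k z / ?m) \<partial>lborel)" by (rule integral_mult_right_zero)
  finally show ?thesis by (rule iffD1[OF mult_left_cancel, rotated]) (use m in simp)
qed

text \<open>On \<open>K\<close> each component of the gradient error is the commutator plus the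
  mollification error of the corresponding component of \<open>g\<close>. Both are bounded by ball
  averages of differences of a fixed \<open>L\<^sup>2\<close> function, hence small for small
  \<epsilon>; taking \<epsilon> below the radius \<open>r\<close> keeps the bumps inside
  \<open>\<Omega>\<close>.\<close>

theorem friedrichs_approximation:
  fixes A :: "real^'n \<Rightarrow> real^'n^'n" and K \<Omega> :: "(real^'n) set"
  assumes \<Omega>: "open \<Omega>" "bounded \<Omega>" and psd: "\<And>y. y \<in> \<Omega> \<Longrightarrow> psd_matrix (A y)"
    and lip: "L-lipschitz_on \<Omega> (\<lambda>y. mat_sqrt (A y))"
    and W: "W12 \<Omega> A u g" and K: "compact K" "K \<subseteq> \<Omega>" and \<delta>: "0 < \<delta>"
  obtains U G B where "\<And>y. (U has_derivative (\<lambda>h. G y \<bullet> h)) (at y)"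
    "\<And>y. \<bar>U y\<bar> \<le> B" "\<And>y. norm (G y) \<le> B" "G \<in> borel_measurable borel"
    "(\<integral>\<^sup>+y. ennreal ((U y - u y)\<^sup>2) \<partial>lebesgue_on K) \<le> ennreal \<delta>"
    "(\<integral>\<^sup>+y. ennreal ((norm (mat_sqrt (A y) *v G y - g y))\<^sup>2) \<partial>lebesgue_on K) \<le> ennreal \<delta>"
proof -
  have \<Omega>b: "\<Omega> \<in> sets borel" and Kb[measurable]: "K \<in> sets borel" using \<Omega> K by (auto simp: borel_compact)
  have "\<exists>F. L-lipschitz_on UNIV F \<and> (\<forall>z\<in>\<Omega>. F z = mat_sqrt (A z) $ i $ j)" for i j
    using mcshane_extension[OF lipschitz_matrix_entry[OF lip, of i j]] by metis
  then obtain S where S: "\<And>i j. L-lipschitz_on UNIV (S i j)" and S_eq: "\<And>i j z. z \<in> \<Omega> \<Longrightarrow> S i j z = mat_sqrt (A z) $ i $ j"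
    by metis
  have L: "0 \<le> L" using lipschitz_on_nonneg[OF S] .
  have repr: "\<exists>f0. f0 \<in> borel_measurable borel \<and> (AE y in lborel. f0 y = indicator \<Omega> y * f y) \<and> integrable lborel f0 \<and> integrable lborel (\<lambda>y. (f0 y)\<^sup>2)"
    if f: "f \<in> borel_measurable (lebesgue_on \<Omega>)" "integrable (lebesgue_on \<Omega>) (\<lambda>y. (f y)\<^sup>2)" for f :: "real^'n \<Rightarrow> real"
  proof -
    obtain f0 where f0[measurable]: "f0 \<in> borel_measurable borel" and eq: "AE y in lborel. f0 y = indicator \<Omega> y * f y"
      and z: "\<And>y. y \<notin> \<Omega> \<Longrightarrow> f0 y = 0"
      using borel_representative[OF \<Omega>b f(1)] by metis
    have "integrable lebesgue (\<lambda>y. indicator \<Omega> y *\<^sub>R (f y)\<^sup>2)"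
      using f(2) \<Omega>b by (subst (asm) integrable_restrict_space) (auto simp: sets_completionI_sets)
    moreover have "AE y in lebesgue. indicator \<Omega> y *\<^sub>R (f y)\<^sup>2 = (f0 y)\<^sup>2"
      using AE_completion[OF eq] by eventually_elim (auto simp: indicator_def)
    moreover have "(\<lambda>y. (f0 y)\<^sup>2) \<in> borel_measurable lebesgue" by (rule measurable_completion) measurable
    ultimately have "integrable lebesgue (\<lambda>y. (f0 y)\<^sup>2)"
      by (subst integrable_cong_AE[where g="\<lambda>y. indicator \<Omega> y *\<^sub>R (f y)\<^sup>2"]) (auto dest: borel_measurable_integrable elim: AE_mp)
    then have f2: "integrable lborel (\<lambda>y. (f0 y)\<^sup>2)" by (subst (asm) integrable_completion) measurable
    have "integrable lborel (\<lambda>y. indicator \<Omega> y + (f0 y)\<^sup>2)"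
      using f2 emeasure_bounded_finite[OF \<Omega>(2)] \<Omega>b by (intro Bochner_Integration.integrable_add integrable_real_indicator) auto
    then have "integrable lborel f0"
    proof (rule Bochner_Integration.integrable_bound)
      show "AE y in lborel. norm (f0 y) \<le> norm (indicat_real \<Omega> y + (f0 y)\<^sup>2)"
      proof (rule AE_I2)
        fix y
        have "0 \<le> (\<bar>f0 y\<bar> - 1)\<^sup>2" by simp
        then have "2 * \<bar>f0 y\<bar> \<le> 1 + (f0 y)\<^sup>2" by (simp add: power2_diff)
        then have "\<bar>f0 y\<bar> \<le> 1 + (f0 y)\<^sup>2" by linarith
        then show "norm (f0 y) \<le> norm (indicat_real \<Omega> y + (f0 y)\<^sup>2)" using z[of y] by (cases "y \<in> \<Omega>") auto
      qed
    qed measurable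
    then show ?thesis using f0 eq f2 by blast
  qed
  have u: "u \<in> borel_measurable (lebesgue_on \<Omega>)" "integrable (lebesgue_on \<Omega>) (\<lambda>y. (u y)\<^sup>2)"
    using W by (auto simp: W12_def in_L2_def)
  have gm: "g \<in> borel_measurable (lebesgue_on \<Omega>)" and g2: "integrable (lebesgue_on \<Omega>) (\<lambda>y. (norm (g y))\<^sup>2)"
    and weak: "is_weak_grad_A \<Omega> A u g"
    using W by (auto simp: W12_def in_L2_def)
  have gj: "(\<lambda>y. g y $ j) \<in> borel_measurable (lebesgue_on \<Omega>)" for j
  proof -
    have "(\<lambda>y. g y \<bullet> axis j 1) \<in> borel_measurable (lebesgue_on \<Omega>)" using gm by measurable
    then show ?thesis by (simp add: inner_axis)
  qed
  have "integrable (lebesgue_on \<Omega>) (\<lambda>y. (g y $ j)\<^sup>2)" for j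
  proof (rule Bochner_Integration.integrable_bound[OF g2])
    show "(\<lambda>y. (g y $ j)\<^sup>2) \<in> borel_measurable (lebesgue_on \<Omega>)" using gj by measurable
    show "AE y in lebesgue_on \<Omega>. norm ((g y $ j)\<^sup>2) \<le> norm ((norm (g y))\<^sup>2)"
    proof (rule AE_I2)
      fix y
      have "\<bar>g y $ j\<bar>\<^sup>2 \<le> (norm (g y))\<^sup>2" by (intro power_mono component_le_norm_cart) auto
      then show "norm ((g y $ j)\<^sup>2) \<le> norm ((norm (g y))\<^sup>2)" by simp
    qed
  qed
  then have "\<forall>j. \<exists>f0. f0 \<in> borel_measurable borel \<and> (AE y in lborel. f0 y = indicator \<Omega> y * (g y $ j)) \<and> integrable lborel f0 \<and> integrable lborel (\<lambda>y. (f0 y)\<^sup>2)"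
    using repr[OF gj] by blast
  then obtain g0 where g0[measurable]: "\<And>j. g0 j \<in> borel_measurable borel" and g0eq: "\<And>j. AE y in lborel. g0 j y = indicator \<Omega> y * (g y $ j)"
    and g0i: "\<And>j. integrable lborel (g0 j)" and g0i2: "\<And>j. integrable lborel (\<lambda>y. (g0 j y)\<^sup>2)"
    by (auto dest!: choice)
  obtain u0 where u0[measurable]: "u0 \<in> borel_measurable borel" and u0eq: "AE y in lborel. u0 y = indicator \<Omega> y * u y"
    and u0i: "integrable lborel u0" and u0i2: "integrable lborel (\<lambda>y. (u0 y)\<^sup>2)"
    using repr[OF u] by blast
  have Sm[measurable]: "S i j \<in> borel_measurable borel" for i j
    by (rule borel_measurable_continuous_onI) (rule lipschitz_on_continuous_on[OF S])
  have "\<exists>r>0. \<forall>y\<in>K. cball y r \<subseteq> \<Omega>"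
  proof -
    obtain e where e: "e > 0" "(\<Union>y\<in>K. ball y e) \<subseteq> \<Omega>"
      using compact_subset_open_imp_ball_epsilon_subset[OF K(1) \<Omega>(1) K(2)] by blast
    have "cball y (e/2) \<subseteq> \<Omega>" if "y \<in> K" for y
    proof -
      have "cball y (e/2) \<subseteq> ball y e" using e(1) by auto
      then show ?thesis using e(2) that by blast
    qed
    then show ?thesis using e(1) by (intro exI[of _ "e/2"]) auto
  qed
  then obtain r where r: "r > 0" "\<And>y. y \<in> K \<Longrightarrow> cball y r \<subseteq> \<Omega>" by blast
  let ?n = "real CARD('n)"
  let ?N = "2 ^ (DIM(real^'n) + 1) :: real"
  \<comment> \<open>Each of the n components is a sum of two errors, and the square of a sum is at
    most twice the sum of the squares; this adds up to n times 4 \<delta>'.\<close>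
  define \<delta>' where "\<delta>' = \<delta> / (4 * ?n)"
  have n1: "?n \<ge> 1" using one_le_card_finite[where 'a='n] by linarith
  have \<delta>': "\<delta>' > 0" "\<delta>' \<le> \<delta>" "?n * (4 * \<delta>') = \<delta>"
  proof -
    show "\<delta>' > 0" "?n * (4 * \<delta>') = \<delta>" using \<delta> n1 by (auto simp: \<delta>'_def)
    have "1 \<le> 4 * ?n" using n1 by linarith
    from divide_left_mono[OF this, of \<delta>] show "\<delta>' \<le> \<delta>" using \<delta> n1 by (simp add: \<delta>'_def)
  qed
  let ?P = "\<lambda>f c \<epsilon>. \<forall>v. (\<forall>y. ennreal \<bar>v y\<bar> \<le> (\<integral>\<^sup>+h. ennreal (c / measure lborel (ball 0 \<epsilon> :: (real^'n) set) * \<bar>f (h + y) - f y\<bar>) * indicator (ball 0 \<epsilon>) h \<partial>lborel)) \<longrightarrow>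
     (\<integral>\<^sup>+y. ennreal ((v y)\<^sup>2) \<partial>lborel) \<le> ennreal \<delta>'"
  have "eventually (\<lambda>\<epsilon>. 0 < \<epsilon> \<and> \<epsilon> < r \<and> ?P u0 ?N \<epsilon> \<and> ?P u0 (5 * ?n * L * ?N) \<epsilon> \<and> (\<forall>j. ?P (g0 j) ?N \<epsilon>)) (at_right 0)"
  proof (intro eventually_conj)
    show "eventually (\<lambda>\<epsilon>. 0 < \<epsilon>) (at_right (0::real))" by (simp add: eventually_at_right_less)
    show "eventually (\<lambda>\<epsilon>. \<epsilon> < r) (at_right 0)" unfolding eventually_at_right_field using r(1) by blast
    show "eventually (?P u0 ?N) (at_right 0)" by (intro kernel_approx_L2_eventually u0 u0i2 \<delta>') simp
    show "eventually (?P u0 (5 * ?n * L * ?N)) (at_right 0)" using L by (intro kernel_approx_L2_eventually u0 u0i2 \<delta>') simp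
    show "eventually (\<lambda>\<epsilon>. \<forall>j. ?P (g0 j) ?N \<epsilon>) (at_right 0)"
    proof (rule eventually_all_finite)
      fix j show "eventually (?P (g0 j) ?N) (at_right 0)" by (intro kernel_approx_L2_eventually g0 g0i2 \<delta>') simp
    qed
  qed
  from eventually_happens'[OF trivial_limit_at_right_real this]
  have "\<exists>\<epsilon>. 0 < \<epsilon> \<and> \<epsilon> < r \<and> ?P u0 ?N \<epsilon> \<and> ?P u0 (5 * ?n * L * ?N) \<epsilon> \<and> (\<forall>j. ?P (g0 j) ?N \<epsilon>)" .
  then obtain \<epsilon> where
    *: "0 < \<epsilon> \<and> \<epsilon> < r \<and> ?P u0 ?N \<epsilon> \<and> ?P u0 (5 * ?n * L * ?N) \<epsilon> \<and> (\<forall>j. ?P (g0 j) ?N \<epsilon>)"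
    by (elim exE) (rule that)
  note \<epsilon> = conjunct1[OF *] conjunct1[OF conjunct2[OF *]]
    and P1 = conjunct1[OF conjunct2[OF conjunct2[OF *]]]
    and P2 = conjunct1[OF conjunct2[OF conjunct2[OF conjunct2[OF *]]]]
    and P3 = conjunct2[OF conjunct2[OF conjunct2[OF conjunct2[OF *]]]]
  have sub: "cball y \<epsilon> \<subseteq> \<Omega>" if "y \<in> K" for y using r(2)[OF that] \<epsilon> by (meson less_imp_le order.trans subset_cball)
  let ?m = "bump_mass TYPE(real^'n) \<epsilon>" and ?b = "measure lborel (ball 0 \<epsilon> :: (real^'n) set)"
  define U where "U = moll \<epsilon> u0"
  define G where "G = moll_grad \<epsilon> u0"
  have [measurable]: "U \<in> borel_measurable borel" "G \<in> borel_measurable borel" unfolding U_def G_def by measurable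
  have E1: "(\<integral>\<^sup>+y. ennreal ((indicator K y * (U y - u0 y))\<^sup>2) \<partial>lborel) \<le> ennreal \<delta>'"
  proof (rule P1[rule_format])
    fix y
    show "ennreal \<bar>indicator K y * (U y - u0 y)\<bar> \<le> (\<integral>\<^sup>+h. ennreal (?N / ?b * \<bar>u0 (h + y) - u0 y\<bar>) * indicator (ball 0 \<epsilon>) h \<partial>lborel)"
      using moll_minus_kernel_bound[OF u0i \<epsilon>(1), of y] by (cases "y \<in> K") (simp_all add: U_def)
  qed
  have E2: "(\<integral>\<^sup>+y. ennreal ((indicator K y * (moll \<epsilon> (g0 j) y - g0 j y))\<^sup>2) \<partial>lborel) \<le> ennreal \<delta>'" for j
  proof (rule P3[rule_format])
    fix y
    show "ennreal \<bar>indicator K y * (moll \<epsilon> (g0 j) y - g0 j y)\<bar> \<le> (\<integral>\<^sup>+h. ennreal (?N / ?b * \<bar>g0 j (h + y) - g0 j y\<bar>) * indicator (ball 0 \<epsilon>) h \<partial>lborel)"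
      using moll_minus_kernel_bound[OF g0i[of j] \<epsilon>(1), of y] by (cases "y \<in> K") simp_all
  qed
  define R where "R j y = (\<Sum>i\<in>UNIV. S i j y * (G y \<bullet> axis i 1)) - moll \<epsilon> (g0 j) y" for j y
  have [measurable]: "R j \<in> borel_measurable borel" for j unfolding R_def[abs_def] by measurable
  have E3: "(\<integral>\<^sup>+y. ennreal ((indicator K y * R j y)\<^sup>2) \<partial>lborel) \<le> ennreal \<delta>'" for j
  proof (rule P2[rule_format])
    fix y
    show "ennreal \<bar>indicator K y * R j y\<bar> \<le> (\<integral>\<^sup>+h. ennreal (5 * ?n * L * ?N / ?b * \<bar>u0 (h + y) - u0 y\<bar>) * indicator (ball 0 \<epsilon>) h \<partial>lborel)"
    proof (cases "y \<in> K")
      case True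
      note C = commutator_kernel[where y=y and S="\<lambda>i. S i j", OF S \<epsilon>(1)]
      have "R j y = (\<integral>z. (u0 z - u0 y) * (comm_kernel \<epsilon> (\<lambda>i. S i j) y z / ?m) \<partial>lborel)"
        unfolding R_def G_def
        by (rule friedrichs_identity[OF \<Omega>(1) S[of _ j] S_eq weak u0i u0eq g0i g0eq \<epsilon>(1) sub[OF True]]) 
      then have "ennreal \<bar>R j y\<bar> \<le> (\<integral>\<^sup>+h. ennreal (5 * ?n * L * ?N / ?b * \<bar>u0 (h + y) - u0 y\<bar>) * indicator (ball 0 \<epsilon>) h \<partial>lborel)"
      proof (simp only:, intro kernel_average_bound u0 C(2))
        show "(\<lambda>z. comm_kernel \<epsilon> (\<lambda>i. S i j) y z / ?m) \<in> borel_measurable borel" using C(1) by measurable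
      qed
      then show ?thesis using True by simp
    qed simp
  qed
  show ?thesis
  proof (rule that)
    show "(U has_derivative (\<lambda>h. G y \<bullet> h)) (at y)" for y
      unfolding U_def G_def by (rule moll_has_derivative[OF u0i \<epsilon>(1)])
    let ?B = "max (\<epsilon> ^ 4 * (\<integral>z. \<bar>u0 z\<bar> \<partial>lborel) / ?m) (4 * \<epsilon> ^ 3 * (\<integral>z. \<bar>u0 z\<bar> \<partial>lborel) / ?m)"
    show "\<bar>U y\<bar> \<le> ?B" for y using moll_bound[OF u0i \<epsilon>(1), of y] by (simp add: U_def)
    show "norm (G y) \<le> ?B" for y using moll_grad_bound[OF u0i \<epsilon>(1), of y] by (simp add: G_def)
    show "G \<in> borel_measurable borel" by measurable
    have "(\<integral>\<^sup>+y. ennreal ((U y - u y)\<^sup>2) \<partial>lebesgue_on K) = (\<integral>\<^sup>+y. ennreal ((indicator K y * (U y - u0 y))\<^sup>2) \<partial>lborel)"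
    proof (rule nn_integral_lebesgue_on_eq_lborel[OF Kb])
      show "AE y in lborel. ennreal ((indicator K y * (U y - u0 y))\<^sup>2) = ennreal ((U y - u y)\<^sup>2) * indicator K y"
        using u0eq by eventually_elim (use K(2) in \<open>auto simp: indicator_def\<close>)
    qed
    then show "(\<integral>\<^sup>+y. ennreal ((U y - u y)\<^sup>2) \<partial>lebesgue_on K) \<le> ennreal \<delta>"
      using E1 \<delta>'(2) by (simp add: order.trans[OF _ ennreal_leI])
    \<comment> \<open>The weak formulation tests columns of the square root of \<open>A\<close>,
      while the product with \<open>G\<close> uses its rows; symmetry of the square root reconciles
      them.\<close>
    have comp: "(mat_sqrt (A y) *v G y) $ j = (\<Sum>i\<in>UNIV. S i j y * (G y \<bullet> axis i 1))" if "y \<in> K" for y j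
    proof -
      have y: "y \<in> \<Omega>" using that K by auto
      have "transpose (mat_sqrt (A y)) = mat_sqrt (A y)" using mat_sqrt(1)[OF psd[OF y]] by (simp add: psd_matrix_def)
      then have sym: "mat_sqrt (A y) $ j $ i = mat_sqrt (A y) $ i $ j" for i
        by (metis (no_types, lifting) transpose_def vec_lambda_beta)
      show ?thesis by (simp add: matrix_vector_mult_def S_eq[OF y] inner_axis sym)
    qed
    have "(\<integral>\<^sup>+y. ennreal ((norm (mat_sqrt (A y) *v G y - g y))\<^sup>2) \<partial>lebesgue_on K) =
      (\<integral>\<^sup>+y. (\<Sum>j\<in>UNIV. ennreal ((indicator K y * R j y + indicator K y * (moll \<epsilon> (g0 j) y - g0 j y))\<^sup>2)) \<partial>lborel)"
    proof (rule nn_integral_lebesgue_on_eq_lborel[OF Kb])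
      have "AE y in lborel. \<forall>j\<in>UNIV. g0 j y = indicator \<Omega> y * (g y $ j)"
        by (intro AE_finite_allI finite g0eq)
      then show "AE y in lborel. (\<Sum>j\<in>UNIV. ennreal ((indicator K y * R j y + indicator K y * (moll \<epsilon> (g0 j) y - g0 j y))\<^sup>2)) =
          ennreal ((norm (mat_sqrt (A y) *v G y - g y))\<^sup>2) * indicator K y"
      proof eventually_elim
        case (elim y)
        show ?case
        proof (cases "y \<in> K")
          case True
          then have "y \<in> \<Omega>" using K by auto
          have "(norm (mat_sqrt (A y) *v G y - g y))\<^sup>2 = (\<Sum>j\<in>UNIV. ((mat_sqrt (A y) *v G y - g y) $ j)\<^sup>2)"
            by (simp add: norm_vec_def L2_set_def sum_nonneg)
          also have "\<dots> = (\<Sum>j\<in>UNIV. (R j y + (moll \<epsilon> (g0 j) y - g0 j y))\<^sup>2)"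
            using elim True \<open>y \<in> \<Omega>\<close> by (intro sum.cong refl) (simp add: comp R_def)
          finally show ?thesis using True by (simp add: sum_ennreal)
        qed simp
      qed
    qed
    also have "\<dots> = (\<Sum>j\<in>UNIV. (\<integral>\<^sup>+y. ennreal ((indicator K y * R j y + indicator K y * (moll \<epsilon> (g0 j) y - g0 j y))\<^sup>2) \<partial>lborel))"
      by (rule nn_integral_sum) measurable
    also have "\<dots> \<le> (\<Sum>j\<in>(UNIV :: 'n set). ennreal (4 * \<delta>'))"
    proof (rule sum_mono)
      fix j
      have "(\<integral>\<^sup>+y. ennreal ((indicator K y * R j y + indicator K y * (moll \<epsilon> (g0 j) y - g0 j y))\<^sup>2) \<partial>lborel) \<le>
         (\<integral>\<^sup>+y. 2 * ennreal ((indicator K y * R j y)\<^sup>2) + 2 * ennreal ((indicator K y * (moll \<epsilon> (g0 j) y - g0 j y))\<^sup>2) \<partial>lborel)"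
      proof (rule nn_integral_mono)
        fix y
        have "(a + b)\<^sup>2 \<le> 2 * a\<^sup>2 + 2 * b\<^sup>2" for a b :: real
          using zero_le_power2[of "a - b"] by (simp add: power2_eq_square algebra_simps)
        then have "ennreal ((a + b)\<^sup>2) \<le> ennreal (2 * a\<^sup>2 + 2 * b\<^sup>2)" for a b :: real by (rule ennreal_leI)
        then show "ennreal ((indicator K y * R j y + indicator K y * (moll \<epsilon> (g0 j) y - g0 j y))\<^sup>2) \<le>
            2 * ennreal ((indicator K y * R j y)\<^sup>2) + 2 * ennreal ((indicator K y * (moll \<epsilon> (g0 j) y - g0 j y))\<^sup>2)"
          by (simp only: ennreal_plus ennreal_mult zero_le_power2 mult_nonneg_nonneg zero_le_numeral ennreal_numeral)
      qed
      also have "\<dots> = 2 * (\<integral>\<^sup>+y. ennreal ((indicator K y * R j y)\<^sup>2) \<partial>lborel) + 2 * (\<integral>\<^sup>+y. ennreal ((indicator K y * (moll \<epsilon> (g0 j) y - g0 j y))\<^sup>2) \<partial>lborel)"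
        by (subst nn_integral_add) (measurable, simp add: nn_integral_cmult)
      also have "\<dots> \<le> 2 * ennreal \<delta>' + 2 * ennreal \<delta>'"
        by (intro add_mono mult_left_mono E2 E3) auto
      also have "\<dots> = ennreal (2 * \<delta>' + 2 * \<delta>')"
        using \<delta>'(1) by (simp only: ennreal_plus ennreal_mult mult_nonneg_nonneg zero_le_numeral ennreal_numeral less_imp_le)
      finally show "(\<integral>\<^sup>+y. ennreal ((indicator K y * R j y + indicator K y * (moll \<epsilon> (g0 j) y - g0 j y))\<^sup>2) \<partial>lborel) \<le> ennreal (4 * \<delta>')"
        by simp
    qed
    also have "\<dots> = ennreal (\<Sum>j\<in>(UNIV :: 'n set). 4 * \<delta>')" using \<delta>'(1) by (intro sum_ennreal) simp
    also have "\<dots> = ennreal \<delta>" using \<delta>'(3) by simp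
    finally show "(\<integral>\<^sup>+y. ennreal ((norm (mat_sqrt (A y) *v G y - g y))\<^sup>2) \<partial>lebesgue_on K) \<le> ennreal \<delta>" .
  qed
qed

section \<open>Gradients of Lipschitz functions with compact support\<close>

lemma grad_eq:
  fixes G :: "real^'n"
  assumes "(f has_derivative (\<lambda>h. G \<bullet> h)) (at y)" shows "grad f y = G"
proof -
  have "frechet_derivative f (at y) = (\<lambda>h. G \<bullet> h)" using frechet_derivative_at[OF assms] by simp
  then show ?thesis by (simp add: grad_def vec_eq_iff inner_axis)
qed

lemma grad_has_derivative:
  fixes f :: "real^'n \<Rightarrow> real"
  assumes "f differentiable (at y)" shows "(f has_derivative (\<lambda>h. grad f y \<bullet> h)) (at y)"
proof -
  let ?f' = "frechet_derivative f (at y)"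
  have d: "(f has_derivative ?f') (at y)" using assms frechet_derivative_works by blast
  then have lin: "linear ?f'" by (rule has_derivative_linear)
  have "?f' h = grad f y \<bullet> h" for h
  proof -
    have "?f' h = ?f' (\<Sum>i\<in>UNIV. (h $ i) *\<^sub>R axis i 1)" by (simp add: sum_scaleR_axis)
    also have "\<dots> = (\<Sum>i\<in>UNIV. h $ i * ?f' (axis i 1))" by (simp add: linear_sum[OF lin] linear_scale[OF lin])
    also have "\<dots> = grad f y \<bullet> h" by (simp add: grad_def inner_vec_def mult.commute)
    finally show ?thesis .
  qed
  then show ?thesis using d by presburger
qed

lemma eq_0_outside_supp: "y \<notin> supp f \<Longrightarrow> f y = 0"
  using closure_subset[of "{y. f y \<noteq> 0}"] by (auto simp: supp_def)

lemma supp_closed: "closed (supp f)" by (simp add: supp_def)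

lemma grad_eq_0_outside_supp:
  fixes f :: "real^'n \<Rightarrow> real"
  assumes "y \<notin> supp f" shows "grad f y = 0"
proof (rule grad_eq)
  have "((\<lambda>y. 0) has_derivative (\<lambda>h. 0 \<bullet> h)) (at y)" by simp
  moreover have "open (- supp f)" by (simp add: supp_closed open_Compl)
  ultimately show "(f has_derivative (\<lambda>h. 0 \<bullet> h)) (at y)"
  proof (rule has_derivative_transform_within_open)
    show "y \<in> - supp f" using assms by simp
    fix z assume "z \<in> - supp f"
    then show "0 = f z" by (simp add: eq_0_outside_supp)
  qed
qed

lemma rademacher_lebesgue:
  fixes f :: "'a::euclidean_space \<Rightarrow> real"
  assumes "L-lipschitz_on UNIV f" shows "AE x in lebesgue. f differentiable (at x)"
  using rademacher[OF assms] by (rule AE_completion)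

text \<open>\<open>grad\<close> has unspecified values where \<open>f\<close> is not differentiable.
  It agrees almost everywhere with a Borel function made of directional limits, and completeness of
  Lebesgue measure does the rest.\<close>

lemma grad_measurable:
  fixes f :: "real^'n \<Rightarrow> real"
  assumes f: "L-lipschitz_on UNIV f" shows "grad f \<in> borel_measurable lebesgue"
proof (rule borel_measurable_AE)
  have "(\<lambda>y. \<Sum>i\<in>UNIV. dirlim f (axis i 1) y *\<^sub>R (axis i 1 :: real^'n)) \<in> borel_measurable borel"
    using dirlim_measurable[OF f] by measurable
  then show "(\<lambda>y. \<Sum>i\<in>UNIV. dirlim f (axis i 1) y *\<^sub>R (axis i 1 :: real^'n)) \<in> borel_measurable lebesgue"
    by (intro measurable_completion) simp
  show "AE y in lebesgue. (\<Sum>i\<in>UNIV. dirlim f (axis i 1) y *\<^sub>R axis i 1) = grad f y"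
    using rademacher_lebesgue[OF f]
  proof eventually_elim
    case (elim y)
    from dirlim_eq_derivative[OF grad_has_derivative[OF elim]] show ?case
      by (simp add: sum_scaleR_axis vec_eq_iff inner_axis)
  qed
qed

lemma grad_bound_AE:
  fixes f :: "real^'n \<Rightarrow> real"
  assumes f: "L-lipschitz_on UNIV f" shows "AE y in lebesgue. norm (grad f y) \<le> real CARD('n) * L"
proof -
  have "AE y in lebesgue. \<forall>i\<in>UNIV. \<bar>dirlim f (axis i 1) y\<bar> \<le> L * norm (axis i (1::real) :: real^'n)"
    by (intro AE_completion AE_finite_allI finite dirlim_bound_AE[OF f])
  with rademacher_lebesgue[OF f] show ?thesis
  proof eventually_elim
    case (elim y)
    from dirlim_eq_derivative[OF grad_has_derivative[OF elim(1)]]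
    have "\<bar>grad f y $ i\<bar> \<le> L" for i using elim(2)[rule_format, of i] by (simp add: inner_axis)
    then have "(\<Sum>i\<in>UNIV. \<bar>grad f y $ i\<bar>) \<le> (\<Sum>i\<in>(UNIV::'n set). L)" by (intro sum_mono) auto
    then show ?case using norm_le_l1_cart[of "grad f y"] by simp
  qed
qed

lemma borel_measurable_matrix_vector_mult:
  fixes F :: "'b \<Rightarrow> real^'n^'m" and f :: "'b \<Rightarrow> real^'n"
  assumes "F \<in> borel_measurable M" "f \<in> borel_measurable M"
  shows "(\<lambda>y. F y *v f y) \<in> borel_measurable M"
proof -
  have "continuous_on UNIV (\<lambda>p::(real^'n^'m) \<times> (real^'n). fst p *v snd p)"
    unfolding matrix_vector_mult_def by (intro continuous_intros)
  then have "continuous_on UNIV (\<lambda>p::(real^'n^'m) \<times> (real^'n). (\<lambda>a b. a *v b) (fst p) (snd p))" by simp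
  from borel_measurable_continuous_Pair[OF assms this] show ?thesis .
qed

lemma norm_matrix_vector_mult_le:
  fixes F :: "real^'n^'m"
  shows "norm (F *v x) \<le> norm F * norm x"
proof -
  have "(norm (F *v x))\<^sup>2 = (\<Sum>i\<in>UNIV. ((F $ i) \<bullet> x)\<^sup>2)"
    by (simp add: norm_vec_def L2_set_def sum_nonneg matrix_vector_mult_def inner_vec_def)
  also have "\<dots> \<le> (\<Sum>i\<in>UNIV. (norm (F $ i))\<^sup>2 * (norm x)\<^sup>2)"
  proof (rule sum_mono)
    fix i
    have "\<bar>F $ i \<bullet> x\<bar>\<^sup>2 \<le> (norm (F $ i) * norm x)\<^sup>2" by (intro power_mono Cauchy_Schwarz_ineq2) auto
    then show "(F $ i \<bullet> x)\<^sup>2 \<le> (norm (F $ i))\<^sup>2 * (norm x)\<^sup>2" by (simp add: power_mult_distrib)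
  qed
  also have "\<dots> = (norm F * norm x)\<^sup>2"
    by (simp add: norm_vec_def[of F] L2_set_def sum_nonneg power_mult_distrib sum_distrib_right)
  finally show ?thesis by (rule power2_le_imp_le) simp
qed

lemma norm_matrix_vector_mult_bound:
  fixes F :: "real^'n^'m"
  shows "norm F \<le> K \<Longrightarrow> norm (F *v x) \<le> K * norm x"
  by (rule order.trans[OF norm_matrix_vector_mult_le mult_right_mono]) auto

lemma mat_sqrt_measurable:
  assumes \<Omega>: "open \<Omega>" and lip: "L-lipschitz_on \<Omega> (\<lambda>y. mat_sqrt (A y))"
  shows "(\<lambda>y. mat_sqrt (A y)) \<in> borel_measurable (lebesgue_on \<Omega>)"
  by (rule continuous_imp_measurable_on_sets_lebesgue[OF lipschitz_on_continuous_on[OF lip]]) (use \<Omega> in auto)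

section \<open>Measurability, boundedness and integrability of A-gradients\<close>

lemma grad_A_eq_0_outside_supp: "y \<notin> supp w \<Longrightarrow> grad_A A w y = 0"
  by (simp add: grad_A_def grad_eq_0_outside_supp)

lemma Lip_c_lipschitz: "w \<in> Lip_c U \<Longrightarrow> \<exists>L. L-lipschitz_on UNIV w"
  and Lip_c_compact: "w \<in> Lip_c U \<Longrightarrow> compact (supp w)"
  and Lip_c_supp: "w \<in> Lip_c U \<Longrightarrow> supp w \<subseteq> U"
  by (auto simp: Lip_c_def)

lemma Lip_c_mono: "U \<subseteq> V \<Longrightarrow> w \<in> Lip_c U \<Longrightarrow> w \<in> Lip_c V"
  by (auto simp: Lip_c_def)

lemma Lip_c_bounded:
  fixes w :: "real^'n \<Rightarrow> real"
  assumes "w \<in> Lip_c U" shows "\<exists>B. \<forall>y. \<bar>w y\<bar> \<le> B"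
proof -
  obtain L where "L-lipschitz_on UNIV w" using Lip_c_lipschitz[OF assms] by blast
  then have "continuous_on (supp w) w" using lipschitz_on_continuous_on lipschitz_on_subset by blast
  then have "bounded (w ` supp w)" using Lip_c_compact[OF assms] by (intro compact_imp_bounded compact_continuous_image)
  then obtain B where B: "\<And>y. y \<in> supp w \<Longrightarrow> \<bar>w y\<bar> \<le> B" unfolding bounded_iff by auto
  have "\<bar>w y\<bar> \<le> max B 0" for y
    using B[of y] eq_0_outside_supp[of y w] by (cases "y \<in> supp w") auto
  then show ?thesis by blast
qed

lemma grad_A_measurable:
  fixes w :: "real^'n \<Rightarrow> real"
  assumes \<Omega>: "open \<Omega>" and lip: "L-lipschitz_on \<Omega> (\<lambda>y. mat_sqrt (A y))" and w: "w \<in> Lip_c \<Omega>"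
  shows "grad_A A w \<in> borel_measurable lebesgue"
proof -
  obtain L' where L': "L'-lipschitz_on UNIV w" using Lip_c_lipschitz[OF w] by blast
  have \<Omega>s: "\<Omega> \<inter> space lebesgue \<in> sets lebesgue" using \<Omega> by auto
  have "(\<lambda>y. indicator \<Omega> y *\<^sub>R mat_sqrt (A y)) \<in> borel_measurable lebesgue"
    using mat_sqrt_measurable[OF \<Omega> lip] by (subst (asm) borel_measurable_restrict_space_iff[OF \<Omega>s])
  from borel_measurable_matrix_vector_mult[OF this grad_measurable[OF L']]
  have "(\<lambda>y. (indicator \<Omega> y *\<^sub>R mat_sqrt (A y)) *v grad w y) \<in> borel_measurable lebesgue" .
  moreover have "(indicator \<Omega> y *\<^sub>R mat_sqrt (A y)) *v grad w y = grad_A A w y" for y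
  proof (cases "y \<in> \<Omega>")
    case False
    then have "y \<notin> supp w" using Lip_c_supp[OF w] by blast
    then show ?thesis using False by (simp add: grad_A_def grad_eq_0_outside_supp)
  qed (simp add: grad_A_def)
  ultimately show ?thesis by simp
qed

lemma grad_A_bounded_AE:
  fixes w :: "real^'n \<Rightarrow> real"
  assumes bd: "bounded ((\<lambda>y. mat_sqrt (A y)) ` \<Omega>)" and w: "w \<in> Lip_c \<Omega>"
  shows "\<exists>C. AE y in lebesgue. norm (grad_A A w y) \<le> C"
proof -
  obtain L' where L': "L'-lipschitz_on UNIV w" using Lip_c_lipschitz[OF w] by blast
  obtain K where K: "\<And>y. y \<in> \<Omega> \<Longrightarrow> norm (mat_sqrt (A y)) \<le> K" using bd unfolding bounded_iff by auto
  have "AE y in lebesgue. norm (grad_A A w y) \<le> max K 0 * (real CARD('n) * L')"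
    using grad_bound_AE[OF L']
  proof eventually_elim
    case (elim y)
    show ?case
    proof (cases "y \<in> \<Omega>")
      case True
      have "norm (grad_A A w y) \<le> norm (mat_sqrt (A y)) * norm (grad w y)"
        unfolding grad_A_def by (rule norm_matrix_vector_mult_le)
      also have "\<dots> \<le> max K 0 * (real CARD('n) * L')"
        using K[OF True] elim by (intro mult_mono) auto
      finally show ?thesis .
    next
      case False
      then have "y \<notin> supp w" using Lip_c_supp[OF w] by blast
      then show ?thesis using lipschitz_on_nonneg[OF L'] by (simp add: grad_A_eq_0_outside_supp)
    qed
  qed
  then show ?thesis by blast
qed

lemma integrable_norm_grad_A:
  fixes w :: "real^'n \<Rightarrow> real"
  assumes \<Omega>: "open \<Omega>" and lip: "L-lipschitz_on \<Omega> (\<lambda>y. mat_sqrt (A y))"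
    and bd: "bounded ((\<lambda>y. mat_sqrt (A y)) ` \<Omega>)" and w: "w \<in> Lip_c \<Omega>"
  shows "integrable lebesgue (grad_A A w)"
proof -
  obtain C where C: "AE y in lebesgue. norm (grad_A A w y) \<le> C" using grad_A_bounded_AE[OF bd w] by blast
  have "integrable lebesgue (\<lambda>y. C * indicator (supp w) y)"
    using lmeasurable_compact[OF Lip_c_compact[OF w]] by (intro integrable_mult_right integrable_real_indicator) (auto simp: fmeasurable_def)
  then show ?thesis
  proof (rule Bochner_Integration.integrable_bound)
    show "grad_A A w \<in> borel_measurable lebesgue" by (rule grad_A_measurable[OF \<Omega> lip w])
    show "AE y in lebesgue. norm (grad_A A w y) \<le> norm (C * indicat_real (supp w) y)"
      using C by eventually_elim (auto simp: indicator_def grad_A_eq_0_outside_supp)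
  qed
qed

lemma grad_A_scale:
  fixes w :: "real^'n \<Rightarrow> real"
  assumes s: "0 < s" and w: "w \<in> Lip_c U"
  shows "(\<lambda>y. s * w y) \<in> Lip_c U" and "AE y in lebesgue. grad_A A (\<lambda>y. s * w y) y = s *\<^sub>R grad_A A w y"
proof -
  obtain L where L: "L-lipschitz_on UNIV w" using Lip_c_lipschitz[OF w] by blast
  have "supp (\<lambda>y. s * w y) = supp w" using s by (simp add: supp_def)
  moreover have "(s * L)-lipschitz_on UNIV (\<lambda>y. s * w y)" using lipschitz_on_cmult_real_nonneg[OF L, of s] s by simp
  ultimately show "(\<lambda>y. s * w y) \<in> Lip_c U" using w unfolding Lip_c_def by auto
  show "AE y in lebesgue. grad_A A (\<lambda>y. s * w y) y = s *\<^sub>R grad_A A w y"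
    using rademacher_lebesgue[OF L]
  proof eventually_elim
    case (elim y)
    from has_derivative_mult_right[OF grad_has_derivative[OF elim], of s]
    have "((\<lambda>y. s * w y) has_derivative (\<lambda>h. (s *\<^sub>R grad w y) \<bullet> h)) (at y)" by simp
    from grad_eq[OF this] show ?case by (simp add: grad_A_def matrix_vector_mult_scaleR)
  qed
qed

lemma Lip_c_measurable:
  fixes w :: "real^'n \<Rightarrow> real"
  assumes "w \<in> Lip_c U" shows "w \<in> borel_measurable lebesgue"
  using Lip_c_lipschitz[OF assms] lipschitz_on_continuous_on
  by (intro measurable_completion) (auto intro!: borel_measurable_continuous_onI)

lemma Lip_c_integrable:
  fixes w :: "real^'n \<Rightarrow> real"
  assumes w: "w \<in> Lip_c U" shows "integrable lebesgue w"
proof -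
  obtain k where k: "\<And>y. \<bar>w y\<bar> \<le> k" using Lip_c_bounded[OF w] by blast
  show ?thesis
  proof (rule Bochner_Integration.integrable_bound[OF _ Lip_c_measurable[OF w]])
    show "integrable lebesgue (\<lambda>y. k * indicator (supp w) y)"
      using lmeasurable_compact[OF Lip_c_compact[OF w]]
      by (intro integrable_mult_right integrable_real_indicator) (auto simp: fmeasurable_def)
    show "AE y in lebesgue. norm (w y) \<le> norm (k * indicat_real (supp w) y)"
    proof (rule AE_I2)
      fix y show "norm (w y) \<le> norm (k * indicat_real (supp w) y)"
        using k[of y] eq_0_outside_supp[of y w] by (cases "y \<in> supp w") auto
    qed
  qed
qed

section \<open>Restricting Lebesgue integrals to subsets\<close>

lemma integrable_lebesgue_on:
  fixes f :: "'a::euclidean_space \<Rightarrow> 'b::{banach, second_countable_topology}"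
  assumes "integrable lebesgue f" "S \<in> sets lebesgue" shows "integrable (lebesgue_on S) f"
  using integrable_mult_indicator[OF assms(2,1)] assms(2) by (simp add: integrable_restrict_space)

lemma measure_pos_of_open:
  fixes B :: "'a::euclidean_space set"
  assumes "open B" "B \<noteq> {}" "bounded B" shows "0 < measure lebesgue B"
proof -
  have "\<not> negligible B" using assms open_not_negligible by blast
  moreover have "B \<in> lmeasurable" using assms by (simp add: lmeasurable_open)
  ultimately show ?thesis by (metis measure_nonneg negligible_iff_measure order_le_less)
qed

lemma integral_lebesgue_on_subset:
  fixes f :: "'a::euclidean_space \<Rightarrow> 'b::{banach, second_countable_topology}"
  assumes "K \<subseteq> \<Omega>" "K \<in> sets lebesgue" "\<Omega> \<in> sets lebesgue" "\<And>y. y \<notin> K \<Longrightarrow> f y = 0"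
  shows "(LINT y|lebesgue_on \<Omega>. f y) = (LINT y|lebesgue_on K. f y)"
proof -
  have "(\<lambda>y. indicator \<Omega> y *\<^sub>R f y) = (\<lambda>y. indicator K y *\<^sub>R f y)" using assms by (auto simp: indicator_def fun_eq_iff)
  then show ?thesis using assms by (simp add: integral_restrict_space)
qed

lemma integral_lebesgue_eq_lebesgue_on:
  fixes f :: "'a::euclidean_space \<Rightarrow> 'b::{banach, second_countable_topology}"
  assumes "K \<in> sets lebesgue" "\<And>y. y \<notin> K \<Longrightarrow> f y = 0"
  shows "(LINT y|lebesgue. f y) = (LINT y|lebesgue_on K. f y)"
  using integral_lebesgue_on_subset[of K UNIV f] assms by (simp add: lebesgue_on_UNIV_eq)

lemma AE_lebesgue_on:
  assumes "AE y in lebesgue. P y" "K \<in> sets lebesgue" shows "AE y in lebesgue_on K. P y"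
  using assms by (subst AE_restrict_space_iff) auto

lemma integral_lebesgue_on_mono_set:
  fixes f h :: "real^'n \<Rightarrow> real"
  assumes S: "S1 \<subseteq> S2" "S1 \<in> sets lebesgue" "S2 \<in> sets lebesgue"
    and f: "integrable (lebesgue_on S1) f" and h: "integrable (lebesgue_on S2) h"
    and le: "\<And>y. y \<in> S1 \<Longrightarrow> f y \<le> h y" and nn: "\<And>y. y \<in> S2 \<Longrightarrow> 0 \<le> h y"
  shows "(LINT y|lebesgue_on S1. f y) \<le> (LINT y|lebesgue_on S2. h y)"
proof -
  have "(LINT y|lebesgue. indicator S1 y *\<^sub>R f y) \<le> (LINT y|lebesgue. indicator S2 y *\<^sub>R h y)"
  proof (rule integral_mono)
    show "integrable lebesgue (\<lambda>y. indicator S1 y *\<^sub>R f y)" "integrable lebesgue (\<lambda>y. indicator S2 y *\<^sub>R h y)"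
      using f h S by (auto simp: integrable_restrict_space)
    show "indicator S1 y *\<^sub>R f y \<le> indicator S2 y *\<^sub>R h y" for y
      using S(1) le[of y] nn[of y] by (cases "y \<in> S1"; cases "y \<in> S2") auto
  qed
  then show ?thesis using S by (simp add: integral_restrict_space)
qed

lemma lipschitz_on_mult_bounded:
  fixes f g :: "'a::metric_space \<Rightarrow> real"
  assumes f: "L1-lipschitz_on X f" and g: "L2-lipschitz_on X g"
    and B: "\<And>x. x \<in> X \<Longrightarrow> \<bar>f x\<bar> \<le> B1" "\<And>x. x \<in> X \<Longrightarrow> \<bar>g x\<bar> \<le> B2" and nn: "0 \<le> B1" "0 \<le> B2"
  shows "(B1 * L2 + B2 * L1)-lipschitz_on X (\<lambda>x. f x * g x)"
proof (rule lipschitz_onI)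
  fix x y assume xy: "x \<in> X" "y \<in> X"
  have "f x * g x - f y * g y = f x * (g x - g y) + g y * (f x - f y)" by (simp add: algebra_simps)
  then have "\<bar>f x * g x - f y * g y\<bar> \<le> \<bar>f x\<bar> * \<bar>g x - g y\<bar> + \<bar>g y\<bar> * \<bar>f x - f y\<bar>"
    by (metis abs_mult abs_triangle_ineq)
  also have "\<dots> \<le> B1 * (L2 * dist x y) + B2 * (L1 * dist x y)"
    using B xy nn lipschitz_onD[OF f xy] lipschitz_onD[OF g xy]
    by (intro add_mono mult_mono) (auto simp: dist_real_def)
  finally show "dist (f x * g x) (f y * g y) \<le> (B1 * L2 + B2 * L1) * dist x y"
    by (simp add: dist_real_def algebra_simps)
qed (use lipschitz_on_nonneg[OF f] lipschitz_on_nonneg[OF g] nn in auto)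

text \<open>\<open>P\<close> and its derivative need no global bound: \<open>U\<close> takes values
  in a bounded interval, on which both are bounded. This makes the product Lipschitz.\<close>

lemma test_function:
  fixes \<psi> :: "real^'n \<Rightarrow> real"
  assumes \<psi>: "L-lipschitz_on UNIV \<psi>" "\<And>y. 0 \<le> \<psi> y \<and> \<psi> y \<le> 1" "compact (supp \<psi>)" "supp \<psi> \<subseteq> V"
    and U: "\<And>y. (U has_derivative (\<lambda>h. G y \<bullet> h)) (at y)" "\<And>y. \<bar>U y\<bar> \<le> B" "\<And>y. norm (G y) \<le> B"
    and P: "\<And>t. (P has_real_derivative P' t) (at t)" "continuous_on UNIV P'"
  shows "(\<lambda>y. (\<psi> y)\<^sup>2 * P (U y)) \<in> Lip_c V"
    and "\<psi> differentiable (at y) \<Longrightarrow> grad_A A (\<lambda>y. (\<psi> y)\<^sup>2 * P (U y)) y =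
      ((\<psi> y)\<^sup>2 * P' (U y)) *\<^sub>R (mat_sqrt (A y) *v G y) + (2 * \<psi> y * P (U y)) *\<^sub>R grad_A A \<psi> y"
proof -
  let ?w = "\<lambda>y. (\<psi> y)\<^sup>2 * P (U y)"
  have B0: "0 \<le> B" using U(2)[of 0] by linarith
  have Pc: "continuous_on S P" for S
    using P(1) by (meson DERIV_isCont continuous_at_imp_continuous_on)
  have "bounded (P ` cball 0 B)" by (intro compact_imp_bounded compact_continuous_image Pc compact_cball)
  then obtain C where C0: "\<And>z. z \<in> P ` cball 0 B \<Longrightarrow> norm z \<le> C" unfolding bounded_iff by blast
  have C: "\<bar>P t\<bar> \<le> C" if "\<bar>t\<bar> \<le> B" for t using C0[of "P t"] that by auto
  have "bounded (P' ` cball 0 B)"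
    by (intro compact_imp_bounded compact_continuous_image continuous_on_subset[OF P(2)] compact_cball) auto
  then obtain C' where C'0: "\<And>z. z \<in> P' ` cball 0 B \<Longrightarrow> norm z \<le> C'" unfolding bounded_iff by blast
  have C': "\<bar>P' t\<bar> \<le> C'" if "\<bar>t\<bar> \<le> B" for t using C'0[of "P' t"] that by auto
  have PU: "((\<lambda>y. P (U y)) has_derivative (\<lambda>h. (P' (U y) *\<^sub>R G y) \<bullet> h)) (at y)" for y
  proof -
    have "(P has_derivative (*) (P' (U y))) (at (U y))" using P(1) by (simp add: has_field_derivative_def)
    from has_derivative_compose[OF U(1)[of y] this] show ?thesis by simp
  qed
  have "norm (P' (U y) *\<^sub>R G y) \<le> C' * B" for y
    using C'[OF U(2)[of y]] U(3)[of y] B0 by (simp add: mult_mono)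
  then have lipP: "(C' * B)-lipschitz_on UNIV (\<lambda>y. P (U y))" by (rule lipschitz_of_gradient_bound[OF PU])
  have lip\<psi>: "(1 * L + 1 * L)-lipschitz_on UNIV (\<lambda>y. \<psi> y * \<psi> y)"
  proof -
    have "\<bar>\<psi> y\<bar> \<le> 1" for y using \<psi>(2)[of y] by simp
    then show ?thesis by (intro lipschitz_on_mult_bounded \<psi>(1)) auto
  qed
  have "\<bar>\<psi> y * \<psi> y\<bar> \<le> 1" for y
    using \<psi>(2)[of y] mult_mono[of "\<psi> y" 1 "\<psi> y" 1] by simp
  moreover have "0 \<le> C" using C[OF U(2)] abs_ge_zero order.trans by blast
  ultimately have "\<exists>L'. L'-lipschitz_on UNIV ?w"
    using lipschitz_on_mult_bounded[OF lip\<psi> lipP, of 1 C] C[OF U(2)] by (auto simp: power2_eq_square)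
  moreover have "supp ?w \<subseteq> supp \<psi>" unfolding supp_def by (intro closure_mono) auto
  moreover then have "compact (supp ?w)" using \<psi>(3) supp_closed[of ?w] compact_Int_closed[of "supp \<psi>" "supp ?w"]
    by (simp add: Int_absorb1)
  ultimately show "?w \<in> Lip_c V" using \<psi>(4) by (auto simp: Lip_c_def)
  assume d: "\<psi> differentiable (at y)"
  have sq: "((\<lambda>y. (\<psi> y)\<^sup>2) has_derivative (\<lambda>h. 2 * \<psi> y * (grad \<psi> y \<bullet> h))) (at y)"
    unfolding power2_eq_square
    by (rule has_derivative_eq_rhs[OF has_derivative_mult[OF grad_has_derivative[OF d] grad_has_derivative[OF d]]])
       (auto simp: algebra_simps)
  have "(?w has_derivative (\<lambda>h. (((\<psi> y)\<^sup>2 * P' (U y)) *\<^sub>R G y + (2 * \<psi> y * P (U y)) *\<^sub>R grad \<psi> y) \<bullet> h)) (at y)"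
    by (rule has_derivative_eq_rhs[OF has_derivative_mult[OF sq PU[of y]]])
       (auto simp: fun_eq_iff inner_add_left algebra_simps)
  then have "grad ?w y = ((\<psi> y)\<^sup>2 * P' (U y)) *\<^sub>R G y + (2 * \<psi> y * P (U y)) *\<^sub>R grad \<psi> y" by (rule grad_eq)
  then show "grad_A A ?w y = ((\<psi> y)\<^sup>2 * P' (U y)) *\<^sub>R (mat_sqrt (A y) *v G y) + (2 * \<psi> y * P (U y)) *\<^sub>R grad_A A \<psi> y"
    by (simp add: grad_A_def matrix_vector_right_distrib matrix_vector_mult_scaleR)
qed

lemma integrable_lebesgue_on_mono:
  fixes f :: "'a::euclidean_space \<Rightarrow> 'b::{banach, second_countable_topology}"
  assumes "integrable (lebesgue_on \<Omega>) f" "K \<in> sets lebesgue" "K \<subseteq> \<Omega>" "\<Omega> \<in> sets lebesgue"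
  shows "integrable (lebesgue_on K) f"
proof -
  have "set_integrable lebesgue \<Omega> f"
    using assms(1,4) by (subst (asm) integrable_restrict_space) (auto simp: set_integrable_def)
  then have "set_integrable lebesgue K f" by (rule set_integrable_subset) (use assms in auto)
  then show ?thesis using assms(2) by (subst integrable_restrict_space) (auto simp: set_integrable_def)
qed

lemma quadratic_majorant:
  fixes a b c d e s :: real
  assumes "a \<le> 2 * b + 2 * c" "c + e \<le> s" "0 \<le> e" "0 \<le> d"
  shows "a \<le> 1 + 2 * (b + d + s)" "a \<le> 1 + 2 * (d + b + s)"
  using assms by simp_all

text \<open>Prescribing the errors 2^-k makes the sum of the squared errors integrable. This yields
  convergence almost everywhere without passing to a subsequence, and a single integrable majorant
  \<open>H\<close> for the whole sequence.\<close>

lemma friedrichs_sequence: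
  fixes A :: "real^'n \<Rightarrow> real^'n^'n" and K \<Omega> :: "(real^'n) set"
  assumes \<Omega>: "open \<Omega>" "bounded \<Omega>" and psd: "\<And>y. y \<in> \<Omega> \<Longrightarrow> psd_matrix (A y)"
    and lip: "L-lipschitz_on \<Omega> (\<lambda>y. mat_sqrt (A y))"
    and W: "W12 \<Omega> A u g" and K: "compact K" "K \<subseteq> \<Omega>"
  obtains U G B H where "\<And>k y. (U k has_derivative (\<lambda>h. G k y \<bullet> h)) (at y)"
    "\<And>k y. \<bar>U k y\<bar> \<le> B k" "\<And>k y. norm (G k y) \<le> B k" "\<And>k. G k \<in> borel_measurable borel"
    "integrable (lebesgue_on K) H"
    "AE y in lebesgue_on K. (\<lambda>k. U k y) \<longlonglongrightarrow> u y"
    "AE y in lebesgue_on K. (\<lambda>k. mat_sqrt (A y) *v G k y) \<longlonglongrightarrow> g y"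
    "AE y in lebesgue_on K. 1 \<le> H y \<and> (u y)\<^sup>2 \<le> H y \<and> (norm (g y))\<^sup>2 \<le> H y \<and>
       (\<forall>k. (U k y)\<^sup>2 \<le> H y \<and> (norm (mat_sqrt (A y) *v G k y))\<^sup>2 \<le> H y)"
proof -
  have Ks: "K \<in> sets lebesgue" "K \<inter> space lebesgue \<in> sets lebesgue" using lmeasurable_compact[OF K(1)] by auto
  have subK: "f \<in> borel_measurable (lebesgue_on \<Omega>) \<Longrightarrow> f \<in> borel_measurable (lebesgue_on K)" for f :: "real^'n \<Rightarrow> 'c::topological_space"
    using measurable_restrict_mono[OF _ K(2)] by blast
  define Q where "Q k U G B \<longleftrightarrow> (\<forall>y. (U has_derivative (\<lambda>h. G y \<bullet> h)) (at y)) \<and> (\<forall>y. \<bar>U y\<bar> \<le> B) \<and> (\<forall>y. norm (G y) \<le> B) \<and> G \<in> borel_measurable borel \<and>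
    (\<integral>\<^sup>+y. ennreal ((U y - u y)\<^sup>2) \<partial>lebesgue_on K) \<le> ennreal ((1/2)^k) \<and>
    (\<integral>\<^sup>+y. ennreal ((norm (mat_sqrt (A y) *v G y - g y))\<^sup>2) \<partial>lebesgue_on K) \<le> ennreal ((1/2)^k)" for k :: nat and U G B
  have "\<exists>U G B. Q k U G B" for k
  proof -
    have pos: "0 < (1/2::real)^k" by simp
    obtain U G B where "\<And>y. (U has_derivative (\<lambda>h. G y \<bullet> h)) (at y)" "\<And>y. \<bar>U y\<bar> \<le> B" "\<And>y. norm (G y) \<le> B"
      "G \<in> borel_measurable borel" "(\<integral>\<^sup>+y. ennreal ((U y - u y)\<^sup>2) \<partial>lebesgue_on K) \<le> ennreal ((1/2)^k)"
      "(\<integral>\<^sup>+y. ennreal ((norm (mat_sqrt (A y) *v G y - g y))\<^sup>2) \<partial>lebesgue_on K) \<le> ennreal ((1/2)^k)"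
      by (rule friedrichs_approximation[OF \<Omega> psd lip W K pos]) (assumption, rule that, assumption+)
    then show ?thesis unfolding Q_def by blast
  qed
  then obtain U G B where Q: "\<And>k. Q k (U k) (G k) (B k)" by metis
  have U: "\<And>k y. (U k has_derivative (\<lambda>h. G k y \<bullet> h)) (at y)" "\<And>k y. \<bar>U k y\<bar> \<le> B k" "\<And>k y. norm (G k y) \<le> B k"
      "\<And>k. G k \<in> borel_measurable borel"
    and a1: "\<And>k::nat. (\<integral>\<^sup>+y. ennreal ((U k y - u y)\<^sup>2) \<partial>lebesgue_on K) \<le> ennreal ((1/2)^k)"
    and a2: "\<And>k::nat. (\<integral>\<^sup>+y. ennreal ((norm (mat_sqrt (A y) *v G k y - g y))\<^sup>2) \<partial>lebesgue_on K) \<le> ennreal ((1/2)^k)"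
    using Q by (auto simp: Q_def)
  have um[measurable]: "u \<in> borel_measurable (lebesgue_on K)" and gm[measurable]: "g \<in> borel_measurable (lebesgue_on K)"
    using W subK by (auto simp: W12_def in_L2_def)
  have Um[measurable]: "U k \<in> borel_measurable (lebesgue_on K)" for k
  proof -
    have "continuous_on UNIV (U k)" using U(1) by (meson continuous_at_imp_continuous_on has_derivative_continuous)
    then have "U k \<in> borel_measurable lebesgue" by (intro measurable_completion) (simp add: borel_measurable_continuous_onI)
    then show ?thesis by (rule measurable_restrict_space1)
  qed
  have Gm: "G k \<in> borel_measurable (lebesgue_on K)" for k
    using U(4)[of k] by (intro measurable_restrict_space1 measurable_completion) simp
  have Zm[measurable]: "(\<lambda>y. mat_sqrt (A y) *v G k y) \<in> borel_measurable (lebesgue_on K)" for k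
    by (intro borel_measurable_matrix_vector_mult subK[OF mat_sqrt_measurable[OF \<Omega>(1) lip]] Gm)
  have u2: "integrable (lebesgue_on K) (\<lambda>y. (u y)\<^sup>2)" and g2: "integrable (lebesgue_on K) (\<lambda>y. (norm (g y))\<^sup>2)"
    using W integrable_lebesgue_on_mono[OF _ Ks(1) K(2)] \<Omega>(1) by (auto simp: W12_def in_L2_def)
  define D where "D k y = (U k y - u y)\<^sup>2 + (norm (mat_sqrt (A y) *v G k y - g y))\<^sup>2" for k y
  have D0: "0 \<le> D k y" for k y by (simp add: D_def)
  have Dm[measurable]: "D k \<in> borel_measurable (lebesgue_on K)" for k unfolding D_def[abs_def] by measurable
  have Di: "(\<integral>\<^sup>+y. ennreal (D k y) \<partial>lebesgue_on K) \<le> ennreal (2 * (1/2)^k)" for k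
  proof -
    have "(\<integral>\<^sup>+y. ennreal (D k y) \<partial>lebesgue_on K) = (\<integral>\<^sup>+y. ennreal ((U k y - u y)\<^sup>2) + ennreal ((norm (mat_sqrt (A y) *v G k y - g y))\<^sup>2) \<partial>lebesgue_on K)"
      unfolding D_def by (intro nn_integral_cong) simp
    also have "\<dots> = (\<integral>\<^sup>+y. ennreal ((U k y - u y)\<^sup>2) \<partial>lebesgue_on K) + (\<integral>\<^sup>+y. ennreal ((norm (mat_sqrt (A y) *v G k y - g y))\<^sup>2) \<partial>lebesgue_on K)"
      by (rule nn_integral_add) measurable
    also have "\<dots> \<le> ennreal ((1/2)^k) + ennreal ((1/2)^k)" by (intro add_mono a1 a2)
    also have "\<dots> = ennreal (2 * (1/2)^k)" by (subst ennreal_plus[symmetric]) auto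
    finally show ?thesis .
  qed
  have Dint: "integrable (lebesgue_on K) (D k)" "(\<integral>y. D k y \<partial>lebesgue_on K) \<le> 2 * (1/2)^k" for k
  proof -
    show "integrable (lebesgue_on K) (D k)"
      using Di[of k] D0 by (intro integrableI_bounded) (auto simp: abs_of_nonneg intro: order.strict_trans1[OF _ ennreal_less_top])
    then have "ennreal (\<integral>y. D k y \<partial>lebesgue_on K) \<le> ennreal (2 * (1/2)^k)"
      using Di[of k] D0 by (subst (asm) nn_integral_eq_integral) auto
    then show "(\<integral>y. D k y \<partial>lebesgue_on K) \<le> 2 * (1/2)^k" by (subst (asm) ennreal_le_iff) auto
  qed
  have sm: "summable (\<lambda>k. \<integral>y. norm (D k y) \<partial>lebesgue_on K)"
  proof (rule summable_comparison_test)
    show "\<exists>N. \<forall>k\<ge>N. norm (\<integral>y. norm (D k y) \<partial>lebesgue_on K) \<le> 2 * (1/2)^k"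
      using Dint(2) D0 by (auto simp: abs_of_nonneg integral_nonneg_AE)
    show "summable (\<lambda>k. 2 * (1/2)^k :: real)" by (intro summable_mult summable_geometric) simp
  qed
  have "(\<Sum>k. \<integral>\<^sup>+y. ennreal (D k y) \<partial>lebesgue_on K) \<le> (\<Sum>k. ennreal (2 * (1/2)^k))"
    by (intro suminf_le Di) auto
  also have "\<dots> = ennreal (\<Sum>k. 2 * (1/2)^k)"
    by (intro suminf_ennreal2 summable_mult summable_geometric) auto
  also have "\<dots> < \<infinity>" by simp
  finally have "(\<integral>\<^sup>+y. (\<Sum>k. ennreal (D k y)) \<partial>lebesgue_on K) < \<infinity>" by (subst nn_integral_suminf) measurable
  then have X: "AE y in lebesgue_on K. (\<Sum>k. ennreal (D k y)) \<noteq> \<infinity>"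
    by (intro nn_integral_PInf_AE) auto
  then have sum: "AE y in lebesgue_on K. summable (\<lambda>k. D k y)"
    using X
  proof eventually_elim
    case (elim y)
    show ?case by (rule summable_suminf_not_top[OF D0 elim(1)[unfolded infinity_ennreal_def]])
  qed
  then have sumn: "AE y in lebesgue_on K. summable (\<lambda>k. norm (D k y))" using D0 by simp
  define S where "S y = (\<Sum>k. D k y)" for y
  have Si: "integrable (lebesgue_on K) S"
    unfolding S_def[abs_def] by (rule integrable_suminf[OF Dint(1) sumn sm])
  \<comment> \<open>The factor 2 comes from bounding a square by twice that of the limit plus twice
    that of the error. The summand 1 makes \<open>sqrt (H y)\<close> at least 1, so that constants
    and first powers are also dominated.\<close>
  define H where "H y = 1 + 2 * ((u y)\<^sup>2 + (norm (g y))\<^sup>2 + S y)" for y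
  have fin: "integrable (lebesgue_on K) (\<lambda>y. 1::real)"
    by (rule finite_measure.integrable_const[OF finite_measure_lebesgue_on[OF lmeasurable_compact[OF K(1)]]])
  show ?thesis
  proof (rule that[OF U])
    show "integrable (lebesgue_on K) H" unfolding H_def[abs_def] by (intro Bochner_Integration.integrable_add integrable_mult_right fin u2 g2 Si)
    have lim0: "AE y in lebesgue_on K. (\<lambda>k. D k y) \<longlonglongrightarrow> 0" using sum by eventually_elim (simp add: summable_LIMSEQ_zero)
    show "AE y in lebesgue_on K. (\<lambda>k. U k y) \<longlonglongrightarrow> u y"
      using lim0
    proof eventually_elim
      case (elim y)
      have "(\<lambda>k. (U k y - u y)\<^sup>2) \<longlonglongrightarrow> 0"
        by (rule tendsto_sandwich[OF _ _ tendsto_const elim]) (auto simp: D_def)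
      then have "(\<lambda>k. sqrt ((U k y - u y)\<^sup>2)) \<longlonglongrightarrow> sqrt 0" by (intro tendsto_real_sqrt)
      then have "(\<lambda>k. U k y - u y) \<longlonglongrightarrow> 0" by (simp add: tendsto_rabs_zero_iff)
      then show ?case by (simp add: LIM_zero_cancel)
    qed
    show "AE y in lebesgue_on K. (\<lambda>k. mat_sqrt (A y) *v G k y) \<longlonglongrightarrow> g y"
      using lim0
    proof eventually_elim
      case (elim y)
      have "(\<lambda>k. (norm (mat_sqrt (A y) *v G k y - g y))\<^sup>2) \<longlonglongrightarrow> 0"
        by (rule tendsto_sandwich[OF _ _ tendsto_const elim]) (auto simp: D_def)
      then have "(\<lambda>k. sqrt ((norm (mat_sqrt (A y) *v G k y - g y))\<^sup>2)) \<longlonglongrightarrow> sqrt 0" by (intro tendsto_real_sqrt)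
      then have "(\<lambda>k. mat_sqrt (A y) *v G k y - g y) \<longlonglongrightarrow> 0" by (simp add: tendsto_norm_zero_iff)
      then show ?case by (simp add: LIM_zero_cancel)
    qed
    show "AE y in lebesgue_on K. 1 \<le> H y \<and> (u y)\<^sup>2 \<le> H y \<and> (norm (g y))\<^sup>2 \<le> H y \<and>
       (\<forall>k. (U k y)\<^sup>2 \<le> H y \<and> (norm (mat_sqrt (A y) *v G k y))\<^sup>2 \<le> H y)"
      using sum
    proof eventually_elim
      case (elim y)
      have DS: "D k y \<le> S y" for k unfolding S_def using sum_le_suminf[OF elim, of "{k}"] D0 by auto
      have S0: "0 \<le> S y" using DS[of 0] D0[of 0 y] by linarith
      have par: "(norm a)\<^sup>2 \<le> 2 * (norm b)\<^sup>2 + 2 * (norm (a - b))\<^sup>2" for a b :: "'z::real_inner"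
        unfolding power2_norm_eq_inner using inner_ge_zero[of "a - b - b"]
        by (simp add: inner_diff_left inner_diff_right inner_commute)
      have sq: "0 \<le> (u y)\<^sup>2" "0 \<le> (norm (g y))\<^sup>2" by auto
      have "(U k y)\<^sup>2 \<le> H y \<and> (norm (mat_sqrt (A y) *v G k y))\<^sup>2 \<le> H y" for k
      proof
        have d: "(U k y - u y)\<^sup>2 + (norm (mat_sqrt (A y) *v G k y - g y))\<^sup>2 \<le> S y"
          using DS[of k] by (simp add: D_def)
        have nn: "0 \<le> (U k y - u y)\<^sup>2" "0 \<le> (norm (mat_sqrt (A y) *v G k y - g y))\<^sup>2" by auto
        have p: "(U k y)\<^sup>2 \<le> 2 * (u y)\<^sup>2 + 2 * (U k y - u y)\<^sup>2" using par[of "U k y" "u y"] by simp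
        show "(U k y)\<^sup>2 \<le> H y" unfolding H_def by (rule quadratic_majorant(1)[OF p d nn(2) sq(2)])
        show "(norm (mat_sqrt (A y) *v G k y))\<^sup>2 \<le> H y"
          unfolding H_def by (rule quadratic_majorant(2)[OF par[of "mat_sqrt (A y) *v G k y" "g y"] _ nn(1) sq(1)]) (use d in simp)
      qed
      then show ?case using sq S0 by (auto simp: H_def)
    qed
  qed
qed

section \<open>The gain from the Orlicz-Sobolev inequality\<close>

context
  fixes m :: real
  assumes m: "2 < m"
begin

lemma Young_Phi_E: "Young_Phi m (exp (2 powr m)) = exp (3 powr m)"
proof -
  have "(2 powr m) powr (1 / m) = (2::real)" using m by (simp add: powr_powr)
  then show ?thesis by (simp add: Young_Phi_def)
qed

lemma Young_Phi_low: "t \<le> exp (2 powr m) \<Longrightarrow> Young_Phi m t = exp (3 powr m) / exp (2 powr m) * t"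
  by (cases "t = exp (2 powr m)") (auto simp: Young_Phi_E, simp add: Young_Phi_def)

lemma Young_Phi_high: "exp (2 powr m) \<le> t \<Longrightarrow> Young_Phi m t = exp ((ln t powr (1 / m) + 1) powr m)"
  by (simp add: Young_Phi_def)

lemma Young_Phi_strict_mono: "s < t \<Longrightarrow> Young_Phi m s < Young_Phi m t"
proof -
  let ?E = "exp (2 powr m) :: real"
  have low: "Young_Phi m s < Young_Phi m t" if "s < t" "t \<le> ?E" for s t
    using that by (auto simp: Young_Phi_low intro!: divide_strict_right_mono mult_strict_left_mono)
  have high: "Young_Phi m s < Young_Phi m t" if "s < t" "?E \<le> s" for s t
  proof -
    have s: "0 < s" using that(2) exp_gt_zero order.strict_trans2 by blast
    have "2 powr m \<le> ln s" using that s by (simp add: ln_ge_iff)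
    moreover have "0 < 2 powr m" by simp
    ultimately have "0 < ln s" by linarith
    moreover have "ln s < ln t" using s that by simp
    ultimately have "ln s powr (1 / m) < ln t powr (1 / m)" using m by (intro powr_less_mono2) auto
    then have "(ln s powr (1 / m) + 1) powr m < (ln t powr (1 / m) + 1) powr m" using m by (intro powr_less_mono2) auto
    then show ?thesis using that by (simp add: Young_Phi_high)
  qed
  assume "s < t"
  then consider "t \<le> ?E" | "?E \<le> s" | "s < ?E" "?E < t" by linarith
  then show ?thesis
  proof cases
    case 3
    then show ?thesis using low[of s ?E] high[of ?E t] by simp
  qed (use low high \<open>s < t\<close> in auto)
qed

lemma Young_Phi_mono: "s \<le> t \<Longrightarrow> Young_Phi m s \<le> Young_Phi m t"
  using Young_Phi_strict_mono[of s t] by (cases "s = t") auto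

lemma Young_Phi_0: "Young_Phi m 0 = 0"
  by (simp add: Young_Phi_low)

lemma Young_Phi_nonneg: "0 \<le> t \<Longrightarrow> 0 \<le> Young_Phi m t"
  using Young_Phi_mono[of 0 t] by (simp add: Young_Phi_0)

lemma Young_Phi_surj:
  assumes "0 \<le> y" shows "\<exists>s\<ge>0. Young_Phi m s = y"
proof (cases "y \<le> exp (3 powr m)")
  case True
  let ?s = "y * exp (2 powr m) / exp (3 powr m)"
  have "?s \<le> exp (2 powr m)" using True by (simp add: field_simps)
  then have "Young_Phi m ?s = y" by (simp add: Young_Phi_low)
  then show ?thesis using assms by (intro exI[of _ ?s]) simp
next
  case False
  then have y1: "exp (3 powr m) < y" by simp
  then have "0 < y" by (rule order.strict_trans[OF exp_gt_zero])
  note y = y1 this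
  have "ln (exp (3 powr m)) < ln y" using y by (subst ln_less_cancel_iff) auto
  then have l: "3 powr m < ln y" by simp
  define a where "a = ln y powr (1 / m)"
  have "(3 powr m) powr (1 / m) < a" unfolding a_def using l m by (intro powr_less_mono2) auto
  then have a: "3 < a" using m by (simp add: powr_powr)
  let ?s = "exp ((a - 1) powr m)"
  have "2 powr m \<le> (a - 1) powr m" using a m by (intro powr_mono2) auto
  then have "Young_Phi m ?s = exp ((((a - 1) powr m) powr (1 / m) + 1) powr m)" by (simp add: Young_Phi_high)
  also have "((a - 1) powr m) powr (1 / m) = a - 1" using a m by (simp add: powr_powr)
  also have "(a - 1 + 1) powr m = ln y"
  proof -
    have "0 < ln y" using l powr_gt_zero[of 3 m] by linarith
    then show ?thesis unfolding a_def using m by (simp add: powr_powr)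
  qed
  also have "exp (ln y) = y" using y by simp
  finally show ?thesis by (intro exI[of _ ?s]) simp
qed

text \<open>Strict monotonicity and surjectivity onto the nonnegative reals give
  \<open>the_inv_into\<close> its intended value; monotonicity then removes the inverse.\<close>

lemma Young_Phi_the_inv_le:
  assumes "0 \<le> y" "the_inv_into {0..} (Young_Phi m) y \<le> t"
  shows "y \<le> Young_Phi m t"
proof -
  obtain s where s: "0 \<le> s" "Young_Phi m s = y" using Young_Phi_surj[OF assms(1)] by blast
  have "inj_on (Young_Phi m) {0..}"
    using Young_Phi_strict_mono by (intro linorder_inj_onI) (auto, metis less_irrefl)
  then have "the_inv_into {0..} (Young_Phi m) y = s" using the_inv_into_f_f[of "Young_Phi m" "{0..}" s] s by auto
  then show ?thesis using assms(2) s(2) Young_Phi_mono[of s t] by simp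
qed

text \<open>With l = ln w and a = l^(1/m), the exponent of \<open>Young_Phi m w\<close> is (a+1)^m,
  which is at least a^m + 2 a^(m-1) because (a+1)^2 is at least a^2 + 2a. Here a^m = l, and a^(m-1)
  = l^(1-1/m) is at least the square root of l, since m > 2 makes the exponent exceed 1/2.\<close>

lemma Young_Phi_superlinear:
  assumes w: "exp (2 powr m) \<le> w" shows "w * exp (2 * sqrt (ln w)) \<le> Young_Phi m w"
proof -
  define l where "l = ln w"
  have w0: "0 < w" using w exp_gt_zero order.strict_trans2 by blast
  have l2: "2 powr m \<le> l" using w w0 by (simp add: l_def ln_ge_iff)
  have "2 powr 2 \<le> 2 powr m" using m by (intro powr_mono) auto
  then have l: "1 \<le> l" using l2 by simp
  define a where "a = l powr (1 / m)"
  have a1: "1 \<le> a" unfolding a_def using l m by (intro ge_one_powr_ge_zero) auto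
  have am: "a powr m = l" unfolding a_def using l m by (simp add: powr_powr)
  have am1: "sqrt l \<le> a powr (m - 1)"
  proof -
    have "a powr (m - 1) = l powr ((m - 1) / m)" unfolding a_def using l by (simp add: powr_powr)
    moreover have "l powr (1/2) \<le> l powr ((m - 1) / m)" using l m by (intro powr_mono) (auto simp: field_simps)
    ultimately show ?thesis using l by (simp add: powr_half_sqrt)
  qed
  have "l + 2 * sqrt l \<le> a powr m + 2 * a powr (m - 1)" using am am1 by simp
  also have "\<dots> = (a powr 2 + 2 * a powr 1) * a powr (m - 2)"
    by (simp only: distrib_right mult.assoc powr_add[symmetric]) simp
  also have "\<dots> \<le> (a + 1) powr 2 * (a + 1) powr (m - 2)"
  proof (rule mult_mono)
    show "a powr 2 + 2 * a powr 1 \<le> (a + 1) powr 2" using a1 by (simp add: powr_numeral power2_eq_square algebra_simps)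
    show "a powr (m - 2) \<le> (a + 1) powr (m - 2)" using a1 m by (intro powr_mono2) auto
  qed auto
  also have "\<dots> = (a + 1) powr m" by (simp add: powr_add[symmetric])
  finally have "exp (l + 2 * sqrt l) \<le> Young_Phi m w"
    using w by (simp add: Young_Phi_high a_def l_def)
  then show ?thesis using w0 by (simp add: exp_add l_def)
qed

lemma Young_Phi_ge: "0 \<le> t \<Longrightarrow> t \<le> Young_Phi m t"
proof (cases "t \<le> exp (2 powr m)")
  case True
  assume "0 \<le> t"
  have "2 powr m \<le> 3 powr m" using m by (intro powr_mono2) auto
  then have "1 \<le> exp (3 powr m - 2 powr m)" by simp
  then have "1 * t \<le> exp (3 powr m) / exp (2 powr m) * t" using \<open>0 \<le> t\<close> by (intro mult_right_mono) (auto simp: exp_diff)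
  then show ?thesis using True by (simp add: Young_Phi_low)
next
  case False
  assume t: "0 \<le> t"
  have "0 < 2 powr m" by simp
  then have "1 < t" using False by (smt (verit) exp_gt_one)
  then have "t * 1 \<le> t * exp (2 * sqrt (ln t))" using t by (intro mult_left_mono) auto
  then show ?thesis using Young_Phi_superlinear[of t] False by simp
qed

lemma Young_Phi_1: "Young_Phi m 1 = exp (3 powr m) / exp (2 powr m)"
proof -
  have "1 \<le> exp (2 powr m)" by simp
  then show ?thesis by (simp add: Young_Phi_low)
qed

text \<open>Replaces a Hoelder inequality for Orlicz norms: values up to \<open>T\<close> are paid
  for by the measure of the set, larger ones by the superlinear growth of the Young
  function.\<close>

lemma Young_Phi_split:
  assumes T: "exp (2 powr m) \<le> T" and w: "0 \<le> w"
  shows "w \<le> T + Young_Phi m w * exp (- 2 * sqrt (ln T))"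
proof (cases "w \<le> T")
  case True
  have "0 \<le> Young_Phi m w * exp (- 2 * sqrt (ln T))" using Young_Phi_nonneg[OF w] by simp
  then show ?thesis using True by simp
next
  case False
  have T0: "0 < T" using T exp_gt_zero order.strict_trans2 by blast
  have "w * exp (2 * sqrt (ln T)) \<le> w * exp (2 * sqrt (ln w))" using False T0 w by (intro mult_left_mono) auto
  also have "\<dots> \<le> Young_Phi m w" using False T by (intro Young_Phi_superlinear) simp
  finally have "w * exp (2 * sqrt (ln T)) * exp (- 2 * sqrt (ln T)) \<le> Young_Phi m w * exp (- 2 * sqrt (ln T))"
    by (intro mult_right_mono) auto
  moreover have "w * exp (2 * sqrt (ln T)) * exp (- 2 * sqrt (ln T)) = w" by (simp add: mult.assoc exp_minus_inverse)
  ultimately have "w \<le> Young_Phi m w * exp (- 2 * sqrt (ln T))" by (simp only:)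
  then show ?thesis using T0 by linarith
qed

end

section \<open>From the Young function inequality to linear estimates\<close>

lemma integral_uniform_measure_lebesgue:
  fixes f :: "'a::euclidean_space \<Rightarrow> real"
  assumes B: "B \<in> sets lebesgue" "emeasure lebesgue B < \<infinity>" "0 < measure lebesgue B" and f: "f \<in> borel_measurable lebesgue"
  shows "(LINT y|uniform_measure lebesgue B. f y) = (LINT y|lebesgue. indicator B y * f y) / measure lebesgue B"
proof -
  have "uniform_measure lebesgue B = density lebesgue (\<lambda>y. ennreal (indicator B y / measure lebesgue B))"
    unfolding uniform_measure_def
  proof (intro density_cong)
    have "emeasure lebesgue B = ennreal (measure lebesgue B)" using B by (intro emeasure_eq_ennreal_measure) auto
    then show "AE y in lebesgue. indicator B y / emeasure lebesgue B = ennreal (indicator B y / measure lebesgue B)"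
      using B(3) by (intro AE_I2) (auto simp: indicator_def divide_ennreal[symmetric])
  qed (use B in measurable)
  then have "(LINT y|uniform_measure lebesgue B. f y) = (LINT y|lebesgue. (indicator B y / measure lebesgue B) *\<^sub>R f y)"
    using B f by (simp add: integral_density)
  also have "\<dots> = (LINT y|lebesgue. (indicator B y * f y) / measure lebesgue B)"
    by (intro Bochner_Integration.integral_cong refl) simp
  finally show ?thesis by simp
qed

text \<open>The hypothesis is not homogeneous in \<open>w\<close>, so it is used for functions
  normalised by their gradient, and the resulting estimates, which are homogeneous of degree one,
  are scaled back. The first conclusion is a Poincare inequality; the second is the gain on sets of
  small relative measure.\<close>

lemma Orlicz_Sobolev_consequences:
  fixes A :: "real^'n \<Rightarrow> real^'n^'n" and \<Omega> :: "(real^'n) set" and d :: "real^'n \<Rightarrow> real^'n \<Rightarrow> real"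
    and x :: "real^'n" and r :: real
  defines "B \<equiv> Metric_space.mball \<Omega> d x r"
  assumes OS: "Orlicz_Sobolev \<Omega> d (Young_Phi m) A \<phi> x r" and m: "2 < m"
    and \<Omega>: "open \<Omega>" and lip: "L-lipschitz_on \<Omega> (\<lambda>y. mat_sqrt (A y))" and bd: "bounded ((\<lambda>y. mat_sqrt (A y)) ` \<Omega>)"
    and B: "open B" "B \<noteq> {}" "bounded B" "B \<subseteq> \<Omega>" and r: "0 < r"
  obtains C where "0 < C" 
    "\<And>w. w \<in> Lip_c B \<Longrightarrow> (LINT y|lebesgue. \<bar>w y\<bar>) \<le> C * (LINT y|lebesgue. norm (grad_A A w y))"
    "\<And>w E \<eta>. w \<in> Lip_c B \<Longrightarrow> E \<in> sets lebesgue \<Longrightarrow> E \<subseteq> B \<Longrightarrow> 0 < \<eta> \<Longrightarrow> \<eta> \<le> exp (- 2 * 2 powr m) \<Longrightarrow>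
       measure lebesgue E \<le> \<eta> * measure lebesgue B \<Longrightarrow>
       (LINT y|lebesgue. indicator E y * \<bar>w y\<bar>) \<le> C * exp (- sqrt (ln (1 / \<eta>))) * (LINT y|lebesgue. norm (grad_A A w y))"
proof -
  let ?b = "measure lebesgue B" and ?F = "Young_Phi m 1"
  let ?I = "\<lambda>w. LINT y|lebesgue. norm (grad_A A w y)"
  have Bl: "B \<in> lmeasurable" using B by (simp add: lmeasurable_open)
  then have Bs: "B \<in> sets lebesgue" "emeasure lebesgue B < \<infinity>" by (auto simp: fmeasurable_def)
  have b: "0 < ?b" by (rule measure_pos_of_open[OF B(1-3)])
  have c: "0 < \<phi> r"
    using OS r unfolding Orlicz_Sobolev_def superradius_def by (smt (verit) atLeastAtMost_iff)
  have ginit: "integrable lebesgue (\<lambda>y. norm (grad_A A w y))" if "w \<in> Lip_c B" for w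
    using integrable_norm_grad_A[OF \<Omega> lip bd Lip_c_mono[OF B(4) that]] by (rule integrable_norm)
  have wint: "integrable lebesgue (\<lambda>y. \<bar>w y\<bar>)" if "w \<in> Lip_c B" for w :: "real^'n \<Rightarrow> real"
    by (rule integrable_abs[OF Lip_c_integrable[OF that]])
  have \<Phi>m: "(\<lambda>y. Young_Phi m \<bar>w y\<bar>) \<in> borel_measurable lebesgue" if "w \<in> Lip_c B" for w :: "real^'n \<Rightarrow> real"
  proof -
    have "Young_Phi m \<in> borel_measurable borel" using Young_Phi_mono[OF m] by (intro borel_measurable_mono) (auto simp: mono_def)
    moreover have "(\<lambda>y. \<bar>w y\<bar>) \<in> borel_measurable lebesgue" using Lip_c_measurable[OF that] by measurable
    ultimately show ?thesis by (rule measurable_compose_rev)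
  qed
  have \<Phi>i: "integrable lebesgue (\<lambda>y. indicator B y * Young_Phi m \<bar>w y\<bar>)" if w: "w \<in> Lip_c B" for w :: "real^'n \<Rightarrow> real"
  proof -
    obtain K where K: "\<And>y. \<bar>w y\<bar> \<le> K" using Lip_c_bounded[OF w] by blast
    have "integrable lebesgue (\<lambda>y. Young_Phi m K * indicator B y)" using Bs by (intro integrable_mult_right integrable_real_indicator)
    then show ?thesis
    proof (rule Bochner_Integration.integrable_bound)
      show "AE y in lebesgue. norm (indicator B y * Young_Phi m \<bar>w y\<bar>) \<le> norm (Young_Phi m K * indicat_real B y)"
      proof (rule AE_I2)
        fix y
        have "0 \<le> Young_Phi m \<bar>w y\<bar>" "Young_Phi m \<bar>w y\<bar> \<le> Young_Phi m K"
          using Young_Phi_nonneg[OF m] Young_Phi_mono[OF m K] by auto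
        then show "norm (indicator B y * Young_Phi m \<bar>w y\<bar>) \<le> norm (Young_Phi m K * indicat_real B y)" by (simp add: indicator_def)
      qed
    qed (use \<Phi>m[OF w] Bs in measurable)
  qed
  have base: "(LINT y|lebesgue. indicator B y * Young_Phi m \<bar>w y\<bar>) \<le> ?b * ?F"
    \<comment> \<open>The normalisation makes the right-hand side of the hypothesis at most 1, so
      the mean of the Young function of \<open>w\<close> is at most its value at 1.\<close>
    if w: "w \<in> Lip_c B" and small: "\<phi> r * ?I w \<le> ?b" for w
  proof -
    have "the_inv_into {0..} (Young_Phi m) (LINT y|uniform_measure lebesgue B. Young_Phi m \<bar>w y\<bar>) \<le> \<phi> r * (LINT y|uniform_measure lebesgue B. norm (grad_A A w y))"
      using OS w unfolding Orlicz_Sobolev_def B_def Let_def by blast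
    also have "(LINT y|uniform_measure lebesgue B. norm (grad_A A w y)) = (LINT y|lebesgue. indicator B y * norm (grad_A A w y)) / ?b"
      by (rule integral_uniform_measure_lebesgue[OF Bs b]) (rule borel_measurable_integrable[OF ginit[OF w]])
    also have "(LINT y|lebesgue. indicator B y * norm (grad_A A w y)) = ?I w"
    proof (intro Bochner_Integration.integral_cong refl)
      fix y show "indicator B y * norm (grad_A A w y) = norm (grad_A A w y)"
        using grad_A_eq_0_outside_supp[of y w A] Lip_c_supp[OF w] by (cases "y \<in> B") auto
    qed
    also have "\<phi> r * (?I w / ?b) \<le> 1" using small b by (simp add: field_simps)
    finally have inv: "the_inv_into {0..} (Young_Phi m) (LINT y|uniform_measure lebesgue B. Young_Phi m \<bar>w y\<bar>) \<le> 1" .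
    have U: "(LINT y|uniform_measure lebesgue B. Young_Phi m \<bar>w y\<bar>) = (LINT y|lebesgue. indicator B y * Young_Phi m \<bar>w y\<bar>) / ?b"
      by (rule integral_uniform_measure_lebesgue[OF Bs b \<Phi>m[OF w]])
    have "0 \<le> (LINT y|lebesgue. indicator B y * Young_Phi m \<bar>w y\<bar>)"
      by (intro integral_nonneg_AE AE_I2 mult_nonneg_nonneg Young_Phi_nonneg[OF m]) auto
    then have "0 \<le> (LINT y|uniform_measure lebesgue B. Young_Phi m \<bar>w y\<bar>)" unfolding U using b by simp
    from Young_Phi_the_inv_le[OF m this inv] show ?thesis unfolding U using b by (simp add: field_simps)
  qed
  have scale: "J w \<le> \<phi> r * R / ?b * ?I w"
    if J: "\<And>w. w \<in> Lip_c B \<Longrightarrow> \<phi> r * ?I w \<le> ?b \<Longrightarrow> J w \<le> R" and hom: "\<And>s w. 0 < s \<Longrightarrow> J (\<lambda>y. s * w y) = s * J w"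
      and w: "w \<in> Lip_c B" for J :: "(real^'n \<Rightarrow> real) \<Rightarrow> real" and R w
  proof -
    have Is: "?I (\<lambda>y. s * w y) = s * ?I w" if "0 < s" for s
    proof -
      have "?I (\<lambda>y. s * w y) = (LINT y|lebesgue. s * norm (grad_A A w y))"
        using that grad_A_scale(2)[OF that w, of A] ginit[OF w] ginit[OF grad_A_scale(1)[OF that w]]
        by (intro integral_cong_AE) (auto elim!: AE_mp)
      then show ?thesis by simp
    qed
    have I0: "0 \<le> ?I w" by (intro integral_nonneg_AE) auto
    have key: "s * J w \<le> R" if "0 < s" "\<phi> r * (s * ?I w) \<le> ?b" for s
      using J[OF grad_A_scale(1)[OF that(1) w]] that Is hom by simp
    show ?thesis
    proof (cases "?I w = 0")
      \<comment> \<open>With vanishing gradient norm every positive multiple of \<open>w\<close> is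
        normalised, so a positive \<open>J w\<close> would exceed \<open>R\<close> after
        scaling.\<close>
      case True
      have "J w \<le> 0"
      proof (rule ccontr)
        assume n: "\<not> J w \<le> 0"
        have R: "J w \<le> R" using key[of 1] True b by simp
        let ?s = "(R + 1) / J w"
        have "?s * J w \<le> R" using n R True b by (intro key) auto
        then show False using n by simp
      qed
      then show ?thesis using True by simp
    next
      case False
      then have I: "0 < ?I w" using I0 by linarith
      have "?b / (\<phi> r * ?I w) * J w \<le> R" using I b c by (intro key) auto
      then show ?thesis using I b c by (simp add: field_simps)
    qed
  qed
  let ?C = "\<phi> r * (1 + ?F)"
  have F: "0 < ?F" by (simp add: Young_Phi_1[OF m])
  show ?thesis
  proof (rule that[of ?C])
    show "0 < ?C" using c F by simp
    fix w :: "real^'n \<Rightarrow> real" assume w: "w \<in> Lip_c B"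
    have I0: "0 \<le> ?I w" by (intro integral_nonneg_AE) auto
    have "(LINT y|lebesgue. \<bar>w y\<bar>) \<le> \<phi> r * (?b * ?F) / ?b * ?I w"
    proof (rule scale[OF _ _ w])
      fix w :: "real^'n \<Rightarrow> real" assume w: "w \<in> Lip_c B" and s: "\<phi> r * ?I w \<le> ?b"
      have "(LINT y|lebesgue. \<bar>w y\<bar>) \<le> (LINT y|lebesgue. indicator B y * Young_Phi m \<bar>w y\<bar>)"
      proof (rule integral_mono[OF wint[OF w] \<Phi>i[OF w]])
        fix y show "\<bar>w y\<bar> \<le> indicator B y * Young_Phi m \<bar>w y\<bar>"
          using Young_Phi_ge[OF m, of "\<bar>w y\<bar>"] eq_0_outside_supp[of y w] Lip_c_supp[OF w] by (cases "y \<in> B") auto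
      qed
      then show "(LINT y|lebesgue. \<bar>w y\<bar>) \<le> ?b * ?F" using base[OF w s] by linarith
    qed (auto simp: abs_mult)
    also have "\<dots> = \<phi> r * ?F * ?I w" using b by simp
    also have "\<dots> \<le> ?C * ?I w" using c I0 by (intro mult_right_mono mult_left_mono) auto
    finally show "(LINT y|lebesgue. \<bar>w y\<bar>) \<le> ?C * ?I w" .
  next
    fix w :: "real^'n \<Rightarrow> real" and E :: "(real^'n) set" and \<eta> :: real
    assume w: "w \<in> Lip_c B" and E: "E \<in> sets lebesgue" "E \<subseteq> B" and \<eta>: "0 < \<eta>" "\<eta> \<le> exp (- 2 * 2 powr m)"
      and mE: "measure lebesgue E \<le> \<eta> * ?b"
    define l where "l = ln (1 / \<eta>)"
    have "ln \<eta> \<le> - 2 * 2 powr m" using \<eta> by (metis ln_exp ln_le_cancel_iff exp_gt_zero)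
    then have l: "2 * 2 powr m \<le> l" using \<eta> by (simp add: l_def ln_div)
    have "2 powr 2 \<le> 2 powr m" using m by (intro powr_mono) auto
    then have l8: "8 \<le> l" using l by simp
    have e\<eta>: "exp (- l) = \<eta>" using \<eta> by (simp add: l_def ln_div)
    \<comment> \<open>\<open>T\<close> is \<eta> to the power -1/2. Then \<open>T * \<eta>\<close>
      is exp(-l/2), while the tail factor is exp(-2 sqrt(l/2)); for l at least 8 both are below
      exp(-sqrt l). The assumed bound on \<eta> puts \<open>T\<close> in the range where
      superlinearity holds.\<close>
    define T where "T = exp (l / 2)"
    have T: "exp (2 powr m) \<le> T" using l by (simp add: T_def)
    have lnT: "ln T = l / 2" by (simp add: T_def)
    have sl: "sqrt l \<le> l / 2"
    proof -
      have "4 * l \<le> l * l" using l8 by (intro mult_right_mono) auto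
      then have "l \<le> (l / 2)\<^sup>2" by (simp add: power2_eq_square)
      then show ?thesis using l8 by (intro real_le_lsqrt) auto
    qed
    have sl2: "sqrt l \<le> 2 * sqrt (l / 2)"
    proof -
      have "2 * sqrt (l / 2) = sqrt (4 * (l / 2))" unfolding real_sqrt_mult by simp
      also have "\<dots> = sqrt (2 * l)" by simp
      finally show ?thesis using l8 by simp
    qed
    let ?e = "exp (- sqrt l)"
    have Em: "E \<in> lmeasurable" using fmeasurableI2[OF Bl E(2)] E(1) by simp
    have "(LINT y|lebesgue. indicator E y * \<bar>w y\<bar>) \<le> \<phi> r * (?b * (1 + ?F) * ?e) / ?b * ?I w"
    proof (rule scale[OF _ _ w])
      fix w :: "real^'n \<Rightarrow> real" assume w: "w \<in> Lip_c B" and s: "\<phi> r * ?I w \<le> ?b"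
      have "(LINT y|lebesgue. indicator E y * \<bar>w y\<bar>) \<le> (LINT y|lebesgue. T * indicator E y + exp (- 2 * sqrt (ln T)) * (indicator B y * Young_Phi m \<bar>w y\<bar>))"
      proof (rule integral_mono)
        show "integrable lebesgue (\<lambda>y. indicator E y * \<bar>w y\<bar>)"
          using integrable_mult_indicator[OF E(1) wint[OF w]] by simp
        show "integrable lebesgue (\<lambda>y. T * indicator E y + exp (- 2 * sqrt (ln T)) * (indicator B y * Young_Phi m \<bar>w y\<bar>))"
          using Em by (intro Bochner_Integration.integrable_add integrable_mult_right \<Phi>i w integrable_real_indicator) (auto simp: fmeasurable_def)
        fix y
        show "indicator E y * \<bar>w y\<bar> \<le> T * indicator E y + exp (- 2 * sqrt (ln T)) * (indicator B y * Young_Phi m \<bar>w y\<bar>)"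
          using Young_Phi_split[OF m T, of "\<bar>w y\<bar>"] E(2) Young_Phi_nonneg[OF m, of "\<bar>w y\<bar>"]
          by (cases "y \<in> E") (auto simp: mult.commute indicator_def)
      qed
      also have "\<dots> = T * measure lebesgue E + exp (- 2 * sqrt (ln T)) * (LINT y|lebesgue. indicator B y * Young_Phi m \<bar>w y\<bar>)"
        using Em \<Phi>i[OF w] by (subst Bochner_Integration.integral_add) (auto simp: fmeasurable_def intro!: integrable_mult_right integrable_real_indicator)
      also have "\<dots> \<le> T * (\<eta> * ?b) + exp (- 2 * sqrt (ln T)) * (?b * ?F)"
        using mE base[OF w s] by (intro add_mono mult_left_mono) (auto simp: T_def)
      also have "\<dots> \<le> ?e * ?b + ?e * (?b * ?F)"
      proof (intro add_mono mult_right_mono)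
        have "T * \<eta> = exp (- (l / 2))" unfolding e\<eta>[symmetric] T_def by (simp add: exp_add[symmetric])
        also have "\<dots> \<le> ?e" using sl by simp
        finally have "T * \<eta> * ?b \<le> ?e * ?b" using b by (intro mult_right_mono) auto
        then show "T * (\<eta> * ?b) \<le> ?e * ?b" by (simp add: mult.assoc)
        show "exp (- 2 * sqrt (ln T)) \<le> ?e" using sl2 by (simp add: lnT)
      qed (use b F in auto)
      also have "\<dots> = ?b * (1 + ?F) * ?e" by (simp add: algebra_simps)
      finally show "(LINT y|lebesgue. indicator E y * \<bar>w y\<bar>) \<le> ?b * (1 + ?F) * ?e" .
    next
      fix s :: real and w :: "real^'n \<Rightarrow> real" assume "0 < s"
      then have "(LINT y|lebesgue. indicator E y * \<bar>s * w y\<bar>) = (LINT y|lebesgue. s * (indicator E y * \<bar>w y\<bar>))"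
        by (intro Bochner_Integration.integral_cong refl) (simp add: abs_mult)
      then show "(LINT y|lebesgue. indicator E y * \<bar>s * w y\<bar>) = s * (LINT y|lebesgue. indicator E y * \<bar>w y\<bar>)" by simp
    qed
    also have "\<dots> = ?C * ?e * ?I w" using b by simp
    finally show "(LINT y|lebesgue. indicator E y * \<bar>w y\<bar>) \<le> ?C * exp (- sqrt (ln (1 / \<eta>))) * ?I w" by (simp add: l_def)
  qed
qed

section \<open>The recursion\<close>

text \<open>The bound \<open>U j \<le> exp (- (j + J)\<^sup>2 / 64)\<close> propagates: the gain is then at least \<open>exp (- (j + J) / 16)\<close>,
  twice the decrement needed, and absorbs the polynomial factor for large \<open>J\<close>.\<close>

lemma de_giorgi_sequence:
  fixes C b \<eta>0 :: real
  assumes C: "0 < C" and b: "0 < b" and \<eta>0: "0 < \<eta>0"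
  shows "\<exists>\<epsilon>0>0. \<forall>U :: nat \<Rightarrow> real. (\<forall>j\<ge>1. 0 \<le> U j) \<and> (\<forall>j\<ge>1. U (Suc j) \<le> U j) \<and>
     (\<forall>j\<ge>1. 0 < U j \<and> 4 * real j ^ 4 * U j / b \<le> \<eta>0 \<longrightarrow>
        U (Suc j) \<le> C * real j ^ 8 * exp (- sqrt (ln (b / (4 * real j ^ 4 * U j)))) * U j) \<and>
     U 1 \<le> \<epsilon>0 \<longrightarrow> U \<longlonglongrightarrow> 0"
proof -
  \<comment> \<open>For t = j + J: the second condition lets a quarter of the exponent t^2/64
    survive the factors j^4 and b, so the gain is at most exp(-t/16); the third makes the relative
    measure admissible; the fourth lets t/16 pay for C, for j^8 and for the decrement (2t+1)/64 of
    the exponent.\<close>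
  have "eventually (\<lambda>t. 1 \<le> t \<and> t\<^sup>2 / 256 \<le> t\<^sup>2 / 64 + ln (b / 4) - 4 * ln t \<and> ln (1 / \<eta>0) \<le> t\<^sup>2 / 256 \<and>
      ln C + 8 * ln t - t / 16 \<le> - (2 * t + 1) / 64) at_top"
    by (intro eventually_conj; real_asymp)
  then obtain T where T: "\<And>t. t \<ge> T \<Longrightarrow> 1 \<le> t \<and> t\<^sup>2 / 256 \<le> t\<^sup>2 / 64 + ln (b / 4) - 4 * ln t \<and> ln (1 / \<eta>0) \<le> t\<^sup>2 / 256 \<and>
      ln C + 8 * ln t - t / 16 \<le> - (2 * t + 1) / 64"
    unfolding eventually_at_top_linorder by blast
  obtain J :: nat where J: "T \<le> real J" using real_arch_simple by blast
  define e where "e j = exp (- ((real j + real J)\<^sup>2 / 64))" for j :: nat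
  have "U \<longlonglongrightarrow> 0" if nn: "\<And>j. j \<ge> 1 \<Longrightarrow> 0 \<le> U j" and mono: "\<And>j. j \<ge> 1 \<Longrightarrow> U (Suc j) \<le> U j"
    and step: "\<And>j. j \<ge> 1 \<Longrightarrow> 0 < U j \<Longrightarrow> 4 * real j ^ 4 * U j / b \<le> \<eta>0 \<Longrightarrow>
        U (Suc j) \<le> C * real j ^ 8 * exp (- sqrt (ln (b / (4 * real j ^ 4 * U j)))) * U j"
    and init: "U 1 \<le> e 1" for U :: "nat \<Rightarrow> real"
  proof -
    have ind: "U j \<le> e j" if "j \<ge> 1" for j
      using that
    proof (induction j rule: nat_induct_at_least)
      case base then show ?case by (rule init)
    next
      case (Suc j)
      define t where "t = real j + real J"
      have "T \<le> t" using J by (simp add: t_def)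
      note t = T[OF this]
      have t0: "t > 0" using t by linarith
      have jt: "real j \<le> t" "1 \<le> real j" using Suc.hyps by (auto simp: t_def)
      show ?case
      proof (cases "U j = 0")
        case True
        then have "U (Suc j) \<le> 0" using mono[OF Suc.hyps] by simp
        then show ?thesis by (simp add: e_def order.trans[OF _ exp_ge_zero])
      next
        case False
        then have pos: "0 < U j" using nn[OF Suc.hyps] by simp
        have lnU: "ln (U j) \<le> - (t\<^sup>2 / 64)"
          using Suc.IH pos unfolding e_def t_def[symmetric] by (metis ln_exp ln_le_cancel_iff exp_gt_zero)
        define q where "q = b / (4 * real j ^ 4 * U j)"
        have qpos: "0 < q" using b pos jt by (simp add: q_def)
        have "ln q = ln (b / 4) - (4 * ln (real j) + ln (U j))"
        proof -
          have "q = (b / 4) / (real j ^ 4 * U j)" by (simp add: q_def)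
          then show ?thesis using b pos jt by (simp add: ln_div ln_mult ln_realpow)
        qed
        moreover have "ln (real j) \<le> ln t" using jt by simp
        ultimately have lnq: "t\<^sup>2 / 256 \<le> ln q" using t lnU by linarith
        have "1 / \<eta>0 \<le> q"
        proof -
          have "ln (1 / \<eta>0) \<le> ln q" using t lnq by linarith
          then show ?thesis using \<eta>0 qpos by (subst (asm) ln_le_cancel_iff) auto
        qed
        then have "1 / q \<le> \<eta>0" using \<eta>0 qpos by (simp add: field_simps)
        then have "4 * real j ^ 4 * U j / b \<le> \<eta>0" by (simp add: q_def)
        from step[OF Suc.hyps pos this]
        have U1: "U (Suc j) \<le> C * real j ^ 8 * exp (- sqrt (ln q)) * U j" by (simp add: q_def)
        have "t / 16 \<le> sqrt (ln q)"
          using lnq t0 by (intro real_le_rsqrt) (simp add: power_divide)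
        then have "exp (- sqrt (ln q)) \<le> exp (- (t / 16))" by simp
        moreover have "real j ^ 8 \<le> exp (8 * ln t)"
        proof -
          have "real j ^ 8 \<le> t ^ 8" using jt by (intro power_mono) auto
          also have "t ^ 8 = exp (8 * ln t)" using t0 by (metis exp_ln exp_of_nat_mult of_nat_numeral)
          finally show ?thesis .
        qed
        moreover have "U j \<le> exp (- (t\<^sup>2 / 64))" using Suc.IH by (simp add: e_def t_def)
        ultimately have "C * real j ^ 8 * exp (- sqrt (ln q)) * U j \<le> exp (ln C) * exp (8 * ln t) * exp (- (t / 16)) * exp (- (t\<^sup>2 / 64))"
          using C pos by (intro mult_mono) auto
        also have "\<dots> = exp (ln C + 8 * ln t + - (t / 16) + - (t\<^sup>2 / 64))" by (simp only: exp_add)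
        also have "\<dots> \<le> exp (- ((t + 1)\<^sup>2 / 64))"
        proof -
          have "(t + 1)\<^sup>2 / 64 = t\<^sup>2 / 64 - (- (2 * t + 1) / 64)" by (simp add: power2_eq_square field_simps)
          moreover have "ln C + 8 * ln t - t / 16 \<le> - (2 * t + 1) / 64" using t by blast
          ultimately have "ln C + 8 * ln t + - (t / 16) + - (t\<^sup>2 / 64) \<le> - ((t + 1)\<^sup>2 / 64)" by linarith
          then show ?thesis by (simp only: exp_le_cancel_iff)
        qed
        also have "\<dots> = e (Suc j)" by (simp add: e_def t_def algebra_simps)
        finally show ?thesis using U1 by linarith
      qed
    qed
    have "e \<longlonglongrightarrow> 0" unfolding e_def by real_asymp
    then show ?thesis
      by (rule tendsto_sandwich[rotated 2, OF tendsto_const]) (use ind nn in \<open>auto simp: eventually_sequentially intro!: exI[of _ 1]\<close>)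
  qed
  then show ?thesis by (intro exI[of _ "e 1"]) (auto simp: e_def)
qed

section \<open>Energy estimates\<close>

lemma positive_part_square_derivative:
  "((\<lambda>t::real. (max 0 (t - a))\<^sup>2) has_real_derivative 2 * max 0 (t - a)) (at t)"
proof -
  have "((\<lambda>t::real. (max 0 (t - a))\<^sup>2) has_derivative (\<lambda>h. (2 * max 0 (t - a)) \<bullet> h)) (at t)"
  proof (rule has_derivative_quadratic_remainder[where d=1 and C=1])
    fix h :: real
    show "\<bar>(max 0 (t + h - a))\<^sup>2 - (max 0 (t - a))\<^sup>2 - ((2 * max 0 (t - a)) \<bullet> h)\<bar> \<le> 1 * (norm h)\<^sup>2"
      using square_max_remainder[of "t + h - a" "t - a"] by simp
  qed simp
  then show ?thesis by (simp add: has_field_derivative_def)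
qed

text \<open>A \<open>C\<^sup>1\<close> substitute for the truncation \<open>max 0 (t - a)\<close>, affine beyond \<open>a + s\<close>; its derivative is \<open>ramp'\<close>.\<close>

definition ramp :: "real \<Rightarrow> real \<Rightarrow> real \<Rightarrow> real" where
  "ramp a s t = ((max 0 (t - a))\<^sup>2 - (max 0 (t - (a + s)))\<^sup>2) / (2 * s)"

definition ramp' :: "real \<Rightarrow> real \<Rightarrow> real \<Rightarrow> real" where
  "ramp' a s t = (max 0 (t - a) - max 0 (t - (a + s))) / s"

lemma ramp_derivative: "s \<noteq> 0 \<Longrightarrow> (ramp a s has_real_derivative ramp' a s t) (at t)"
  unfolding ramp_def[abs_def] ramp'_def
  by (rule DERIV_cong[OF DERIV_cdivide[OF DERIV_diff[OF positive_part_square_derivative positive_part_square_derivative]]])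
     (simp add: field_simps)

lemma ramp'_continuous: "continuous_on S (ramp' a s)"
  unfolding ramp'_def[abs_def] divide_inverse by (intro continuous_intros)

text \<open>The last bound expresses convexity. It puts the factor \<open>ramp' a s t\<close>, which
  weights the energy, on the terms containing the gradient of the cutoff, so that these can be
  absorbed.\<close>

lemma ramp_bounds:
  assumes s: "0 < s"
  shows "0 \<le> ramp' a s t" "ramp' a s t \<le> 1" "a + s \<le> t \<Longrightarrow> ramp' a s t = 1" "t \<le> a \<Longrightarrow> ramp' a s t = 0"
    "0 \<le> ramp a s t" "ramp a s t \<le> ramp' a s t * max 0 (t - a)"
proof -
  consider "t \<le> a" | "a < t" "t < a + s" | "a + s \<le> t" by linarith
  then have "0 \<le> ramp' a s t \<and> ramp' a s t \<le> 1 \<and> 0 \<le> ramp a s t \<and> ramp a s t \<le> ramp' a s t * max 0 (t - a)"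
  proof cases
    case 1 then show ?thesis using s by (simp add: ramp'_def ramp_def)
  next
    case 2
    have "(t - a)\<^sup>2 / (2 * s) \<le> (t - a)\<^sup>2 / s" using s by (intro divide_left_mono) auto
    then show ?thesis using 2 s by (simp add: ramp'_def ramp_def power2_eq_square)
  next
    case 3
    have e: "(t - a)\<^sup>2 - (t - (a + s))\<^sup>2 = 2 * s * (t - a - s / 2)" by (simp add: power2_eq_square algebra_simps)
    then have "((t - a)\<^sup>2 - (t - (a + s))\<^sup>2) / (2 * s) = t - a - s / 2" using s by (simp only:) simp
    then show ?thesis using 3 s by (simp add: ramp'_def ramp_def)
  qed
  then show "0 \<le> ramp' a s t" "ramp' a s t \<le> 1" "0 \<le> ramp a s t" "ramp a s t \<le> ramp' a s t * max 0 (t - a)" by auto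
  show "a + s \<le> t \<Longrightarrow> ramp' a s t = 1" "t \<le> a \<Longrightarrow> ramp' a s t = 0" using s by (auto simp: ramp'_def)
qed

section \<open>Limit passage in the energy inequality and in the gain\<close>

locale cutoff =
  fixes A :: "real^'n \<Rightarrow> real^'n^'n" and B :: "(real^'n) set" and \<psi> :: "real^'n \<Rightarrow> real" and \<Lambda> :: real
  assumes cutoff_Lip_c: "\<psi> \<in> Lip_c B"
    and cutoff_range: "\<And>y. 0 \<le> \<psi> y \<and> \<psi> y \<le> 1"
    and cutoff_grad: "AE y in lebesgue. norm (grad_A A \<psi> y) \<le> \<Lambda>"
    and cutoff_Lambda: "1 \<le> \<Lambda>"

text \<open>The equation with its coefficient frozen into \<open>M\<close>: the dependence on the
  solution no longer appears. \<open>energy\<close> keeps only an inequality with the data already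
  bounded, \<open>gain\<close> records the Orlicz-Sobolev estimate, and \<open>M_low\<close> states
  ellipticity on the range of the square root of \<open>A\<close>, the only place where it is
  available.\<close>

locale energy_setting =
  fixes \<Omega> B :: "(real^'n) set" and A M :: "real^'n \<Rightarrow> real^'n^'n" and u :: "real^'n \<Rightarrow> real" and g :: "real^'n \<Rightarrow> real^'n"
    and L lam KM N :: real and R :: "real \<Rightarrow> real" and \<eta>max :: real
  assumes \<Omega>: "open \<Omega>" "bounded \<Omega>" and psd: "\<And>y. y \<in> \<Omega> \<Longrightarrow> psd_matrix (A y)"
    and lip: "L-lipschitz_on \<Omega> (\<lambda>y. mat_sqrt (A y))"
    and W: "W12 \<Omega> A u g"
    and Mm: "M \<in> borel_measurable (lebesgue_on \<Omega>)" and Mb: "\<And>y. y \<in> \<Omega> \<Longrightarrow> norm (M y) \<le> KM"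
    and M_low: "AE y in lebesgue_on \<Omega>. \<forall>\<xi>. lam * (norm (mat_sqrt (A y) *v \<xi>))\<^sup>2 \<le> (norm (M y *v (mat_sqrt (A y) *v \<xi>)))\<^sup>2"
    and lam: "0 < lam" and KM: "0 \<le> KM" and N: "0 \<le> N"
    and B: "open B" "B \<subseteq> \<Omega>"
    and energy: "\<And>w. w \<in> Lip_c B \<Longrightarrow> (\<And>y. 0 \<le> w y) \<Longrightarrow>
       energy_form \<Omega> M g (grad_A A w) \<le> N * (LINT y|lebesgue. norm (grad_A A w y))"
    and R0: "\<And>\<eta>. 0 \<le> R \<eta>"
    and gain: "\<And>w E \<eta>. w \<in> Lip_c B \<Longrightarrow> E \<in> sets lebesgue \<Longrightarrow> E \<subseteq> B \<Longrightarrow> 0 < \<eta> \<Longrightarrow> \<eta> \<le> \<eta>max \<Longrightarrow>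
       measure lebesgue E \<le> \<eta> * measure lebesgue B \<Longrightarrow>
       (LINT y|lebesgue. indicator E y * \<bar>w y\<bar>) \<le> R \<eta> * (LINT y|lebesgue. norm (grad_A A w y))"

locale cutoff_energy = cutoff A B \<psi> \<Lambda> + energy_setting \<Omega> B A M u g L lam KM N R \<eta>max
  for \<Omega> B :: "(real^'n) set" and A M u g L lam KM N R \<eta>max \<psi> \<Lambda>
begin

abbreviation "K \<equiv> supp \<psi>"
abbreviation "D \<equiv> grad_A A \<psi>"

lemma K: "compact K" "K \<subseteq> B" "K \<subseteq> \<Omega>" "K \<in> sets lebesgue" "K \<in> lmeasurable"
proof -
  show "compact K" "K \<subseteq> B" using cutoff_Lip_c by (auto simp: Lip_c_def)
  then show "K \<subseteq> \<Omega>" "K \<in> lmeasurable" using B by (auto intro: lmeasurable_compact)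
  then show "K \<in> sets lebesgue" by auto
qed

lemma \<Omega>_sets: "\<Omega> \<in> sets lebesgue" using \<Omega> by auto

lemma measurable_on_K: "f \<in> borel_measurable (lebesgue_on \<Omega>) \<Longrightarrow> f \<in> borel_measurable (lebesgue_on K)"
  for f :: "real^'n \<Rightarrow> 'c::topological_space"
  using measurable_restrict_mono[OF _ K(3)] by blast

lemma AE_on_K: "AE y in lebesgue_on \<Omega>. P y \<Longrightarrow> AE y in lebesgue_on K. P y"
  using K(3,4) \<Omega>_sets by (auto simp: AE_restrict_space_iff elim: AE_mp)

lemma u_measurable [measurable]: "u \<in> borel_measurable (lebesgue_on K)"
  and g_measurable [measurable]: "g \<in> borel_measurable (lebesgue_on K)"
  and M_measurable: "M \<in> borel_measurable (lebesgue_on K)"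
  using W Mm measurable_on_K by (auto simp: W12_def in_L2_def)

lemma cutoff_measurable [measurable]: "\<psi> \<in> borel_measurable (lebesgue_on K)"
  using Lip_c_lipschitz[OF cutoff_Lip_c] lipschitz_on_continuous_on
  by (intro measurable_restrict_space1 measurable_completion) (auto intro!: borel_measurable_continuous_onI)

lemma D_measurable [measurable]: "D \<in> borel_measurable (lebesgue_on K)"
  by (intro measurable_restrict_space1 grad_A_measurable[OF \<Omega>(1) lip] Lip_c_mono[OF B(2) cutoff_Lip_c])

lemma Mg_measurable [measurable]: "(\<lambda>y. M y *v g y) \<in> borel_measurable (lebesgue_on K)"
  by (intro borel_measurable_matrix_vector_mult M_measurable g_measurable)

lemma M_mult_measurable: "f \<in> borel_measurable (lebesgue_on K) \<Longrightarrow> (\<lambda>y. M y *v f y) \<in> borel_measurable (lebesgue_on K)"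
  by (intro borel_measurable_matrix_vector_mult M_measurable)

lemma integrable_square: "integrable (lebesgue_on K) (\<lambda>y. (u y)\<^sup>2)" "integrable (lebesgue_on K) (\<lambda>y. (norm (g y))\<^sup>2)"
  using W integrable_lebesgue_on_mono[OF _ K(4,3) \<Omega>_sets] by (auto simp: W12_def in_L2_def)

lemma integrable_const_K: "integrable (lebesgue_on K) (\<lambda>y. c :: real)"
  by (rule finite_measure.integrable_const[OF finite_measure_lebesgue_on[OF K(5)]])

lemma D_bound: "AE y in lebesgue_on K. norm (D y) \<le> \<Lambda>"
  by (rule AE_lebesgue_on[OF cutoff_grad K(4)])

text \<open>Collects what both limit passages need and hides the mollifications: \<open>Z k\<close>
  stands for the A-gradient of \<open>U k\<close>, and the last clause supplies the test function
  and its gradient for every C^1 function \<open>P\<close>.\<close>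

lemma test_sequence:
  obtains U Z H where "\<And>k. U k \<in> borel_measurable (lebesgue_on K)" "\<And>k. Z k \<in> borel_measurable (lebesgue_on K)"
    "integrable (lebesgue_on K) H"
    "AE y in lebesgue_on K. (\<lambda>k. U k y) \<longlonglongrightarrow> u y"
    "AE y in lebesgue_on K. (\<lambda>k. Z k y) \<longlonglongrightarrow> g y"
    "AE y in lebesgue_on K. 1 \<le> H y \<and> (u y)\<^sup>2 \<le> H y \<and> (norm (g y))\<^sup>2 \<le> H y \<and>
       (\<forall>k. (U k y)\<^sup>2 \<le> H y \<and> (norm (Z k y))\<^sup>2 \<le> H y)"
    "AE y in lebesgue_on K. lam * (norm (g y))\<^sup>2 \<le> (norm (M y *v g y))\<^sup>2"
    "\<forall>P P' k. (\<forall>t. (P has_real_derivative P' t) (at t)) \<and> continuous_on UNIV P' \<longrightarrow>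
       (\<lambda>y. (\<psi> y)\<^sup>2 * P (U k y)) \<in> Lip_c B \<and>
       (AE y in lebesgue_on K. grad_A A (\<lambda>y. (\<psi> y)\<^sup>2 * P (U k y)) y =
          ((\<psi> y)\<^sup>2 * P' (U k y)) *\<^sub>R Z k y + (2 * \<psi> y * P (U k y)) *\<^sub>R D y)"
proof -
  obtain U G b H where U: "\<And>k y. (U k has_derivative (\<lambda>h. G k y \<bullet> h)) (at y)"
    "\<And>k y. \<bar>U k y\<bar> \<le> b k" "\<And>k y. norm (G k y) \<le> b k" "\<And>k. G k \<in> borel_measurable borel"
    and H: "integrable (lebesgue_on K) H"
    and lim: "AE y in lebesgue_on K. (\<lambda>k. U k y) \<longlonglongrightarrow> u y"
    "AE y in lebesgue_on K. (\<lambda>k. mat_sqrt (A y) *v G k y) \<longlonglongrightarrow> g y"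
    and dom: "AE y in lebesgue_on K. 1 \<le> H y \<and> (u y)\<^sup>2 \<le> H y \<and> (norm (g y))\<^sup>2 \<le> H y \<and>
       (\<forall>k. (U k y)\<^sup>2 \<le> H y \<and> (norm (mat_sqrt (A y) *v G k y))\<^sup>2 \<le> H y)"
    by (rule friedrichs_sequence[OF \<Omega> psd lip W K(1,3)]) (assumption, rule that, assumption+)
  define Z where "Z k y = mat_sqrt (A y) *v G k y" for k y
  obtain l where l: "l-lipschitz_on UNIV \<psi>" using Lip_c_lipschitz[OF cutoff_Lip_c] by blast
  show ?thesis
  proof (rule that[of U Z H])
    show "U k \<in> borel_measurable (lebesgue_on K)" for k
    proof -
      have "continuous_on UNIV (U k)" using U(1) by (meson continuous_at_imp_continuous_on has_derivative_continuous)
      then have "U k \<in> borel_measurable lebesgue" by (intro measurable_completion) (simp add: borel_measurable_continuous_onI)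
      then show ?thesis by (rule measurable_restrict_space1)
    qed
    have Gm: "G k \<in> borel_measurable (lebesgue_on K)" for k
      using U(4)[of k] by (intro measurable_restrict_space1 measurable_completion) simp
    show "Z k \<in> borel_measurable (lebesgue_on K)" for k
      unfolding Z_def[abs_def] by (intro borel_measurable_matrix_vector_mult measurable_on_K[OF mat_sqrt_measurable[OF \<Omega>(1) lip]] Gm)
    show "integrable (lebesgue_on K) H" by (rule H)
    show "AE y in lebesgue_on K. (\<lambda>k. U k y) \<longlonglongrightarrow> u y" by (rule lim)
    show "AE y in lebesgue_on K. (\<lambda>k. Z k y) \<longlonglongrightarrow> g y" using lim(2) by (simp add: Z_def)
    show "AE y in lebesgue_on K. 1 \<le> H y \<and> (u y)\<^sup>2 \<le> H y \<and> (norm (g y))\<^sup>2 \<le> H y \<and>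
       (\<forall>k. (U k y)\<^sup>2 \<le> H y \<and> (norm (Z k y))\<^sup>2 \<le> H y)" using dom by (simp add: Z_def)
    \<comment> \<open>Ellipticity is known for vectors in the range of the square root of
      \<open>A\<close>. It passes to \<open>g\<close> because \<open>g\<close> is a limit of such
      vectors and the inequality is closed.\<close>
    show "AE y in lebesgue_on K. lam * (norm (g y))\<^sup>2 \<le> (norm (M y *v g y))\<^sup>2"
      using lim(2) AE_on_K[OF M_low]
    proof eventually_elim
      case (elim y)
      have "(\<lambda>k. lam * (norm (mat_sqrt (A y) *v G k y))\<^sup>2) \<longlonglongrightarrow> lam * (norm (g y))\<^sup>2"
        by (intro tendsto_intros elim)
      moreover have "(\<lambda>k. M y *v (mat_sqrt (A y) *v G k y)) \<longlonglongrightarrow> M y *v g y"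
        by (rule isCont_tendsto_compose[OF matrix_vector_mult_linear_continuous_at elim(1)])
      then have "(\<lambda>k. (norm (M y *v (mat_sqrt (A y) *v G k y)))\<^sup>2) \<longlonglongrightarrow> (norm (M y *v g y))\<^sup>2" by (intro tendsto_intros)
      ultimately show ?case by (rule LIMSEQ_le) (use elim(2) in auto)
    qed
    show "\<forall>P P' k. (\<forall>t. (P has_real_derivative P' t) (at t)) \<and> continuous_on UNIV P' \<longrightarrow>
       (\<lambda>y. (\<psi> y)\<^sup>2 * P (U k y)) \<in> Lip_c B \<and>
       (AE y in lebesgue_on K. grad_A A (\<lambda>y. (\<psi> y)\<^sup>2 * P (U k y)) y =
          ((\<psi> y)\<^sup>2 * P' (U k y)) *\<^sub>R Z k y + (2 * \<psi> y * P (U k y)) *\<^sub>R D y)"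
    proof (intro allI impI conjI; elim conjE)
      fix P P' :: "real \<Rightarrow> real" and k
      assume P: "\<forall>t. (P has_real_derivative P' t) (at t)" "continuous_on UNIV P'"
      note T = test_function[OF l cutoff_range K(1,2) U(1)[of k] U(2)[of k] U(3)[of k] P(1)[rule_format] P(2)]
      show "(\<lambda>y. (\<psi> y)\<^sup>2 * P (U k y)) \<in> Lip_c B" by (rule T(1))
      have "AE y in lebesgue. grad_A A (\<lambda>y. (\<psi> y)\<^sup>2 * P (U k y)) y =
          ((\<psi> y)\<^sup>2 * P' (U k y)) *\<^sub>R Z k y + (2 * \<psi> y * P (U k y)) *\<^sub>R D y"
        using rademacher_lebesgue[OF l] by eventually_elim (simp add: T(2) Z_def)
      then show "AE y in lebesgue_on K. grad_A A (\<lambda>y. (\<psi> y)\<^sup>2 * P (U k y)) y =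
          ((\<psi> y)\<^sup>2 * P' (U k y)) *\<^sub>R Z k y + (2 * \<psi> y * P (U k y)) *\<^sub>R D y"
        by (rule AE_lebesgue_on[OF _ K(4)])
    qed
  qed
qed

lemma supp_test: "supp (\<lambda>y. (\<psi> y)\<^sup>2 * f y) \<subseteq> K"
  unfolding supp_def by (intro closure_mono) auto

lemma grad_A_test_eq_0: "y \<notin> K \<Longrightarrow> grad_A A (\<lambda>y. (\<psi> y)\<^sup>2 * f y) y = 0"
  using supp_test[of f] by (intro grad_A_eq_0_outside_supp) auto

lemma cutoff_eq_0: "y \<notin> K \<Longrightarrow> \<psi> y = 0"
  by (rule eq_0_outside_supp)

text \<open>The \<open>A\<close>-gradient of \<open>\<psi>\<^sup>2 P(u)\<close> as given by the product and chain rules.\<close>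

definition flux :: "(real \<Rightarrow> real) \<Rightarrow> (real \<Rightarrow> real) \<Rightarrow> real \<Rightarrow> real^'n \<Rightarrow> real^'n \<Rightarrow> real^'n" where
  "flux P P' t z y = ((\<psi> y)\<^sup>2 * P' t) *\<^sub>R z + (2 * \<psi> y * P t) *\<^sub>R D y"

lemma flux_bound:
  assumes "norm (D y) \<le> \<Lambda>" "\<bar>P' t\<bar> \<le> p1" "\<bar>P t\<bar> \<le> p0" "norm z \<le> h"
  shows "norm (flux P P' t z y) \<le> p1 * h + 2 * p0 * \<Lambda>"
proof -
  have p1: "0 \<le> p1" and h: "0 \<le> h" and p0: "0 \<le> p0"
    using assms(2,3,4) by (meson abs_ge_zero norm_ge_zero order.trans)+
  have r: "0 \<le> \<psi> y" "\<psi> y \<le> 1" using cutoff_range by auto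
  have r2: "(\<psi> y)\<^sup>2 \<le> 1" using r by (simp add: power_le_one)
  have "norm (flux P P' t z y) \<le> norm (((\<psi> y)\<^sup>2 * P' t) *\<^sub>R z) + norm ((2 * \<psi> y * P t) *\<^sub>R D y)"
    unfolding flux_def by (rule norm_triangle_ineq)
  also have "\<dots> = ((\<psi> y)\<^sup>2 * \<bar>P' t\<bar>) * norm z + 2 * (\<psi> y * \<bar>P t\<bar>) * norm (D y)"
    using r by (simp add: abs_mult)
  also have "\<dots> \<le> (1 * p1) * h + 2 * (1 * p0) * \<Lambda>"
    using assms r r2 p1 p0 h by (intro add_mono mult_mono) (auto intro!: mult_nonneg_nonneg)
  finally show ?thesis by simp
qed

lemma flux_tendsto:
  assumes "continuous_on UNIV P" "continuous_on UNIV P'" "s \<longlonglongrightarrow> t" "zz \<longlonglongrightarrow> z"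
  shows "(\<lambda>k. flux P P' (s k) (zz k) y) \<longlonglongrightarrow> flux P P' t z y"
proof -
  have "(\<lambda>k. P (s k)) \<longlonglongrightarrow> P t" "(\<lambda>k. P' (s k)) \<longlonglongrightarrow> P' t"
    using assms by (auto intro!: isCont_tendsto_compose[of t] simp: continuous_on_eq_continuous_at)
  then show ?thesis unfolding flux_def by (intro tendsto_intros assms)
qed

lemma flux_measurable:
  assumes P: "continuous_on UNIV P" "continuous_on UNIV P'" and [measurable]: "s \<in> borel_measurable (lebesgue_on K)" "z \<in> borel_measurable (lebesgue_on K)"
  shows "(\<lambda>y. flux P P' (s y) (z y) y) \<in> borel_measurable (lebesgue_on K)"
proof -
  have [measurable]: "P \<in> borel_measurable borel" "P' \<in> borel_measurable borel" using P by (auto intro: borel_measurable_continuous_onI)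
  show ?thesis unfolding flux_def by measurable
qed

text \<open>With \<open>P\<close> of linear growth and bounded derivative the flux is bounded by a
  multiple of \<open>sqrt (H y)\<close>, and so is \<open>M y *v g y\<close>. Their product is
  dominated by a multiple of the integrable \<open>H\<close>.\<close>

lemma energy_limit:
  assumes P: "\<And>t. (P has_real_derivative P' t) (at t)" "continuous_on UNIV P'"
    and P0: "\<And>t. 0 \<le> P t" and P1: "\<And>t. \<bar>P t\<bar> \<le> \<bar>t\<bar> + c" and P'1: "\<And>t. \<bar>P' t\<bar> \<le> 1" and c: "0 \<le> c"
  shows "(LINT y|lebesgue_on K. (M y *v g y) \<bullet> (M y *v flux P P' (u y) (g y) y)) \<le> N * (LINT y|lebesgue_on K. norm (flux P P' (u y) (g y) y))"
    and "integrable (lebesgue_on K) (\<lambda>y. (M y *v g y) \<bullet> (M y *v flux P P' (u y) (g y) y))"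
    and "integrable (lebesgue_on K) (\<lambda>y. norm (flux P P' (u y) (g y) y))"
proof -
  have Pc: "continuous_on UNIV P" using P(1) by (meson DERIV_isCont continuous_at_imp_continuous_on)
  obtain U Z H where UZ: "\<And>k. U k \<in> borel_measurable (lebesgue_on K)" "\<And>k. Z k \<in> borel_measurable (lebesgue_on K)"
    and H: "integrable (lebesgue_on K) H"
    and lim: "AE y in lebesgue_on K. (\<lambda>k. U k y) \<longlonglongrightarrow> u y" "AE y in lebesgue_on K. (\<lambda>k. Z k y) \<longlonglongrightarrow> g y"
    and dom: "AE y in lebesgue_on K. 1 \<le> H y \<and> (u y)\<^sup>2 \<le> H y \<and> (norm (g y))\<^sup>2 \<le> H y \<and> (\<forall>k. (U k y)\<^sup>2 \<le> H y \<and> (norm (Z k y))\<^sup>2 \<le> H y)"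
    and test: "\<forall>P P' k. (\<forall>t. (P has_real_derivative P' t) (at t)) \<and> continuous_on UNIV P' \<longrightarrow>
       (\<lambda>y. (\<psi> y)\<^sup>2 * P (U k y)) \<in> Lip_c B \<and>
       (AE y in lebesgue_on K. grad_A A (\<lambda>y. (\<psi> y)\<^sup>2 * P (U k y)) y = ((\<psi> y)\<^sup>2 * P' (U k y)) *\<^sub>R Z k y + (2 * \<psi> y * P (U k y)) *\<^sub>R D y)"
    by (rule test_sequence) (rule that, assumption+)
  note [measurable] = flux_measurable[OF Pc P(2) UZ] flux_measurable[OF Pc P(2) u_measurable g_measurable]
    M_mult_measurable[OF flux_measurable[OF Pc P(2) UZ]] M_mult_measurable[OF flux_measurable[OF Pc P(2) u_measurable g_measurable]]
  let ?F = "\<lambda>k y. flux P P' (U k y) (Z k y) y" and ?f = "\<lambda>y. flux P P' (u y) (g y) y"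
  let ?w = "\<lambda>k y. (\<psi> y)\<^sup>2 * P (U k y)"
  define C where "C = 1 + 2 * (1 + c) * \<Lambda>"
  have C0: "0 \<le> C" using c cutoff_Lambda by (simp add: C_def)
  have bound: "AE y in lebesgue_on K. \<forall>k. norm (?F k y) \<le> C * sqrt (H y) \<and> norm (g y) \<le> sqrt (H y) \<and> 1 \<le> sqrt (H y) \<and> sqrt (H y) * sqrt (H y) = H y"
    using dom D_bound
  proof eventually_elim
    case (elim y)
    have s: "1 \<le> sqrt (H y)" using elim by simp
    have "norm (?F k y) \<le> C * sqrt (H y)" for k
    proof -
      have "\<bar>U k y\<bar> \<le> sqrt (H y)" "norm (Z k y) \<le> sqrt (H y)" using elim by (auto intro!: real_le_rsqrt)
      moreover have "c * 1 \<le> c * sqrt (H y)" using c s by (intro mult_left_mono)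
      ultimately have "\<bar>P (U k y)\<bar> \<le> (1 + c) * sqrt (H y)" using P1[of "U k y"] by (simp add: algebra_simps)
      from flux_bound[where P=P and P'=P' and t="U k y", OF elim(2) P'1 this \<open>norm (Z k y) \<le> sqrt (H y)\<close>]
      show ?thesis by (simp add: C_def algebra_simps)
    qed
    then show ?case using elim s by (auto intro!: real_le_rsqrt)
  qed
  have HC: "integrable (lebesgue_on K) (\<lambda>y. C * H y)" "integrable (lebesgue_on K) (\<lambda>y. (KM * KM * C) * H y)" using H by auto
  have limF: "AE y in lebesgue_on K. (\<lambda>k. ?F k y) \<longlonglongrightarrow> ?f y"
    using lim by eventually_elim (simp add: flux_tendsto[OF Pc P(2)])
  have b1: "AE y in lebesgue_on K. norm (norm (?F k y)) \<le> C * H y" for k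
    using bound
  proof eventually_elim
    case (elim y)
    have "sqrt (H y) * 1 \<le> sqrt (H y) * sqrt (H y)" using elim by (intro mult_left_mono) auto
    then have "C * sqrt (H y) \<le> C * H y" using elim C0 by (intro mult_left_mono) auto
    then show ?case using elim by (auto intro: order.trans)
  qed
  have l1: "(\<lambda>k. LINT y|lebesgue_on K. norm (?F k y)) \<longlonglongrightarrow> (LINT y|lebesgue_on K. norm (?f y))"
    by (rule integral_dominated_convergence[OF _ _ HC(1) _ b1]) (measurable, use limF in eventually_elim, rule tendsto_norm)
  show "integrable (lebesgue_on K) (\<lambda>y. norm (?f y))"
    by (rule integrable_dominated_convergence[OF _ _ HC(1) _ b1]) (measurable, use limF in eventually_elim, rule tendsto_norm)
  have y\<Omega>: "AE y in lebesgue_on K. y \<in> \<Omega>" using K(3) by (intro AE_I2) auto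
  have b2: "AE y in lebesgue_on K. norm ((M y *v g y) \<bullet> (M y *v ?F k y)) \<le> (KM * KM * C) * H y" for k
    using bound y\<Omega>
  proof eventually_elim
    case (elim y)
    have "norm (M y *v g y) \<le> KM * sqrt (H y)"
      using norm_matrix_vector_mult_bound[OF Mb[OF elim(2)], of "g y"] elim(1) KM by (meson mult_left_mono order.trans)
    moreover have "norm (M y *v ?F k y) \<le> KM * (C * sqrt (H y))"
      using norm_matrix_vector_mult_bound[OF Mb[OF elim(2)], of "?F k y"] elim(1) KM by (meson mult_left_mono order.trans)
    ultimately have "norm (M y *v g y) * norm (M y *v ?F k y) \<le> (KM * sqrt (H y)) * (KM * (C * sqrt (H y)))"
      using elim KM by (intro mult_mono) auto
    also have "\<dots> = (KM * KM * C) * (sqrt (H y) * sqrt (H y))" by (simp only: mult_ac)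
    also have "\<dots> = (KM * KM * C) * H y" using elim by simp
    finally show ?case using Cauchy_Schwarz_ineq2[of "M y *v g y" "M y *v ?F k y"] by simp
  qed
  have lim2: "AE y in lebesgue_on K. (\<lambda>k. (M y *v g y) \<bullet> (M y *v ?F k y)) \<longlonglongrightarrow> (M y *v g y) \<bullet> (M y *v ?f y)"
    using limF by eventually_elim (intro tendsto_intros isCont_tendsto_compose[OF matrix_vector_mult_linear_continuous_at])
  have l2: "(\<lambda>k. LINT y|lebesgue_on K. (M y *v g y) \<bullet> (M y *v ?F k y)) \<longlonglongrightarrow> (LINT y|lebesgue_on K. (M y *v g y) \<bullet> (M y *v ?f y))"
    by (rule integral_dominated_convergence[OF _ _ HC(2) lim2 b2]) measurable
  show "integrable (lebesgue_on K) (\<lambda>y. (M y *v g y) \<bullet> (M y *v ?f y))"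
    by (rule integrable_dominated_convergence[OF _ _ HC(2) lim2 b2]) measurable
  have ineq: "(LINT y|lebesgue_on K. (M y *v g y) \<bullet> (M y *v ?F k y)) \<le> N * (LINT y|lebesgue_on K. norm (?F k y))" for k
  proof -
    have wL: "?w k \<in> Lip_c B" and wg: "AE y in lebesgue_on K. grad_A A (?w k) y = ?F k y"
      using test[rule_format, of P P' k] P by (auto simp: flux_def)
    have gm: "grad_A A (?w k) \<in> borel_measurable (lebesgue_on K)"
      by (intro measurable_restrict_space1 grad_A_measurable[OF \<Omega>(1) lip] Lip_c_mono[OF B(2) wL])
    have "energy_form \<Omega> M g (grad_A A (?w k)) \<le> N * (LINT y|lebesgue. norm (grad_A A (?w k) y))"
      using P0 by (intro energy[OF wL]) simp
    also have "(LINT y|lebesgue. norm (grad_A A (?w k) y)) = (LINT y|lebesgue_on K. norm (grad_A A (?w k) y))"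
      by (rule integral_lebesgue_eq_lebesgue_on[OF K(4)]) (simp add: grad_A_test_eq_0)
    also have "\<dots> = (LINT y|lebesgue_on K. norm (?F k y))"
      using wg gm by (intro integral_cong_AE) auto
    also have "energy_form \<Omega> M g (grad_A A (?w k)) = (LINT y|lebesgue_on K. (M y *v g y) \<bullet> (M y *v grad_A A (?w k) y))"
      unfolding energy_form_def by (rule integral_lebesgue_on_subset[OF K(3,4) \<Omega>_sets]) (simp add: grad_A_test_eq_0)
    also have "\<dots> = (LINT y|lebesgue_on K. (M y *v g y) \<bullet> (M y *v ?F k y))"
    proof (rule integral_cong_AE)
      show "(\<lambda>y. (M y *v g y) \<bullet> (M y *v grad_A A (?w k) y)) \<in> borel_measurable (lebesgue_on K)"
        using M_mult_measurable[OF gm] by measurable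
      show "AE y in lebesgue_on K. (M y *v g y) \<bullet> (M y *v grad_A A (?w k) y) = (M y *v g y) \<bullet> (M y *v ?F k y)"
        using wg by eventually_elim simp
    qed measurable
    finally show ?thesis .
  qed
  show "(LINT y|lebesgue_on K. (M y *v g y) \<bullet> (M y *v ?f y)) \<le> N * (LINT y|lebesgue_on K. norm (?f y))"
    by (rule LIMSEQ_le[OF l2 tendsto_mult_left[OF l1]]) (use ineq in auto)
qed

text \<open>Here the flux is not paired with \<open>g\<close>, so the quadratic \<open>q\<close> is
  affordable: its flux is bounded by a multiple of \<open>H\<close> itself.\<close>

lemma gain_limit:
  fixes \<kappa> :: real
  assumes E: "E \<in> sets lebesgue" "E \<subseteq> K" and \<eta>: "0 < \<eta>" "\<eta> \<le> \<eta>max" "measure lebesgue E \<le> \<eta> * measure lebesgue B"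
  defines "q \<equiv> \<lambda>t. (max 0 (t - \<kappa>))\<^sup>2" and "q' \<equiv> \<lambda>t. 2 * max 0 (t - \<kappa>)"
  shows "(LINT y|lebesgue_on K. indicator E y * ((\<psi> y)\<^sup>2 * q (u y))) \<le> R \<eta> * (LINT y|lebesgue_on K. norm (flux q q' (u y) (g y) y))"
    and "integrable (lebesgue_on K) (\<lambda>y. norm (flux q q' (u y) (g y) y))"
proof -
  have q: "\<And>t. (q has_real_derivative q' t) (at t)" unfolding q_def q'_def by (rule positive_part_square_derivative)
  have q'c: "continuous_on UNIV q'" unfolding q'_def by (intro continuous_intros)
  have qc: "continuous_on UNIV q" unfolding q_def by (intro continuous_intros)
  have q0: "0 \<le> q t" for t by (simp add: q_def)
  obtain U Z H where UZ: "\<And>k. U k \<in> borel_measurable (lebesgue_on K)" "\<And>k. Z k \<in> borel_measurable (lebesgue_on K)"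
    and H: "integrable (lebesgue_on K) H"
    and lim: "AE y in lebesgue_on K. (\<lambda>k. U k y) \<longlonglongrightarrow> u y" "AE y in lebesgue_on K. (\<lambda>k. Z k y) \<longlonglongrightarrow> g y"
    and dom: "AE y in lebesgue_on K. 1 \<le> H y \<and> (u y)\<^sup>2 \<le> H y \<and> (norm (g y))\<^sup>2 \<le> H y \<and> (\<forall>k. (U k y)\<^sup>2 \<le> H y \<and> (norm (Z k y))\<^sup>2 \<le> H y)"
    and test: "\<forall>P P' k. (\<forall>t. (P has_real_derivative P' t) (at t)) \<and> continuous_on UNIV P' \<longrightarrow>
       (\<lambda>y. (\<psi> y)\<^sup>2 * P (U k y)) \<in> Lip_c B \<and>
       (AE y in lebesgue_on K. grad_A A (\<lambda>y. (\<psi> y)\<^sup>2 * P (U k y)) y = ((\<psi> y)\<^sup>2 * P' (U k y)) *\<^sub>R Z k y + (2 * \<psi> y * P (U k y)) *\<^sub>R D y)"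
    by (rule test_sequence) (rule that, assumption+)
  have qm[measurable]: "q \<in> borel_measurable borel" using qc by (rule borel_measurable_continuous_onI)
  note [measurable] = UZ flux_measurable[OF qc q'c UZ] flux_measurable[OF qc q'c u_measurable g_measurable]
  have Em[measurable]: "indicat_real E \<in> borel_measurable (lebesgue_on K)"
    using E by (intro measurable_restrict_space1) simp
  let ?F = "\<lambda>k y. flux q q' (U k y) (Z k y) y" and ?f = "\<lambda>y. flux q q' (u y) (g y) y"
  let ?w = "\<lambda>k y. (\<psi> y)\<^sup>2 * q (U k y)"
  let ?a = "1 + \<bar>\<kappa>\<bar>"
  have bound: "AE y in lebesgue_on K. \<forall>k. norm (?F k y) \<le> (2 * ?a + 2 * ?a\<^sup>2 * \<Lambda>) * H y \<and> q (U k y) \<le> ?a\<^sup>2 * H y"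
    using dom D_bound
  proof eventually_elim
    case (elim y)
    have s: "1 \<le> sqrt (H y)" "sqrt (H y) * sqrt (H y) = H y" using elim by auto
    show ?case
    proof
      fix k
      have UZb: "\<bar>U k y\<bar> \<le> sqrt (H y)" "norm (Z k y) \<le> sqrt (H y)" using elim by (auto intro!: real_le_rsqrt)
      have "\<bar>\<kappa>\<bar> * 1 \<le> \<bar>\<kappa>\<bar> * sqrt (H y)" using s by (intro mult_left_mono) auto
      then have m: "max 0 (U k y - \<kappa>) \<le> ?a * sqrt (H y)" using UZb s by (simp add: distrib_right)
      have "q (U k y) \<le> (?a * sqrt (H y))\<^sup>2" unfolding q_def using m by (intro power_mono) auto
      also have "\<dots> = ?a\<^sup>2 * H y" using s by (simp add: power_mult_distrib power2_eq_square)
      finally have qb: "q (U k y) \<le> ?a\<^sup>2 * H y" .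
      have "\<bar>q' (U k y)\<bar> \<le> 2 * (?a * sqrt (H y))" "\<bar>q (U k y)\<bar> \<le> ?a\<^sup>2 * H y" using m qb q0 by (auto simp: q'_def)
      from flux_bound[where P=q and P'=q' and t="U k y", OF elim(2) this UZb(2)]
      have "norm (?F k y) \<le> 2 * ?a * (sqrt (H y) * sqrt (H y)) + 2 * (?a\<^sup>2 * H y) * \<Lambda>" by (simp only: mult.assoc)
      also have "\<dots> = (2 * ?a + 2 * ?a\<^sup>2 * \<Lambda>) * H y" unfolding s(2) by (simp add: algebra_simps)
      finally show "norm (?F k y) \<le> (2 * ?a + 2 * ?a\<^sup>2 * \<Lambda>) * H y \<and> q (U k y) \<le> ?a\<^sup>2 * H y" using qb by simp
    qed
  qed
  have HC: "integrable (lebesgue_on K) (\<lambda>y. (2 * ?a + 2 * ?a\<^sup>2 * \<Lambda>) * H y)" "integrable (lebesgue_on K) (\<lambda>y. ?a\<^sup>2 * H y)" using H by auto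
  have limF: "AE y in lebesgue_on K. (\<lambda>k. ?F k y) \<longlonglongrightarrow> ?f y"
    using lim by eventually_elim (simp add: flux_tendsto[OF qc q'c])
  have b1: "AE y in lebesgue_on K. norm (norm (?F k y)) \<le> (2 * ?a + 2 * ?a\<^sup>2 * \<Lambda>) * H y" for k
    using bound by eventually_elim auto
  have l1: "(\<lambda>k. LINT y|lebesgue_on K. norm (?F k y)) \<longlonglongrightarrow> (LINT y|lebesgue_on K. norm (?f y))"
    by (rule integral_dominated_convergence[OF _ _ HC(1) _ b1]) (measurable, use limF in eventually_elim, rule tendsto_norm)
  show "integrable (lebesgue_on K) (\<lambda>y. norm (?f y))"
    by (rule integrable_dominated_convergence[OF _ _ HC(1) _ b1]) (measurable, use limF in eventually_elim, rule tendsto_norm)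
  have b2: "AE y in lebesgue_on K. norm (indicator E y * ?w k y) \<le> ?a\<^sup>2 * H y" for k
    using bound
  proof eventually_elim
    case (elim y)
    have "(\<psi> y)\<^sup>2 \<le> 1" using cutoff_range[of y] by (simp add: power_le_one)
    then have "(\<psi> y)\<^sup>2 * q (U k y) \<le> 1 * (?a\<^sup>2 * H y)" using elim q0 by (intro mult_mono) auto
    moreover have "0 \<le> (\<psi> y)\<^sup>2 * q (U k y)" using q0 by simp
    ultimately show ?case by (auto simp: indicator_def)
  qed
  have lim2: "AE y in lebesgue_on K. (\<lambda>k. indicator E y * ?w k y) \<longlonglongrightarrow> indicator E y * ((\<psi> y)\<^sup>2 * q (u y))"
    using lim(1)
  proof eventually_elim
    case (elim y)
    have "(\<lambda>k. q (U k y)) \<longlonglongrightarrow> q (u y)"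
      using qc elim by (auto intro!: isCont_tendsto_compose[of "u y"] simp: continuous_on_eq_continuous_at)
    then show ?case by (intro tendsto_intros)
  qed
  have l2: "(\<lambda>k. LINT y|lebesgue_on K. indicator E y * ?w k y) \<longlonglongrightarrow> (LINT y|lebesgue_on K. indicator E y * ((\<psi> y)\<^sup>2 * q (u y)))"
    by (rule integral_dominated_convergence[OF _ _ HC(2) lim2 b2]) measurable
  have ineq: "(LINT y|lebesgue_on K. indicator E y * ?w k y) \<le> R \<eta> * (LINT y|lebesgue_on K. norm (?F k y))" for k
  proof -
    have wL: "?w k \<in> Lip_c B" and wg: "AE y in lebesgue_on K. grad_A A (?w k) y = ?F k y"
      using test[rule_format, of q q' k] q q'c by (auto simp: flux_def)
    have gm: "grad_A A (?w k) \<in> borel_measurable (lebesgue_on K)"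
      by (intro measurable_restrict_space1 grad_A_measurable[OF \<Omega>(1) lip] Lip_c_mono[OF B(2) wL])
    have "(LINT y|lebesgue. indicator E y * \<bar>?w k y\<bar>) \<le> R \<eta> * (LINT y|lebesgue. norm (grad_A A (?w k) y))"
      by (rule gain[OF wL E(1) _ \<eta>]) (use E(2) K(2) in auto)
    also have "(LINT y|lebesgue. norm (grad_A A (?w k) y)) = (LINT y|lebesgue_on K. norm (grad_A A (?w k) y))"
      by (rule integral_lebesgue_eq_lebesgue_on[OF K(4)]) (simp add: grad_A_test_eq_0)
    also have "\<dots> = (LINT y|lebesgue_on K. norm (?F k y))"
      using wg gm by (intro integral_cong_AE) auto
    also have "(LINT y|lebesgue. indicator E y * \<bar>?w k y\<bar>) = (LINT y|lebesgue_on K. indicator E y * \<bar>?w k y\<bar>)"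
      by (rule integral_lebesgue_eq_lebesgue_on[OF K(4)]) (simp add: cutoff_eq_0)
    also have "\<dots> = (LINT y|lebesgue_on K. indicator E y * ?w k y)"
      using q0 by (intro Bochner_Integration.integral_cong refl) simp
    finally show ?thesis .
  qed
  show "(LINT y|lebesgue_on K. indicator E y * ((\<psi> y)\<^sup>2 * q (u y))) \<le> R \<eta> * (LINT y|lebesgue_on K. norm (?f y))"
    by (rule LIMSEQ_le[OF l2 tendsto_mult_left[OF l1]]) (use ineq in auto)
qed

end

section \<open>Pointwise absorption and the Caccioppoli inequality\<close>

lemma young_inequality_real:
  fixes lam k v \<alpha> :: real
  assumes "0 < lam" shows "2 * k * v * \<alpha> \<le> lam / 4 * \<alpha>\<^sup>2 + 4 * k\<^sup>2 / lam * v\<^sup>2"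
proof -
  have "0 \<le> (lam * \<alpha> / 2 - 2 * k * v)\<^sup>2 / lam" using assms by simp
  also have "\<dots> = lam / 4 * \<alpha>\<^sup>2 + 4 * k\<^sup>2 / lam * v\<^sup>2 - 2 * k * v * \<alpha>"
    using assms by (simp add: power2_eq_square field_simps)
  finally show ?thesis by simp
qed

text \<open>Read \<open>p\<close> and \<open>P\<close> as the ramp's derivative and value at
  \<open>u\<close>, \<open>v\<close> as the positive part of \<open>u - a\<close>, \<open>G\<close>
  as the norm of \<open>g\<close>, \<open>mm\<close> as the squared norm of \<open>M g\<close> and
  \<open>md\<close> as its inner product with \<open>M D\<close>. The cross term consumes a quarter
  of the energy.\<close>

lemma energy_lower_bound_real:
  fixes p P \<psi> v G mm md lam k :: real
  assumes p: "0 \<le> p" "p \<le> 1" and P: "0 \<le> P" "P \<le> p * v" and \<psi>: "0 \<le> \<psi>" and v: "0 \<le> v"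
    and lam: "0 < lam" and mm: "lam * G\<^sup>2 \<le> mm" and md: "\<bar>md\<bar> \<le> k * G" and k: "0 \<le> k * G"
  shows "3 / 4 * lam * (\<psi>\<^sup>2 * p * G\<^sup>2) - 4 * k\<^sup>2 / lam * v\<^sup>2 \<le> \<psi>\<^sup>2 * p * mm + 2 * \<psi> * P * md"
proof -
  have "lam * (\<psi>\<^sup>2 * p * G\<^sup>2) \<le> \<psi>\<^sup>2 * p * mm"
    using mult_left_mono[OF mm, of "\<psi>\<^sup>2 * p"] p by (simp add: mult_ac)
  moreover have "\<bar>2 * \<psi> * P * md\<bar> \<le> p * (2 * k * v * (\<psi> * G))"
  proof -
    have "\<bar>2 * \<psi> * P * md\<bar> = (2 * \<psi> * P) * \<bar>md\<bar>" using \<psi> P by (simp add: abs_mult)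
    also have "\<dots> \<le> (2 * \<psi> * (p * v)) * (k * G)" using \<psi> P md p v by (intro mult_mono) auto
    finally show ?thesis by (simp add: mult_ac)
  qed
  moreover have "p * (2 * k * v * (\<psi> * G)) \<le> p * (lam / 4 * (\<psi> * G)\<^sup>2 + 4 * k\<^sup>2 / lam * v\<^sup>2)"
    by (intro mult_left_mono young_inequality_real[OF lam] p(1))
  moreover have "p * (4 * k\<^sup>2 / lam * v\<^sup>2) \<le> 1 * (4 * k\<^sup>2 / lam * v\<^sup>2)"
    using p lam by (intro mult_right_mono) auto
  moreover have "p * (lam / 4 * (\<psi> * G)\<^sup>2 + 4 * k\<^sup>2 / lam * v\<^sup>2) = lam / 4 * (\<psi>\<^sup>2 * p * G\<^sup>2) + p * (4 * k\<^sup>2 / lam * v\<^sup>2)"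
    by (simp add: distrib_left power_mult_distrib)
  ultimately show ?thesis by linarith
qed

text \<open>\<open>F\<close> is the norm of the flux and \<open>i\<close> the indicator of the
  superlevel set. Splitting \<open>N\<close> times the gradient of \<open>u\<close> by Young's
  inequality leaves a constant without any factor \<open>v\<close>; multiplied by \<open>p\<close>,
  which is at most \<open>i\<close>, it produces the measure term of the Caccioppoli
  inequality.\<close>

lemma source_bound_real:
  fixes p P \<psi> v G F lam N \<Lambda> i :: real
  assumes p: "0 \<le> p" "p \<le> i" "i \<le> 1" and P: "0 \<le> P" "P \<le> p * v" and \<psi>: "0 \<le> \<psi>" "\<psi> \<le> 1" and v: "0 \<le> v"
    and lam: "0 < lam" and F: "F \<le> \<psi>\<^sup>2 * p * G + 2 * \<psi> * P * \<Lambda>" and N: "0 \<le> N" and \<Lambda>: "0 \<le> \<Lambda>" and G: "0 \<le> G"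
  shows "N * F \<le> lam / 4 * (\<psi>\<^sup>2 * p * G\<^sup>2) + (N\<^sup>2 / lam + N\<^sup>2) * i + \<Lambda>\<^sup>2 * v\<^sup>2"
proof -
  have "\<psi>\<^sup>2 * p * G \<le> \<psi> * p * G"
    using \<psi> p G by (intro mult_right_mono) (auto simp: power2_eq_square mult_left_le)
  moreover have "2 * \<psi> * P * \<Lambda> \<le> 2 * 1 * (p * v) * \<Lambda>" using \<psi> P \<Lambda> p v by (intro mult_mono) auto
  ultimately have "F \<le> p * (\<psi> * G + 2 * v * \<Lambda>)" using F by (simp add: algebra_simps)
  then have "N * F \<le> N * (p * (\<psi> * G + 2 * v * \<Lambda>))" using N by (rule mult_left_mono)
  also have "\<dots> = p * (N * (\<psi> * G) + 2 * (N * (\<Lambda> * v)))" by (simp add: algebra_simps)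
  also have "\<dots> \<le> p * ((lam / 4 * (\<psi> * G)\<^sup>2 + N\<^sup>2 / lam) + (N\<^sup>2 + (\<Lambda> * v)\<^sup>2))"
  proof (intro mult_left_mono add_mono p)
    show "N * (\<psi> * G) \<le> lam / 4 * (\<psi> * G)\<^sup>2 + N\<^sup>2 / lam"
      using young_inequality_real[OF lam, of "N / 2" 1 "\<psi> * G"] by (simp add: power_divide)
    show "2 * (N * (\<Lambda> * v)) \<le> N\<^sup>2 + (\<Lambda> * v)\<^sup>2"
      using zero_le_power2[of "N - \<Lambda> * v"] by (simp add: power2_eq_square algebra_simps)
  qed
  also have "\<dots> = lam / 4 * (\<psi>\<^sup>2 * p * G\<^sup>2) + p * (N\<^sup>2 / lam + N\<^sup>2) + p * (\<Lambda>\<^sup>2 * v\<^sup>2)"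
    by (simp add: power_mult_distrib algebra_simps)
  also have "\<dots> \<le> lam / 4 * (\<psi>\<^sup>2 * p * G\<^sup>2) + i * (N\<^sup>2 / lam + N\<^sup>2) + 1 * (\<Lambda>\<^sup>2 * v\<^sup>2)"
    using p lam by (intro add_mono mult_right_mono order_refl) auto
  finally show ?thesis by (simp add: mult.commute)
qed

context energy_setting
begin

text \<open>Dominates both the coefficient of the measure term and, after division by the square of
  \<Lambda>, that of the integral in \<open>caccioppoli\<close>.\<close>

definition C0 :: real where "C0 = N\<^sup>2 / lam + N\<^sup>2 + 1 + 4 * KM ^ 4 / lam"

text \<open>The 10 is the 2 of \<open>caccioppoli\<close> times 4 + 1, for the superlevel set at the
  halfway level and for the integral; the 3 bounds 1 + 2 \<Lambda> by the square of
  \<Lambda>.\<close>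

definition C2 :: real where "C2 = 10 * C0 / lam + 3"

lemma C0_pos: "1 \<le> C0" using lam by (simp add: C0_def)

lemma C2_pos: "0 < C2" using C0_pos lam by (simp add: C2_def add_nonneg_pos)

end

context cutoff_energy
begin

lemma superlevel_sets: "{y \<in> K. a < u y} \<in> sets lebesgue" "{y \<in> K. a < u y} \<in> lmeasurable"
proof -
  have "{y \<in> space (lebesgue_on K). a < u y} \<in> sets (lebesgue_on K)" by measurable
  then have "{y \<in> K. a < u y} \<in> sets (lebesgue_on K)" by simp
  then show s: "{y \<in> K. a < u y} \<in> sets lebesgue" using K(4) by (simp add: sets_restrict_space_iff)
  then show "{y \<in> K. a < u y} \<in> lmeasurable" by (rule fmeasurableI2[OF K(5), rotated]) auto
qed

lemma integral_indicator_K: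
  assumes "S \<in> sets lebesgue" "S \<subseteq> K"
  shows "(LINT y|lebesgue_on K. indicator S y) = measure lebesgue S" "integrable (lebesgue_on K) (indicat_real S)"
proof -
  have Sl: "S \<in> lmeasurable" by (rule fmeasurableI2[OF K(5) assms(2,1)])
  have "S \<in> sets (lebesgue_on K)" using assms K(4) by (simp add: sets_restrict_space_iff)
  moreover have m: "measure (lebesgue_on K) S = measure lebesgue S"
    by (rule measure_restrict_space) (use assms K(4) in auto)
  moreover have "emeasure (lebesgue_on K) S = emeasure lebesgue S"
    by (rule emeasure_restrict_space) (use assms K(4) in auto)
  ultimately show "(LINT y|lebesgue_on K. indicator S y) = measure lebesgue S" "integrable (lebesgue_on K) (indicat_real S)"
    using Sl assms(2) by (auto simp: fmeasurable_def Int_absorb2 simp del: emeasure_completion intro!: integrable_real_indicator)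
qed

lemma integrable_positive_part: "integrable (lebesgue_on K) (\<lambda>y. (max 0 (u y - a))\<^sup>2)"
proof (rule Bochner_Integration.integrable_bound)
  show "integrable (lebesgue_on K) (\<lambda>y. 2 * (u y)\<^sup>2 + 2 * a\<^sup>2)"
    by (intro Bochner_Integration.integrable_add integrable_mult_right integrable_square integrable_const_K)
  have "(max 0 (t - a))\<^sup>2 \<le> 2 * t\<^sup>2 + 2 * a\<^sup>2" for t :: real
  proof -
    have "(max 0 (t - a))\<^sup>2 \<le> (t - a)\<^sup>2" by (simp add: max_def)
    moreover have "0 \<le> (t + a)\<^sup>2" by simp
    ultimately show ?thesis by (simp add: power2_eq_square algebra_simps)
  qed
  then show "AE y in lebesgue_on K. norm ((max 0 (u y - a))\<^sup>2) \<le> norm (2 * (u y)\<^sup>2 + 2 * a\<^sup>2)"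
    by (intro AE_I2) simp
qed measurable

lemma markov:
  assumes "k < a"
  shows "measure lebesgue {y \<in> K. a < u y} \<le> (LINT y|lebesgue_on K. (max 0 (u y - k))\<^sup>2) / (a - k)\<^sup>2"
proof -
  let ?S = "{y \<in> K. a < u y}"
  have "measure lebesgue ?S = (LINT y|lebesgue_on K. indicator ?S y)"
    by (rule integral_indicator_K(1)[symmetric]) (use superlevel_sets in auto)
  also have "\<dots> \<le> (LINT y|lebesgue_on K. (max 0 (u y - k))\<^sup>2 / (a - k)\<^sup>2)"
  proof (rule integral_mono)
    show "integrable (lebesgue_on K) (indicat_real ?S)" by (rule integral_indicator_K(2)) (use superlevel_sets in auto)
    show "integrable (lebesgue_on K) (\<lambda>y. (max 0 (u y - k))\<^sup>2 / (a - k)\<^sup>2)" using integrable_positive_part by simp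
    fix y
    show "indicat_real ?S y \<le> (max 0 (u y - k))\<^sup>2 / (a - k)\<^sup>2"
    proof (cases "y \<in> ?S")
      case True
      then have "(a - k)\<^sup>2 \<le> (max 0 (u y - k))\<^sup>2" using assms by (intro power_mono) auto
      then show ?thesis using True assms by simp
    qed simp
  qed
  finally show ?thesis by simp
qed

lemma ramp_X_measurable: "(\<lambda>y. (\<psi> y)\<^sup>2 * ramp' a s (u y) * (norm (g y))\<^sup>2) \<in> borel_measurable (lebesgue_on K)"
proof -
  have [measurable]: "ramp' a s \<in> borel_measurable borel" using ramp'_continuous by (rule borel_measurable_continuous_onI)
  show ?thesis by measurable
qed

lemma integrable_ramp_X:
  assumes s: "0 < s" shows "integrable (lebesgue_on K) (\<lambda>y. (\<psi> y)\<^sup>2 * ramp' a s (u y) * (norm (g y))\<^sup>2)"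
proof (rule Bochner_Integration.integrable_bound[OF integrable_square(2) ramp_X_measurable AE_I2])
  fix y
  have "(\<psi> y)\<^sup>2 * ramp' a s (u y) \<le> 1 * 1"
    using cutoff_range[of y] ramp_bounds[OF s] by (intro mult_mono) (auto simp: power_le_one)
  then have "(\<psi> y)\<^sup>2 * ramp' a s (u y) * (norm (g y))\<^sup>2 \<le> 1 * (norm (g y))\<^sup>2" by (intro mult_right_mono) auto
  moreover have "0 \<le> (\<psi> y)\<^sup>2 * ramp' a s (u y) * (norm (g y))\<^sup>2" using ramp_bounds(1)[OF s] by simp
  ultimately show "norm ((\<psi> y)\<^sup>2 * ramp' a s (u y) * (norm (g y))\<^sup>2) \<le> norm ((norm (g y))\<^sup>2)" by simp
qed

text \<open>Of the energy, 3/4 survives the cross term and the data use another 1/4, so half of it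
  remains on the left. The bound does not depend on the width \<open>s\<close> of the ramp.\<close>

lemma caccioppoli:
  assumes s: "0 < s"
  shows "(LINT y|lebesgue_on K. (\<psi> y)\<^sup>2 * ramp' a s (u y) * (norm (g y))\<^sup>2) \<le>
     2 * C0 / lam * \<Lambda>\<^sup>2 * (measure lebesgue {y \<in> K. a < u y} + (LINT y|lebesgue_on K. (max 0 (u y - a))\<^sup>2))"
proof -
  let ?P = "ramp a s" and ?P' = "ramp' a s"
  let ?S = "{y \<in> K. a < u y}"
  let ?X = "\<lambda>y. (\<psi> y)\<^sup>2 * ?P' (u y) * (norm (g y))\<^sup>2" and ?V = "\<lambda>y. (max 0 (u y - a))\<^sup>2"
  let ?f = "\<lambda>y. flux ?P ?P' (u y) (g y) y"
  let ?k = "KM * KM * \<Lambda>"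
  have \<Lambda>: "0 \<le> \<Lambda>" "1 \<le> \<Lambda>" using cutoff_Lambda by auto
  have Pb: "\<bar>?P t\<bar> \<le> \<bar>t\<bar> + \<bar>a\<bar>" for t
  proof -
    have "?P t \<le> ?P' t * max 0 (t - a)" by (rule ramp_bounds(6)[OF s])
    also have "\<dots> \<le> 1 * max 0 (t - a)" using ramp_bounds(2)[OF s] by (intro mult_right_mono) auto
    finally show ?thesis using ramp_bounds(5)[OF s, of a t] by simp
  qed
  have P'b: "\<bar>?P' t\<bar> \<le> 1" for t using ramp_bounds(1,2)[OF s, of a t] by simp
  have der: "(?P has_real_derivative ?P' t) (at t)" for t using s by (intro ramp_derivative) simp
  note EL = energy_limit[where P="?P" and P'="?P'" and c="\<bar>a\<bar>", OF der ramp'_continuous ramp_bounds(5)[OF s] Pb P'b abs_ge_zero]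
  have y\<Omega>: "AE y in lebesgue_on K. y \<in> \<Omega>" using K(3) by (intro AE_I2) auto
  obtain U Z H where low: "AE y in lebesgue_on K. lam * (norm (g y))\<^sup>2 \<le> (norm (M y *v g y))\<^sup>2"
    by (rule test_sequence) (rule that, assumption)
  have p1: "AE y in lebesgue_on K. 3 / 4 * lam * ?X y - 4 * ?k\<^sup>2 / lam * ?V y \<le> (M y *v g y) \<bullet> (M y *v ?f y)"
    using low D_bound y\<Omega>
  proof eventually_elim
    case (elim y)
    have e: "(M y *v g y) \<bullet> (M y *v ?f y) = (\<psi> y)\<^sup>2 * ?P' (u y) * (norm (M y *v g y))\<^sup>2 + 2 * \<psi> y * ?P (u y) * ((M y *v g y) \<bullet> (M y *v D y))"
      by (simp add: flux_def matrix_vector_right_distrib matrix_vector_mult_scaleR inner_add_right power2_norm_eq_inner)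
    have "\<bar>(M y *v g y) \<bullet> (M y *v D y)\<bar> \<le> norm (M y *v g y) * norm (M y *v D y)" by (rule Cauchy_Schwarz_ineq2)
    also have "\<dots> \<le> (KM * norm (g y)) * (KM * \<Lambda>)"
      using norm_matrix_vector_mult_bound[OF Mb[OF elim(3)], of "g y"] norm_matrix_vector_mult_bound[OF Mb[OF elim(3)], of "D y"]
        mult_left_mono[OF elim(2) KM] KM by (intro mult_mono) auto
    finally have md: "\<bar>(M y *v g y) \<bullet> (M y *v D y)\<bar> \<le> ?k * norm (g y)" by (simp add: mult_ac)
    show ?case unfolding e
      by (rule energy_lower_bound_real[OF ramp_bounds(1,2)[OF s] ramp_bounds(5,6)[OF s] _ _ lam elim(1) md])
         (use cutoff_range[of y] KM \<Lambda> in auto)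
  qed
  have p2: "AE y in lebesgue_on K. N * norm (?f y) \<le> lam / 4 * ?X y + (N\<^sup>2 / lam + N\<^sup>2) * indicator ?S y + \<Lambda>\<^sup>2 * ?V y"
    using D_bound
  proof (rule AE_mp, intro AE_I2 impI)
    fix y assume y: "y \<in> space (lebesgue_on K)" and D: "norm (D y) \<le> \<Lambda>"
    have nf: "norm (?f y) \<le> (\<psi> y)\<^sup>2 * ?P' (u y) * norm (g y) + 2 * \<psi> y * ?P (u y) * \<Lambda>"
    proof -
      have "norm (?f y) \<le> norm (((\<psi> y)\<^sup>2 * ?P' (u y)) *\<^sub>R g y) + norm ((2 * \<psi> y * ?P (u y)) *\<^sub>R D y)"
        unfolding flux_def by (rule norm_triangle_ineq)
      also have "\<dots> = (\<psi> y)\<^sup>2 * ?P' (u y) * norm (g y) + 2 * \<psi> y * ?P (u y) * norm (D y)"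
        using cutoff_range[of y] ramp_bounds(1,5)[OF s] by (simp add: abs_mult)
      also have "\<dots> \<le> (\<psi> y)\<^sup>2 * ?P' (u y) * norm (g y) + 2 * \<psi> y * ?P (u y) * \<Lambda>"
        using cutoff_range[of y] ramp_bounds(5)[OF s] D by (intro add_left_mono mult_left_mono) auto
      finally show ?thesis .
    qed
    have i: "?P' (u y) \<le> indicat_real ?S y"
      using ramp_bounds(2,4)[OF s] y by (cases "a < u y") auto
    show "N * norm (?f y) \<le> lam / 4 * ?X y + (N\<^sup>2 / lam + N\<^sup>2) * indicator ?S y + \<Lambda>\<^sup>2 * ?V y"
      by (rule source_bound_real[OF ramp_bounds(1)[OF s] i _ ramp_bounds(5,6)[OF s] _ _ _ lam nf N \<Lambda>(1)])
         (use cutoff_range[of y] in \<open>auto simp: indicator_def\<close>)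
  qed
  have Xi: "integrable (lebesgue_on K) ?X" by (rule integrable_ramp_X[OF s])
  have Vi: "integrable (lebesgue_on K) ?V" by (rule integrable_positive_part)
  have Si: "integrable (lebesgue_on K) (indicat_real ?S)" and Sv: "(LINT y|lebesgue_on K. indicator ?S y) = measure lebesgue ?S"
    using integral_indicator_K[of ?S] superlevel_sets by auto
  let ?x = "LINT y|lebesgue_on K. ?X y" and ?v = "LINT y|lebesgue_on K. ?V y" and ?m = "measure lebesgue ?S"
  have "3 / 4 * lam * ?x - 4 * ?k\<^sup>2 / lam * ?v = (LINT y|lebesgue_on K. 3 / 4 * lam * ?X y - 4 * ?k\<^sup>2 / lam * ?V y)"
    using Xi Vi by simp
  also have "\<dots> \<le> (LINT y|lebesgue_on K. (M y *v g y) \<bullet> (M y *v ?f y))"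
    by (rule integral_mono_AE[OF _ EL(2) p1]) (intro Bochner_Integration.integrable_diff integrable_mult_right Xi Vi)
  also have "\<dots> \<le> N * (LINT y|lebesgue_on K. norm (?f y))" by (rule EL(1))
  also have "\<dots> = (LINT y|lebesgue_on K. N * norm (?f y))" by simp
  also have "\<dots> \<le> (LINT y|lebesgue_on K. lam / 4 * ?X y + (N\<^sup>2 / lam + N\<^sup>2) * indicator ?S y + \<Lambda>\<^sup>2 * ?V y)"
    by (rule integral_mono_AE[OF integrable_mult_right[OF EL(3)] _ p2])
       (intro Bochner_Integration.integrable_add integrable_mult_right Xi Vi Si)
  also have "\<dots> = lam / 4 * ?x + (N\<^sup>2 / lam + N\<^sup>2) * ?m + \<Lambda>\<^sup>2 * ?v"
    using Xi Vi Si Sv by simp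
  finally have mn: "3 / 4 * lam * ?x - 4 * ?k\<^sup>2 / lam * ?v \<le> lam / 4 * ?x + (N\<^sup>2 / lam + N\<^sup>2) * ?m + \<Lambda>\<^sup>2 * ?v" .
  have absorb: "lam / 2 * p \<le> b * q + (e + c) * r" if "3 / 4 * lam * p - c * r \<le> lam / 4 * p + b * q + e * r" for p c r b q e :: real
    using that by (simp add: algebra_simps)
  have main: "lam / 2 * ?x \<le> (N\<^sup>2 / lam + N\<^sup>2) * ?m + (\<Lambda>\<^sup>2 + 4 * ?k\<^sup>2 / lam) * ?v" by (rule absorb[OF mn])
  have v0: "0 \<le> ?v" by (intro integral_nonneg_AE AE_I2) auto
  have L2: "1 \<le> \<Lambda>\<^sup>2" using \<Lambda> by (simp add: one_le_power)
  have "(N\<^sup>2 / lam + N\<^sup>2) \<le> C0 * 1" using lam by (simp add: C0_def)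
  also have "\<dots> \<le> C0 * \<Lambda>\<^sup>2" using L2 C0_pos by (intro mult_left_mono) auto
  finally have a1: "(N\<^sup>2 / lam + N\<^sup>2) * ?m \<le> C0 * \<Lambda>\<^sup>2 * ?m" by (intro mult_right_mono) auto
  have "\<Lambda>\<^sup>2 + 4 * ?k\<^sup>2 / lam = (1 + 4 * KM ^ 4 / lam) * \<Lambda>\<^sup>2"
    by (simp add: power_mult_distrib algebra_simps power2_eq_square eval_nat_numeral)
  also have "\<dots> \<le> C0 * \<Lambda>\<^sup>2" using lam by (intro mult_right_mono) (auto simp: C0_def)
  finally have a2: "(\<Lambda>\<^sup>2 + 4 * ?k\<^sup>2 / lam) * ?v \<le> C0 * \<Lambda>\<^sup>2 * ?v" using v0 by (intro mult_right_mono) auto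
  have fin: "p \<le> 2 * c / lam * l * (q + r)" if "lam / 2 * p \<le> c * l * q + c * l * r" for p c l q r :: real
    using that lam by (simp add: field_simps)
  show ?thesis by (rule fin[OF order.trans[OF main add_mono[OF a1 a2]]])
qed

text \<open>The levels are k, k + \<delta>/2 and k + \<delta>. Chebyshev from \<open>k\<close> makes
  the top superlevel set small, so that the gain applies to it. The gradient there is bounded by the
  energy of a ramp that starts at the middle level and has slope 1 beyond the top one; the measure
  term of that energy is again controlled by Chebyshev from \<open>k\<close>.\<close>

lemma de_giorgi_step:
  assumes \<delta>: "0 < \<delta>" "\<delta> \<le> 1" and \<eta>: "0 < \<eta>" "\<eta> \<le> \<eta>max"
    and small: "(LINT y|lebesgue_on K. (max 0 (u y - k))\<^sup>2) \<le> \<eta> * measure lebesgue B * \<delta>\<^sup>2"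
  shows "(LINT y|lebesgue_on K. (\<psi> y)\<^sup>2 * (max 0 (u y - (k + \<delta>)))\<^sup>2) \<le>
     R \<eta> * (C2 * \<Lambda>\<^sup>2 / \<delta>\<^sup>2 * (LINT y|lebesgue_on K. (max 0 (u y - k))\<^sup>2))"
proof -
  let ?V = "LINT y|lebesgue_on K. (max 0 (u y - k))\<^sup>2"
  define \<kappa> where "\<kappa> = k + \<delta>"
  define q where "q t = (max 0 (t - \<kappa>))\<^sup>2" for t :: real
  define q' where "q' t = 2 * max 0 (t - \<kappa>)" for t :: real
  let ?X = "\<lambda>y. (\<psi> y)\<^sup>2 * ramp' (k + \<delta>/2) (\<delta>/2) (u y) * (norm (g y))\<^sup>2"
  let ?E = "{y \<in> K. \<kappa> < u y}"
  have s: "0 < \<delta> / 2" using \<delta> by simp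
  have \<Lambda>: "1 \<le> \<Lambda>" "0 \<le> \<Lambda>" using cutoff_Lambda by auto
  have V0: "0 \<le> ?V" by (intro integral_nonneg_AE AE_I2) auto
  have "measure lebesgue ?E \<le> ?V / \<delta>\<^sup>2" using markov[of k \<kappa>] \<delta> by (simp add: \<kappa>_def)
  also have "\<dots> \<le> \<eta> * measure lebesgue B" using small \<delta> by (simp add: field_simps)
  finally have mE: "measure lebesgue ?E \<le> \<eta> * measure lebesgue B" .
  have EK: "?E \<subseteq> K" by auto
  have GL: "(LINT y|lebesgue_on K. indicator ?E y * ((\<psi> y)\<^sup>2 * q (u y))) \<le> R \<eta> * (LINT y|lebesgue_on K. norm (flux q q' (u y) (g y) y))"
    "integrable (lebesgue_on K) (\<lambda>y. norm (flux q q' (u y) (g y) y))"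
    using gain_limit[OF superlevel_sets(1) EK \<eta> mE, of \<kappa>] by (simp_all add: q_def[abs_def] q'_def[abs_def])
  have "(LINT y|lebesgue_on K. (\<psi> y)\<^sup>2 * (max 0 (u y - (k + \<delta>)))\<^sup>2) = (LINT y|lebesgue_on K. indicator ?E y * ((\<psi> y)\<^sup>2 * q (u y)))"
  proof (rule Bochner_Integration.integral_cong[OF refl])
    fix y assume "y \<in> space (lebesgue_on K)"
    then have "y \<in> K" by simp
    then show "(\<psi> y)\<^sup>2 * (max 0 (u y - (k + \<delta>)))\<^sup>2 = indicator ?E y * ((\<psi> y)\<^sup>2 * q (u y))"
      by (cases "\<kappa> < u y") (auto simp: q_def \<kappa>_def)
  qed
  also have "\<dots> \<le> R \<eta> * (LINT y|lebesgue_on K. norm (flux q q' (u y) (g y) y))" by (rule GL(1))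
  also have "\<dots> \<le> R \<eta> * (C2 * \<Lambda>\<^sup>2 / \<delta>\<^sup>2 * ?V)"
  proof (rule mult_left_mono[OF _ R0])
    have "AE y in lebesgue_on K. norm (flux q q' (u y) (g y) y) \<le> ?X y + (1 + 2 * \<Lambda>) * (max 0 (u y - k))\<^sup>2"
      using D_bound
    proof eventually_elim
      case (elim y)
      define v where "v = max 0 (u y - \<kappa>)"
      have v: "0 \<le> v" "v \<le> max 0 (u y - k)" using \<delta> by (auto simp: v_def \<kappa>_def)
      have \<psi>: "0 \<le> \<psi> y" "\<psi> y \<le> 1" using cutoff_range by auto
      have X0: "0 \<le> ?X y" using ramp_bounds(1)[OF s] by simp
      have "norm (flux q q' (u y) (g y) y) \<le> norm (((\<psi> y)\<^sup>2 * (2 * v)) *\<^sub>R g y) + norm ((2 * \<psi> y * v\<^sup>2) *\<^sub>R D y)"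
        unfolding flux_def q_def q'_def v_def[symmetric] by (rule norm_triangle_ineq)
      also have "\<dots> = (\<psi> y)\<^sup>2 * (2 * v * norm (g y)) + (2 * \<psi> y * v\<^sup>2) * norm (D y)"
        using \<psi> v by (simp add: abs_mult)
      also have "\<dots> \<le> (?X y + v\<^sup>2) + (2 * 1 * v\<^sup>2) * \<Lambda>"
      proof (rule add_mono)
        show "(2 * \<psi> y * v\<^sup>2) * norm (D y) \<le> (2 * 1 * v\<^sup>2) * \<Lambda>"
          using \<psi> elim by (intro mult_mono) auto
        show "(\<psi> y)\<^sup>2 * (2 * v * norm (g y)) \<le> ?X y + v\<^sup>2"
        proof (cases "v = 0")
          case False
          then have "\<kappa> < u y" by (auto simp: v_def)
          then have r1: "ramp' (k + \<delta>/2) (\<delta>/2) (u y) = 1" by (intro ramp_bounds(3)[OF s]) (simp add: \<kappa>_def)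
          have "2 * v * norm (g y) \<le> v\<^sup>2 + (norm (g y))\<^sup>2"
            using zero_le_power2[of "v - norm (g y)"] by (simp add: power2_eq_square algebra_simps)
          then have "(\<psi> y)\<^sup>2 * (2 * v * norm (g y)) \<le> (\<psi> y)\<^sup>2 * (v\<^sup>2 + (norm (g y))\<^sup>2)" by (intro mult_left_mono) auto
          moreover have "(\<psi> y)\<^sup>2 * v\<^sup>2 \<le> 1 * v\<^sup>2" using \<psi> by (intro mult_right_mono) (auto simp: power_le_one)
          ultimately show ?thesis by (simp add: r1 distrib_left)
        qed (use X0 in simp)
      qed
      also have "\<dots> = ?X y + (1 + 2 * \<Lambda>) * v\<^sup>2" by (simp add: algebra_simps)
      also have "\<dots> \<le> ?X y + (1 + 2 * \<Lambda>) * (max 0 (u y - k))\<^sup>2"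
        using v \<Lambda> by (intro add_left_mono mult_left_mono power_mono) auto
      finally show ?case .
    qed
    then have "(LINT y|lebesgue_on K. norm (flux q q' (u y) (g y) y)) \<le> (LINT y|lebesgue_on K. ?X y + (1 + 2 * \<Lambda>) * (max 0 (u y - k))\<^sup>2)"
      by (intro integral_mono_AE GL(2) Bochner_Integration.integrable_add integrable_mult_right integrable_ramp_X[OF s] integrable_positive_part)
    also have "\<dots> = (LINT y|lebesgue_on K. ?X y) + (1 + 2 * \<Lambda>) * ?V"
      using integrable_ramp_X[OF s] integrable_positive_part by simp
    also have "(LINT y|lebesgue_on K. ?X y) \<le> 2 * C0 / lam * \<Lambda>\<^sup>2 * (4 * ?V / \<delta>\<^sup>2 + ?V / \<delta>\<^sup>2)"
    proof (rule order.trans[OF caccioppoli[OF s]], rule mult_left_mono[OF add_mono])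
      have e: "(\<delta> / 2)\<^sup>2 = \<delta>\<^sup>2 / 4" by (simp add: power_divide)
      have "measure lebesgue {y \<in> K. k + \<delta> / 2 < u y} \<le> ?V / (\<delta> / 2)\<^sup>2" using markov[of k "k + \<delta>/2"] \<delta> by simp
      then show "measure lebesgue {y \<in> K. k + \<delta> / 2 < u y} \<le> 4 * ?V / \<delta>\<^sup>2" unfolding e by (simp add: mult.commute)
      have "(LINT y|lebesgue_on K. (max 0 (u y - (k + \<delta> / 2)))\<^sup>2) \<le> ?V"
        using \<delta> by (intro integral_mono integrable_positive_part power_mono) auto
      also have "?V \<le> ?V / \<delta>\<^sup>2"
        using V0 \<delta> by (simp add: le_divide_eq mult_left_le power_le_one)
      finally show "(LINT y|lebesgue_on K. (max 0 (u y - (k + \<delta> / 2)))\<^sup>2) \<le> ?V / \<delta>\<^sup>2" .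
      show "0 \<le> 2 * C0 / lam * \<Lambda>\<^sup>2" using C0_pos lam by simp
    qed
    also have "(1 + 2 * \<Lambda>) * ?V \<le> 3 * \<Lambda>\<^sup>2 * (?V / \<delta>\<^sup>2)"
    proof (rule mult_mono)
      have "\<Lambda> * 1 \<le> \<Lambda> * \<Lambda>" using \<Lambda> by (intro mult_left_mono) auto
      then show "1 + 2 * \<Lambda> \<le> 3 * \<Lambda>\<^sup>2" using \<Lambda>(1) unfolding power2_eq_square by linarith
      show "?V \<le> ?V / \<delta>\<^sup>2" using V0 \<delta> by (simp add: le_divide_eq mult_left_le power_le_one)
    qed (use V0 in auto)
    also have "2 * C0 / lam * \<Lambda>\<^sup>2 * (4 * ?V / \<delta>\<^sup>2 + ?V / \<delta>\<^sup>2) + 3 * \<Lambda>\<^sup>2 * (?V / \<delta>\<^sup>2) = C2 * \<Lambda>\<^sup>2 / \<delta>\<^sup>2 * ?V"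
      using lam \<delta> by (simp add: C2_def field_simps)
    finally show "(LINT y|lebesgue_on K. norm (flux q q' (u y) (g y) y)) \<le> C2 * \<Lambda>\<^sup>2 / \<delta>\<^sup>2 * ?V" by simp
  qed
  finally show ?thesis .
qed

end

section \<open>Iteration along shrinking cutoffs and rising levels\<close>

context energy_setting
begin

text \<open>The levels rise from n to n + 1, with n so large that the first integral is below the
  threshold of \<open>de_giorgi_sequence\<close>. By \<open>nest\<close> each cutoff equals 1 on the
  next support, so the weighted integral in \<open>de_giorgi_step\<close> dominates the next
  term.\<close>

lemma AE_bounded_above:
  fixes \<psi> :: "nat \<Rightarrow> real^'n \<Rightarrow> real"
  assumes cut: "\<And>j. 1 \<le> j \<Longrightarrow> cutoff A B (\<psi> j) (\<Lambda>0 * (real j)\<^sup>2)"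
    and nest: "\<And>j y. 1 \<le> j \<Longrightarrow> y \<in> supp (\<psi> (Suc j)) \<Longrightarrow> \<psi> j y = 1"
    and \<Lambda>0: "1 \<le> \<Lambda>0"
    and Rexp: "\<And>\<eta>. R \<eta> = CG * exp (- sqrt (ln (1 / \<eta>)))" and CG: "0 < CG"
    and Bpos: "0 < measure lebesgue B" and \<eta>max: "0 < \<eta>max"
    and S: "S \<in> sets lebesgue" "\<And>j. 1 \<le> j \<Longrightarrow> S \<subseteq> supp (\<psi> j)"
  shows "\<exists>c. AE y in lebesgue_on S. u y \<le> c"
proof -
  have ce: "cutoff_energy \<Omega> B A M u g L lam KM N R \<eta>max (\<psi> j) (\<Lambda>0 * (real j)\<^sup>2)" if "1 \<le> j" for j
    by (intro cutoff_energy.intro cut that energy_setting_axioms)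
  define V where "V j k = (LINT y|lebesgue_on (supp (\<psi> j)). (max 0 (u y - k))\<^sup>2)" for j k
  note int = cutoff_energy.integrable_positive_part[OF ce] and Ks = cutoff_energy.K(4)[OF ce]
  have V0: "0 \<le> V j k" for j k unfolding V_def by (intro integral_nonneg_AE AE_I2) auto
  have sub: "supp (\<psi> (Suc j)) \<subseteq> supp (\<psi> j)" if "1 \<le> j" for j
    using nest[OF that] eq_0_outside_supp[of _ "\<psi> j"] by fastforce
  have Vmono: "V (Suc j) k' \<le> V j k" if "1 \<le> j" "k \<le> k'" for j k k'
    unfolding V_def using that
    by (intro integral_lebesgue_on_mono_set sub Ks int power_mono max.mono) auto
  define C where "C = 4 * CG * C2 * \<Lambda>0\<^sup>2"
  have C: "0 < C" using CG C2_pos \<Lambda>0 by (simp add: C_def)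
  let ?b = "measure lebesgue B"
  obtain \<epsilon>0 where \<epsilon>0: "0 < \<epsilon>0" and conv: "\<And>U :: nat \<Rightarrow> real. (\<forall>j\<ge>1. 0 \<le> U j) \<and> (\<forall>j\<ge>1. U (Suc j) \<le> U j) \<and>
      (\<forall>j\<ge>1. 0 < U j \<and> 4 * real j ^ 4 * U j / ?b \<le> \<eta>max \<longrightarrow>
         U (Suc j) \<le> C * real j ^ 8 * exp (- sqrt (ln (?b / (4 * real j ^ 4 * U j)))) * U j) \<and>
      U 1 \<le> \<epsilon>0 \<Longrightarrow> U \<longlonglongrightarrow> 0"
    using de_giorgi_sequence[OF C Bpos \<eta>max] by blast
  have "(\<lambda>n. V 1 (real n)) \<longlonglongrightarrow> (LINT y|lebesgue_on (supp (\<psi> 1)). 0)"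
    unfolding V_def
  proof (rule integral_dominated_convergence[where w="\<lambda>y. (max 0 (u y - 0))\<^sup>2"])
    show "integrable (lebesgue_on (supp (\<psi> 1))) (\<lambda>y. (max 0 (u y - 0))\<^sup>2)" by (rule int) simp
    show "(\<lambda>y. (max 0 (u y - real n))\<^sup>2) \<in> borel_measurable (lebesgue_on (supp (\<psi> 1)))" for n
      using int[of 1 "real n"] by (rule borel_measurable_integrable) simp
    show "AE y in lebesgue_on (supp (\<psi> 1)). (\<lambda>n. (max 0 (u y - real n))\<^sup>2) \<longlonglongrightarrow> 0"
    proof (intro AE_I2 tendsto_eventually)
      fix y
      obtain n0 :: nat where n0: "u y \<le> real n0" using real_arch_simple by blast
      then show "\<forall>\<^sub>F n in sequentially. (max 0 (u y - real n))\<^sup>2 = 0"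
        by (intro eventually_mono[OF eventually_ge_at_top[of n0]]) simp
    qed
    show "AE y in lebesgue_on (supp (\<psi> 1)). norm ((max 0 (u y - real n))\<^sup>2) \<le> (max 0 (u y - 0))\<^sup>2" for n
      by (intro AE_I2) (auto intro!: power_mono)
  qed simp
  then have "(\<lambda>n. V 1 (real n)) \<longlonglongrightarrow> 0" by simp
  then have "\<forall>\<^sub>F n in sequentially. V 1 (real n) < \<epsilon>0" using \<epsilon>0 by (rule order_tendstoD(2))
  then obtain n where n: "V 1 (real n) < \<epsilon>0" by (meson eventually_happens sequentially_bot)
  \<comment> \<open>Consecutive levels differ by 1/(j(j+1)), which is \<open>\<delta>\<close> below;
    its inverse square is at most 4 j^4. Together with j^4 from the squared gradient bound of the
    cutoff this gives the power 8 and the 4 in \<open>C\<close>.\<close>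
  define k where "k j = real n + 1 - 1 / real j" for j
  define U where "U j = V j (k j)" for j
  have kmono: "k j \<le> k (Suc j)" if "1 \<le> j" for j using that by (simp add: k_def frac_le)
  have "U \<longlonglongrightarrow> 0"
  proof (rule conv, intro conjI allI impI; (elim conjE)?)
    show "0 \<le> U j" for j by (simp add: U_def V0)
    show "U (Suc j) \<le> U j" if "1 \<le> j" for j unfolding U_def using that by (intro Vmono kmono)
    show "U 1 \<le> \<epsilon>0" using n by (simp add: U_def k_def)
    fix j :: nat
    assume j: "1 \<le> j" and Uj: "0 < U j" and small: "4 * real j ^ 4 * U j / ?b \<le> \<eta>max"
    \<comment> \<open>Chosen so that Chebyshev's bound, the integral divided by the squared gap, is
      at most \<eta> times the measure of \<open>B\<close>.\<close>
    define \<eta> where "\<eta> = 4 * real j ^ 4 * U j / ?b"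
    define \<delta> where "\<delta> = 1 / (real j * (real j + 1))"
    have j1: "1 \<le> real j" using j by simp
    have \<delta>: "0 < \<delta>" "\<delta> \<le> 1" using j1 by (auto simp: \<delta>_def divide_le_eq_1 mult_ge1_I)
    have \<eta>: "0 < \<eta>" "\<eta> \<le> \<eta>max" using Uj j Bpos small by (auto simp: \<eta>_def)
    have k\<delta>: "k j + \<delta> = k (Suc j)" using j by (simp add: k_def \<delta>_def divide_simps) (simp add: algebra_simps)
    have jj: "(real j + 1)\<^sup>2 \<le> 4 * (real j)\<^sup>2"
      using power_mono[of "real j + 1" "2 * real j" 2] j1 by (simp add: power_mult_distrib)
    have \<delta>2: "1 / \<delta>\<^sup>2 = (real j)\<^sup>2 * (real j + 1)\<^sup>2" using j1 by (simp add: \<delta>_def power_divide power_mult_distrib)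
    have \<delta>i: "1 / \<delta>\<^sup>2 \<le> 4 * real j ^ 4"
    proof -
      have "1 / \<delta>\<^sup>2 \<le> (real j)\<^sup>2 * (4 * (real j)\<^sup>2)" unfolding \<delta>2 by (intro mult_left_mono jj) auto
      then show ?thesis by (simp add: eval_nat_numeral)
    qed
    have "V j (k j) \<le> \<eta> * ?b * \<delta>\<^sup>2"
    proof -
      have "1 \<le> 4 * real j ^ 4 * \<delta>\<^sup>2" using \<delta>i \<delta> by (simp add: field_simps)
      then have "U j * 1 \<le> U j * (4 * real j ^ 4 * \<delta>\<^sup>2)" using Uj by (intro mult_left_mono) auto
      also have "\<dots> = \<eta> * ?b * \<delta>\<^sup>2" using Bpos by (simp add: \<eta>_def)
      finally show ?thesis by (simp add: U_def)
    qed
    then have step: "(LINT y|lebesgue_on (supp (\<psi> j)). (\<psi> j y)\<^sup>2 * (max 0 (u y - (k j + \<delta>)))\<^sup>2) \<le>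
        R \<eta> * (C2 * (\<Lambda>0 * (real j)\<^sup>2)\<^sup>2 / \<delta>\<^sup>2 * V j (k j))"
      unfolding V_def by (intro cutoff_energy.de_giorgi_step[OF ce[OF j] \<delta> \<eta>])
    have i\<psi>: "integrable (lebesgue_on (supp (\<psi> j))) (\<lambda>y. (\<psi> j y)\<^sup>2 * (max 0 (u y - (k j + \<delta>)))\<^sup>2)"
    proof (rule Bochner_Integration.integrable_bound[OF int[OF j, of "k j + \<delta>"]])
      have [measurable]: "\<psi> j \<in> borel_measurable (lebesgue_on (supp (\<psi> j)))" "u \<in> borel_measurable (lebesgue_on (supp (\<psi> j)))"
        by (rule cutoff_energy.cutoff_measurable[OF ce[OF j]]) (rule cutoff_energy.u_measurable[OF ce[OF j]])
      show "(\<lambda>y. (\<psi> j y)\<^sup>2 * (max 0 (u y - (k j + \<delta>)))\<^sup>2) \<in> borel_measurable (lebesgue_on (supp (\<psi> j)))" by measurable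
      have "(\<psi> j y)\<^sup>2 * t\<^sup>2 \<le> 1 * t\<^sup>2" for y t
        using cutoff.cutoff_range[OF cut[OF j], of y] by (intro mult_right_mono) (auto simp: power_le_one)
      then show "AE y in lebesgue_on (supp (\<psi> j)). norm ((\<psi> j y)\<^sup>2 * (max 0 (u y - (k j + \<delta>)))\<^sup>2) \<le> norm ((max 0 (u y - (k j + \<delta>)))\<^sup>2)"
        by (intro AE_I2) simp
    qed
    have "U (Suc j) \<le> (LINT y|lebesgue_on (supp (\<psi> j)). (\<psi> j y)\<^sup>2 * (max 0 (u y - (k j + \<delta>)))\<^sup>2)"
      unfolding U_def V_def k\<delta>[symmetric] using j nest[OF j]
      by (intro integral_lebesgue_on_mono_set sub Ks i\<psi> int) auto
    also note step
    also have "R \<eta> * (C2 * (\<Lambda>0 * (real j)\<^sup>2)\<^sup>2 / \<delta>\<^sup>2 * V j (k j)) =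
        (1 / \<delta>\<^sup>2) * (CG * C2 * \<Lambda>0\<^sup>2 * real j ^ 4 * exp (- sqrt (ln (1 / \<eta>))) * U j)"
      by (simp add: Rexp U_def power_mult_distrib mult_ac flip: power_mult)
    also have "\<dots> \<le> (4 * real j ^ 4) * (CG * C2 * \<Lambda>0\<^sup>2 * real j ^ 4 * exp (- sqrt (ln (1 / \<eta>))) * U j)"
      using Uj CG C2_pos by (intro mult_right_mono \<delta>i) auto
    also have "\<dots> = C * real j ^ 8 * exp (- sqrt (ln (?b / (4 * real j ^ 4 * U j)))) * U j"
      by (simp add: C_def \<eta>_def eval_nat_numeral mult_ac)
    finally show "U (Suc j) \<le> C * real j ^ 8 * exp (- sqrt (ln (?b / (4 * real j ^ 4 * U j)))) * U j" .
  qed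
  have S1: "S \<subseteq> supp (\<psi> 1)" using S(2)[of 1] by simp
  have SV: "integrable (lebesgue_on S) (\<lambda>y. (max 0 (u y - (real n + 1)))\<^sup>2)"
    by (rule integrable_lebesgue_on_mono[OF int[of 1] S(1) S1]) (use Ks[of 1] in auto)
  \<comment> \<open>All levels stay below n + 1 and \<open>S\<close> lies in every support, so this
    fixed integral is below each term of a sequence tending to 0.\<close>
  have "(LINT y|lebesgue_on S. (max 0 (u y - (real n + 1)))\<^sup>2) \<le> U j" if "1 \<le> j" for j
    unfolding U_def V_def using that
    by (intro integral_lebesgue_on_mono_set S SV Ks int power_mono max.mono) (auto simp: k_def)
  then have "(LINT y|lebesgue_on S. (max 0 (u y - (real n + 1)))\<^sup>2) \<le> 0"
    by (intro LIMSEQ_le_const[OF \<open>U \<longlonglongrightarrow> 0\<close>]) auto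
  then have "(LINT y|lebesgue_on S. (max 0 (u y - (real n + 1)))\<^sup>2) = 0"
    by (intro order.antisym integral_nonneg_AE AE_I2) auto
  then have "AE y in lebesgue_on S. (max 0 (u y - (real n + 1)))\<^sup>2 = 0"
    using integral_nonneg_eq_0_iff_AE[OF SV] by simp
  then have "AE y in lebesgue_on S. u y \<le> real n + 1" by eventually_elim (auto simp: max_def split: if_splits)
  then show ?thesis by blast
qed

end

section \<open>Admissible data and cutoffs\<close>

text \<open>Dividing \<open>w\<close> by the \<open>L\<^sup>1\<close> norm of its A-gradient puts it
  into the unit class, with the constant sequence as approximation; the suprema then bound both
  pairings.\<close>

lemma admissible_bound:
  fixes A :: "real^'n \<Rightarrow> real^'n^'n" and \<Omega> B :: "(real^'n) set" and \<phi>0 :: "real^'n \<Rightarrow> real" and \<phi>1 :: "real^'n \<Rightarrow> real^'n"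
  assumes adm: "X_norm B A \<phi>0 \<phi>1 < \<infinity>" and loc: "locally_integrable \<Omega> \<phi>0" "locally_integrable \<Omega> \<phi>1"
    and \<Omega>: "open \<Omega>" and lip: "L-lipschitz_on \<Omega> (\<lambda>y. mat_sqrt (A y))" and bd: "bounded ((\<lambda>y. mat_sqrt (A y)) ` \<Omega>)"
    and B: "open B" "B \<subseteq> \<Omega>"
    and poincare: "\<And>w. w \<in> Lip_c B \<Longrightarrow> (LINT y|lebesgue. \<bar>w y\<bar>) \<le> C * (LINT y|lebesgue. norm (grad_A A w y))"
  obtains N where "0 \<le> N"
    "\<And>w. w \<in> Lip_c B \<Longrightarrow> \<bar>rhs_form \<Omega> A \<phi>0 \<phi>1 w\<bar> \<le> N * (LINT y|lebesgue. norm (grad_A A w y))"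
proof -
  let ?S0 = "SUP (v, g) \<in> unit_W11_0 B A. ennreal \<bar>LINT y|lebesgue_on B. v y * \<phi>0 y\<bar>"
  let ?S1 = "SUP (v, g) \<in> unit_W11_0 B A. ennreal \<bar>LINT y|lebesgue_on B. g y \<bullet> \<phi>1 y\<bar>"
  define N0 where "N0 = enn2real ?S0"
  define N1 where "N1 = enn2real ?S1"
  have "?S0 + ?S1 < top" using adm by (simp add: X_norm_def)
  then have N: "?S0 = ennreal N0" "?S1 = ennreal N1" by (simp_all add: N0_def N1_def)
  have N0: "0 \<le> N0" "0 \<le> N1" by (simp_all add: N0_def N1_def)
  have bound: "\<bar>LINT y|lebesgue_on B. v y * \<phi>0 y\<bar> \<le> N0" "\<bar>LINT y|lebesgue_on B. g y \<bullet> \<phi>1 y\<bar> \<le> N1"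
    if "(v, g) \<in> unit_W11_0 B A" for v g
  proof -
    have "ennreal \<bar>LINT y|lebesgue_on B. v y * \<phi>0 y\<bar> \<le> ?S0" using SUP_upper[OF that, of "\<lambda>(v, g). ennreal \<bar>LINT y|lebesgue_on B. v y * \<phi>0 y\<bar>"] by simp
    then show "\<bar>LINT y|lebesgue_on B. v y * \<phi>0 y\<bar> \<le> N0" unfolding N(1) using N0 by simp
    have "ennreal \<bar>LINT y|lebesgue_on B. g y \<bullet> \<phi>1 y\<bar> \<le> ?S1" using SUP_upper[OF that, of "\<lambda>(v, g). ennreal \<bar>LINT y|lebesgue_on B. g y \<bullet> \<phi>1 y\<bar>"] by simp
    then show "\<bar>LINT y|lebesgue_on B. g y \<bullet> \<phi>1 y\<bar> \<le> N1" unfolding N(2) using N0 by simp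
  qed
  have Bs: "B \<in> sets lebesgue" and \<Omega>s: "\<Omega> \<in> sets lebesgue" using B \<Omega> by auto
  show ?thesis
  proof (rule that[of "N0 + N1"])
    show "0 \<le> N0 + N1" using N0 by simp
    fix w :: "real^'n \<Rightarrow> real" assume w: "w \<in> Lip_c B"
    let ?K = "supp w" and ?D = "grad_A A w"
    define c where "c = (LINT y|lebesgue. norm (?D y))"
    have K: "compact ?K" "?K \<subseteq> B" "?K \<subseteq> \<Omega>" using Lip_c_compact[OF w] Lip_c_supp[OF w] B by auto
    have Ks: "?K \<in> sets lebesgue" using lmeasurable_compact[OF K(1)] by auto
    have w\<Omega>: "w \<in> Lip_c \<Omega>" by (rule Lip_c_mono[OF B(2) w])
    have Di: "integrable lebesgue ?D" by (rule integrable_norm_grad_A[OF \<Omega> lip bd w\<Omega>])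
    have wi: "integrable lebesgue w" by (rule Lip_c_integrable[OF w])
    have c0: "0 \<le> c" unfolding c_def by (intro integral_nonneg_AE AE_I2) auto
    have \<phi>: "integrable (lebesgue_on ?K) \<phi>0" "integrable (lebesgue_on ?K) \<phi>1"
      using loc K unfolding locally_integrable_def by auto
    have [measurable]: "\<phi>0 \<in> borel_measurable (lebesgue_on ?K)" "\<phi>1 \<in> borel_measurable (lebesgue_on ?K)"
      using \<phi> by auto
    have [measurable]: "w \<in> borel_measurable (lebesgue_on ?K)" "?D \<in> borel_measurable (lebesgue_on ?K)"
      using integrable_lebesgue_on[OF wi Ks] integrable_lebesgue_on[OF Di Ks] by auto
    obtain k where k: "\<And>y. \<bar>w y\<bar> \<le> k" using Lip_c_bounded[OF w] by blast
    have i0: "integrable (lebesgue_on ?K) (\<lambda>y. \<phi>0 y * w y)"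
    proof (rule Bochner_Integration.integrable_bound)
      show "integrable (lebesgue_on ?K) (\<lambda>y. \<phi>0 y * k)" using \<phi>(1) by simp
      have "\<bar>\<phi>0 y\<bar> * \<bar>w y\<bar> \<le> \<bar>\<phi>0 y\<bar> * \<bar>k\<bar>" for y using k[of y] by (intro mult_left_mono) auto
      then show "AE y in lebesgue_on ?K. norm (\<phi>0 y * w y) \<le> norm (\<phi>0 y * k)"
        by (intro AE_I2) (simp add: abs_mult)
    qed measurable
    obtain l where l: "AE y in lebesgue. norm (?D y) \<le> l" using grad_A_bounded_AE[OF bd w\<Omega>] by blast
    have i1: "integrable (lebesgue_on ?K) (\<lambda>y. \<phi>1 y \<bullet> ?D y)"
    proof (rule Bochner_Integration.integrable_bound)
      show "integrable (lebesgue_on ?K) (\<lambda>y. norm (\<phi>1 y) * l)" using \<phi>(2) by simp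
      show "AE y in lebesgue_on ?K. norm (\<phi>1 y \<bullet> ?D y) \<le> norm (norm (\<phi>1 y) * l)"
        using AE_lebesgue_on[OF l Ks]
      proof eventually_elim
        case (elim y)
        have "\<bar>\<phi>1 y \<bullet> ?D y\<bar> \<le> norm (\<phi>1 y) * norm (?D y)" by (rule Cauchy_Schwarz_ineq2)
        also have "\<dots> \<le> norm (\<phi>1 y) * \<bar>l\<bar>" using elim by (intro mult_left_mono) auto
        finally show ?case by (simp add: abs_mult)
      qed
    qed measurable
    have D0: "y \<notin> ?K \<Longrightarrow> ?D y = 0" and w0: "y \<notin> ?K \<Longrightarrow> w y = 0" for y
      by (rule grad_A_eq_0_outside_supp, assumption) (rule eq_0_outside_supp)
    define I0 where "I0 = (LINT y|lebesgue_on ?K. \<phi>0 y * w y)"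
    define I1 where "I1 = (LINT y|lebesgue_on ?K. \<phi>1 y \<bullet> ?D y)"
    have rhs: "rhs_form \<Omega> A \<phi>0 \<phi>1 w = I0 + I1"
    proof -
      have "rhs_form \<Omega> A \<phi>0 \<phi>1 w = (LINT y|lebesgue_on ?K. \<phi>0 y * w y + \<phi>1 y \<bullet> ?D y)"
        unfolding rhs_form_def by (rule integral_lebesgue_on_subset[OF K(3) Ks \<Omega>s]) (simp add: D0 w0)
      then show ?thesis using i0 i1 by (simp add: I0_def I1_def)
    qed
    have "\<bar>I0\<bar> \<le> N0 * c \<and> \<bar>I1\<bar> \<le> N1 * c"
    proof (cases "c = 0")
      \<comment> \<open>No normalisation is possible here. The Poincare inequality forces
        \<open>w = 0\<close> almost everywhere, so both pairings vanish.\<close>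
      case True
      have "AE y in lebesgue. norm (?D y) = 0"
        using integral_nonneg_eq_0_iff_AE[OF integrable_norm[OF Di]] True by (simp add: c_def)
      from AE_lebesgue_on[OF this Ks] have "AE y in lebesgue_on ?K. \<phi>1 y \<bullet> ?D y = 0" by eventually_elim simp
      then have I1: "I1 = 0" unfolding I1_def by (rule integral_eq_zero_AE)
      have "(LINT y|lebesgue. \<bar>w y\<bar>) = 0"
        using poincare[OF w] True by (intro order.antisym integral_nonneg_AE AE_I2) (auto simp: c_def)
      then have "AE y in lebesgue. \<bar>w y\<bar> = 0"
        using integral_nonneg_eq_0_iff_AE[OF integrable_abs[OF wi]] by simp
      from AE_lebesgue_on[OF this Ks] have "AE y in lebesgue_on ?K. \<phi>0 y * w y = 0" by eventually_elim simp
      then have "I0 = 0" unfolding I0_def by (rule integral_eq_zero_AE)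
      then show ?thesis using I1 True by simp
    next
      case False
      then have c: "0 < c" using c0 by simp
      let ?v = "\<lambda>y. (1 / c) * w y"
      have s: "0 < 1 / c" using c by simp
      note v = grad_A_scale[OF s w]
      let ?G = "grad_A A ?v"
      have Gi: "integrable lebesgue ?G" by (rule integrable_norm_grad_A[OF \<Omega> lip bd Lip_c_mono[OF B(2) v(1)]])
      have G: "AE y in lebesgue. ?G y = (1 / c) *\<^sub>R ?D y" by (rule v(2))
      have supv: "supp ?v = ?K" using c by (simp add: supp_def)
      have G0: "y \<notin> ?K \<Longrightarrow> ?G y = 0" for y using grad_A_eq_0_outside_supp[of y ?v A] supv by simp
      have nG: "(LINT y|lebesgue_on B. norm (?G y)) = 1"
      proof -
        have "(LINT y|lebesgue_on B. norm (?G y)) = (LINT y|lebesgue. norm (?G y))"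
        proof (rule integral_lebesgue_eq_lebesgue_on[OF Bs, symmetric])
          fix z assume "z \<notin> B"
          then have "z \<notin> ?K" using K(2) by blast
          then show "norm (?G z) = 0" by (simp only: G0[OF \<open>z \<notin> ?K\<close>] norm_zero)
        qed
        also have "\<dots> = (LINT y|lebesgue. (1 / c) * norm (?D y))"
        proof (rule integral_cong_AE)
          show "AE y in lebesgue. norm (?G y) = (1 / c) * norm (?D y)" using G c by (auto elim!: AE_mp)
        qed (use Gi Di in auto)
        also have "\<dots> = (1 / c) * c" by (simp add: c_def)
        finally show ?thesis using c by simp
      qed
      have "W11_0 B A ?v ?G"
        unfolding W11_0_def
      proof (intro conjI exI allI)
        show "integrable (lebesgue_on B) ?v" by (rule integrable_lebesgue_on[OF Lip_c_integrable[OF v(1)] Bs])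
        show "integrable (lebesgue_on B) ?G" by (rule integrable_lebesgue_on[OF Gi Bs])
        show "?v \<in> Lip_c B" by (rule v(1))
      qed simp
      then have un: "(?v, ?G) \<in> unit_W11_0 B A" using nG by (simp add: unit_W11_0_def)
      have "(LINT y|lebesgue_on B. ?v y * \<phi>0 y) = (LINT y|lebesgue_on ?K. ?v y * \<phi>0 y)"
        by (rule integral_lebesgue_on_subset[OF K(2) Ks Bs]) (simp add: w0)
      also have "\<dots> = (LINT y|lebesgue_on ?K. (1 / c) * (\<phi>0 y * w y))"
        by (intro Bochner_Integration.integral_cong refl) simp
      also have "\<dots> = (1 / c) * I0" unfolding I0_def by (rule integral_mult_right_zero)
      finally have b0: "\<bar>I0\<bar> / c \<le> N0" using bound(1)[OF un] c by (simp add: abs_mult)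
      have "(LINT y|lebesgue_on B. ?G y \<bullet> \<phi>1 y) = (LINT y|lebesgue_on ?K. ?G y \<bullet> \<phi>1 y)"
      proof (rule integral_lebesgue_on_subset[OF K(2) Ks Bs])
        show "?G z \<bullet> \<phi>1 z = 0" if "z \<notin> ?K" for z by (simp only: G0[OF that] inner_zero_left)
      qed
      also have "\<dots> = (LINT y|lebesgue_on ?K. (1 / c) * (\<phi>1 y \<bullet> ?D y))"
      proof (rule integral_cong_AE)
        have [measurable]: "?G \<in> borel_measurable (lebesgue_on ?K)" using integrable_lebesgue_on[OF Gi Ks] by auto
        show "(\<lambda>y. ?G y \<bullet> \<phi>1 y) \<in> borel_measurable (lebesgue_on ?K)" by measurable
        show "(\<lambda>y. (1 / c) * (\<phi>1 y \<bullet> ?D y)) \<in> borel_measurable (lebesgue_on ?K)" by measurable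
        show "AE y in lebesgue_on ?K. ?G y \<bullet> \<phi>1 y = (1 / c) * (\<phi>1 y \<bullet> ?D y)"
          using AE_lebesgue_on[OF G Ks] by eventually_elim (simp add: inner_commute)
      qed
      also have "\<dots> = (1 / c) * I1" unfolding I1_def by (rule integral_mult_right_zero)
      finally have "\<bar>I1\<bar> / c \<le> N1" using bound(2)[OF un] c by (simp add: abs_mult)
      then show ?thesis using b0 c by (simp add: field_simps)
    qed
    then show "\<bar>rhs_form \<Omega> A \<phi>0 \<phi>1 w\<bar> \<le> (N0 + N1) * (LINT y|lebesgue. norm (?D y))"
      unfolding rhs c_def[symmetric] distrib_right by linarith
  qed
qed

text \<open>The sign of \<open>c\<close> is not part of the definition of the cutoffs. If
  \<open>c\<close> were not positive, the radii would be nondecreasing and could not tend to \<nu>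
  r, which is less than r; so they decrease strictly.\<close>

lemma cutoff_radii:
  fixes rr :: "nat \<Rightarrow> real"
  assumes r: "rr 1 = r" "0 < r" and \<nu>: "0 < \<nu>" "\<nu> < 1" and lim: "rr \<longlonglongrightarrow> \<nu> * r"
    and step: "\<And>j. 1 \<le> j \<Longrightarrow> rr j - rr (Suc j) = c / (real j)\<^sup>2 * (1 - \<nu>) * r"
    and j: "1 \<le> j"
  shows "\<nu> * r < rr j" "rr j \<le> r"
proof -
  have c: "0 < c"
  proof (rule ccontr)
    assume "\<not> 0 < c"
    then have inc: "rr j \<le> rr (Suc j)" if "1 \<le> j" for j
    proof -
      have "c / (real j)\<^sup>2 * (1 - \<nu>) * r \<le> 0"
        using \<open>\<not> 0 < c\<close> \<nu> r by (intro mult_nonpos_nonneg divide_nonpos_nonneg) auto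
      then show ?thesis using step[OF that] by simp
    qed
    have "r \<le> rr j" if "1 \<le> j" for j
      using that
    proof (induction j rule: dec_induct)
      case base show ?case using r(1) by simp
    next
      case (step n) then show ?case using inc[of n] by linarith
    qed
    then have "r \<le> \<nu> * r" by (intro LIMSEQ_le_const[OF lim]) auto
    then show False using r \<nu> by (simp add: mult_le_cancel_right)
  qed
  have dec: "rr (Suc j) < rr j" if "1 \<le> j" for j
  proof -
    have "0 < c / (real j)\<^sup>2 * (1 - \<nu>) * r" using c \<nu> r that by (intro mult_pos_pos divide_pos_pos) auto
    then show ?thesis using step[OF that] by simp
  qed
  have le: "rr k \<le> rr i" if "1 \<le> i" "i \<le> k" for i k
    using that(2)
  proof (induction k rule: dec_induct)
    case (step n) then show ?case using dec[of n] that(1) by linarith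
  qed simp
  show "rr j \<le> r" using le[of 1 j] j r by simp
  have "\<nu> * r \<le> rr (Suc j)"
    using le[of "Suc j"] by (intro LIMSEQ_le_const2[OF lim]) auto
  then show "\<nu> * r < rr j" using dec[OF j] by simp
qed

text \<open>Nothing relates \<open>d\<close> to the Euclidean topology, so both the openness of the
  metric ball and a Euclidean neighbourhood of \<open>x\<close> are extracted from the cutoffs, as
  sets where a continuous cutoff is positive.\<close>

lemma standard_cutoffs_family:
  fixes A :: "real^'n \<Rightarrow> real^'n^'n" and \<Omega> :: "(real^'n) set" and d :: "real^'n \<Rightarrow> real^'n \<Rightarrow> real" and x :: "real^'n"
  assumes cut: "standard_cutoffs \<Omega> d A x r" and metric: "Metric_space \<Omega> d" and x: "x \<in> \<Omega>" and r: "0 < r"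
    and \<Omega>: "open \<Omega>" "bounded \<Omega>"
  obtains \<psi> S \<Lambda> where "open (Metric_space.mball \<Omega> d x r)" "open S" "x \<in> S" "S \<subseteq> \<Omega>" "1 \<le> \<Lambda>"
    "\<And>j. 1 \<le> j \<Longrightarrow> cutoff A (Metric_space.mball \<Omega> d x r) (\<psi> j) (\<Lambda> * (real j)\<^sup>2)"
    "\<And>j y. 1 \<le> j \<Longrightarrow> y \<in> supp (\<psi> (Suc j)) \<Longrightarrow> \<psi> j y = 1"
    "\<And>j. 1 \<le> j \<Longrightarrow> S \<subseteq> supp (\<psi> j)"
proof -
  interpret Metric_space \<Omega> d by (rule metric)
  obtain C0 where C0: "\<forall>\<nu>\<in>{0<..<1}. \<exists>c (\<psi> :: nat \<Rightarrow> real^'n \<Rightarrow> real) (rr :: nat \<Rightarrow> real).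
        rr 1 = r \<and> rr \<longlonglongrightarrow> \<nu> * r \<and>
        (\<forall>j\<ge>1. rr j - rr (Suc j) = c / (real j)\<^sup>2 * (1 - \<nu>) * r) \<and>
        (\<forall>j\<ge>1. (\<exists>L. L-lipschitz_on UNIV (\<psi> j)) \<and>
           (\<forall>y. 0 \<le> \<psi> j y \<and> \<psi> j y \<le> 1) \<and>
           supp (\<psi> j) \<subseteq> mball x (rr j) \<and>
           (\<forall>y \<in> mball x (rr (Suc j)). \<psi> j y = 1) \<and>
           (AE y in lebesgue_on \<Omega>. norm (grad_A A (\<psi> j) y) \<le> C0 * (real j)\<^sup>2 / ((1 - \<nu>) * r)))"
    using cut unfolding standard_cutoffs_def by blast
  define good where "good \<nu> \<psi> rr \<longleftrightarrow> rr \<longlonglongrightarrow> \<nu> * r \<and>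
     (\<forall>j\<ge>1. \<nu> * r < rr j \<and> rr j \<le> r \<and> (\<exists>L. L-lipschitz_on UNIV (\<psi> j)) \<and> (\<forall>y. 0 \<le> \<psi> j y \<and> \<psi> j y \<le> 1) \<and>
        supp (\<psi> j) \<subseteq> mball x (rr j) \<and> (\<forall>y \<in> mball x (rr (Suc j)). \<psi> j y = 1) \<and>
        (AE y in lebesgue_on \<Omega>. norm (grad_A A (\<psi> j) y) \<le> C0 * (real j)\<^sup>2 / ((1 - \<nu>) * r)))"
    for \<nu> and \<psi> :: "nat \<Rightarrow> real^'n \<Rightarrow> real" and rr
  have family: "\<exists>\<psi> rr. good \<nu> \<psi> rr" if \<nu>: "0 < \<nu>" "\<nu> < 1" for \<nu>
  proof -
    obtain c rr and \<psi> :: "nat \<Rightarrow> real^'n \<Rightarrow> real" where rr: "rr 1 = r" "rr \<longlonglongrightarrow> \<nu> * r"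
        "\<And>j. 1 \<le> j \<Longrightarrow> rr j - rr (Suc j) = c / (real j)\<^sup>2 * (1 - \<nu>) * r"
      and \<psi>: "\<forall>j\<ge>1. (\<exists>L. L-lipschitz_on UNIV (\<psi> j)) \<and>
           (\<forall>y. 0 \<le> \<psi> j y \<and> \<psi> j y \<le> 1) \<and> supp (\<psi> j) \<subseteq> mball x (rr j) \<and>
           (\<forall>y \<in> mball x (rr (Suc j)). \<psi> j y = 1) \<and>
           (AE y in lebesgue_on \<Omega>. norm (grad_A A (\<psi> j) y) \<le> C0 * (real j)\<^sup>2 / ((1 - \<nu>) * r))"
      using bspec[OF C0, of \<nu>] \<nu> by auto
    have "\<nu> * r < rr j \<and> rr j \<le> r" if "1 \<le> j" for j
      using cutoff_radii[OF rr(1) r \<nu> rr(2) rr(3) that] by blast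
    then have "good \<nu> \<psi> rr" unfolding good_def using rr(2) \<psi> by blast
    then show ?thesis by blast
  qed
  let ?B = "mball x r"
  have Bo: "open ?B"
    unfolding open_subopen[of ?B]
  proof
    fix y assume y: "y \<in> ?B"
    \<comment> \<open>The midpoint between d(x,y)/r and 1: all radii then exceed d(x,y), so the
      first cutoff equals 1 at \<open>y\<close>, and its positivity set is an open neighbourhood of
      \<open>y\<close> inside the ball.\<close>
    define \<nu> where "\<nu> = (d x y / r + 1) / 2"
    have dr: "0 \<le> d x y / r" "d x y / r < 1" using y r by (auto simp: in_mball)
    have "0 < (t + 1) / 2" "(t + 1) / 2 < 1" "t < (t + 1) / 2" if "0 \<le> t" "t < 1" for t :: real using that by auto
    then have \<nu>: "0 < \<nu>" "\<nu> < 1" "d x y / r < \<nu>" unfolding \<nu>_def using dr by blast+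
    obtain \<psi> rr where "good \<nu> \<psi> rr" using family[OF \<nu>(1,2)] by blast
    then have \<psi>: "\<forall>j\<ge>1. \<nu> * r < rr j \<and> rr j \<le> r \<and> (\<exists>L. L-lipschitz_on UNIV (\<psi> j)) \<and>
        supp (\<psi> j) \<subseteq> mball x (rr j) \<and> (\<forall>y \<in> mball x (rr (Suc j)). \<psi> j y = 1)"
      unfolding good_def by blast
    obtain L where "L-lipschitz_on UNIV (\<psi> 1)" using \<psi> by auto
    then have "open {z. 0 < \<psi> 1 z}" by (intro open_Collect_less lipschitz_on_continuous_on continuous_on_const)
    moreover have "y \<in> {z. 0 < \<psi> 1 z}"
    proof -
      have "d x y < \<nu> * r" using \<nu>(3) r by (simp add: field_simps)
      also have "\<dots> < rr (Suc 1)" using \<psi>[rule_format, of "Suc 1"] by simp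
      finally have "y \<in> mball x (rr (Suc 1))" using y by (simp add: in_mball)
      then have "\<psi> 1 y = 1" using \<psi>[rule_format, of 1] by auto
      then show ?thesis by simp
    qed
    moreover have "{z. 0 < \<psi> 1 z} \<subseteq> ?B"
    proof
      fix z assume "z \<in> {z. 0 < \<psi> 1 z}"
      then have "z \<in> supp (\<psi> 1)" using eq_0_outside_supp[of z "\<psi> 1"] by fastforce
      then have "z \<in> mball x (rr 1)" using \<psi>[rule_format, of 1] by auto
      then show "z \<in> ?B" using \<psi>[rule_format, of 1] by (auto simp: in_mball)
    qed
    ultimately show "\<exists>T. open T \<and> y \<in> T \<and> T \<subseteq> ?B" by blast
  qed
  obtain \<psi> rr where "good (1/2) \<psi> rr" using family[of "1/2"] by auto
  then have \<psi>: "\<And>j. 1 \<le> j \<Longrightarrow> (1/2) * r < rr j \<and> rr j \<le> r \<and> (\<exists>L. L-lipschitz_on UNIV (\<psi> j)) \<and>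
        (\<forall>y. 0 \<le> \<psi> j y \<and> \<psi> j y \<le> 1) \<and> supp (\<psi> j) \<subseteq> mball x (rr j) \<and> (\<forall>y \<in> mball x (rr (Suc j)). \<psi> j y = 1) \<and>
        (AE y in lebesgue_on \<Omega>. norm (grad_A A (\<psi> j) y) \<le> C0 * (real j)\<^sup>2 / ((1 - 1/2) * r))"
    unfolding good_def by blast
  \<comment> \<open>A second family, with \<nu> = 1/4, has a member supported in a ball of radius
    below r/2. On the positivity set of that member all cutoffs of the first family equal 1, since
    their radii exceed r/2.\<close>
  obtain \<psi>' rr' where "good (1/4) \<psi>' rr'" using family[of "1/4"] by auto
  then have lim': "rr' \<longlonglongrightarrow> (1/4) * r" and
    \<psi>': "\<And>j. 1 \<le> j \<Longrightarrow> (1/4) * r < rr' j \<and> rr' j \<le> r \<and> (\<exists>L. L-lipschitz_on UNIV (\<psi>' j)) \<and>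
        supp (\<psi>' j) \<subseteq> mball x (rr' j) \<and> (\<forall>y \<in> mball x (rr' (Suc j)). \<psi>' j y = 1)"
    unfolding good_def by blast+
  have "\<forall>\<^sub>F j in sequentially. rr' j < (1/2) * r" using r by (intro order_tendstoD(2)[OF lim']) simp
  from eventually_conj[OF this eventually_ge_at_top[of 1]]
  have "\<forall>\<^sub>F j in sequentially. rr' j < (1/2) * r \<and> 1 \<le> j" .
  from eventually_happens'[OF sequentially_bot this] obtain j' where j': "rr' j' < (1/2) * r" "1 \<le> j'" by auto
  define S where "S = {z. 0 < \<psi>' j' z}"
  define \<Lambda> where "\<Lambda> = max 1 (C0 / ((1 - 1/2) * r))"
  have suppB: "supp (\<psi> j) \<subseteq> ?B" if "1 \<le> j" for j using \<psi>[OF that] by (auto simp: in_mball)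
  have B\<Omega>: "?B \<subseteq> \<Omega>" by (auto simp: in_mball)
  have S1: "\<psi> j z = 1" if "z \<in> S" "1 \<le> j" for z j
  proof -
    have "z \<in> supp (\<psi>' j')" using that eq_0_outside_supp[of z "\<psi>' j'"] by (fastforce simp: S_def)
    then have "z \<in> mball x (rr' j')" using \<psi>'[OF j'(2)] by auto
    then have "z \<in> mball x (rr (Suc j))" using j'(1) \<psi>[of "Suc j"] by (auto simp: in_mball)
    then show ?thesis using \<psi>[OF that(2)] by auto
  qed
  show ?thesis
  proof (rule that[of S \<Lambda> \<psi>])
    show "open ?B" by (rule Bo)
    obtain L where "L-lipschitz_on UNIV (\<psi>' j')" using \<psi>'[OF j'(2)] by auto
    then show "open S" unfolding S_def by (intro open_Collect_less lipschitz_on_continuous_on continuous_on_const)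
    have "0 < rr' (Suc j')" using \<psi>'[of "Suc j'"] r by simp
    then have "x \<in> mball x (rr' (Suc j'))" using x by simp
    then have "\<psi>' j' x = 1" using \<psi>'[OF j'(2)] by auto
    then show "x \<in> S" by (simp add: S_def)
    show SK: "S \<subseteq> supp (\<psi> j)" if "1 \<le> j" for j
      using S1[OF _ that] eq_0_outside_supp[of _ "\<psi> j"] by fastforce
    show "S \<subseteq> \<Omega>" using SK[of 1] suppB[of 1] B\<Omega> by auto
    show "1 \<le> \<Lambda>" by (simp add: \<Lambda>_def)
    show "\<psi> j y = 1" if "1 \<le> j" "y \<in> supp (\<psi> (Suc j))" for j y
      using \<psi>[OF that(1)] \<psi>[of "Suc j"] that(2) by auto
    fix j :: nat assume j: "1 \<le> j"
    show "cutoff A ?B (\<psi> j) (\<Lambda> * (real j)\<^sup>2)"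
    proof
      have "bounded (supp (\<psi> j))" by (rule bounded_subset[OF \<Omega>(2)]) (use suppB[OF j] B\<Omega> in auto)
      then have "compact (supp (\<psi> j))" by (simp add: compact_eq_bounded_closed supp_closed)
      then show "\<psi> j \<in> Lip_c ?B" using \<psi>[OF j] suppB[OF j] by (auto simp: Lip_c_def)
      show "0 \<le> \<psi> j y \<and> \<psi> j y \<le> 1" for y using \<psi>[OF j] by auto
      have j1: "1 \<le> (real j)\<^sup>2" using j by (simp add: one_le_power)
      have "1 * 1 \<le> \<Lambda> * (real j)\<^sup>2" using j1 by (intro mult_mono) (auto simp: \<Lambda>_def)
      then show \<Lambda>1: "1 \<le> \<Lambda> * (real j)\<^sup>2" by simp
      have "C0 * (real j)\<^sup>2 / ((1 - 1/2) * r) = C0 / ((1 - 1/2) * r) * (real j)\<^sup>2" by simp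
      also have "\<dots> \<le> \<Lambda> * (real j)\<^sup>2" unfolding \<Lambda>_def by (intro mult_right_mono) auto
      finally have le: "C0 * (real j)\<^sup>2 / ((1 - 1/2) * r) \<le> \<Lambda> * (real j)\<^sup>2" .
      have "AE y in lebesgue. y \<in> \<Omega> \<longrightarrow> norm (grad_A A (\<psi> j) y) \<le> C0 * (real j)\<^sup>2 / ((1 - 1/2) * r)"
        using \<psi>[OF j] \<Omega>(1) by (subst AE_restrict_space_iff[symmetric]) auto
      then show "AE y in lebesgue. norm (grad_A A (\<psi> j) y) \<le> \<Lambda> * (real j)\<^sup>2"
      proof eventually_elim
        case (elim y)
        show ?case
        proof (cases "y \<in> \<Omega>")
          case True then show ?thesis using elim le by linarith
        next
          case False
          then have "grad_A A (\<psi> j) y = 0" using suppB[OF j] B\<Omega> by (intro grad_A_eq_0_outside_supp) auto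
          then show ?thesis using \<Lambda>1 by simp
        qed
      qed
    qed
  qed
qed

section \<open>Change of sign, choice of representatives and conclusion\<close>

lemma W12_uminus: "W12 \<Omega> A u g \<Longrightarrow> W12 \<Omega> A (\<lambda>y. - u y) (\<lambda>y. - g y)"
  by (auto simp: W12_def in_L2_def is_weak_grad_A_def)

lemma energy_form_uminus: "energy_form \<Omega> M (\<lambda>y. - g y) h = - energy_form \<Omega> M g h"
proof -
  have "M y *v (- g y) = - (M y *v g y)" for y by (simp add: vec_eq_iff matrix_vector_mult_def sum_negf)
  then show ?thesis by (simp add: energy_form_def)
qed

lemma modify_on_null_set:
  assumes S: "open S" "S \<subseteq> \<Omega>" and \<Omega>: "open \<Omega>"
    and P: "AE y in lebesgue_on S. P (u y)" "P s"
  obtains v where "AE y in lebesgue_on \<Omega>. v y = u y" "\<And>y. y \<in> S \<Longrightarrow> P (v y)"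
proof
  let ?v = "\<lambda>y. if y \<in> S \<and> \<not> P (u y) then s else u y"
  have "AE y in lebesgue. y \<in> S \<longrightarrow> P (u y)" using P(1) S(1) by (subst (asm) AE_restrict_space_iff) auto
  then have "AE y in lebesgue. y \<in> \<Omega> \<longrightarrow> ?v y = u y" by eventually_elim auto
  then show "AE y in lebesgue_on \<Omega>. ?v y = u y" using \<Omega> by (subst AE_restrict_space_iff) auto
  show "y \<in> S \<Longrightarrow> P (?v y)" for y using P(2) by auto
qed

text \<open>The squared norm of a square root applied to \<xi> is the quadratic form of the matrix
  at \<xi>, so comparability of the forms is exactly ellipticity of \<open>M\<close> on the range of
  the square root of \<open>A\<close>.\<close>

lemma sqrt_factor_lower:
  assumes M: "sqrt_factor \<Omega> A At M" and \<Omega>: "\<Omega> \<in> sets lebesgue"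
    and A: "\<And>y. y \<in> \<Omega> \<Longrightarrow> psd_matrix (A y)" and At: "\<And>y. y \<in> \<Omega> \<Longrightarrow> psd_matrix (At y)"
    and low: "AE y in lebesgue_on \<Omega>. \<forall>\<xi>. lam * (\<xi> \<bullet> (A y *v \<xi>)) \<le> \<xi> \<bullet> (At y *v \<xi>)"
  shows "AE y in lebesgue_on \<Omega>. \<forall>\<xi>. lam * (norm (mat_sqrt (A y) *v \<xi>))\<^sup>2 \<le> (norm (M y *v (mat_sqrt (A y) *v \<xi>)))\<^sup>2"
proof -
  have "AE y in lebesgue_on \<Omega>. mat_sqrt (At y) = M y ** mat_sqrt (A y)" using M by (simp add: sqrt_factor_def)
  with low AE_space[of "lebesgue_on \<Omega>"] show ?thesis
  proof eventually_elim
    case (elim y)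
    then have y: "y \<in> \<Omega>" by simp
    show ?case
    proof
      fix \<xi>
      have "M y *v (mat_sqrt (A y) *v \<xi>) = mat_sqrt (At y) *v \<xi>" using elim(3) by (simp add: matrix_vector_mul_assoc)
      then show "lam * (norm (mat_sqrt (A y) *v \<xi>))\<^sup>2 \<le> (norm (M y *v (mat_sqrt (A y) *v \<xi>)))\<^sup>2"
        using elim(1) by (simp add: norm_mat_sqrt[OF A[OF y]] norm_mat_sqrt[OF At[OF y]])
    qed
  qed
qed

text \<open>The argument \<open>w\<close> of the coefficient is separate from \<open>u\<close>, and
  the data enter through an absolute value, so that the negative of a supersolution is covered with
  its coefficient unchanged. \<open>S\<close> does not depend on the solution, so upper and lower
  bounds hold on one common neighbourhood.\<close>

lemma essentially_bounded_above_near: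
  fixes \<Omega> :: "(real^'n) set" and A :: "real^'n \<Rightarrow> real^'n^'n" and \<A> :: "real^'n \<Rightarrow> real \<Rightarrow> real^'n^'n"
    and d :: "real^'n \<Rightarrow> real^'n \<Rightarrow> real" and \<phi>0 :: "real^'n \<Rightarrow> real" and \<phi>1 :: "real^'n \<Rightarrow> real^'n" and x :: "real^'n"
  assumes \<Omega>: "open \<Omega>" "bounded \<Omega>"
    and A: "\<And>y. y \<in> \<Omega> \<Longrightarrow> psd_matrix (A y)" and bd: "bounded ((\<lambda>y. mat_sqrt (A y)) ` \<Omega>)"
    and lip: "L-lipschitz_on \<Omega> (\<lambda>y. mat_sqrt (A y))"
    and \<A>: "\<And>y z. y \<in> \<Omega> \<Longrightarrow> psd_matrix (\<A> y z)" and lam: "0 < lam"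
    and low: "AE y in lebesgue_on \<Omega>. \<forall>\<xi> z. lam * (\<xi> \<bullet> (A y *v \<xi>)) \<le> \<xi> \<bullet> (\<A> y z *v \<xi>)"
    and metric: "Metric_space \<Omega> d" and x: "x \<in> \<Omega>"
    and loc: "locally_integrable \<Omega> \<phi>0" "locally_integrable \<Omega> \<phi>1" and r: "0 < r"
    and adm: "admissible \<Omega> d A \<phi>0 \<phi>1 x r" and m: "2 < m"
    and OS: "Orlicz_Sobolev \<Omega> d (Young_Phi m) A \<phi> x r" and cut: "standard_cutoffs \<Omega> d A x r"
  obtains S where "open S" "x \<in> S" "S \<subseteq> \<Omega>"
    "\<forall>w u g M. W12 \<Omega> A u g \<longrightarrow> sqrt_factor \<Omega> A (\<lambda>y. \<A> y (w y)) M \<longrightarrow>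
       (\<forall>h \<in> Lip_c \<Omega>. (\<forall>y. 0 \<le> h y) \<longrightarrow> energy_form \<Omega> M g (grad_A A h) \<le> \<bar>rhs_form \<Omega> A \<phi>0 \<phi>1 h\<bar>) \<longrightarrow>
       (\<exists>c. AE y in lebesgue_on S. u y \<le> c)"
proof -
  let ?B = "Metric_space.mball \<Omega> d x r"
  obtain \<psi> S \<Lambda> where S: "open ?B" "open S" "x \<in> S" "S \<subseteq> \<Omega>" "1 \<le> \<Lambda>"
    and \<psi>: "\<And>j. 1 \<le> j \<Longrightarrow> cutoff A ?B (\<psi> j) (\<Lambda> * (real j)\<^sup>2)"
      "\<And>j y. 1 \<le> j \<Longrightarrow> y \<in> supp (\<psi> (Suc j)) \<Longrightarrow> \<psi> j y = 1" "\<And>j. 1 \<le> j \<Longrightarrow> S \<subseteq> supp (\<psi> j)"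
    using standard_cutoffs_family[OF cut metric x r \<Omega>] by metis
  have "x \<in> ?B" using x r Metric_space.mdist_zero[OF metric, of x] by (simp add: Metric_space.in_mball[OF metric])
  then have B: "?B \<noteq> {}" "?B \<subseteq> \<Omega>" using Metric_space.in_mball[OF metric] by auto
  have Bb: "bounded ?B" by (rule bounded_subset[OF \<Omega>(2) B(2)])
  obtain C where C: "0 < C"
    and poincare: "\<And>w. w \<in> Lip_c ?B \<Longrightarrow> (LINT y|lebesgue. \<bar>w y\<bar>) \<le> C * (LINT y|lebesgue. norm (grad_A A w y))"
    and gain: "\<And>w E \<eta>. w \<in> Lip_c ?B \<Longrightarrow> E \<in> sets lebesgue \<Longrightarrow> E \<subseteq> ?B \<Longrightarrow> 0 < \<eta> \<Longrightarrow> \<eta> \<le> exp (- 2 * 2 powr m) \<Longrightarrow>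
       measure lebesgue E \<le> \<eta> * measure lebesgue ?B \<Longrightarrow>
       (LINT y|lebesgue. indicator E y * \<bar>w y\<bar>) \<le> C * exp (- sqrt (ln (1 / \<eta>))) * (LINT y|lebesgue. norm (grad_A A w y))"
    by (rule Orlicz_Sobolev_consequences[OF OS m \<Omega>(1) lip bd S(1) B(1) Bb B(2) r]) (rule that, assumption+)
  obtain N where N: "0 \<le> N"
    and rhs: "\<And>w. w \<in> Lip_c ?B \<Longrightarrow> \<bar>rhs_form \<Omega> A \<phi>0 \<phi>1 w\<bar> \<le> N * (LINT y|lebesgue. norm (grad_A A w y))"
    by (rule admissible_bound[OF adm[unfolded admissible_def] loc \<Omega>(1) lip bd S(1) B(2) poincare]) (assumption, rule that, assumption+)
  show ?thesis
  proof (rule that[OF S(2,3,4)], intro allI impI)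
    fix w u g M
    assume W: "W12 \<Omega> A u g" and M: "sqrt_factor \<Omega> A (\<lambda>y. \<A> y (w y)) M"
      and en: "\<forall>h \<in> Lip_c \<Omega>. (\<forall>y. 0 \<le> h y) \<longrightarrow> energy_form \<Omega> M g (grad_A A h) \<le> \<bar>rhs_form \<Omega> A \<phi>0 \<phi>1 h\<bar>"
    obtain KM where KM: "\<And>y. y \<in> \<Omega> \<Longrightarrow> norm (M y) \<le> KM"
      using M unfolding sqrt_factor_def bounded_iff by auto
    have KM0: "0 \<le> KM" using KM[OF x] norm_ge_zero order.trans by blast
    define R where "R \<eta> = C * exp (- sqrt (ln (1 / \<eta>)))" for \<eta>
    have "energy_setting \<Omega> ?B A M u g L lam KM N R (exp (- 2 * 2 powr m))"
    proof
      show "open \<Omega>" "bounded \<Omega>" by (rule \<Omega>)+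
      show "psd_matrix (A y)" if "y \<in> \<Omega>" for y by (rule A[OF that])
      show "L-lipschitz_on \<Omega> (\<lambda>y. mat_sqrt (A y))" by (rule lip)
      show "W12 \<Omega> A u g" by (rule W)
      show "M \<in> borel_measurable (lebesgue_on \<Omega>)" using M by (simp add: sqrt_factor_def)
      show "norm (M y) \<le> KM" if "y \<in> \<Omega>" for y by (rule KM[OF that])
      have low': "AE y in lebesgue_on \<Omega>. \<forall>\<xi>. lam * (\<xi> \<bullet> (A y *v \<xi>)) \<le> \<xi> \<bullet> (\<A> y (w y) *v \<xi>)"
        using low by eventually_elim blast
      show "AE y in lebesgue_on \<Omega>. \<forall>\<xi>. lam * (norm (mat_sqrt (A y) *v \<xi>))\<^sup>2 \<le> (norm (M y *v (mat_sqrt (A y) *v \<xi>)))\<^sup>2"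
        by (rule sqrt_factor_lower[OF M _ A \<A> low']) (use \<Omega> in auto)
      show "0 < lam" "0 \<le> KM" "0 \<le> N" "open ?B" "?B \<subseteq> \<Omega>" by (rule lam KM0 N S(1) B(2))+
      show "energy_form \<Omega> M g (grad_A A h) \<le> N * (LINT y|lebesgue. norm (grad_A A h y))"
        if "h \<in> Lip_c ?B" "\<And>y. 0 \<le> h y" for h
        by (rule order.trans[OF en[rule_format, OF Lip_c_mono[OF B(2) that(1)] that(2)] rhs[OF that(1)]])
      show "0 \<le> R \<eta>" for \<eta> using C by (simp add: R_def)
      show "(LINT y|lebesgue. indicator E y * \<bar>h y\<bar>) \<le> R \<eta> * (LINT y|lebesgue. norm (grad_A A h y))"
        if "h \<in> Lip_c ?B" "E \<in> sets lebesgue" "E \<subseteq> ?B" "0 < \<eta>" "\<eta> \<le> exp (- 2 * 2 powr m)"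
          "measure lebesgue E \<le> \<eta> * measure lebesgue ?B" for h E \<eta>
        unfolding R_def by (rule gain[OF that])
    qed
    then show "\<exists>c. AE y in lebesgue_on S. u y \<le> c"
      by (rule energy_setting.AE_bounded_above[OF _ \<psi>(1,2) S(5) R_def C measure_pos_of_open[OF S(1) B(1) Bb] exp_gt_zero _ \<psi>(3)])
        (use S(2) in auto)
  qed
qed

theorem theorem7:
  fixes \<Omega> :: "(real^'n) set"
    and A :: "real^'n \<Rightarrow> real^'n^'n"
    and \<A> :: "real^'n \<Rightarrow> real \<Rightarrow> real^'n^'n"
    and d :: "real^'n \<Rightarrow> real^'n \<Rightarrow> real"
    and \<phi>0 :: "real^'n \<Rightarrow> real" and \<phi>1 :: "real^'n \<Rightarrow> real^'n"
    and \<phi> :: "real \<Rightarrow> real"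
    and x :: "real^'n" and lam Lam r0 m :: real
  assumes domain: "open \<Omega>" "connected \<Omega>" "bounded \<Omega>"
    and A_psd: "\<And>y. y \<in> \<Omega> \<Longrightarrow> psd_matrix (A y)"
    and sqrt_A_bounded: "bounded ((\<lambda>y. mat_sqrt (A y)) ` \<Omega>)"
    and sqrt_A_Lipschitz: "\<exists>L. L-lipschitz_on \<Omega> (\<lambda>y. mat_sqrt (A y))"
    and \<A>_psd: "\<And>y z. y \<in> \<Omega> \<Longrightarrow> psd_matrix (\<A> y z)"
    and lam_Lam: "0 < lam" "lam \<le> Lam"
    and comparable: "AE y in lebesgue_on \<Omega>. \<forall>\<xi> z.
          lam * (\<xi> \<bullet> (A y *v \<xi>)) \<le> \<xi> \<bullet> (\<A> y z *v \<xi>) \<and>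
          \<xi> \<bullet> (\<A> y z *v \<xi>) \<le> Lam * (\<xi> \<bullet> (A y *v \<xi>))"
    and metric: "Metric_space \<Omega> d"
    and x_in: "x \<in> \<Omega>"
    and \<phi>_loc: "locally_integrable \<Omega> \<phi>0" "locally_integrable \<Omega> \<phi>1"
    and r0_pos: "0 < r0"
    and adm: "admissible \<Omega> d A \<phi>0 \<phi>1 x r0"
    and m_gt: "2 < m"
    and bump: "Orlicz_Sobolev \<Omega> d (Young_Phi m) A \<phi> x r0"
    and cutoffs: "standard_cutoffs \<Omega> d A x r0"
  shows "(\<forall>u. weak_subsolution \<Omega> A \<A> \<phi>0 \<phi>1 u \<longrightarrow> locally_bdd_above_at \<Omega> u x) \<and>
         (\<forall>u. weak_supersolution \<Omega> A \<A> \<phi>0 \<phi>1 u \<longrightarrow> locally_bdd_below_at \<Omega> u x) \<and>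
         (\<forall>u. weak_solution \<Omega> A \<A> \<phi>0 \<phi>1 u \<longrightarrow> locally_bounded_at \<Omega> u x)"
proof -
  obtain L where lip: "L-lipschitz_on \<Omega> (\<lambda>y. mat_sqrt (A y))" using sqrt_A_Lipschitz by blast
  have low: "AE y in lebesgue_on \<Omega>. \<forall>\<xi> z. lam * (\<xi> \<bullet> (A y *v \<xi>)) \<le> \<xi> \<bullet> (\<A> y z *v \<xi>)"
    using comparable by eventually_elim blast
  obtain S where S: "open S" "x \<in> S" "S \<subseteq> \<Omega>"
    and bounded_above: "\<forall>w u g M. W12 \<Omega> A u g \<longrightarrow> sqrt_factor \<Omega> A (\<lambda>y. \<A> y (w y)) M \<longrightarrow>
       (\<forall>h \<in> Lip_c \<Omega>. (\<forall>y. 0 \<le> h y) \<longrightarrow> energy_form \<Omega> M g (grad_A A h) \<le> \<bar>rhs_form \<Omega> A \<phi>0 \<phi>1 h\<bar>) \<longrightarrow>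
       (\<exists>c. AE y in lebesgue_on S. u y \<le> c)"
    by (rule essentially_bounded_above_near[OF domain(1,3) A_psd sqrt_A_bounded lip \<A>_psd lam_Lam(1) low
          metric x_in \<phi>_loc r0_pos adm m_gt bump cutoffs]) (assumption, assumption, rule that, assumption+)
  have above: "\<exists>c. AE y in lebesgue_on S. u y \<le> c" if sub: "weak_subsolution \<Omega> A \<A> \<phi>0 \<phi>1 u" for u
  proof -
    obtain g M where W: "W12 \<Omega> A u g" and M: "sqrt_factor \<Omega> A (\<lambda>y. \<A> y (u y)) M"
      and e: "\<And>h. h \<in> Lip_c \<Omega> \<Longrightarrow> (\<And>y. 0 \<le> h y) \<Longrightarrow> energy_form \<Omega> M g (grad_A A h) \<le> rhs_form \<Omega> A \<phi>0 \<phi>1 h"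
      using sub unfolding weak_subsolution_def by blast
    show ?thesis
    proof (rule bounded_above[rule_format, OF W M])
      fix h :: "real^'n \<Rightarrow> real" assume "h \<in> Lip_c \<Omega>" "\<And>y. 0 \<le> h y"
      then show "energy_form \<Omega> M g (grad_A A h) \<le> \<bar>rhs_form \<Omega> A \<phi>0 \<phi>1 h\<bar>" using e[of h] by simp
    qed
  qed
  \<comment> \<open>Changing the sign of \<open>u\<close> and \<open>g\<close> but not of
    \<open>M\<close> reverses the energy inequality; the right-hand side becomes
    \<open>- rhs_form\<close>, which the absolute value dominates.\<close>
  have below: "\<exists>c. AE y in lebesgue_on S. - u y \<le> c" if super: "weak_supersolution \<Omega> A \<A> \<phi>0 \<phi>1 u" for u
  proof -
    obtain g M where W: "W12 \<Omega> A u g" and M: "sqrt_factor \<Omega> A (\<lambda>y. \<A> y (u y)) M"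
      and e: "\<And>h. h \<in> Lip_c \<Omega> \<Longrightarrow> (\<And>y. 0 \<le> h y) \<Longrightarrow> rhs_form \<Omega> A \<phi>0 \<phi>1 h \<le> energy_form \<Omega> M g (grad_A A h)"
      using super unfolding weak_supersolution_def by blast
    show ?thesis
    proof (rule bounded_above[rule_format, OF W12_uminus[OF W] M])
      fix h :: "real^'n \<Rightarrow> real" assume "h \<in> Lip_c \<Omega>" "\<And>y. 0 \<le> h y"
      then have "rhs_form \<Omega> A \<phi>0 \<phi>1 h \<le> energy_form \<Omega> M g (grad_A A h)" using e[of h] by simp
      then show "energy_form \<Omega> M (\<lambda>y. - g y) (grad_A A h) \<le> \<bar>rhs_form \<Omega> A \<phi>0 \<phi>1 h\<bar>"
        unfolding energy_form_uminus by linarith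
    qed
  qed
  show ?thesis
  proof (intro conjI allI impI)
    fix u assume "weak_subsolution \<Omega> A \<A> \<phi>0 \<phi>1 u"
    then obtain c where "AE y in lebesgue_on S. u y \<le> c" using above by blast
    then obtain v where "AE y in lebesgue_on \<Omega>. v y = u y" "\<And>y. y \<in> S \<Longrightarrow> v y \<le> c"
      by (rule modify_on_null_set[OF S(1,3) domain(1), where P="\<lambda>t. t \<le> c" and s=c]) auto
    moreover from this(2) have "bdd_above (v ` S)" by (intro bdd_aboveI2)
    ultimately show "locally_bdd_above_at \<Omega> u x" unfolding locally_bdd_above_at_def using S by blast
  next
    fix u assume "weak_supersolution \<Omega> A \<A> \<phi>0 \<phi>1 u"
    then obtain c where "AE y in lebesgue_on S. - u y \<le> c" using below by blast
    then obtain v where "AE y in lebesgue_on \<Omega>. v y = u y" "\<And>y. y \<in> S \<Longrightarrow> - v y \<le> c"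
      by (rule modify_on_null_set[OF S(1,3) domain(1), where P="\<lambda>t. - t \<le> c" and s="- c"]) auto
    moreover from this(2) have "bdd_below (v ` S)" by (intro bdd_belowI2[of _ "- c"]) (simp add: minus_le_iff)
    ultimately show "locally_bdd_below_at \<Omega> u x" unfolding locally_bdd_below_at_def using S by blast
  next
    fix u assume "weak_solution \<Omega> A \<A> \<phi>0 \<phi>1 u"
    then have "weak_subsolution \<Omega> A \<A> \<phi>0 \<phi>1 u" "weak_supersolution \<Omega> A \<A> \<phi>0 \<phi>1 u"
      unfolding weak_solution_def weak_subsolution_def weak_supersolution_def by (metis order_refl)+
    then obtain c1 c2 where c: "AE y in lebesgue_on S. u y \<le> c1" "AE y in lebesgue_on S. - u y \<le> c2"
      using above below by blast
    define c where "c = max \<bar>c1\<bar> \<bar>c2\<bar>"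
    have "AE y in lebesgue_on S. \<bar>u y\<bar> \<le> c" using c by eventually_elim (auto simp: c_def)
    then obtain v where v: "AE y in lebesgue_on \<Omega>. v y = u y" "\<And>y. y \<in> S \<Longrightarrow> \<bar>v y\<bar> \<le> c"
      by (rule modify_on_null_set[OF S(1,3) domain(1), where P="\<lambda>t. \<bar>t\<bar> \<le> c" and s=0]) (auto simp: c_def)
    have "bounded (v ` S)" using v(2) by (auto simp: bounded_iff)
    then show "locally_bounded_at \<Omega> u x" unfolding locally_bounded_at_def using S v(1) by blast
  qed
qed

end
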